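(* Let $\mu$ be a finite positive measure on $\mathbb{R}$. Let $A=\{a_n\}_{n\in\mathbb{Z}}$ be a $d$-uniform sequence of real numbers such that $$\sum_n\frac{\log\mu\big((a_n-\varepsilon_n,a_n+\varepsilon_n)\big)}{1+n^2}>-\infty,\qquad\text{where }\ \varepsilon_n=\tfrac13\min\big(a_{n+1}-a_n,\ a_n-a_{n-1}\big).$$ Then $\mathcal{G}^\infty_\mu\geqslant 2\pi d$.
   Context: Discrete sequences are enumerated in increasing order with indices in $\mathbb{Z}$. For a finite positive Borel measure $\mu$ on $\mathbb{R}$ and $1\leqslant p\leqslant\infty$, $$\mathcal{G}^p_\mu=\sup\Big\{a>0:\ \exists\, f\in L^p(\mu),\ f\neq 0,\ \int f(x)e^{i\lambda x}\,d\mu(x)=0\ \ \forall\lambda\in[0,a]\Big\},$$ with $\mathcal{G}^p_\mu=0$ if the set is empty. A short partition of $\mathbb{R}$: points $\dots<c_{-1}<c_0=0<c_1<\dots$, $I_n=(c_n,c_{n+1}]$, with $|I_n|\to\infty$ as $n\to\pm\infty$ and $\sum_n |I_n|^2/(1+\operatorname{dist}^2(0,I_n))<\infty$. A discrete $\Lambda\subset\mathbb{R}$ is $d$-uniform ($d>0$) if for some short partition, with $\Delta_n=\#(\Lambda\cap I_n)$ and $E_n=\sum\log|\lambda_k-\lambda_l|$ over ordered pairs of distinct $\lambda_k,\lambda_l\in\Lambda\cap I_n$: $\Delta_n=d|I_n|+o(|I_n|)$ as $n\to\pm\infty$ and $\sum_n\frac{\Delta_n^2\log|I_n|-E_n}{1+\operatorname{dist}^2(0,I_n)}<\infty$.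 *)

theory Defs
  imports "HOL-Analysis.Analysis" "HOL-Library.Landau_Symbols"
begin

definition gap_witness :: "real measure \<Rightarrow> real \<Rightarrow> bool" where
  "gap_witness \<mu> a \<longleftrightarrow> a > 0 \<and>
     (\<exists>f :: real \<Rightarrow> complex.
        f \<in> borel_measurable \<mu> \<and> (\<exists>C. AE x in \<mu>. norm (f x) \<le> C) \<and>
        \<not> (AE x in \<mu>. f x = 0) \<and>
        (\<forall>t\<in>{0..a}. (LINT x|\<mu>. f x * cis (t * x)) = 0))"

definition gap_infty :: "real measure \<Rightarrow> ereal" where
  "gap_infty \<mu> = (if {a. gap_witness \<mu> a} = {} then 0
                   else Sup (ereal ` {a. gap_witness \<mu> a}))"

definition part_int :: "(int \<Rightarrow> real) \<Rightarrow> int \<Rightarrow> real set" where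
  "part_int c n = {c n<..c (n+1)}"

definition short_partition :: "(int \<Rightarrow> real) \<Rightarrow> bool" where
  "short_partition c \<longleftrightarrow> strict_mono c \<and> c 0 = 0 \<and>
     filterlim (\<lambda>n. c (n+1) - c n) at_top at_top \<and>
     filterlim (\<lambda>n. c (n+1) - c n) at_top at_bot \<and>
     (\<lambda>n. (c (n+1) - c n)\<^sup>2 / (1 + (infdist 0 (part_int c n))\<^sup>2)) summable_on UNIV"

definition discrete_set :: "real set \<Rightarrow> bool" where
  "discrete_set \<Lambda> \<longleftrightarrow> (\<forall>r s. finite (\<Lambda> \<inter> {r..s}))"

definition energy :: "real set \<Rightarrow> real" where
  "energy S = (\<Sum>(x,y)\<in>{(x,y). x \<in> S \<and> y \<in> S \<and> x \<noteq> y}. ln \<bar>x - y\<bar>)"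

definition d_uniform :: "real \<Rightarrow> real set \<Rightarrow> bool" where
  "d_uniform d \<Lambda> \<longleftrightarrow> d > 0 \<and> discrete_set \<Lambda> \<and>
     (\<exists>c. short_partition c \<and>
        (let \<Delta> = (\<lambda>n. real (card (\<Lambda> \<inter> part_int c n)));
             L = (\<lambda>n. c (n+1) - c n)
         in (\<lambda>n. \<Delta> n - d * L n) \<in> o[at_top](L) \<and>
            (\<lambda>n. \<Delta> n - d * L n) \<in> o[at_bot](L) \<and>
            (\<lambda>n. ((\<Delta> n)\<^sup>2 * ln (L n) - energy (\<Lambda> \<inter> part_int c n))
                   / (1 + (infdist 0 (part_int c n))\<^sup>2)) summable_on UNIV))"

end

theory Submission
  imports Defs "HOL-Complex_Analysis.Complex_Analysis" "HOL-Real_Asymp.Real_Asymp"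
begin

text \<open>
  Fix \<open>b < \<pi> d\<close>. By duality (an orthogonal projection in a weighted sequence space of averages over
  the intervals around the \<open>a\<^sub>n\<close>), a bounded function whose Fourier transform vanishes on an interval
  of length \<open>2 b\<close> exists as soon as \<open>norm (h \<i>)\<close> is bounded uniformly over all entire \<open>h\<close> of
  exponential type \<open>b\<close>, small at infinity on the real line, that satisfy \<open>norm (h x\<^sub>n) \<le> exp (W\<^sub>n)\<close> at
  some points \<open>x\<^sub>n\<close> of these intervals, where \<open>W\<close> is summable against \<open>1 / (1 + n\<^sup>2)\<close>.

  For the uniform bound let \<open>\<sigma>\<close> be the least 1-Lipschitz majorant of a multiple of
  \<open>ln (max 1 (norm (h x)))\<close> and consider a contact point \<open>t\<close>, with \<open>s = \<sigma> t\<close>. If the Poisson integral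
  of \<open>\<sigma>\<close> is under control at \<open>t\<close>, then \<open>h\<close> grows at most like \<open>exp (b \<bar>Im z\<bar> + \<theta> s)\<close> on the disc of
  radius \<open>s\<close>. Uniformity of the sequence provides more than \<open>(b / \<pi>) s\<close> nodes per length \<open>s\<close>, of small
  energy, in the disc, except where a fixed Poisson-summable density \<open>q\<close> has mass at least \<open>s\<^sup>2\<close>.
  Lagrange interpolation at these nodes, compared with the lattice, makes \<open>h t\<close> smaller than the
  contact condition allows. Hence every contact point lies in an exceptional window or sees a large Poisson integral, and a
  Vitali covering turns this into a bound of the Poisson integral of \<open>\<sigma>\<close> by that of \<open>q\<close>. The covering
  argument presupposes that the Poisson integral is not too large; this is removed by applying it to
  \<open>exp (- c) h\<close> and letting \<open>c\<close> decrease to zero.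
\<close>

section \<open>Lagrange interpolation at perturbed lattice points\<close>

text \<open>The point \<open>\<i>\<close> enters because the vector to be separated comes from
  \<open>1 / (1 + x\<^sup>2)\<close>. If an admissible \<open>h\<close> nearly cancels it, then
  \<open>1 + (1 + z\<^sup>2) * h z\<close>, times a damping factor, is controlled at one point of
  each interval by the reciprocal mass, yet equals 1 times that factor at \<open>\<i>\<close>, where
  the pole was. Only averages over the intervals are under control, so the position of that point is
  unknown; every estimate on nodes must therefore be uniform over displacements up to a third of the
  gap. The Lipschitz majorant supplies a length scale: a contact point of height \<open>s\<close>
  carries mass of order \<open>s\<^sup>2\<close> on a window of length \<open>s\<close>. Squared
  interval lengths, logarithmic energies and log-masses of the intervals are of the same order, so
  all hypotheses can be collected in one density. The growth bound in the disc is again a multiple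
  of \<Theta> times \<open>s\<close>, the very quantity to be contradicted. This is no circle: the
  multiple is an absolute constant, while the surplus of \<pi> times the node density over
  \<open>b\<close> does not depend on \<Theta>, so a small \<Theta> makes the growth a fraction of
  the surplus.\<close>

lemma partial_fractions_prod:
  fixes W :: "'a::field set"
  assumes "finite W" "W \<noteq> {}" "z \<notin> W"
  shows "1 / (\<Prod>w\<in>W. z - w) = (\<Sum>w\<in>W. 1 / ((\<Prod>w'\<in>W-{w}. w - w') * (z - w)))"
  using assms
proof (induction W arbitrary: z rule: finite_ne_induct)
  case (singleton x)
  then show ?case by simp
next
  case (insert v F)
  let ?g = "\<lambda>w. 1 / (\<Prod>w'\<in>F-{w}. w - w')"
  have v: "1 / (\<Prod>w\<in>F. v - w) = (\<Sum>w\<in>F. ?g w / (v - w))"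
    using insert.IH[of v] insert.hyps by simp
  have z: "1 / (\<Prod>w\<in>F. z - w) = (\<Sum>w\<in>F. ?g w / (z - w))"
    using insert.IH[of z] insert.prems by simp
  have dif: "insert v F - {w} = insert v (F - {w})" if "w \<in> F" for w
    using that insert.hyps by auto
  have "(\<Sum>w\<in>insert v F. 1 / ((\<Prod>w'\<in>insert v F-{w}. w - w') * (z - w)))
     = 1 / ((\<Prod>w\<in>F. v - w) * (z - v)) + (\<Sum>w\<in>F. 1 / ((\<Prod>w'\<in>insert v F-{w}. w - w') * (z - w)))"
    using insert.hyps by simp
  also have "(\<Sum>w\<in>F. 1 / ((\<Prod>w'\<in>insert v F-{w}. w - w') * (z - w))) = (\<Sum>w\<in>F. ?g w / ((w - v) * (z - w)))"
  proof (intro sum.cong refl)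
    fix w assume w: "w \<in> F"
    have "(\<Prod>w'\<in>insert v F-{w}. w - w') = (w - v) * (\<Prod>w'\<in>F-{w}. w - w')"
      using dif[OF w] insert.hyps by simp
    then show "1 / ((\<Prod>w'\<in>insert v F-{w}. w - w') * (z - w)) = ?g w / ((w - v) * (z - w))"
      by (simp add: mult_ac)
  qed
  also have "1 / ((\<Prod>w\<in>F. v - w) * (z - v)) = (\<Sum>w\<in>F. ?g w / ((v - w) * (z - v)))"
  proof -
    have "1 / ((\<Prod>w\<in>F. v - w) * (z - v)) = 1 / (\<Prod>w\<in>F. v - w) / (z - v)" by simp
    also have "\<dots> = (\<Sum>w\<in>F. ?g w / ((v - w) * (z - v)))"
      unfolding v sum_divide_distrib by (simp add: mult.assoc)
    finally show ?thesis .
  qed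
  also have "(\<Sum>w\<in>F. ?g w / ((v - w) * (z - v))) + (\<Sum>w\<in>F. ?g w / ((w - v) * (z - w)))
      = (\<Sum>w\<in>F. ?g w / ((z - v) * (z - w)))"
    unfolding sum.distrib[symmetric]
  proof (intro sum.cong refl)
    fix w assume "w \<in> F"
    then have ne: "v - w \<noteq> 0" "z - v \<noteq> 0" "z - w \<noteq> 0" using insert by auto
    have wv: "w - v = -(v - w)" by simp
    have "1 / ((v - w) * (z - v)) + 1 / ((w - v) * (z - w)) = 1 / ((z - v) * (z - w))"
      unfolding wv using ne by (simp add: divide_simps) (simp add: algebra_simps)
    then have "?g w * (1 / ((v - w) * (z - v)) + 1 / ((w - v) * (z - w))) = ?g w * (1 / ((z - v) * (z - w)))"
      by simp
    then show "?g w / ((v - w) * (z - v)) + ?g w / ((w - v) * (z - w)) = ?g w / ((z - v) * (z - w))"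
      by (simp add: distrib_left)
  qed
  also have "\<dots> = 1 / (\<Prod>w\<in>F. z - w) / (z - v)"
    unfolding z sum_divide_distrib by (simp add: mult_ac)
  also have "\<dots> = 1 / (\<Prod>w\<in>insert v F. z - w)"
    using insert.hyps by (simp add: mult_ac)
  finally show ?case by simp
qed

text \<open>Cauchy's formula for \<open>H\<close> divided by \<open>z\<close> times the node
  product, with the partial fraction expansion in place of residues. A node outside the circle has
  zero integral, so no value of \<open>H\<close> is needed there; it still sits in the products,
  which later permits comparison with a long stretch of the lattice.\<close>

lemma lagrange_cauchy_bound:
  fixes H :: "complex \<Rightarrow> complex"
  assumes holo: "H holomorphic_on UNIV" and fin: "finite Y" and Y0: "0 \<notin> Y"
    and r: "0 < r" and C: "C \<ge> 0"
    and off: "\<And>y. y \<in> Y \<Longrightarrow> norm y \<noteq> r"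
    and circ: "\<And>z. norm z = r \<Longrightarrow> norm (H z) \<le> C * norm (\<Prod>y\<in>Y. z - y)"
  shows "norm (H 0) \<le> (\<Prod>y\<in>Y. norm y) * C
     + (\<Sum>y\<in>{y\<in>Y. norm y < r}. norm (H y) * (\<Prod>w\<in>Y-{y}. norm w / norm (y - w)))"
proof -
  define W where "W = insert 0 Y"
  define c where "c w = 1 / (\<Prod>w'\<in>W-{w}. w - w')" for w
  have finW: "finite W" and Wne: "W \<noteq> {}" using fin by (auto simp: W_def)
  have offW: "norm w \<noteq> r" if "w \<in> W" for w using that off r by (auto simp: W_def)
  have one: "((\<lambda>u. c w * (H u / (u - w))) has_contour_integral c w * (if norm w < r then 2 * of_real pi * \<i> * H w else 0)) (circlepath 0 r)"
    if "w \<in> W" for w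
  proof (rule has_contour_integral_lmul, cases "norm w < r")
    case True
    have "((\<lambda>u. H u / (u - w)) has_contour_integral (2 * of_real pi * \<i> * H w)) (circlepath 0 r)"
      by (rule Cauchy_integral_circlepath)
        (use True holo in \<open>auto intro: holomorphic_on_subset holomorphic_on_imp_continuous_on\<close>)
    then show "((\<lambda>u. H u / (u - w)) has_contour_integral (if norm w < r then 2 * of_real pi * \<i> * H w else 0)) (circlepath 0 r)"
      using True by simp
  next
    case False
    then have gt: "norm w > r" using offW[OF that] by simp
    have "((\<lambda>u. H u / (u - w)) has_contour_integral 0) (circlepath 0 r)"
    proof (rule Cauchy_theorem_disc_simple)
      show "(\<lambda>u. H u / (u - w)) holomorphic_on ball 0 (norm w)"
        by (intro holomorphic_intros holomorphic_on_subset[OF holo]) auto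
      show "path_image (circlepath 0 r) \<subseteq> ball 0 (norm w)"
        using gt r by (auto simp: sphere_def)
    qed auto
    then show "((\<lambda>u. H u / (u - w)) has_contour_integral (if norm w < r then 2 * of_real pi * \<i> * H w else 0)) (circlepath 0 r)"
      using False by simp
  qed
  define S where "S = (\<Sum>w\<in>W. c w * (if norm w < r then 2 * of_real pi * \<i> * H w else 0))"
  have "((\<lambda>u. \<Sum>w\<in>W. c w * (H u / (u - w))) has_contour_integral S) (circlepath 0 r)"
    unfolding S_def by (rule has_contour_integral_sum) (use finW one in auto)
  then have I: "((\<lambda>u. H u / (\<Prod>w\<in>W. u - w)) has_contour_integral S) (circlepath 0 r)"
  proof (rule has_contour_integral_eq)
    fix u assume "u \<in> path_image (circlepath 0 r)"
    then have "norm u = r" using r by (auto simp: sphere_def)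
    then have "u \<notin> W" using offW by auto
    from partial_fractions_prod[OF finW Wne this]
    have "H u / (\<Prod>w\<in>W. u - w) = H u * (\<Sum>w\<in>W. 1 / ((\<Prod>w'\<in>W-{w}. w - w') * (u - w)))"
      by (simp add: divide_inverse)
    then show "(\<Sum>w\<in>W. c w * (H u / (u - w))) = H u / (\<Prod>w\<in>W. u - w)"
      unfolding sum_distrib_left c_def by simp
  qed
  have "norm S \<le> (C / r) * (2 * pi * r)"
  proof (rule has_contour_integral_bound_circlepath[OF I])
    fix x :: complex assume "norm (x - 0) = r"
    then have x: "norm x = r" by simp
    then have "x \<notin> Y" using off by auto
    then have "norm (\<Prod>y\<in>Y. x - y) > 0" using fin by (auto simp: prod_zero_iff)
    moreover have "(\<Prod>w\<in>W. x - w) = x * (\<Prod>y\<in>Y. x - y)" using fin Y0 by (simp add: W_def)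
    ultimately show "norm (H x / (\<Prod>w\<in>W. x - w)) \<le> C / r"
      using circ[OF x] x r by (simp add: norm_divide norm_mult field_simps)
  qed (use C r in auto)
  then have nS: "norm S \<le> C * (2 * pi)" using r by simp
  have "S = (2 * of_real pi * \<i>) * (\<Sum>w\<in>W. if norm w < r then c w * H w else 0)"
    unfolding S_def sum_distrib_left by (intro sum.cong) auto
  also have "(\<Sum>w\<in>W. if norm w < r then c w * H w else 0) = c 0 * H 0 + (\<Sum>w\<in>{y\<in>Y. norm y < r}. c w * H w)"
    using fin Y0 r by (simp add: W_def sum.inter_filter)
  finally have S: "S = (2 * of_real pi * \<i>) * (c 0 * H 0 + (\<Sum>w\<in>{y\<in>Y. norm y < r}. c w * H w))" .
  have "norm (c 0 * H 0 + (\<Sum>w\<in>{y\<in>Y. norm y < r}. c w * H w)) \<le> C"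
    using nS unfolding S by (simp add: norm_mult)
  then have "norm (c 0 * H 0) \<le> C + norm (\<Sum>w\<in>{y\<in>Y. norm y < r}. c w * H w)"
    using norm_diff_ineq[of "c 0 * H 0" "\<Sum>w\<in>{y\<in>Y. norm y < r}. c w * H w"] by linarith
  also have "\<dots> \<le> C + (\<Sum>w\<in>{y\<in>Y. norm y < r}. norm (c w) * norm (H w))"
    by (intro add_left_mono order.trans[OF norm_sum]) (simp add: norm_mult)
  finally have *: "norm (c 0) * norm (H 0) \<le> C + (\<Sum>w\<in>{y\<in>Y. norm y < r}. norm (c w) * norm (H w))"
    by (simp add: norm_mult)
  \<comment> \<open>Multiplying by the moduli of all nodes normalises the coefficient of
    \<open>H 0\<close> to 1 and turns every other coefficient into a product of ratios.\<close>
  let ?P = "\<Prod>y\<in>Y. norm y"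
  have Ppos: "?P > 0" using fin Y0 by (intro prod_pos) auto
  have W0: "W - {0} = Y" using Y0 by (auto simp: W_def)
  have c0: "?P * norm (c 0) = 1"
    using Ppos unfolding c_def W0 by (simp add: norm_divide prod_norm[symmetric])
  have cy: "?P * norm (c y) = (\<Prod>w\<in>Y-{y}. norm w / norm (y - w))" if y: "y \<in> Y" for y
  proof -
    have y0: "y \<noteq> 0" using y Y0 by auto
    have "W - {y} = insert 0 (Y - {y})" using y0 by (auto simp: W_def)
    then have "(\<Prod>w'\<in>W-{y}. y - w') = y * (\<Prod>w\<in>Y-{y}. y - w)"
      using fin Y0 by simp
    then have "norm (c y) = 1 / (norm y * (\<Prod>w\<in>Y-{y}. norm (y - w)))"
      unfolding c_def by (simp add: norm_divide norm_mult prod_norm)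
    moreover have "?P = norm y * (\<Prod>w\<in>Y-{y}. norm w)" using fin y by (simp add: prod.remove)
    ultimately show ?thesis using y0 by (simp add: prod_dividef)
  qed
  have "norm (H 0) = ?P * (norm (c 0) * norm (H 0))" using c0 by (simp add: mult.assoc[symmetric])
  also have "\<dots> \<le> ?P * (C + (\<Sum>w\<in>{y\<in>Y. norm y < r}. norm (c w) * norm (H w)))"
    using Ppos * by (intro mult_left_mono) auto
  also have "\<dots> = ?P * C + (\<Sum>y\<in>{y\<in>Y. norm y < r}. norm (H y) * (?P * norm (c y)))"
    by (simp add: distrib_left sum_distrib_left mult_ac)
  also have "(\<Sum>y\<in>{y\<in>Y. norm y < r}. norm (H y) * (?P * norm (c y))) = (\<Sum>y\<in>{y\<in>Y. norm y < r}. norm (H y) * (\<Prod>w\<in>Y-{y}. norm w / norm (y - w)))"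
    by (intro sum.cong refl) (simp add: cy)
  finally show ?thesis .
qed

text \<open>On such a circle either the imaginary part is at least 1/4 in modulus and the
  exponential dominates, or the real part is within 1/8 of plus or minus \<open>n + 1/2\<close>,
  where \<open>cos (2 * (pi * Re z))\<close> is not positive and cannot cancel it.\<close>

lemma norm_sin_pi_half_integer_circle:
  fixes z :: complex and n :: nat
  assumes z: "norm z = real n + 1/2"
  shows "exp (pi * \<bar>Im z\<bar>) / 10 \<le> norm (sin (of_real pi * z))"
proof -
  define T where "T = exp (2 * (pi * \<bar>Im z\<bar>))"
  have Tpos: "T > 0" by (simp add: T_def)
  have sq: "norm (sin (of_real pi * z)) ^ 2 = (T + 1 / T - 2 * cos (2 * (pi * Re z))) / 4"
    unfolding norm_sin_squared T_def by (cases "Im z \<ge> 0") (simp_all add: exp_minus field_simps)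
  have "T / 100 \<le> (T + 1 / T - 2 * cos (2 * (pi * Re z))) / 4"
  proof (cases "\<bar>Im z\<bar> \<ge> 1/4")
    case True
    have "1 + 2 * (pi * \<bar>Im z\<bar>) \<le> T" unfolding T_def by (rule exp_ge_add_one_self)
    moreover have "pi * \<bar>Im z\<bar> \<ge> 3 * (1/4)" by (rule mult_mono) (use True pi_gt3 in auto)
    ultimately have "T \<ge> 5/2" by linarith
    moreover have "cos (2 * (pi * Re z)) \<le> 1" by simp
    moreover have "inverse T \<ge> 0" using Tpos by simp
    moreover have "T / 100 \<le> (T + u - 2 * c) / 4" if "5 / 2 \<le> T" "c \<le> 1" "0 \<le> u" for u c :: real
      using that by (simp add: field_simps)
    ultimately show ?thesis unfolding inverse_eq_divide[symmetric] by blast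
  next
    case False
    define x where "x = \<bar>Re z\<bar>"
    define \<delta> where "\<delta> = real n + 1/2 - x"
    have nz: "x\<^sup>2 + (Im z)\<^sup>2 = (real n + 1/2)\<^sup>2"
      using cmod_power2[of z] unfolding z x_def by simp
    have xle: "x \<le> real n + 1/2" using abs_Re_le_cmod[of z] z by (simp add: x_def)
    then have d0: "\<delta> \<ge> 0" by (simp add: \<delta>_def)
    have "(Im z)\<^sup>2 \<le> (1/4)\<^sup>2" using False by (intro power2_le_iff_abs_le[THEN iffD2]) auto
    then have I: "(Im z)\<^sup>2 \<le> 1/16" by (simp add: power2_eq_square)
    have "\<delta> * (real n + 1/2 + x) = (Im z)\<^sup>2" using nz by (simp add: \<delta>_def power2_eq_square algebra_simps)
    moreover have "\<delta> * (1/2) \<le> \<delta> * (real n + 1/2 + x)" by (intro mult_left_mono) (auto simp: d0 x_def)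
    ultimately have d1: "\<delta> \<le> 1/8" using I by linarith
    have "cos (2 * (pi * Re z)) = cos (2 * (pi * x))"
      unfolding x_def by (cases "Re z \<ge> 0") simp_all
    also have "2 * (pi * x) = (pi - 2 * pi * \<delta>) + 2 * pi * real n" by (simp add: \<delta>_def algebra_simps)
    also have "cos \<dots> = cos (pi - 2 * pi * \<delta>)" 
      using cos_int_2pin[of "int n"] sin_int_2pin[of "int n"] by (simp add: cos_add mult_ac)
    also have "\<dots> = - cos (2 * pi * \<delta>)" by simp
    also have "\<dots> \<le> 0"
    proof -
      have "2 * pi * \<delta> \<le> 2 * pi * (1/8)" using d1 by (intro mult_left_mono) auto
      moreover have "0 \<le> 2 * pi * \<delta>" using d0 by simp
      ultimately have "0 \<le> cos (2 * pi * \<delta>)" using pi_gt_zero by (intro cos_ge_zero) linarith+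
      then show ?thesis by simp
    qed
    finally have "cos (2 * (pi * Re z)) \<le> 0" .
    moreover have "inverse T \<ge> 0" using Tpos by simp
    moreover have "T / 100 \<le> (T + u - 2 * c) / 4" if "c \<le> 0" "0 \<le> u" for u c :: real
      using that Tpos by (simp add: field_simps)
    ultimately show ?thesis unfolding inverse_eq_divide[symmetric] by blast
  qed
  then have "(exp (pi * \<bar>Im z\<bar>) / 10)\<^sup>2 \<le> norm (sin (of_real pi * z)) ^ 2"
    unfolding sq by (simp add: T_def power_divide exp_double)
  then show ?thesis by (rule power2_le_imp_le) simp
qed

section \<open>The sine against its truncated product\<close>

lemma sum_inverse_squares_tail:
  fixes K n :: nat
  assumes "K \<ge> 1" "n \<ge> K"
  shows "(\<Sum>k=Suc K..n. 1 / (real k)\<^sup>2) \<le> 1 / real K - 1 / real n"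
  using assms(2)
proof (induction n rule: dec_induct)
  case base then show ?case by simp
next
  case (step n)
  have n: "real n > 0" using step.hyps assms by auto
  have "1 / (real (Suc n))\<^sup>2 \<le> 1 / real n - 1 / real (Suc n)"
    using n by (simp add: divide_simps power2_eq_square)
  then show ?case using step by (simp add: sum.nat_ivl_Suc')
qed

text \<open>Each factor of Euler's product beyond \<open>K\<close> is at most the exponential of
  \<open>(norm z)\<^sup>2 / k\<^sup>2\<close>, and the squares beyond \<open>K\<close> sum to at
  most \<open>1 / K\<close>.\<close>

lemma norm_sin_le_partial_product:
  fixes z :: complex and K :: nat
  assumes K: "K \<ge> 1"
  shows "norm (sin (of_real pi * z)) \<le> pi * norm z * (\<Prod>k=1..K. norm (1 - z\<^sup>2 / (of_nat k)\<^sup>2)) * exp ((norm z)\<^sup>2 / real K)"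
proof (rule Lim_bounded)
  show "(\<lambda>n. norm (of_real pi * z * (\<Prod>k=1..n. 1 - z^2 / of_nat k^2))) \<longlonglongrightarrow> norm (sin (of_real pi * z))"
    by (intro tendsto_norm sin_product_formula_complex)
  show "\<forall>n\<ge>K. norm (of_real pi * z * (\<Prod>k=1..n. 1 - z^2 / of_nat k^2))
      \<le> pi * norm z * (\<Prod>k=1..K. norm (1 - z\<^sup>2 / (of_nat k)\<^sup>2)) * exp ((norm z)\<^sup>2 / real K)"
  proof (intro allI impI)
    fix n assume n: "n \<ge> K"
    let ?f = "\<lambda>k. norm (1 - z\<^sup>2 / (of_nat k)\<^sup>2)"
    have "{1..n} = {1..K} \<union> {Suc K..n}" using n K by auto
    then have "(\<Prod>k=1..n. ?f k) = (\<Prod>k=1..K. ?f k) * (\<Prod>k=Suc K..n. ?f k)"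
      by (simp add: prod.union_disjoint)
    also have "(\<Prod>k=Suc K..n. ?f k) \<le> (\<Prod>k=Suc K..n. exp ((norm z)\<^sup>2 * (1 / (real k)\<^sup>2)))"
    proof (intro prod_mono conjI)
      fix k assume "k \<in> {Suc K..n}"
      have "?f k \<le> 1 + norm (z\<^sup>2 / (of_nat k)\<^sup>2)" using norm_triangle_ineq4[of 1 "z\<^sup>2 / (of_nat k)\<^sup>2"] by simp
      also have "\<dots> \<le> exp ((norm z)\<^sup>2 * (1 / (real k)\<^sup>2))"
        by (simp add: norm_divide norm_power)
      finally show "?f k \<le> exp ((norm z)\<^sup>2 * (1 / (real k)\<^sup>2))" .
    qed auto
    also have "\<dots> = exp ((norm z)\<^sup>2 * (\<Sum>k=Suc K..n. 1 / (real k)\<^sup>2))"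
      by (simp add: exp_sum sum_distrib_left)
    also have "\<dots> \<le> exp ((norm z)\<^sup>2 * (1 / real K))"
    proof -
      have "(\<Sum>k=Suc K..n. 1 / (real k)\<^sup>2) \<le> 1 / real K" 
        using sum_inverse_squares_tail[OF K n] by (smt (verit) divide_nonneg_nonneg of_nat_0_le_iff)
      then show ?thesis by (simp add: mult_left_mono del: times_divide_eq_right)
    qed
    finally have "(\<Prod>k=1..n. ?f k) \<le> (\<Prod>k=1..K. ?f k) * exp ((norm z)\<^sup>2 / real K)"
      by (simp add: mult_left_mono prod_nonneg)
    then show "norm (of_real pi * z * (\<Prod>k=1..n. 1 - z^2 / of_nat k^2))
      \<le> pi * norm z * (\<Prod>k=1..K. ?f k) * exp ((norm z)\<^sup>2 / real K)"
      by (simp add: norm_mult prod_norm[symmetric] mult.assoc mult_left_mono)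
  qed
qed

section \<open>Factorial estimates\<close>

lemma self_power_le_exp_fact: "(real n) ^ n \<le> exp (real n) * fact n"
proof -
  have "(\<Sum>k\<in>{n}. (real n)^k /\<^sub>R fact k) \<le> (\<Sum>k. (real n)^k /\<^sub>R fact k)"
    by (rule sum_le_suminf) (use exp_converges[of "real n"] in \<open>auto simp: sums_iff\<close>)
  also have "\<dots> = exp (real n)" using exp_converges[of "real n"] by (simp add: sums_iff)
  finally show ?thesis by (simp add: field_simps)
qed

lemma fact_add_le_power:
  assumes "real (K + E) \<le> B"
  shows "fact (K + E) \<le> fact K * B ^ E"
  using assms
proof (induction E)
  case (Suc E)
  have "(fact (K + Suc E) :: real) = real (K + Suc E) * fact (K + E)" by simp
  also have "\<dots> \<le> B * (fact K * B ^ E)" using Suc by (intro mult_mono) auto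
  finally show ?case by (simp add: mult_ac)
qed simp

text \<open>The product is the binomial coefficient of \<open>K + E\<close> over \<open>E\<close>,
  hence at most \<open>(K + E) ^ E / fact E\<close>, and \<open>fact E\<close> is at least
  \<open>(E / exp 1) ^ E\<close>.\<close>

lemma prod_shift_ratio_le:
  fixes K E :: nat
  assumes "E \<ge> 1"
  shows "(\<Prod>k=1..K. (real k + real E) / real k) \<le> (exp 1 * (real (K + E) / real E)) ^ E"
proof -
  have eq: "(\<Prod>k=1..K. (real k + real E) / real k) = fact (K + E) / (fact K * fact E)"
  proof (induction K)
    case (Suc K)
    have "(\<Prod>k=1..Suc K. (real k + real E) / real k) = (fact (K + E) / (fact K * fact E)) * ((real (Suc K) + real E) / real (Suc K))"
      using Suc by simp
    also have "\<dots> = fact (Suc K + E) / (fact (Suc K) * fact E)"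
      by (simp add: mult_ac add_ac)
    finally show ?case .
  qed simp
  have "fact (K + E) \<le> fact K * real (K + E) ^ E" by (rule fact_add_le_power) simp
  then have "fact (K + E) / (fact K * fact E) \<le> real (K + E) ^ E / fact E"
    by (simp add: field_simps)
  also have "\<dots> \<le> real (K + E) ^ E * (exp (real E) / real E ^ E)"
  proof -
    have "1 / fact E \<le> exp (real E) / real E ^ E" using self_power_le_exp_fact[of E] assms by (simp add: field_simps)
    then show ?thesis using mult_left_mono[of "1 / fact E" "exp (real E) / real E ^ E" "real (K + E) ^ E"] by simp
  qed
  also have "\<dots> = (exp 1 * (real (K + E) / real E)) ^ E"
    by (simp add: power_mult_distrib power_divide exp_of_nat_mult[symmetric])
  finally show ?thesis unfolding eq .
qed

section \<open>Products over a perturbed lattice\<close>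

lemma prod_le_scaled:
  fixes u v \<rho> :: "'a \<Rightarrow> real"
  assumes "\<And>k. k \<in> J \<Longrightarrow> 0 \<le> \<rho> k" "\<And>k. k \<in> J \<Longrightarrow> 0 \<le> u k" "\<And>k. k \<in> J \<Longrightarrow> \<rho> k * u k \<le> v k"
  shows "(\<Prod>k\<in>J. \<rho> k) * (\<Prod>k\<in>J. u k) \<le> (\<Prod>k\<in>J. v k)"
  unfolding prod.distrib[symmetric] by (rule prod_mono) (use assms in auto)

lemma card_int_near:
  fixes x :: real and D :: nat
  shows "finite {k::int. \<bar>x - of_int k\<bar> < real D}" "card {k::int. \<bar>x - of_int k\<bar> < real D} \<le> 2 * D + 1"
proof -
  have sub: "{k::int. \<bar>x - of_int k\<bar> < real D} \<subseteq> {\<lfloor>x\<rfloor> - int D..\<lfloor>x\<rfloor> + int D}"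
    by (auto simp: abs_less_iff) linarith+
  then show "finite {k::int. \<bar>x - of_int k\<bar> < real D}" by (rule finite_subset) simp
  show "card {k::int. \<bar>x - of_int k\<bar> < real D} \<le> 2 * D + 1"
    using card_mono[OF _ sub] by simp
qed

lemma prod_two_valued_ge:
  fixes \<alpha> \<beta> :: real
  assumes fin: "finite J" and a: "0 \<le> \<alpha>" "\<alpha> \<le> 1" and b: "0 \<le> \<beta>" "\<beta> \<le> 1"
    and cA: "card {k\<in>J. P k} \<le> p" and cJ: "card J \<le> q"
  shows "\<alpha> ^ p * \<beta> ^ q \<le> (\<Prod>k\<in>J. if P k then \<alpha> else \<beta>)"
proof -
  have "(\<Prod>k\<in>J. if P k then \<alpha> else \<beta>) = (\<Prod>k\<in>{k\<in>J. P k}. \<alpha>) * (\<Prod>k\<in>{k\<in>J. \<not> P k}. \<beta>)"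
    using fin by (simp add: prod.If_cases Int_def)
  also have "\<dots> = \<alpha> ^ card {k\<in>J. P k} * \<beta> ^ card {k\<in>J. \<not> P k}" by simp
  also have "\<dots> \<ge> \<alpha> ^ p * \<beta> ^ q"
  proof (intro mult_mono power_decreasing)
    show "card {k\<in>J. \<not> P k} \<le> q" using card_mono[OF fin, of "{k\<in>J. \<not> P k}"] cJ by auto
  qed (use a b cA in auto)
  finally show ?thesis .
qed

text \<open>A lattice point at distance at least \<open>D\<close> from \<open>z\<close> changes its
  factor by a ratio of at least \<open>1 - E / D\<close> when it moves by \<open>E\<close>. A closer
  one still leaves a factor at least \<open>g\<close> against one below \<open>D\<close>, and at
  most \<open>2 * D + 1\<close> integers can be that close.\<close>

lemma perturbed_lattice_prod_ge:
  fixes Y :: "int \<Rightarrow> real" and z :: complex and K D :: nat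
  defines "J \<equiv> {- int K..int K} - {0}"
  assumes Y: "\<And>k. k \<in> J \<Longrightarrow> \<bar>Y k - of_int k\<bar> \<le> E"
    and sep: "\<And>k. k \<in> J \<Longrightarrow> g \<le> norm (z - of_real (Y k))"
    and g: "0 < g" "g \<le> real D" and E: "0 \<le> E" "E \<le> real D"
  shows "(g / real D) ^ (2*D+1) * (1 - E / real D) ^ (2*K) * (\<Prod>k\<in>J. norm (z - of_int k))
      \<le> (\<Prod>k\<in>J. norm (z - of_real (Y k)))"
proof -
  have D: "real D > 0" using g by linarith
  have fin: "finite J" by (simp add: J_def)
  have cJ: "card J \<le> 2 * K" by (simp add: J_def card_Diff_subset)
  let ?P = "\<lambda>k. \<bar>Re z - of_int k\<bar> < real D"
  let ?\<rho> = "\<lambda>k. if ?P k \<and> norm (z - of_int k) < real D then g / real D else 1 - E / real D"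
  have "(g / real D) ^ (2*D+1) * (1 - E / real D) ^ (2*K) \<le> (\<Prod>k\<in>J. ?\<rho> k)"
  proof (rule prod_two_valued_ge[OF fin _ _ _ _ _ cJ])
    have "card {k \<in> J. ?P k \<and> norm (z - of_int k) < real D} \<le> card {k. ?P k}"
      by (rule card_mono) (use card_int_near(1) in auto)
    then show "card {k \<in> J. ?P k \<and> norm (z - of_int k) < real D} \<le> 2 * D + 1"
      using card_int_near(2)[of "Re z" D] by linarith
  qed (use g E D in \<open>auto simp: field_simps\<close>)
  then have "(g / real D) ^ (2*D+1) * (1 - E / real D) ^ (2*K) * (\<Prod>k\<in>J. norm (z - of_int k))
      \<le> (\<Prod>k\<in>J. ?\<rho> k) * (\<Prod>k\<in>J. norm (z - of_int k))"
    by (intro mult_right_mono prod_nonneg) auto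
  also have "\<dots> \<le> (\<Prod>k\<in>J. norm (z - of_real (Y k)))"
  proof (rule prod_le_scaled)
    fix k assume k: "k \<in> J"
    show "?\<rho> k * norm (z - of_int k) \<le> norm (z - of_real (Y k))"
    proof (cases "norm (z - of_int k) < real D")
      case True
      have "\<bar>Re (z - of_int k)\<bar> \<le> norm (z - of_int k)" by (rule abs_Re_le_cmod)
      then have "?\<rho> k = g / real D" using True by simp
      then have "?\<rho> k * norm (z - of_int k) \<le> g / real D * real D"
        using True g D by (simp only:) (intro mult_left_mono, auto)
      also have "\<dots> = g" using D by simp
      finally show ?thesis using sep[OF k] by linarith
    next
      case False
      let ?n = "norm (z - of_int k)"
      have "norm (z - of_int k) \<le> norm (z - of_real (Y k)) + norm (of_real (Y k) - of_int k :: complex)"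
        by norm
      moreover have "norm (of_real (Y k) - of_int k :: complex) = \<bar>Y k - of_int k\<bar>"
        by (metis norm_of_real of_real_diff of_real_of_int_eq)
      ultimately have "?n - E \<le> norm (z - of_real (Y k))" using Y[OF k] by linarith
      moreover have "E * 1 \<le> E * (?n / real D)"
        using False E D by (intro mult_left_mono) (auto simp: field_simps)
      ultimately show ?thesis using False by (simp add: algebra_simps)
    qed
  qed (use g E D in auto)
  finally show ?thesis .
qed

text \<open>The same comparison seen from a node instead of a point of the circle. Both ends move,
  hence \<open>2 * E\<close>. Nodes of \<open>F\<close> may be arbitrarily close to each other; the
  product of their small distances is the hypothesis \<open>near\<close>, and it enters as the
  factor \<open>exp (- \<tau>)\<close>.\<close>

lemma perturbed_lattice_row_ge:
  fixes Y :: "int \<Rightarrow> real" and K D :: nat and k :: int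
  defines "J \<equiv> {- int K..int K} - {0}"
  assumes k: "k \<in> J" and Y: "\<And>l. l \<in> J \<Longrightarrow> \<bar>Y l - of_int l\<bar> \<le> E"
    and F: "F \<subseteq> J"
    and sep: "\<And>l. l \<in> J - F \<Longrightarrow> l \<noteq> k \<Longrightarrow> g \<le> \<bar>Y k - Y l\<bar>"
    and near: "exp (- \<tau>) \<le> (\<Prod>l\<in>{l\<in>F-{k}. \<bar>real_of_int k - of_int l\<bar> < real D}. \<bar>Y k - Y l\<bar> / real D)"
    and g: "0 < g" "g \<le> real D" and E: "0 \<le> E" "2 * E \<le> real D"
  shows "exp (- \<tau>) * ((g / real D) ^ (2*D+1) * (1 - 2 * E / real D) ^ (2*K)) * (\<Prod>l\<in>J-{k}. \<bar>real_of_int k - of_int l\<bar>)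
      \<le> (\<Prod>l\<in>J-{k}. \<bar>Y k - Y l\<bar>)"
proof -
  have D: "real D > 0" using g by linarith
  have fin: "finite J" by (simp add: J_def)
  have cJ: "card J \<le> 2 * K" by (simp add: J_def card_Diff_subset)
  let ?P = "\<lambda>l. \<bar>real_of_int k - of_int l\<bar> < real D"
  let ?\<sigma> = "\<lambda>l. if l \<in> F \<and> ?P l then \<bar>Y k - Y l\<bar> / real D else 1"
  let ?\<rho> = "\<lambda>l. if ?P l then g / real D else 1 - 2 * E / real D"
  let ?\<rho>' = "\<lambda>l. if l \<in> F \<and> ?P l then 1 else ?\<rho> l"
  have 1: "(g / real D) ^ (2*D+1) * (1 - 2 * E / real D) ^ (2*K) \<le> (\<Prod>l\<in>J-{k}. ?\<rho> l)"
  proof (rule prod_two_valued_ge)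
    have "card {l \<in> J-{k}. ?P l} \<le> card {l. ?P l}"
      by (rule card_mono) (use card_int_near(1) in auto)
    then show "card {l \<in> J-{k}. ?P l} \<le> 2 * D + 1"
      using card_int_near(2)[of "of_int k" D] by linarith
    show "card (J - {k}) \<le> 2 * K" using cJ card_Diff1_le[of J k] by linarith
  qed (use g E D fin in \<open>auto simp: field_simps\<close>)
  also have "\<dots> \<le> (\<Prod>l\<in>J-{k}. ?\<rho>' l)"
    by (rule prod_mono) (use g E D in \<open>auto simp: field_simps\<close>)
  finally have 2: "(g / real D) ^ (2*D+1) * (1 - 2 * E / real D) ^ (2*K) \<le> (\<Prod>l\<in>J-{k}. ?\<rho>' l)" .
  have "(\<Prod>l\<in>J-{k}. ?\<sigma> l) = (\<Prod>l\<in>{l\<in>F-{k}. ?P l}. \<bar>Y k - Y l\<bar> / real D)"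
  proof -
    have eq: "{l\<in>F-{k}. ?P l} = {l\<in>J-{k}. l \<in> F \<and> ?P l}" using F by auto
    show ?thesis unfolding eq by (rule prod.inter_filter[symmetric]) (use fin in simp)
  qed
  with near have 3: "exp (- \<tau>) \<le> (\<Prod>l\<in>J-{k}. ?\<sigma> l)" by simp
  have "exp (- \<tau>) * ((g / real D) ^ (2*D+1) * (1 - 2 * E / real D) ^ (2*K)) \<le> (\<Prod>l\<in>J-{k}. ?\<sigma> l) * (\<Prod>l\<in>J-{k}. ?\<rho>' l)"
  proof (rule mult_mono[OF 3 2])
    show "0 \<le> (\<Prod>l\<in>J-{k}. ?\<sigma> l)" using D by (intro prod_nonneg) auto
    show "0 \<le> (g / real D) ^ (2*D+1) * (1 - 2 * E / real D) ^ (2*K)"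
      using g E D by (intro mult_nonneg_nonneg zero_le_power) (auto simp: divide_le_eq)
  qed
  then have "exp (- \<tau>) * ((g / real D) ^ (2*D+1) * (1 - 2 * E / real D) ^ (2*K)) * (\<Prod>l\<in>J-{k}. \<bar>real_of_int k - of_int l\<bar>)
     \<le> (\<Prod>l\<in>J-{k}. ?\<sigma> l * ?\<rho>' l) * (\<Prod>l\<in>J-{k}. \<bar>real_of_int k - of_int l\<bar>)"
    unfolding prod.distrib by (intro mult_right_mono prod_nonneg) auto
  also have "\<dots> \<le> (\<Prod>l\<in>J-{k}. \<bar>Y k - Y l\<bar>)"
  proof (rule prod_le_scaled)
    fix l assume l: "l \<in> J - {k}"
    show "?\<sigma> l * ?\<rho>' l * \<bar>real_of_int k - of_int l\<bar> \<le> \<bar>Y k - Y l\<bar>"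
    proof (cases "?P l")
      case True
      show ?thesis
      proof (cases "l \<in> F")
        case lF: True
        have "\<bar>Y k - Y l\<bar> / real D * \<bar>real_of_int k - of_int l\<bar> \<le> \<bar>Y k - Y l\<bar> / real D * real D"
          using True D by (intro mult_left_mono) auto
        then show ?thesis using True lF D by simp
      next
        case lF: False
        have "g / real D * \<bar>real_of_int k - of_int l\<bar> \<le> g / real D * real D"
          using True D g by (intro mult_left_mono) auto
        moreover have "g \<le> \<bar>Y k - Y l\<bar>" using sep l lF by auto
        ultimately show ?thesis using True lF D by simp
      qed
    next
      case False
      let ?n = "\<bar>real_of_int k - of_int l\<bar>"
      have "?n - 2 * E \<le> \<bar>Y k - Y l\<bar>" using Y[OF k] Y[of l] l by auto
      moreover have "(2 * E) * 1 \<le> (2 * E) * (?n / real D)"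
        using False E D by (intro mult_left_mono) (auto simp: field_simps)
      ultimately show ?thesis using False by (simp add: algebra_simps)
    qed
  qed (use g E D in auto)
  finally show ?thesis .
qed

lemma prod_nonzero_ints:
  fixes f :: "int \<Rightarrow> 'a::comm_monoid_mult"
  shows "(\<Prod>k\<in>{- int K..int K} - {0}. f k) = (\<Prod>k=1..K. f (int k) * f (- int k))"
proof (induction K)
  case (Suc K)
  have "{- int (Suc K)..int (Suc K)} - {0} = insert (int (Suc K)) (insert (- int (Suc K)) ({- int K..int K} - {0}))"
    by auto
  then show ?case using Suc by (simp add: mult_ac)
qed simp

lemma prod_lattice_norm:
  fixes z :: complex
  shows "(\<Prod>k\<in>{- int K..int K} - {0}. norm (z - of_int k)) = (fact K)\<^sup>2 * (\<Prod>k=1..K. norm (1 - z\<^sup>2 / (of_nat k)\<^sup>2))"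
proof -
  have "(\<Prod>k\<in>{- int K..int K} - {0}. norm (z - of_int k)) = (\<Prod>k=1..K. norm (z - of_nat k) * norm (z + of_nat k))"
    unfolding prod_nonzero_ints by simp
  also have "\<dots> = (\<Prod>k=1..K. (real k)\<^sup>2 * norm (1 - z\<^sup>2 / (of_nat k)\<^sup>2))"
  proof (intro prod.cong refl)
    fix k assume "k \<in> {1..K}"
    then have k: "(of_nat k :: complex) \<noteq> 0" by simp
    have "(z - of_nat k) * (z + of_nat k) = - ((of_nat k)\<^sup>2 * (1 - z\<^sup>2 / (of_nat k)\<^sup>2))"
      using k by (simp add: field_simps power2_eq_square)
    then have "norm ((z - of_nat k) * (z + of_nat k)) = norm ((of_nat k)\<^sup>2 * (1 - z\<^sup>2 / (of_nat k)\<^sup>2))"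
      by (simp only: norm_minus_cancel)
    then show "norm (z - of_nat k) * norm (z + of_nat k) = (real k)\<^sup>2 * norm (1 - z\<^sup>2 / (of_nat k)\<^sup>2)"
      by (simp add: norm_mult norm_power)
  qed
  also have "\<dots> = (\<Prod>k=1..K. real k)\<^sup>2 * (\<Prod>k=1..K. norm (1 - z\<^sup>2 / (of_nat k)\<^sup>2))"
    by (simp add: prod.distrib prod_power_distrib)
  also have "(\<Prod>k=1..K. real k) = fact K" by (simp add: fact_prod)
  finally show ?thesis .
qed

text \<open>Log-convexity of the factorial: passing from \<open>j\<close> to \<open>j + 1\<close>
  multiplies the right side by \<open>(K + j + 1) / (K - j)\<close>, which is at least 1.\<close>

lemma fact_square_le: 
  assumes "j \<le> K"
  shows "(fact K)\<^sup>2 \<le> (fact (K + j) * fact (K - j) :: real)"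
  using assms
proof (induction j)
  case (Suc j)
  have f: "fact (K - j) = real (K - j) * fact (K - Suc j)" using fact_reduce[of "K - j", where 'a=real] Suc.prems by simp
  have "(fact K)\<^sup>2 \<le> fact (K + j) * (fact (K - j) :: real)" using Suc by simp
  also have "\<dots> = real (K - j) * (fact (K + j) * fact (K - Suc j))" by (simp add: f)
  also have "\<dots> \<le> real (K + Suc j) * (fact (K + j) * fact (K - Suc j))" by (intro mult_right_mono) auto
  also have "\<dots> = fact (K + Suc j) * fact (K - Suc j)" by simp
  finally show ?case .
qed (simp add: power2_eq_square)

text \<open>The row product, with the factor for 0 restored, is
  \<open>fact (K + k) * fact (K - k)\<close>, at least \<open>(fact K)\<^sup>2\<close>. In other
  words, the Lagrange coefficients of the symmetric lattice at the omitted point 0 have modulus at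
  most 1.\<close>

lemma prod_lattice_row_ge:
  fixes k :: int and K :: nat
  defines "J \<equiv> {- int K..int K} - {0}"
  assumes k: "k \<in> J"
  shows "(\<Prod>l\<in>J-{k}. \<bar>real_of_int l\<bar>) \<le> (\<Prod>l\<in>J-{k}. \<bar>real_of_int k - of_int l\<bar>)"
proof -
  have fin: "finite J" by (simp add: J_def)
  have k0: "\<bar>real_of_int k\<bar> > 0" using k by (auto simp: J_def)
  have up: "(\<Prod>i=1..n. real i) = fact n" for n by (simp add: fact_prod)
  have "\<bar>real_of_int k\<bar> * (\<Prod>l\<in>J-{k}. \<bar>real_of_int l\<bar>) = (\<Prod>l\<in>J. \<bar>real_of_int l\<bar>)"
    using k fin by (simp add: prod.remove)
  also have "\<dots> = (fact K)\<^sup>2" unfolding J_def prod_nonzero_ints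
    by (simp add: prod.distrib power2_eq_square up[symmetric])
  also have "\<dots> \<le> fact (nat (int K + k)) * fact (nat (int K - k))"
  proof (cases "k \<ge> 0")
    case True
    then have "nat (int K + k) = K + nat k" "nat (int K - k) = K - nat k" "nat k \<le> K" using k by (auto simp: J_def)
    then show ?thesis using fact_square_le[of "nat k" K] by simp
  next
    case False
    then have "nat (int K + k) = K - nat (-k)" "nat (int K - k) = K + nat (-k)" "nat (-k) \<le> K" using k by (auto simp: J_def)
    then show ?thesis using fact_square_le[of "nat (-k)" K] by (simp add: mult.commute)
  qed
  also have "\<dots> = (\<Prod>l\<in>{- int K..int K}-{k}. \<bar>real_of_int k - of_int l\<bar>)"
  proof -
    have "{- int K..int K}-{k} = {- int K..k-1} \<union> {k+1..int K}" using k by (auto simp: J_def)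
    then have "(\<Prod>l\<in>{- int K..int K}-{k}. \<bar>real_of_int k - of_int l\<bar>) = 
      (\<Prod>l\<in>{- int K..k-1}. \<bar>real_of_int k - of_int l\<bar>) * (\<Prod>l\<in>{k+1..int K}. \<bar>real_of_int k - of_int l\<bar>)"
      by (simp add: prod.union_disjoint)
    also have "(\<Prod>l\<in>{- int K..k-1}. \<bar>real_of_int k - of_int l\<bar>) = (\<Prod>i=1..nat (int K + k). real i)"
      by (rule prod.reindex_bij_witness[of _ "\<lambda>i. k - int i" "\<lambda>l. nat (k - l)"]) auto
    also have "(\<Prod>l\<in>{k+1..int K}. \<bar>real_of_int k - of_int l\<bar>) = (\<Prod>i=1..nat (int K - k). real i)"
      by (rule prod.reindex_bij_witness[of _ "\<lambda>i. k + int i" "\<lambda>l. nat (l - k)"]) auto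
    finally show ?thesis unfolding up by simp
  qed
  also have "\<dots> = \<bar>real_of_int k\<bar> * (\<Prod>l\<in>J-{k}. \<bar>real_of_int k - of_int l\<bar>)"
  proof -
    have "{- int K..int K}-{k} = insert 0 (J - {k})" "0 \<notin> J - {k}" using k by (auto simp: J_def)
    then show ?thesis using fin by simp
  qed
  finally show ?thesis using k0 by simp
qed

text \<open>Moving a lattice point outwards by \<open>E\<close> multiplies its modulus by a ratio of
  at least 1, so the product of ratios over \<open>S\<close> may be extended to all of
  \<open>J\<close>, where positive and negative indices each give one binomial product.\<close>

lemma prod_shift_ratio_ints_le:
  fixes Y :: "int \<Rightarrow> real" and K E :: nat
  defines "J \<equiv> {- int K..int K} - {0}"
  assumes Y: "\<And>k. k \<in> J \<Longrightarrow> \<bar>Y k - of_int k\<bar> \<le> real E" and E: "E \<ge> 1" and S: "S \<subseteq> J"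
  shows "(\<Prod>k\<in>S. \<bar>Y k\<bar>) \<le> ((exp 1 * (real (K + E) / real E)) ^ E)\<^sup>2 * (\<Prod>k\<in>S. \<bar>real_of_int k\<bar>)"
proof -
  let ?r = "\<lambda>k::int. (\<bar>real_of_int k\<bar> + real E) / \<bar>real_of_int k\<bar>"
  have fin: "finite J" by (simp add: J_def)
  have "(\<Prod>k\<in>S. \<bar>Y k\<bar>) \<le> (\<Prod>k\<in>S. ?r k * \<bar>real_of_int k\<bar>)"
  proof (rule prod_mono, safe)
    fix k assume "k \<in> S"
    then have "k \<in> J" using S by auto
    then have "k \<noteq> 0" by (auto simp: J_def)
    then show "\<bar>Y k\<bar> \<le> ?r k * \<bar>real_of_int k\<bar>" using Y[OF \<open>k \<in> J\<close>] by simp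
  qed auto
  also have "\<dots> = (\<Prod>k\<in>S. ?r k) * (\<Prod>k\<in>S. \<bar>real_of_int k\<bar>)" by (rule prod.distrib)
  also have "(\<Prod>k\<in>S. ?r k) \<le> (\<Prod>k\<in>J. ?r k)"
  proof (rule prod_mono2[OF fin S])
    fix k assume "k \<in> J - S" then have "k \<noteq> 0" by (auto simp: J_def)
    then show "1 \<le> ?r k" by simp
  qed auto
  also have "(\<Prod>k\<in>J. ?r k) = (\<Prod>k=1..K. (real k + real E) / real k)\<^sup>2"
    unfolding J_def prod_nonzero_ints by (simp only: power2_eq_square prod.distrib) simp
  also have "\<dots> \<le> ((exp 1 * (real (K + E) / real E)) ^ E)\<^sup>2"
    by (intro power_mono prod_shift_ratio_le E prod_nonneg) auto
  finally show ?thesis by (simp add: mult_right_mono prod_nonneg)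
qed

text \<open>In lattice coordinates: \<open>M\<close> indices on either side are within reach of the
  circle, \<open>K\<close> is where the lattice is cut, \<open>E\<close> bounds the displacement,
  and \<open>D\<close> separates near indices from far ones. The losses are kept apart:
  \<open>q\<close> for the products of differences, \<Lambda> for the product of the node moduli,
  \<Xi> for cutting the sine product at \<open>K\<close>. On the circle the sine has the same size
  as the growth allowed for \<open>G\<close>, so the two cancel.\<close>

lemma interpolation_lattice_bound:
  fixes N m n A :: nat and Y :: "int \<Rightarrow> real" and G :: "complex \<Rightarrow> complex"
  defines "M \<equiv> m * N" and "D \<equiv> n * N" and "K \<equiv> A * (m * N)" and "E \<equiv> 2 * N"
    and "R \<equiv> real ((m - 1) * N) + 1/2" and "J \<equiv> {- int (A * (m * N))..int (A * (m * N))} - {0}"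
  assumes N: "N \<ge> 1" and m: "m \<ge> 8" and n: "n \<ge> 8" and A: "A \<ge> 1"
    and F: "F = {k\<in>J. \<bar>k\<bar> \<le> int ((m - 2) * N)}"
    and inj: "inj_on Y J" and Y0: "\<And>k. k \<in> J \<Longrightarrow> Y k \<noteq> 0"
    and YE: "\<And>k. k \<in> J \<Longrightarrow> \<bar>Y k - of_int k\<bar> \<le> real E"
    and Yin: "\<And>k. k \<in> F \<Longrightarrow> \<bar>Y k\<bar> \<le> real ((m - 2) * N)"
    and Yout: "\<And>k. k \<in> J - F \<Longrightarrow> \<bar>Y k\<bar> \<ge> real M + 1"
    and holo: "G holomorphic_on UNIV" and B: "B \<ge> 0"
    and circ: "\<And>z. norm z = R \<Longrightarrow> norm (G z) \<le> B * exp (pi * \<bar>Im z\<bar>)"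
    and node: "\<And>k. k \<in> F \<Longrightarrow> norm (G (of_real (Y k))) \<le> U"
    and near: "\<And>k. k \<in> F \<Longrightarrow> exp (- \<tau>) \<le> (\<Prod>l\<in>{l\<in>F-{k}. \<bar>real_of_int k - of_int l\<bar> < real D}. \<bar>Y k - Y l\<bar> / real D)"
    and Q: "0 < q" "q \<le> (1 / real n) ^ (2*D+1) * (1 - 4 / real n) ^ (2*K)"
    and \<Lambda>: "((exp 1 * (real (K + E) / real E)) ^ E)\<^sup>2 \<le> \<Lambda>" and ex: "exp (R\<^sup>2 / real K) \<le> \<Xi>"
  shows "norm (G 0) \<le> 10 * pi * real M * \<Lambda> * \<Xi> * B / q + 2 * real M * \<Lambda> * exp \<tau> * U / q"
proof -
  have Kdef: "K = A * M" by (simp add: K_def M_def)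
  have J: "J = {- int K..int K} - {0}" by (simp add: J_def K_def)
  have finJ: "finite J" by (simp add: J)
  have Npos: "real N > 0" and npos: "real n > 0" using N n by auto
  have Mm: "real M = real m * real N" by (simp add: M_def)
  have m2: "real ((m - 2) * N) = real M - 2 * real N" using m by (simp add: M_def of_nat_diff algebra_simps)
  have R: "R = real M - real N + 1/2" using m by (simp add: R_def M_def of_nat_diff algebra_simps)
  have N1: "real N \<ge> 1" using N by simp
  have RM: "R \<le> real M" "0 < R"
  proof -
    show "R \<le> real M" using N1 R by linarith
    show "0 < R" unfolding R_def by (rule add_nonneg_pos) auto
  qed
  have FJ: "F \<subseteq> J" using F by auto
  have K1: "K \<ge> 1" using A m N by (simp add: K_def)
  have Dr: "real N / real D = 1 / real n" "real E / real D = 2 / real n" using Npos by (simp_all add: D_def E_def)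
  have ND: "real N \<le> real D" using n mult_right_mono[of 1 "real n" "real N"] by (simp add: D_def)
  have ED: "2 * real E \<le> real D" using mult_right_mono[of 8 "real n" "real N"] n by (simp add: D_def E_def)
  have nn: "0 \<le> 1 - 4 / real n" "1 - 4 / real n \<le> 1 - 2 / real n" using n by (simp_all add: field_simps)
  have q2: "q \<le> (1 / real n) ^ (2*D+1) * (1 - 2 / real n) ^ (2*K)"
  proof (rule order.trans[OF Q(2)])
    show "(1 / real n) ^ (2*D+1) * (1 - 4 / real n) ^ (2*K) \<le> (1 / real n) ^ (2*D+1) * (1 - 2 / real n) ^ (2*K)"
      using nn by (intro mult_left_mono power_mono) auto
  qed
  have fK: "(fact K :: real) > 0" by simp
  have Lpos: "0 \<le> \<Lambda>" using \<Lambda> by (rule order.trans[rotated]) simp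
  have Xpos: "0 < \<Xi>" using ex by (rule less_le_trans[rotated]) simp
  define V where "V = (\<lambda>k. complex_of_real (Y k)) ` J"
  have injV: "inj_on (\<lambda>k. complex_of_real (Y k)) J" using inj by (auto simp: inj_on_def)
  have finV: "finite V" using finJ by (simp add: V_def)
  \<comment> \<open>The nodes of \<open>F\<close> stay within \<open>M - 2 * N\<close> and the
    others beyond \<open>M + 1\<close>, while \<open>R\<close> is \<open>M - N + 1/2\<close>; the
    circle runs through a gap of the nodes.\<close>
  have sep: "real N \<le> norm (z - of_real (Y k))" if z: "norm z = R" and k: "k \<in> J" for z :: complex and k
  proof -
    have tri: "\<bar>R - \<bar>Y k\<bar>\<bar> \<le> norm (z - of_real (Y k))" using norm_triangle_ineq3[of z "of_real (Y k)"] z by simp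
    show ?thesis
    proof (cases "k \<in> F")
      case True then show ?thesis using Yin[OF True] tri m2 R by linarith
    next
      case False then show ?thesis using Yout[of k] k tri R by auto
    qed
  qed
  have lattice: "(\<Prod>k\<in>J. norm (z - of_int k)) \<ge> (fact K)\<^sup>2 * exp (pi * \<bar>Im z\<bar>) / (10 * pi * R * \<Xi>)" if z: "norm z = R" for z
  proof -
    let ?p = "\<Prod>k=1..K. norm (1 - z\<^sup>2 / (of_nat k)\<^sup>2)"
    have "exp (pi * \<bar>Im z\<bar>) / 10 \<le> norm (sin (of_real pi * z))"
      by (rule norm_sin_pi_half_integer_circle[of z "(m - 1) * N"]) (simp add: z R_def)
    also have "\<dots> \<le> pi * R * ?p * exp (R\<^sup>2 / real K)"
      using norm_sin_le_partial_product[OF K1, of z] z by simp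
    also have "\<dots> \<le> pi * R * ?p * \<Xi>" using ex RM by (intro mult_left_mono) (auto intro!: mult_nonneg_nonneg prod_nonneg)
    finally have "exp (pi * \<bar>Im z\<bar>) / (10 * pi * R * \<Xi>) \<le> ?p" using RM Xpos by (simp add: field_simps)
    then show ?thesis unfolding J prod_lattice_norm using mult_left_mono[of _ ?p "(fact K :: real)\<^sup>2"] by fastforce
  qed
  define C where "C = B * (10 * pi * R * \<Xi>) / (q * (fact K)\<^sup>2)"
  have C0: "C \<ge> 0" unfolding C_def using B RM Xpos Q by simp
  have circ': "norm (G z) \<le> C * norm (\<Prod>y\<in>V. z - y)" if z: "norm z = R" for z
  proof -
    have "norm (\<Prod>y\<in>V. z - y) = (\<Prod>k\<in>J. norm (z - of_real (Y k)))"
      unfolding V_def prod.reindex[OF injV] by (simp add: prod_norm)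
    also have "\<dots> \<ge> (real N / real D) ^ (2*D+1) * (1 - real E / real D) ^ (2*K) * (\<Prod>k\<in>J. norm (z - of_int k))"
      unfolding J by (rule perturbed_lattice_prod_ge) (use YE sep[OF z] Npos ND ED J in auto)
    finally have "(1 / real n) ^ (2*D+1) * (1 - 2 / real n) ^ (2*K) * (\<Prod>k\<in>J. norm (z - of_int k)) \<le> norm (\<Prod>y\<in>V. z - y)"
      unfolding Dr .
    moreover have "q * ((fact K)\<^sup>2 * exp (pi * \<bar>Im z\<bar>) / (10 * pi * R * \<Xi>)) \<le> (1 / real n) ^ (2*D+1) * (1 - 2 / real n) ^ (2*K) * (\<Prod>k\<in>J. norm (z - of_int k))"
      by (rule mult_mono[OF q2 lattice[OF z]]) (use Q q2 RM Xpos in auto)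
    ultimately have *: "q * ((fact K)\<^sup>2 * exp (pi * \<bar>Im z\<bar>) / (10 * pi * R * \<Xi>)) \<le> norm (\<Prod>y\<in>V. z - y)" by linarith
    have "norm (G z) \<le> B * exp (pi * \<bar>Im z\<bar>)" by (rule circ[OF z])
    also have "\<dots> = C * (q * ((fact K)\<^sup>2 * exp (pi * \<bar>Im z\<bar>) / (10 * pi * R * \<Xi>)))"
      unfolding C_def using Q RM Xpos fK by simp
    also have "\<dots> \<le> C * norm (\<Prod>y\<in>V. z - y)" by (rule mult_left_mono[OF * C0])
    finally show ?thesis .
  qed
  have main: "norm (G 0) \<le> (\<Prod>y\<in>V. norm y) * C
     + (\<Sum>y\<in>{y\<in>V. norm y < R}. norm (G y) * (\<Prod>w\<in>V-{y}. norm w / norm (y - w)))"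
  proof (rule lagrange_cauchy_bound[OF holo finV _ RM(2) C0 _ circ'])
    show "0 \<notin> V" using Y0 by (auto simp: V_def)
    show "norm y \<noteq> R" if yV: "y \<in> V" for y
    proof
      assume R: "norm y = R"
      obtain k where "k \<in> J" "y = of_real (Y k)" using yV by (auto simp: V_def)
      then show False using sep[OF R, of k] Npos by simp
    qed
  qed
  have prodJ: "(\<Prod>k\<in>J. \<bar>real_of_int k\<bar>) = (fact K)\<^sup>2"
    using prod_lattice_norm[of 0 K] unfolding J[symmetric] by (simp add: norm_minus_commute)
  have "(\<Prod>y\<in>V. norm y) = (\<Prod>k\<in>J. \<bar>Y k\<bar>)" unfolding V_def prod.reindex[OF injV] by simp
  also have "\<dots> \<le> ((exp 1 * (real (K + E) / real E)) ^ E)\<^sup>2 * (\<Prod>k\<in>J. \<bar>real_of_int k\<bar>)"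
    by (rule prod_shift_ratio_ints_le) (use YE J N E_def in auto)
  also have "\<dots> \<le> \<Lambda> * (fact K)\<^sup>2" unfolding prodJ using \<Lambda> by (intro mult_right_mono) auto
  finally have "(\<Prod>y\<in>V. norm y) * C \<le> \<Lambda> * (fact K)\<^sup>2 * C" using C0 by (rule mult_right_mono)
  also have "\<dots> = 10 * pi * R * \<Lambda> * \<Xi> * B / q" unfolding C_def using fK Q by simp
  also have "\<dots> \<le> 10 * pi * real M * \<Lambda> * \<Xi> * B / q"
    using RM Q Xpos Lpos B by (intro divide_right_mono mult_right_mono mult_left_mono) auto
  finally have t1: "(\<Prod>y\<in>V. norm y) * C \<le> 10 * pi * real M * \<Lambda> * \<Xi> * B / q" .
  have setF: "{y\<in>V. norm y < R} = (\<lambda>k. complex_of_real (Y k)) ` F"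
  proof -
    have "\<bar>Y k\<bar> < R \<longleftrightarrow> k \<in> F" if "k \<in> J" for k
    proof (cases "k \<in> F")
      case True then show ?thesis using Yin[OF True] m2 R N1 by linarith
    next
      case False then show ?thesis using Yout[of k] that R N1 by auto
    qed
    then show ?thesis using FJ by (auto simp: V_def)
  qed
  have injF: "inj_on (\<lambda>k. complex_of_real (Y k)) F" using injV FJ by (rule inj_on_subset)
  have U0: "k \<in> F \<Longrightarrow> U \<ge> 0" for k using node[of k] norm_ge_zero order.trans by blast
  have row: "(\<Prod>w\<in>V-{of_real (Y k)}. norm w / norm (of_real (Y k) - w)) \<le> \<Lambda> * exp \<tau> / q" if k: "k \<in> F" for k
  proof -
    have kJ: "k \<in> J" using k FJ by auto
    have "V - {of_real (Y k)} = (\<lambda>l. complex_of_real (Y l)) ` (J - {k})"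
      using kJ injV by (auto simp: V_def inj_on_def)
    moreover have "inj_on (\<lambda>l. complex_of_real (Y l)) (J - {k})" using injV by (rule inj_on_subset) auto
    ultimately have "(\<Prod>w\<in>V-{of_real (Y k)}. norm w / norm (of_real (Y k) - w)) = (\<Prod>l\<in>J-{k}. \<bar>Y l\<bar> / \<bar>Y k - Y l\<bar>)"
      by (simp add: prod.reindex flip: of_real_diff)
    also have "\<dots> = (\<Prod>l\<in>J-{k}. \<bar>Y l\<bar>) / (\<Prod>l\<in>J-{k}. \<bar>Y k - Y l\<bar>)" by (rule prod_dividef)
    also have "\<dots> \<le> \<Lambda> * exp \<tau> / q"
    proof -
      let ?L = "\<Prod>l\<in>J-{k}. \<bar>real_of_int k - of_int l\<bar>" and ?T = "\<Prod>l\<in>J-{k}. \<bar>real_of_int l\<bar>"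
      have Tpos: "?T > 0" using J by (intro prod_pos) auto
      have TL: "?T \<le> ?L" unfolding J by (rule prod_lattice_row_ge) (use kJ J in auto)
      have "(\<Prod>l\<in>J-{k}. \<bar>Y l\<bar>) \<le> ((exp 1 * (real (K + E) / real E)) ^ E)\<^sup>2 * ?T"
        by (rule prod_shift_ratio_ints_le) (use YE J N E_def in auto)
      also have "\<dots> \<le> \<Lambda> * ?T" using \<Lambda> Tpos by (intro mult_right_mono) auto
      finally have a: "(\<Prod>l\<in>J-{k}. \<bar>Y l\<bar>) \<le> \<Lambda> * ?T" .
      have rowge: "exp (- \<tau>) * ((real N / real D) ^ (2*D+1) * (1 - 2 * real E / real D) ^ (2*K)) * ?L \<le> (\<Prod>l\<in>J-{k}. \<bar>Y k - Y l\<bar>)"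
        unfolding J
      proof (rule perturbed_lattice_row_ge)
        show "exp (- \<tau>) \<le> (\<Prod>l\<in>{l\<in>F-{k}. \<bar>real_of_int k - of_int l\<bar> < real D}. \<bar>Y k - Y l\<bar> / real D)" by (rule near[OF k])
        show "real N \<le> \<bar>Y k - Y l\<bar>" if "l \<in> {- int K..int K} - {0} - F" for l
          using Yout[of l] Yin[OF k] that m2 J N1 by (simp add: abs_if split: if_splits)
      qed (use kJ J YE FJ Npos ND ED in auto)
      have DE: "1 - 2 * real E / real D = 1 - 4 / real n" using Dr(2) by simp
      have "exp (- \<tau>) * q * ?T \<le> exp (- \<tau>) * ((1 / real n) ^ (2*D+1) * (1 - 4 / real n) ^ (2*K)) * ?L"
        by (intro mult_mono Q TL) (use Q Tpos nn in \<open>auto intro!: mult_nonneg_nonneg\<close>)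
      with rowge have b: "exp (- \<tau>) * q * ?T \<le> (\<Prod>l\<in>J-{k}. \<bar>Y k - Y l\<bar>)" unfolding DE Dr by linarith
      have "(\<Prod>l\<in>J-{k}. \<bar>Y l\<bar>) / (\<Prod>l\<in>J-{k}. \<bar>Y k - Y l\<bar>) \<le> (\<Lambda> * ?T) / (exp (- \<tau>) * q * ?T)"
        by (rule frac_le[OF _ a _ b]) (use Q Tpos Lpos in auto)
      also have "\<dots> = \<Lambda> * exp \<tau> / q" using Tpos by (simp add: exp_minus field_simps)
      finally show ?thesis .
    qed
    finally show ?thesis .
  qed
  have cF: "card F \<le> 2 * M"
  proof -
    have "F \<subseteq> {- int M..int M} - {0}"
    proof
      fix k assume "k \<in> F"
      then have "\<bar>k\<bar> \<le> int ((m-2)*N)" "k \<noteq> 0" using F J by auto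
      moreover have "int ((m-2)*N) \<le> int M" unfolding M_def of_nat_le_iff by (rule mult_right_mono) auto
      ultimately have "- int M \<le> k" "k \<le> int M" "k \<noteq> 0" by linarith+
      then show "k \<in> {- int M..int M} - {0}" by simp
    qed
    from card_mono[OF _ this] show ?thesis by (simp add: card_Diff_subset)
  qed
  have "(\<Sum>y\<in>{y\<in>V. norm y < R}. norm (G y) * (\<Prod>w\<in>V-{y}. norm w / norm (y - w)))
      = (\<Sum>k\<in>F. norm (G (of_real (Y k))) * (\<Prod>w\<in>V-{of_real (Y k)}. norm w / norm (of_real (Y k) - w)))"
    unfolding setF sum.reindex[OF injF] by simp
  also have "\<dots> \<le> (\<Sum>k\<in>F. U * (\<Lambda> * exp \<tau> / q))"
    by (intro sum_mono mult_mono node row U0 prod_nonneg) auto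
  also have "\<dots> = real (card F) * (U * (\<Lambda> * exp \<tau> / q))" by simp
  also have "\<dots> \<le> real (2 * M) * (U * (\<Lambda> * exp \<tau> / q))"
  \<comment> \<open>The sign of \<open>U\<close> is known only if some node exists; the index 1
    always belongs to \<open>F\<close>, so the empty case is void.\<close>
  proof (cases "F = {}")
    case False
    then have "U \<ge> 0" using U0 by auto
    then show ?thesis using cF Lpos Q by (intro mult_right_mono mult_nonneg_nonneg) auto
  next
    case True
    have "1 * 1 \<le> (m - 2) * N" using m N by (intro mult_mono) auto
    then have "\<bar>1\<bar> \<le> int ((m - 2) * N)" by linarith
    then have "1 \<in> F" unfolding F J using K1 by (simp del: of_nat_mult)
    then show ?thesis using True by simp
  qed
  finally show ?thesis using main t1 by (simp add: mult_ac)
qed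

text \<open>The powers of \<open>A\<close> are chosen so that every loss is the exponential of a
  multiple of \<open>M / A\<close>. With \<open>n\<close> the square and \<open>m\<close> the fourth
  power of \<open>A\<close>, the near indices cost about \<open>D * ln n\<close>, at most
  \<open>6 * M / A\<close>, the far ones about \<open>K / n\<close>, giving
  \<open>16 * M / A\<close>, and the displacement of the node moduli costs at most
  \<open>6 * M / A\<close>.\<close>

lemma interpolation_loss_bound:
  fixes N A :: nat
  defines "n \<equiv> A^2" and "m \<equiv> A^4"
  defines "M \<equiv> m * N" and "D \<equiv> n * N" and "K \<equiv> A * (m * N)" and "E \<equiv> 2 * N"
  assumes N: "N \<ge> 1" and A: "A \<ge> 4"
  shows "exp (- 22 * real M / real A) \<le> (1 / real n) ^ (2*D+1) * (1 - 4 / real n) ^ (2*K)"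
    and "((exp 1 * (real (K + E) / real E)) ^ E)\<^sup>2 \<le> exp (6 * real M / real A)"
    and "\<bar>R\<bar> \<le> real M \<Longrightarrow> exp (R\<^sup>2 / real K) \<le> exp (real M / real A)"
proof -
  have A4: "real A \<ge> 4" using A by simp
  have Apos: "real A > 0" using A by simp
  have Npos: "real N > 0" using N by simp
  have n16: "real n \<ge> 16" using power_mono[OF A4, of 2] by (simp add: n_def)
  have nA: "real n = real A ^ 2" by (simp add: n_def)
  have M: "real M = real A ^ 4 * real N" by (simp add: M_def m_def)
  have lnA: "ln (real A) \<le> real A" using ln_le_minus_one[OF Apos] by linarith
  have K: "real K = real A * real M" by (simp add: K_def M_def)
  have Dn: "real D = real A ^ 2 * real N" by (simp add: D_def n_def)
  have D1: "real D \<ge> 1"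
  proof -
    have "1 * 1 \<le> n * N" using n16 N by (intro mult_mono) auto
    then show ?thesis unfolding D_def by (metis mult_1 of_nat_1 of_nat_le_iff)
  qed
  show "exp (- 22 * real M / real A) \<le> (1 / real n) ^ (2*D+1) * (1 - 4 / real n) ^ (2*K)"
  proof -
    have "exp (- 6 * real M / real A) \<le> (1 / real n) ^ (2*D+1)"
    proof -
      have "real (2*D+1) * ln (real n) \<le> (3 * real D) * (2 * real A)"
      proof (rule mult_mono)
        show "ln (real n) \<le> 2 * real A" using lnA Apos by (simp add: nA ln_realpow)
        show "0 \<le> ln (real n)" using n16 by simp
      qed (use D1 in auto)
      also have "\<dots> = 6 * (real A ^ 3 * real N)" by (simp add: Dn power2_eq_square power3_eq_cube)
      also have "\<dots> = 6 * real M / real A" using Apos by (simp add: M power_eq_if)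
      finally have "- 6 * real M / real A \<le> real (2*D+1) * ln (1 / real n)" using n16 by (simp add: ln_div)
      then have "exp (- 6 * real M / real A) \<le> exp (real (2*D+1) * ln (1 / real n))" by (simp only: exp_le_cancel_iff)
      also have "\<dots> = (1 / real n) ^ (2*D+1)" unfolding exp_of_nat_mult using n16 by (subst exp_ln) auto
      finally show ?thesis .
    qed
    moreover have "exp (- 16 * real M / real A) \<le> (1 - 4 / real n) ^ (2*K)"
    proof -
      define x where "x = 4 / real n"
      have x: "0 \<le> x" "x \<le> 1/2" using n16 by (auto simp: x_def field_simps)
      have "1 \<le> (1 - x) * (1 + 2 * x)" using mult_nonneg_nonneg[of x "1 - 2 * x"] x by (simp add: algebra_simps)
      also have "\<dots> \<le> (1 - x) * exp (2 * x)" using x by (intro mult_left_mono exp_ge_add_one_self) auto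
      finally have "exp (- (2 * x)) \<le> 1 - x" by (simp add: exp_minus field_simps)
      then have "exp (- (2 * x)) ^ (2*K) \<le> (1 - x) ^ (2*K)" by (rule power_mono) simp
      also have "exp (- (2 * x)) ^ (2*K) = exp (real (2*K) * (- (2 * x)))" by (simp only: exp_of_nat_mult)
      also have "real (2*K) * (- (2 * x)) = - 16 * real M / real A"
        using Apos by (simp add: K x_def nA power2_eq_square)
      finally show ?thesis by (simp add: x_def)
    qed
    ultimately have "exp (- 6 * real M / real A) * exp (- 16 * real M / real A) \<le> (1 / real n) ^ (2*D+1) * (1 - 4 / real n) ^ (2*K)"
      by (intro mult_mono) auto
    also have "exp (- 6 * real M / real A) * exp (- 16 * real M / real A) = exp (- 22 * real M / real A)"
      unfolding exp_add[symmetric] by (simp add: field_simps)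
    finally show ?thesis .
  qed
  show "((exp 1 * (real (K + E) / real E)) ^ E)\<^sup>2 \<le> exp (6 * real M / real A)"
  proof -
    have "real (K + E) / real E = real A ^ 5 / 2 + 1" using Npos
      by (simp add: K_def E_def m_def field_simps power_eq_if)
    also have "\<dots> \<le> real A ^ 5"
      using power_mono[OF A4, of 5] by simp
    finally have "exp 1 * (real (K + E) / real E) \<le> exp 1 * real A ^ 5" by (rule mult_left_mono) simp
    also have "\<dots> = exp (1 + 5 * ln (real A))" 
      using Apos exp_of_nat_mult[of 5 "ln (real A)"] by (simp add: exp_add)
    also have "\<dots> \<le> exp (6 * real A)" using lnA A4 by simp
    finally have "(exp 1 * (real (K + E) / real E)) ^ E \<le> exp (6 * real A) ^ E"
      by (intro power_mono) auto
    also have "\<dots> = exp (real E * (6 * real A))" by (simp only: exp_of_nat_mult)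
    finally have "((exp 1 * (real (K + E) / real E)) ^ E)\<^sup>2 \<le> (exp (real E * (6 * real A)))\<^sup>2"
      by (intro power_mono) auto
    also have "\<dots> = exp (2 * (real E * (6 * real A)))" by (simp only: exp_double)
    also have "2 * (real E * (6 * real A)) \<le> 6 * real M / real A"
    proof -
      have "4 * real A * real A \<le> real A ^ 4"
        using mult_mono[of 4 "real A * real A" "real A * real A" "real A * real A"] mult_mono[OF A4 A4] A4 
        by (simp add: power_eq_if mult_ac)
      then have "6 * real N * (4 * real A * real A) \<le> 6 * real N * real A ^ 4" using Npos by (intro mult_left_mono) auto
      then show ?thesis using Apos by (simp add: E_def M field_simps)
    qed
    finally show ?thesis by simp
  qed
  show "exp (R\<^sup>2 / real K) \<le> exp (real M / real A)" if "\<bar>R\<bar> \<le> real M"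
  proof -
    have Mpos: "real M > 0" using Apos Npos by (simp add: M)
    have "R\<^sup>2 \<le> (real M)\<^sup>2" using that by (metis abs_le_square_iff abs_of_nat)
    then have "R\<^sup>2 / real K \<le> real M / real A" using Apos Mpos by (simp add: K field_simps power2_eq_square)
    then show ?thesis by simp
  qed
qed

text \<open>Equal numbers of points are taken from each of the \<open>2 * m\<close> cells, so the
  \<open>k\<close>-th point lies in the cell that also contains the \<open>k\<close>-th of
  \<open>m * N\<close> equally spaced points on that side. This is what makes the nodes a perturbed
  lattice.\<close>

lemma enumerate_cells:
  fixes Z :: "real set" and m N :: nat
  assumes fin: "finite Z" and m: "m \<ge> 1" and N: "N \<ge> 1"
    and cells: "\<And>j::int. - int m \<le> j \<Longrightarrow> j < int m \<Longrightarrow> N \<le> card (Z \<inter> {of_int j / real m<..(of_int j + 1) / real m})"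
  obtains y :: "int \<Rightarrow> real" where
    "inj_on y {k. k \<noteq> 0 \<and> \<bar>k\<bar> \<le> int (m * N)}"
    "\<And>k. k \<noteq> 0 \<Longrightarrow> \<bar>k\<bar> \<le> int (m * N) \<Longrightarrow> y k \<in> Z \<and> \<bar>y k - of_int k / real (m * N)\<bar> \<le> 1 / real m"
    "\<And>k i. k \<noteq> 0 \<Longrightarrow> i \<le> m \<Longrightarrow> \<bar>k\<bar> \<le> int (i * N) \<Longrightarrow> \<bar>y k\<bar> \<le> real i / real m"
proof -
  let ?c = "\<lambda>j::int. Z \<inter> {of_int j / real m<..(of_int j + 1) / real m}"
  have "\<exists>f. inj_on f {..<N} \<and> f ` {..<N} \<subseteq> ?c j" if "- int m \<le> j" "j < int m" for j
    using card_le_inj[of "{..<N}" "?c j"] cells[OF that] fin by auto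
  then obtain f where f: "\<And>j. - int m \<le> j \<Longrightarrow> j < int m \<Longrightarrow> inj_on (f j) {..<N} \<and> f j ` {..<N} \<subseteq> ?c j" by metis
  \<comment> \<open>The index 0 is left out, so positive indices are shifted down by one: 1 to
    \<open>N\<close> fill cell 0, and \<open>- N\<close> to -1 fill cell -1.\<close>
  define p where "p k = (if k > 0 then k - 1 else k)" for k :: int
  define y where "y k = f (p k div int N) (nat (p k mod int N))" for k
  have Nint: "int N > 0" using N by simp
  have rng: "- int i \<le> p k div int N \<and> p k div int N < int i" if "k \<noteq> 0" "\<bar>k\<bar> \<le> int (i * N)" for k i
  proof -
    have 1: "- int i * int N \<le> p k" "p k < int i * int N" using that by (auto simp: p_def split: if_splits)
    have "(- int i * int N) div int N \<le> p k div int N" using 1(1) Nint by (rule zdiv_mono1)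
    moreover have "p k div int N < int i"
    proof (rule ccontr)
      assume "\<not> p k div int N < int i"
      then have "int i * int N \<le> (p k div int N) * int N" using Nint by (intro mult_right_mono) auto
      moreover have "(p k div int N) * int N + p k mod int N = p k" by simp
      moreover have "p k mod int N \<ge> 0" using Nint by simp
      ultimately show False using 1(2) by linarith
    qed
    moreover have "(- int i * int N) div int N = - int i" by (rule nonzero_mult_div_cancel_right) (use Nint in simp)
    ultimately show ?thesis by simp
  qed
  have md: "nat (p k mod int N) < N" for k using Nint by (simp add: nat_less_iff)
  have ycell: "y k \<in> ?c (p k div int N)" if "k \<noteq> 0" "\<bar>k\<bar> \<le> int (m * N)" for k
    using f[of "p k div int N"] rng[OF that] md[of k] unfolding y_def by blast
  have mpos: "real m > 0" and Npos: "real N > 0" using m N by auto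
  show thesis
  proof
    show "inj_on y {k. k \<noteq> 0 \<and> \<bar>k\<bar> \<le> int (m * N)}"
    proof (rule inj_onI, safe)
      fix k l assume k: "k \<noteq> 0" "\<bar>k\<bar> \<le> int (m * N)" and l: "l \<noteq> 0" "\<bar>l\<bar> \<le> int (m * N)" and eq: "y k = y l"
      have d: "p k div int N = p l div int N"
      proof (rule ccontr)
        assume ne: "p k div int N \<noteq> p l div int N"
        have disj: False if "u \<in> ?c i" "u \<in> ?c j" "i < j" for u i j
        proof -
          have "of_int j < of_int i + (1::real)" using that mpos by (auto simp: field_simps)
          then show False using that(3) by linarith
        qed
        show False using ne ycell[OF k] ycell[OF l] disj unfolding eq by (meson linorder_neqE)
      qed
      have "inj_on (f (p k div int N)) {..<N}" using f rng[OF k] by blast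
      moreover have "f (p k div int N) (nat (p k mod int N)) = f (p k div int N) (nat (p l mod int N))"
        using eq unfolding y_def d by simp
      ultimately have "nat (p k mod int N) = nat (p l mod int N)" using md by (auto dest!: inj_onD)
      then have "p k mod int N = p l mod int N" using Nint by (simp add: nat_eq_iff)
      then have "p k = p l" using d by (metis div_mult_mod_eq)
      then show "k = l" using k l by (auto simp: p_def split: if_splits)
    qed
  next
    fix k :: int assume k: "k \<noteq> 0" "\<bar>k\<bar> \<le> int (m * N)"
    define j where "j = p k div int N"
    have "p k = j * int N + p k mod int N" by (simp add: j_def)
    moreover have "0 \<le> p k mod int N" "p k mod int N < int N" using Nint by auto
    ultimately have "j * int N \<le> p k" "p k + 1 \<le> j * int N + int N" by linarith+
    then have "j * int N \<le> k" "k \<le> j * int N + int N" by (auto simp: p_def split: if_splits)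
    then have 1: "of_int j * real N \<le> of_int k" "of_int k \<le> of_int j * real N + real N" 
      by (metis of_int_le_iff of_int_mult of_int_of_nat_eq) (metis (mono_tags) \<open>k \<le> j * int N + int N\<close> of_int_add of_int_le_iff of_int_mult of_int_of_nat_eq)
    have "of_int j / real m \<le> of_int k / real (m * N)" "of_int k / real (m * N) \<le> (of_int j + 1) / real m"
      using 1 mpos Npos by (simp_all add: field_simps)
    moreover have "y k \<in> Z" "of_int j / real m < y k" "y k \<le> (of_int j + 1) / real m" using ycell[OF k] by (auto simp: j_def)
    moreover have "(of_int j + 1) / real m - of_int j / real m = 1 / real m" using mpos by (simp add: field_simps)
    ultimately show "y k \<in> Z \<and> \<bar>y k - of_int k / real (m * N)\<bar> \<le> 1 / real m" by (auto simp: abs_le_iff)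
  next
    fix k :: int and i :: nat assume k: "k \<noteq> 0" "i \<le> m" "\<bar>k\<bar> \<le> int (i * N)"
    have "i * N \<le> m * N" using k(2) by simp
    then have "\<bar>k\<bar> \<le> int (m * N)" using k(3) by linarith
    then have c: "y k \<in> ?c (p k div int N)" using ycell k by blast
    have r: "- int i \<le> p k div int N" "p k div int N + 1 \<le> int i" using rng[OF k(1) k(3)] by auto
    have "- real i / real m \<le> of_int (p k div int N) / real m"
      using r(1) mpos by (intro divide_right_mono) linarith+
    moreover have "(of_int (p k div int N) + 1) / real m \<le> real i / real m"
      using r(2) mpos by (intro divide_right_mono) linarith+
    ultimately show "\<bar>y k\<bar> \<le> real i / real m" using c by auto
  qed
qed

text \<open>The disc of radius \<open>s\<close> about a contact point has been rescaled to the unit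
  disc. Both \<open>m\<close> and \<open>s0\<close> depend on the constants only, not on
  \<open>H\<close> or the nodes. The conclusion is strict since equality is what holds at a contact
  point.\<close>

lemma interpolation_local_bound:
  fixes b d2 \<Theta> \<kappa> :: real
  assumes b: "0 \<le> b" "b < pi * d2" and \<Theta>: "0 < \<Theta>" and \<kappa>: "0 < \<kappa>" "\<kappa> \<le> 1"
  obtains m :: nat and s0 :: real where "m \<ge> 1"
    "\<And>s (H :: complex \<Rightarrow> complex) Z. \<lbrakk>s \<ge> s0; H holomorphic_on UNIV; finite Z;
      \<And>z. norm z \<le> 1 \<Longrightarrow> norm (H z) \<le> exp (s * (b * \<bar>Im z\<bar> + (pi * d2 - b) / 16));
      \<And>j::int. - int m \<le> j \<Longrightarrow> j < int m \<Longrightarrow> d2 * s / real m \<le> real (card (Z \<inter> {of_int j / real m<..(of_int j + 1) / real m}));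
      \<And>y. y \<in> Z \<Longrightarrow> norm (H (of_real y)) \<le> exp (\<Theta> / 8 * s);
      \<And>y. y \<in> Z \<Longrightarrow> (\<Sum>y'\<in>{y'\<in>Z. y' \<noteq> y \<and> \<bar>y - y'\<bar> < \<kappa>}. ln (1 / \<bar>y - y'\<bar>)) \<le> \<Theta> / 8 * s\<rbrakk>
      \<Longrightarrow> norm (H 0) < exp (\<Theta> * s)"
proof -
  \<comment> \<open>A quarter of the density surplus. It is the exponent of a Gaussian factor
    introduced below.\<close>
  define \<gamma> where "\<gamma> = (pi * d2 - b) / 4"
  have \<gamma>: "\<gamma> > 0" using b by (simp add: \<gamma>_def)
  have d2: "d2 > 0"
  proof (rule ccontr)
    assume "\<not> d2 > 0"
    then have "pi * d2 \<le> 0" by (simp add: mult_nonneg_nonpos)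
    then show False using b by linarith
  qed
  \<comment> \<open>All interpolation losses add up to at most \<open>29 * M / A\<close> (22 + 6 +
    1), and \<open>M\<close> is at most \<open>d2 * s\<close>; the first two bounds make them an
    eighth of the available gains. The bound \<open>5 / \<kappa>\<close> puts nodes whose indices
    differ by less than \<open>n * N\<close> within distance \<kappa>.\<close>
  obtain A0 :: nat where A0: "real A0 > max (max (29 * d2 / (\<Theta> / 8)) (29 * d2 / (\<gamma> / 8))) (5 / \<kappa>)"
    using reals_Archimedean2 by blast
  define A where "A = max 4 A0"
  have A4: "A \<ge> 4" and Apos: "real A > 0" by (auto simp: A_def)
  have AA: "real A \<ge> real A0" by (simp add: A_def)
  have "29 * d2 / (\<Theta> / 8) \<le> real A" "29 * d2 / (\<gamma> / 8) \<le> real A" "5 / \<kappa> \<le> real A" using A0 AA by linarith+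
  then have A1: "29 * d2 / real A \<le> \<Theta> / 8" and A2: "29 * d2 / real A \<le> \<gamma> / 8" and A3: "5 / real A \<le> \<kappa>"
    using \<Theta> \<gamma> \<kappa> Apos by (simp_all add: field_simps)
  define n where "n = A^2"
  define m where "m = A^4"
  have n16: "n \<ge> 16" using power_mono[OF A4, of 2] by (simp add: n_def)
  have m256: "m \<ge> 256" using power_mono[OF A4, of 4] by (simp add: m_def)
  have mn: "m = n * n" by (simp add: m_def n_def power_eq_if)
  have mpos: "real m > 0" using m256 by simp
  have ev: "eventually (\<lambda>s. 10 * pi * (d2 * s) * exp (pi * real m - 3 / 8 * \<gamma> * s) + 2 * (d2 * s) * exp (3 / 8 * \<Theta> * s) < exp (\<Theta> * s)) at_top"
  proof -
    have lim: "((\<lambda>s::real. s * exp (- c * s)) \<longlongrightarrow> 0) at_top" if "c > 0" for c :: real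
      using that by real_asymp
    have "((\<lambda>s. 10 * pi * d2 * exp (pi * real m) * (s * exp (- (3 / 8 * \<gamma>) * s))) \<longlongrightarrow> 10 * pi * d2 * exp (pi * real m) * 0) at_top"
      using \<gamma> by (intro tendsto_mult tendsto_const lim) simp
    then have 1: "eventually (\<lambda>s. 10 * pi * d2 * exp (pi * real m) * (s * exp (- (3 / 8 * \<gamma>) * s)) < 1/2) at_top"
      by (rule order_tendstoD(2)) simp
    have "((\<lambda>s. 2 * d2 * (s * exp (- (5 / 8 * \<Theta>) * s))) \<longlongrightarrow> 2 * d2 * 0) at_top"
      using \<Theta> by (intro tendsto_mult tendsto_const lim) simp
    then have 2: "eventually (\<lambda>s. 2 * d2 * (s * exp (- (5 / 8 * \<Theta>) * s)) < 1/2) at_top"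
      by (rule order_tendstoD(2)) simp
    show ?thesis using 1 2 eventually_ge_at_top[of 0]
    proof eventually_elim
      case (elim s)
      have e1: "1 \<le> exp (\<Theta> * s)" using \<Theta> elim(3) by simp
      have "10 * pi * (d2 * s) * exp (pi * real m - 3 / 8 * \<gamma> * s) = 10 * pi * d2 * exp (pi * real m) * (s * exp (- (3 / 8 * \<gamma>) * s))"
      proof -
        have "exp (pi * real m - 3 / 8 * \<gamma> * s) = exp (pi * real m) * exp (- (3 / 8 * \<gamma>) * s)"
          unfolding exp_add[symmetric] by simp
        then show ?thesis by (simp only: mult_ac)
      qed
      then have a: "10 * pi * (d2 * s) * exp (pi * real m - 3 / 8 * \<gamma> * s) < 1/2 * exp (\<Theta> * s)" using elim(1) e1 by linarith
      have "exp (3 / 8 * \<Theta> * s) = exp (- (5 / 8 * \<Theta>) * s) * exp (\<Theta> * s)" unfolding exp_add[symmetric] by (simp add: algebra_simps)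
      then have "2 * (d2 * s) * exp (3 / 8 * \<Theta> * s) = (2 * d2 * (s * exp (- (5 / 8 * \<Theta>) * s))) * exp (\<Theta> * s)" by simp
      also have "\<dots> < 1/2 * exp (\<Theta> * s)" using elim(2) by (intro mult_strict_right_mono) auto
      finally show ?case using a by linarith
    qed
  qed
  then obtain s1 where s1: "\<And>s. s \<ge> s1 \<Longrightarrow> 10 * pi * (d2 * s) * exp (pi * real m - 3 / 8 * \<gamma> * s) + 2 * (d2 * s) * exp (3 / 8 * \<Theta> * s) < exp (\<Theta> * s)"
    by (auto simp: eventually_at_top_linorder)
  \<comment> \<open>The second entry guarantees \<open>d2 * s / m \<ge> 1\<close>, so that each cell
    yields at least one node after rounding down.\<close>
  define s0 where "s0 = max s1 (real m / d2)"
  show thesis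
  proof
    show "m \<ge> 1" using m256 by simp
  next
    fix s and H :: "complex \<Rightarrow> complex" and Z
    assume s: "s \<ge> s0" and holo: "H holomorphic_on UNIV" and finZ: "finite Z"
      and Hb: "\<And>z. norm z \<le> 1 \<Longrightarrow> norm (H z) \<le> exp (s * (b * \<bar>Im z\<bar> + (pi * d2 - b) / 16))"
      and cells: "\<And>j::int. - int m \<le> j \<Longrightarrow> j < int m \<Longrightarrow> d2 * s / real m \<le> real (card (Z \<inter> {of_int j / real m<..(of_int j + 1) / real m}))"
      and Hn: "\<And>y. y \<in> Z \<Longrightarrow> norm (H (of_real y)) \<le> exp (\<Theta> / 8 * s)"
      and en: "\<And>y. y \<in> Z \<Longrightarrow> (\<Sum>y'\<in>{y'\<in>Z. y' \<noteq> y \<and> \<bar>y - y'\<bar> < \<kappa>}. ln (1 / \<bar>y - y'\<bar>)) \<le> \<Theta> / 8 * s"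
    have ss1: "s \<ge> s1" and dsm: "d2 * s \<ge> real m" using s d2 by (auto simp: s0_def field_simps)
    have spos: "s > 0" using dsm mpos d2 by (metis less_le_trans zero_less_mult_pos)
    show "norm (H 0) < exp (\<Theta> * s)"
    proof (cases "0 \<in> Z")
      case True
      have "norm (H 0) \<le> exp (\<Theta> / 8 * s)" using Hn[OF True] by simp
      also have "\<dots> < exp (\<Theta> * s)" using \<Theta> spos by simp
      finally show ?thesis .
    next
      case Z0: False
      define N where "N = nat \<lfloor>d2 * s / real m\<rfloor>"
      have fl: "\<lfloor>d2 * s / real m\<rfloor> \<ge> 1" using dsm mpos by (simp add: le_floor_iff)
      have N1: "N \<ge> 1" unfolding N_def using fl by linarith
      have Nle: "real N \<le> d2 * s / real m" and Nge: "d2 * s / real m < real N + 1" using fl unfolding N_def by linarith+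
      define M where "M = m * N"
      have Mle: "real M \<le> d2 * s" and Mge: "real M \<ge> d2 * s - real m" using Nle Nge mpos by (simp_all add: M_def field_simps)
      have Mpos: "real M > 0" using mpos N1 by (simp add: M_def)
      have "N \<le> card (Z \<inter> {of_int j / real m<..(of_int j + 1) / real m})" if "- int m \<le> j" "j < int m" for j :: int
        using cells[OF that] Nle by linarith
      then obtain y where y: "inj_on y {k. k \<noteq> 0 \<and> \<bar>k\<bar> \<le> int (m * N)}"
        "\<And>k. k \<noteq> 0 \<Longrightarrow> \<bar>k\<bar> \<le> int (m * N) \<Longrightarrow> y k \<in> Z \<and> \<bar>y k - of_int k / real (m * N)\<bar> \<le> 1 / real m"
        "\<And>k i. k \<noteq> 0 \<Longrightarrow> i \<le> m \<Longrightarrow> \<bar>k\<bar> \<le> int (i * N) \<Longrightarrow> \<bar>y k\<bar> \<le> real i / real m"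
        using enumerate_cells[of Z m N] finZ N1 m256 by auto
      define J where "J = {- int (A * (m * N))..int (A * (m * N))} - {0}"
      define F where "F = {k\<in>J. \<bar>k\<bar> \<le> int ((m - 2) * N)}"
      \<comment> \<open>Given nodes are used only for
        \<open>\<bar>k\<bar> \<le> (m - 2) * N\<close>. Beyond, fictitious nodes are placed at
        lattice points pushed outwards by \<open>2 * N\<close>: they lie outside the circle, where
        \<open>H\<close> is never evaluated, and they clear the gap that the circle needs.\<close>
      define Y where "Y k = (if \<bar>k\<bar> \<le> int ((m - 2) * N) then real M * y k else of_int k + 2 * real N * of_int (sgn k))" for k
      have Npos: "real N > 0" using N1 by simp
      have "(m - 2) * N \<le> m * N" by simp
      then have m2M: "int ((m - 2) * N) \<le> int (m * N)" by (simp only: of_nat_le_iff)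
      have FM: "k \<noteq> 0 \<and> \<bar>k\<bar> \<le> int (m * N)" if "k \<in> F" for k
      proof -
        have "k \<noteq> 0" "\<bar>k\<bar> \<le> int ((m - 2) * N)" using that unfolding F_def J_def by blast+
        then show ?thesis using m2M by linarith
      qed
      have YF: "Y k = real M * y k" if "k \<in> F" for k using that by (simp add: Y_def F_def)
      have m2: "real ((m - 2) * N) = real M - 2 * real N" using m256 by (simp add: M_def of_nat_diff algebra_simps)
      have m2': "int ((m - 2) * N) = int M - 2 * int N" using m256 by (simp add: M_def of_nat_diff algebra_simps)
      have Yin: "\<bar>Y k\<bar> \<le> real ((m - 2) * N)" if "k \<in> F" for k
      proof -
        have "\<bar>y k\<bar> \<le> real (m - 2) / real m" using y(3)[of k "m - 2"] that by (auto simp: F_def J_def)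
        then have "real M * \<bar>y k\<bar> \<le> real M * (real (m - 2) / real m)" by (intro mult_left_mono) auto
        then show ?thesis using YF[OF that] mpos by (simp add: abs_mult M_def mult_ac)
      qed
      have Yo: "Y k = of_int k + 2 * real N * of_int (sgn k) \<and> k \<noteq> 0 \<and> \<bar>k\<bar> > int ((m - 2) * N)" if "k \<in> J - F" for k
        using that by (auto simp: Y_def F_def J_def)
      have Yout: "\<bar>Y k\<bar> \<ge> real M + 1" if "k \<in> J - F" for k
      proof -
        have k: "\<bar>k\<bar> \<ge> int M - 2 * int N + 1" using Yo[OF that] m2' by linarith
        then have kr: "\<bar>real_of_int k\<bar> \<ge> real M - 2 * real N + 1" by linarith
        show ?thesis using Yo[OF that] kr Npos by (cases "k > 0") (auto simp: sgn_if)
      qed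
      \<comment> \<open>The surplus of the node density is worth
        \<open>4 * \<gamma> * s * \<bar>Im z\<bar>\<close> and is therefore lost near the real axis.
        Multiplying by the Gaussian \<open>exp (- \<gamma> * s * z\<^sup>2)\<close> repairs this: it
        decays on the circle near the axis, where the surplus fails, it can grow only where the
        surplus pays for it, its modulus is at most 1 at the real nodes, and it is 1 at the
        origin.\<close>
      have G: "norm (H (0 / of_real (real M)) * exp (- of_real (\<gamma> * s) * (0 / of_real (real M))\<^sup>2)) \<le> 
         10 * pi * real M * exp (6 * real M / real A) * exp (real M / real A) * exp (pi * real m - \<gamma> * s / 2) / exp (- 22 * real M / real A) + 2 * real M * exp (6 * real M / real A) * exp (\<Theta> / 8 * s) * exp (\<Theta> / 8 * s) / exp (- 22 * real M / real A)"
        unfolding M_def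
      proof (rule interpolation_lattice_bound[where G = "\<lambda>\<zeta>. H (\<zeta> / of_real (real (m * N))) * exp (- of_real (\<gamma> * s) * (\<zeta> / of_real (real (m * N)))\<^sup>2)" and Y = Y and A = A and n = n and F = F and N = N and m = m])
        show "N \<ge> 1" "m \<ge> 8" "n \<ge> 8" "A \<ge> 1" using N1 m256 n16 A4 by auto
        show "F = {k \<in> {- int (A * (m * N))..int (A * (m * N))} - {0}. \<bar>k\<bar> \<le> int ((m - 2) * N)}"
          by (simp add: F_def J_def)
        show "inj_on Y ({- int (A * (m * N))..int (A * (m * N))} - {0})"
          unfolding J_def[symmetric]
        proof (rule inj_onI)
          fix k l assume kl: "k \<in> J" "l \<in> J" "Y k = Y l"
          show "k = l"
          proof (cases "k \<in> F")
            case kF: True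
            have lF: "l \<in> F"
            proof (rule ccontr)
              assume "l \<notin> F" then have "\<bar>Y l\<bar> \<ge> real M + 1" using Yout kl by auto
              then show False using Yin[OF kF] m2 Npos unfolding kl(3) by linarith
            qed
            then have "y k = y l" using kF kl(3) YF Mpos by simp
            then show ?thesis using y(1) FM[OF kF] FM[OF lF] by (auto dest: inj_onD)
          next
            case kF: False
            have lF: "l \<notin> F"
            proof
              assume lF: "l \<in> F"
              have "real M + 1 \<le> \<bar>Y k\<bar>" using Yout kF kl by blast
              then show False using Yin[OF lF] m2 Npos unfolding kl(3) by linarith
            qed
            have k: "Y k = of_int k + 2 * real N * of_int (sgn k)" "k \<noteq> 0" and l: "Y l = of_int l + 2 * real N * of_int (sgn l)" "l \<noteq> 0" using Yo kF lF kl by auto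
            show ?thesis using k l kl(3) Npos by (auto simp: sgn_if split: if_splits)
          qed
        qed
        show "Y k \<noteq> 0" if "k \<in> {- int (A * (m * N))..int (A * (m * N))} - {0}" for k
        proof (cases "k \<in> F")
          case True
          then have "y k \<in> Z" using y(2) FM by blast
          then show ?thesis using Z0 YF[OF True] Mpos by auto
        next
          case False
          then show ?thesis using Yout[of k] that by (auto simp: J_def)
        qed
        show "\<bar>Y k - of_int k\<bar> \<le> real (2 * N)" if "k \<in> {- int (A * (m * N))..int (A * (m * N))} - {0}" for k
        proof (cases "k \<in> F")
          case True
          have "\<bar>y k - of_int k / real M\<bar> \<le> 1 / real m" using y(2) FM[OF True] by (simp add: M_def)
          then have "real M * \<bar>y k - of_int k / real M\<bar> \<le> real M * (1 / real m)" by (intro mult_left_mono) auto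
          moreover have "real M * \<bar>y k - of_int k / real M\<bar> = \<bar>real M * y k - of_int k\<bar>"
            using Mpos by (subst abs_of_pos[OF Mpos, symmetric], subst abs_mult[symmetric]) (simp add: algebra_simps)
          moreover have "real M * (1 / real m) = real N" using mpos by (simp add: M_def)
          ultimately show ?thesis using YF[OF True] by simp
        next
          case False
          then show ?thesis using Yo[of k] that by (auto simp: J_def sgn_if)
        qed
        show "\<bar>Y k\<bar> \<le> real ((m - 2) * N)" if "k \<in> F" for k by (rule Yin[OF that])
        show "real (m * N) + 1 \<le> \<bar>Y k\<bar>" if "k \<in> {- int (A * (m * N))..int (A * (m * N))} - {0} - F" for k
          using Yout that by (simp add: M_def J_def)
        show "(\<lambda>\<zeta>. H (\<zeta> / of_real (real (m * N))) * exp (- of_real (\<gamma> * s) * (\<zeta> / of_real (real (m * N)))\<^sup>2)) holomorphic_on UNIV"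
          using Mpos by (intro holomorphic_intros holomorphic_on_compose_gen[OF _ holo, unfolded o_def]) (auto simp: M_def)
        show "exp (pi * real m - \<gamma> * s / 2) \<ge> 0" by simp
      next
        fix \<zeta> :: complex assume nz: "norm \<zeta> = real ((m - 1) * N) + 1/2"
        define z where "z = \<zeta> / of_real (real M)"
        define r where "r = norm z"
        have m1: "real ((m - 1) * N) = real M - real N" using m256 by (simp add: M_def of_nat_diff algebra_simps)
        have rM: "r * real M = real M - real N + 1/2" using Mpos nz m1 by (simp add: r_def z_def norm_divide)
        have "r * real M \<le> 1 * real M" unfolding rM using N1 by simp
        then have r1: "r \<le> 1" using Mpos by simp
        have "8 * real N \<le> real m * real N" using m256 by (intro mult_right_mono) auto
        then have "8 * real N \<le> real M" by (simp add: M_def)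
        then have "(7/8) * real M \<le> r * real M" unfolding rM using Npos by linarith
        then have r2: "7/8 \<le> r" using Mpos by (simp only: mult_le_cancel_right_pos)
        have "(7/8)\<^sup>2 \<le> r\<^sup>2" using r2 by (intro power_mono) auto
        then have r3: "3/4 \<le> r\<^sup>2" by (simp add: power2_eq_square)
        define v where "v = \<bar>Im z\<bar>"
        have v1: "0 \<le> v" "v \<le> 1" using abs_Im_le_cmod[of z] r1 by (auto simp: v_def r_def)
        have Rez: "Re (z\<^sup>2) = r\<^sup>2 - 2 * v\<^sup>2" using cmod_power2[of z] by (simp add: r_def v_def power2_eq_square)
        have Imz: "\<bar>Im \<zeta>\<bar> = real M * v" using Mpos by (simp add: z_def v_def)
        have "norm (H z * exp (- of_real (\<gamma> * s) * z\<^sup>2)) \<le> exp (s * (b * v + \<gamma> / 4)) * exp (- (\<gamma> * s) * (r\<^sup>2 - 2 * v\<^sup>2))"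
          unfolding norm_mult norm_exp_eq_Re
        proof (rule mult_mono)
          show "norm (H z) \<le> exp (s * (b * v + \<gamma> / 4))" using Hb[of z] r1 by (simp add: v_def \<gamma>_def r_def)
          show "exp (Re (- of_real (\<gamma> * s) * z\<^sup>2)) \<le> exp (- (\<gamma> * s) * (r\<^sup>2 - 2 * v\<^sup>2))"
            unfolding Rez[symmetric] by simp
        qed auto
        also have "\<dots> = exp (s * (b * v + \<gamma> / 4) - (\<gamma> * s) * (r\<^sup>2 - 2 * v\<^sup>2))" by (simp add: exp_add[symmetric])
        \<comment> \<open>Growth contributes \<open>\<gamma> / 4\<close>, the Gaussian at least
          \<open>- 3 / 4 * \<gamma>\<close> since \<open>r\<^sup>2 \<ge> 3 / 4\<close>, and
          \<open>2 * v\<^sup>2 \<le> 4 * v\<close> is absorbed by the surplus. The term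
          \<open>pi * real m\<close> pays for rounding \<open>d2 * s\<close> down to
          \<open>M\<close>.\<close>
        also have "\<dots> \<le> exp (pi * real m - \<gamma> * s / 2 + pi * (real M * v))"
        proof -
          have "(pi * v) * (d2 * s - real m) \<le> (pi * v) * real M" using Mge v1 by (intro mult_left_mono) auto
          moreover have "pi * real m * v \<le> pi * real m * 1" using v1 by (intro mult_left_mono) auto
          moreover have "(b + 4 * \<gamma>) * (v * s) = (pi * v) * (d2 * s - real m) + pi * real m * v"
          proof -
            have "b + 4 * \<gamma> = pi * d2" by (simp add: \<gamma>_def field_simps)
            then show ?thesis by (simp only:) (simp add: algebra_simps)
          qed
          moreover have "pi * v * real M = pi * (real M * v)" by simp
          ultimately have e1: "(b + 4 * \<gamma>) * (v * s) \<le> pi * (real M * v) + pi * real m"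
            by linarith
          have "0 \<le> \<gamma> * s * ((r\<^sup>2 - 3/4) + (4 * v - 2 * v\<^sup>2))"
          proof -
            have "v * v \<le> 1 * v" using v1 by (intro mult_right_mono) auto
            then have "0 \<le> 4 * v - 2 * v\<^sup>2" using v1 by (simp add: power2_eq_square)
            then show ?thesis using \<gamma> spos r3 by (intro mult_nonneg_nonneg) auto
          qed
          then show ?thesis using e1 by (simp add: algebra_simps)
        qed
        also have "\<dots> = exp (pi * real m - \<gamma> * s / 2) * exp (pi * \<bar>Im \<zeta>\<bar>)" by (simp add: Imz exp_add)
        finally show "norm (H (\<zeta> / of_real (real (m * N))) * exp (- of_real (\<gamma> * s) * (\<zeta> / of_real (real (m * N)))\<^sup>2)) \<le> exp (pi * real m - \<gamma> * s / 2) * exp (pi * \<bar>Im \<zeta>\<bar>)"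
          by (simp add: z_def M_def)
      next
        fix k assume k: "k \<in> F"
        have yZ: "y k \<in> Z" using y(2) FM[OF k] by blast
        have q: "complex_of_real (Y k) / of_real (real (m * N)) = of_real (y k)"
          using YF[OF k] Mpos unfolding M_def[symmetric] by simp
        have "norm (exp (- of_real (\<gamma> * s) * (complex_of_real (y k))\<^sup>2)) \<le> 1"
          using \<gamma> spos by (simp add: norm_exp_eq_Re flip: of_real_power of_real_mult)
        then show "norm (H (complex_of_real (Y k) / of_real (real (m * N))) * exp (- of_real (\<gamma> * s) * (complex_of_real (Y k) / of_real (real (m * N)))\<^sup>2)) \<le> exp (\<Theta> / 8 * s)"
          unfolding q norm_mult using mult_mono[OF Hn[OF yZ], of _ 1] by simp
        let ?S = "{l\<in>F-{k}. \<bar>real_of_int k - of_int l\<bar> < real (n * N)}"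
        have finF: "finite F" by (rule finite_subset[of _ J]) (auto simp: F_def J_def)
        have injS: "inj_on y ?S" using y(1) by (rule inj_on_subset) (use FM in auto)
        have MD: "real M = real n * real (n * N)" by (simp add: M_def mn)
        have Dpos: "real (n * N) > 0" using n16 N1 by simp
        have neq: "y l \<noteq> y k" if "l \<in> ?S" for l
          using y(1) FM[OF k] FM[of l] that by (auto dest: inj_onD)
        have sub: "y ` ?S \<subseteq> {y'\<in>Z. y' \<noteq> y k \<and> \<bar>y k - y'\<bar> < \<kappa>}"
        proof safe
          fix l assume l: "l \<in> F" "l \<noteq> k" "\<bar>real_of_int k - of_int l\<bar> < real (n * N)"
          show "y l \<in> Z" using y(2) FM[OF l(1)] by blast
          have yk: "\<bar>y k - of_int k / real M\<bar> \<le> 1 / real m" "\<bar>y l - of_int l / real M\<bar> \<le> 1 / real m"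
            using y(2) FM[OF k] FM[OF l(1)] by (auto simp: M_def)
          have "\<bar>of_int k / real M - of_int l / real M\<bar> = \<bar>real_of_int k - of_int l\<bar> / real M" 
            using Mpos by (simp add: diff_divide_distrib[symmetric] abs_divide)
          also have "\<dots> < real (n * N) / real M" using l(3) Mpos by (intro divide_strict_right_mono) auto
          also have "\<dots> = 1 / real n" unfolding MD using Dpos by (simp only: nonzero_divide_mult_cancel_right)
          finally have "\<bar>y k - y l\<bar> < 1 / real n + 2 / real m" using yk by linarith
          also have "\<dots> \<le> 5 / real A"
          proof -
            have "real A \<le> real n" using A4 by (simp add: n_def power2_eq_square)
            moreover have "real A \<le> real m" using A4 self_le_power[of "real A" 4] by (simp add: m_def)
            ultimately have "1 / real n \<le> 1 / real A" "2 / real m \<le> 2 / real A" using Apos by (auto intro!: divide_left_mono mult_pos_pos)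
            moreover have "1 / real A + 2 / real A \<le> 5 / real A" using Apos by (simp add: field_simps)
            ultimately show ?thesis by linarith
          qed
          finally show "\<bar>y k - y l\<bar> < \<kappa>" using A3 by linarith
          assume "y l = y k" then show False using neq[of l] l by auto
        qed
        have "(\<Sum>l\<in>?S. ln (1 / \<bar>y k - y l\<bar>)) = (\<Sum>y'\<in>y ` ?S. ln (1 / \<bar>y k - y'\<bar>))"
          by (subst sum.reindex[OF injS]) (simp del: of_nat_mult)
        also have "\<dots> \<le> (\<Sum>y'\<in>{y'\<in>Z. y' \<noteq> y k \<and> \<bar>y k - y'\<bar> < \<kappa>}. ln (1 / \<bar>y k - y'\<bar>))"
          by (rule sum_mono2[OF _ sub]) (use finZ \<kappa> in auto)
        also have "\<dots> \<le> \<Theta> / 8 * s" by (rule en[OF yZ])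
        finally have "exp (- (\<Theta> / 8 * s)) \<le> exp (- (\<Sum>l\<in>?S. ln (1 / \<bar>y k - y l\<bar>)))" by simp
        also have "\<dots> = (\<Prod>l\<in>?S. \<bar>y k - y l\<bar>)"
        proof -
          have "exp (\<Sum>l\<in>?S. - ln (1 / \<bar>y k - y l\<bar>)) = (\<Prod>l\<in>?S. exp (- ln (1 / \<bar>y k - y l\<bar>)))"
            by (rule exp_sum) (use finF in auto)
          also have "\<dots> = (\<Prod>l\<in>?S. \<bar>y k - y l\<bar>)"
          proof (rule prod.cong[OF refl])
            fix l assume "l \<in> ?S"
            then have "\<bar>y k - y l\<bar> > 0" using neq[of l] by force
            then show "exp (- ln (1 / \<bar>y k - y l\<bar>)) = \<bar>y k - y l\<bar>" by (simp add: ln_div)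
          qed
          finally show ?thesis by (simp add: sum_negf)
        qed
        \<comment> \<open>Distances are scaled up by \<open>M\<close> and divided by
          \<open>n * N\<close>; the quotient of the two is \<open>n\<close>, at least 1.\<close>
        also have "\<dots> \<le> (\<Prod>l\<in>?S. \<bar>Y k - Y l\<bar> / real (n * N))"
        proof (rule prod_mono, safe)
          fix l assume l: "l \<in> F"
          have "\<bar>Y k - Y l\<bar> = real M * \<bar>y k - y l\<bar>" using YF[OF k] YF[OF l] Mpos
            by (simp add: right_diff_distrib[symmetric] abs_mult)
          then have "\<bar>Y k - Y l\<bar> = (real n * \<bar>y k - y l\<bar>) * real (n * N)" unfolding MD by (simp only: mult_ac)
          then have "\<bar>Y k - Y l\<bar> / real (n * N) = real n * \<bar>y k - y l\<bar>" using Dpos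
            by (metis less_irrefl nonzero_mult_div_cancel_right)
          moreover have "1 * \<bar>y k - y l\<bar> \<le> real n * \<bar>y k - y l\<bar>" using n16 by (intro mult_right_mono) auto
          ultimately show "\<bar>y k - y l\<bar> \<le> \<bar>Y k - Y l\<bar> / real (n * N)" by simp
        qed auto
        finally show "exp (- (\<Theta> / 8 * s)) \<le> (\<Prod>l\<in>?S. \<bar>Y k - Y l\<bar> / real (n * N))" .
      next
        show "exp (- 22 * real (m * N) / real A) > 0" by simp
        show "exp (- 22 * real (m * N) / real A) \<le> (1 / real n) ^ (2*(n*N)+1) * (1 - 4 / real n) ^ (2*(A*(m*N)))"
          unfolding m_def n_def by (rule interpolation_loss_bound(1)[OF N1 A4])
        show "((exp 1 * (real (A*(m*N) + 2*N) / real (2*N))) ^ (2*N))\<^sup>2 \<le> exp (6 * real (m * N) / real A)"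
          unfolding m_def by (rule interpolation_loss_bound(2)[OF N1 A4])
        show "exp ((real ((m - 1) * N) + 1/2)\<^sup>2 / real (A*(m*N))) \<le> exp (real (m * N) / real A)"
          unfolding m_def
        proof (rule interpolation_loss_bound(3)[OF N1 A4], fold m_def)
          have m1: "real ((m - 1) * N) = real M - real N" using m256 by (simp add: M_def of_nat_diff algebra_simps)
          have "0 \<le> real ((m - 1) * N)" by simp
          moreover have "real N \<ge> 1" using N1 by simp
          ultimately show "\<bar>real ((m - 1) * N) + 1/2\<bar> \<le> real (m * N)" using m1 unfolding M_def by linarith
        qed
      qed
      have l1: "29 * real M / real A \<le> \<gamma> / 8 * s" and l2: "29 * real M / real A \<le> \<Theta> / 8 * s"
      proof -
        have *: "29 * real M / real A \<le> (29 * d2 / real A) * s" using Mle Apos by (simp add: divide_right_mono)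
        also have "\<dots> \<le> \<gamma> / 8 * s" using A2 spos by (intro mult_right_mono) auto
        finally show "29 * real M / real A \<le> \<gamma> / 8 * s" .
        note *
        also have "(29 * d2 / real A) * s \<le> \<Theta> / 8 * s" using A1 spos by (intro mult_right_mono) auto
        finally show "29 * real M / real A \<le> \<Theta> / 8 * s" .
      qed
      have "norm (H 0) \<le> 10 * pi * real M * exp (6 * real M / real A) * exp (real M / real A) * exp (pi * real m - \<gamma> * s / 2) / exp (- 22 * real M / real A) + 2 * real M * exp (6 * real M / real A) * exp (\<Theta> / 8 * s) * exp (\<Theta> / 8 * s) / exp (- 22 * real M / real A)"
        using G by simp
      also have "\<dots> = 10 * pi * real M * exp (29 * real M / real A + (pi * real m - \<gamma> * s / 2)) + 2 * real M * exp (28 * real M / real A + \<Theta> / 4 * s)"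
      proof -
        have "exp (29 * real M / real A + (pi * real m - \<gamma> * s / 2)) = exp (6 * real M / real A) * exp (real M / real A) * exp (pi * real m - \<gamma> * s / 2) / exp (- 22 * real M / real A)"
          unfolding exp_add[symmetric] exp_diff[symmetric] by (simp add: field_simps)
        moreover have "exp (28 * real M / real A + \<Theta> / 4 * s) = exp (6 * real M / real A) * exp (\<Theta> / 8 * s) * exp (\<Theta> / 8 * s) / exp (- 22 * real M / real A)"
          unfolding exp_add[symmetric] exp_diff[symmetric] by (simp add: field_simps)
        ultimately show ?thesis by simp
      qed
      also have "\<dots> \<le> 10 * pi * (d2 * s) * exp (pi * real m - 3 / 8 * \<gamma> * s) + 2 * (d2 * s) * exp (3 / 8 * \<Theta> * s)"
      proof (intro add_mono mult_mono)
        show "exp (29 * real M / real A + (pi * real m - \<gamma> * s / 2)) \<le> exp (pi * real m - 3 / 8 * \<gamma> * s)"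
          using l1 by simp
        have "28 * real M / real A \<le> 29 * real M / real A" using Apos by (intro divide_right_mono) auto
        then show "exp (28 * real M / real A + \<Theta> / 4 * s) \<le> exp (3 / 8 * \<Theta> * s)" using l2 by simp
      qed (use Mle d2 spos in auto)
      also have "\<dots> < exp (\<Theta> * s)" by (rule s1[OF ss1])
      finally show ?thesis .
    qed
  qed
qed

section \<open>Growth bounds from Poisson integrals\<close>

text \<open>The Cauchy integral of \<phi> over \<open>{-T..T}\<close> has the Poisson integral
  (without the factor \<open>1 / pi\<close>) as its imaginary part; multiplication by
  \<open>- \<i>\<close> makes it the real part, ready for use in an exponent.\<close>

lemma poisson_holomorphic:
  fixes \<phi> :: "real \<Rightarrow> real"
  assumes cont: "continuous_on UNIV \<phi>" and T: "T > 0"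
  obtains f where "f holomorphic_on {z. Im z > 0}"
    "\<And>z. Im z > 0 \<Longrightarrow> Re (f z) = integral {-T..T} (\<lambda>u. \<phi> u * Im z / ((Re z - u)\<^sup>2 + (Im z)\<^sup>2))"
proof -
  define \<gamma> where "\<gamma> = linepath (complex_of_real (-T)) (complex_of_real T)"
  define k where "k u = complex_of_real (\<phi> (Re u))" for u
  define g where "g w = contour_integral \<gamma> (\<lambda>u. k u / (u - w))" for w
  have img: "Im u = 0" if "u \<in> path_image \<gamma>" for u
    using that unfolding \<gamma>_def path_image_linepath closed_segment_of_real by auto
  have kc: "continuous_on S k" for S
    unfolding k_def by (intro continuous_intros continuous_on_compose2[OF cont]) auto
  have int: "((\<lambda>u. k u / (u - w)) has_contour_integral g w) \<gamma>" if "w \<notin> path_image \<gamma>" for w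
    unfolding g_def
  proof (rule has_contour_integral_integral)
    show "(\<lambda>u. k u / (u - w)) contour_integrable_on \<gamma>"
      unfolding \<gamma>_def
    proof (rule contour_integrable_continuous_linepath)
      show "continuous_on (closed_segment (complex_of_real (- T)) (complex_of_real T)) (\<lambda>u. k u / (u - w))"
        using that by (intro continuous_intros kc) (auto simp: \<gamma>_def)
    qed
  qed
  have der: "\<exists>D. (g has_field_derivative D) (at w)" if "Im w > 0" for w
  proof -
    have w: "w \<in> UNIV - path_image \<gamma>" using img[of w] that by auto
    have *: "((\<lambda>u. k u / (u - w) ^ 1) has_contour_integral g w) \<gamma>" if "w \<in> UNIV - path_image \<gamma>" for w
      using int[of w] that by simp
    have "(g has_field_derivative (of_nat 1 * contour_integral \<gamma> (\<lambda>u. k u / (u - w) ^ Suc 1))) (at w)"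
      by (rule Cauchy_next_derivative(2)[where S = UNIV and B = "norm (complex_of_real T - complex_of_real (-T))"])
        (use w * kc in \<open>auto simp: \<gamma>_def vector_derivative_linepath_at\<close>)
    then show ?thesis by blast
  qed
  show thesis
  proof
    show "(\<lambda>z. - \<i> * g z) holomorphic_on {z. Im z > 0}"
    proof (intro holomorphic_intros)
      show "g holomorphic_on {z. Im z > 0}"
        unfolding holomorphic_on_def field_differentiable_def
        using der has_field_derivative_at_within by blast
    qed
  next
    fix z assume z: "Im z > 0"
    then have "z \<notin> path_image \<gamma>" using img by auto
    from int[OF this] have "((\<lambda>x. k (of_real x) / (of_real x - z)) has_integral g z) {-T..T}"
      unfolding \<gamma>_def using T by (subst (asm) has_contour_integral_linepath_Reals_iff) auto
    from has_integral_linear[OF this bounded_linear_Im]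
    have "((\<lambda>x. Im (k (of_real x) / (of_real x - z))) has_integral Im (g z)) {-T..T}" by (simp add: o_def)
    moreover have "Im (k (of_real x) / (of_real x - z)) = \<phi> x * Im z / ((Re z - x)\<^sup>2 + (Im z)\<^sup>2)" for x
      by (simp add: k_def Im_divide power2_commute)
    ultimately have "((\<lambda>u. \<phi> u * Im z / ((Re z - u)\<^sup>2 + (Im z)\<^sup>2)) has_integral Im (g z)) {-T..T}" by simp
    then show "Re (- \<i> * g z) = integral {-T..T} (\<lambda>u. \<phi> u * Im z / ((Re z - u)\<^sup>2 + (Im z)\<^sup>2))"
      by (simp add: integral_unique)
  qed
qed

lemma poisson_kernel_window:
  fixes x \<delta> \<eta> :: real
  assumes \<delta>: "\<delta> > 0" and \<eta>: "\<eta> > 0"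
  shows "((\<lambda>u. \<delta> / ((x - u)\<^sup>2 + \<delta>\<^sup>2)) has_integral 2 * arctan (\<eta> / \<delta>)) {x - \<eta>..x + \<eta>}"
proof -
  have "((\<lambda>u. \<delta> / ((x - u)\<^sup>2 + \<delta>\<^sup>2)) has_integral arctan ((x + \<eta> - x) / \<delta>) - arctan ((x - \<eta> - x) / \<delta>)) {x - \<eta>..x + \<eta>}"
  proof (rule fundamental_theorem_of_calculus)
    fix u assume "u \<in> {x - \<eta>..x + \<eta>}"
    have "((\<lambda>u. arctan ((u - x) / \<delta>)) has_real_derivative inverse (1 + ((u - x) / \<delta>)\<^sup>2) * (1 / \<delta>)) (at u)"
      using \<delta> by (auto intro!: derivative_eq_intros)
    moreover have "inverse (1 + ((u - x) / \<delta>)\<^sup>2) * (1 / \<delta>) = \<delta> / ((x - u)\<^sup>2 + \<delta>\<^sup>2)"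
    proof -
      have "1 + ((u - x) / \<delta>)\<^sup>2 = ((x - u)\<^sup>2 + \<delta>\<^sup>2) / \<delta>\<^sup>2"
        using \<delta> by (simp add: field_simps power2_commute)
      then show ?thesis using \<delta> by (simp add: power2_eq_square)
    qed
    ultimately show "((\<lambda>u. arctan ((u - x) / \<delta>)) has_vector_derivative \<delta> / ((x - u)\<^sup>2 + \<delta>\<^sup>2)) (at u within {x - \<eta>..x + \<eta>})"
      by (simp add: has_real_derivative_iff_has_vector_derivative[symmetric] has_field_derivative_at_within)
  qed (use \<eta> in auto)
  then show ?thesis by (simp add: arctan_minus)
qed

text \<open>At height \<delta> the Poisson integral of a Lipschitz function falls short of its
  boundary value by at most the oscillation over a window plus the kernel mass outside it. Where
  \<phi> exceeds that oscillation, the window is inside \<open>{-T..T}\<close>, because \<phi> is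
  positive on it.\<close>

lemma poisson_lower:
  fixes \<phi> :: "real \<Rightarrow> real"
  assumes nn: "\<And>x. \<phi> x \<ge> 0" and L: "L \<ge> 0" "\<And>x y. \<bar>\<phi> x - \<phi> y\<bar> \<le> L * \<bar>x - y\<bar>"
    and supp: "\<And>x. \<bar>x\<bar> > T \<Longrightarrow> \<phi> x = 0" and \<Phi>: "\<And>x. \<phi> x \<le> \<Phi>" and \<delta>: "\<delta> > 0"
    and cont: "continuous_on UNIV \<phi>"
  shows "\<phi> x - 1 / pi * integral {-T..T} (\<lambda>u. \<phi> u * \<delta> / ((x - u)\<^sup>2 + \<delta>\<^sup>2))
     \<le> L * sqrt \<delta> + \<Phi> * (1 - 2 / pi * arctan (1 / sqrt \<delta>))"
proof -
  \<comment> \<open>With this window the oscillation tends to 0 with \<delta>, and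
    \<open>\<eta> / \<delta>\<close> tends to infinity, so the kernel mass outside vanishes as
    well.\<close>
  define \<eta> where "\<eta> = sqrt \<delta>"
  define q where "q = 2 / pi * arctan (1 / sqrt \<delta>)"
  define P where "P = integral {-T..T} (\<lambda>u. \<phi> u * \<delta> / ((x - u)\<^sup>2 + \<delta>\<^sup>2))"
  have \<eta>: "\<eta> > 0" "\<eta> * \<eta> = \<delta>" using \<delta> by (auto simp: \<eta>_def)
  have ratio: "\<eta> / \<delta> = 1 / sqrt \<delta>" using \<eta> by (simp add: \<eta>_def[symmetric]) (simp add: field_simps flip: \<eta>(2))
  have q01: "0 \<le> q" "q \<le> 1"
  proof -
    show "0 \<le> q" unfolding q_def using \<delta> by (intro mult_nonneg_nonneg) auto
    have "2 / pi * arctan (1 / sqrt \<delta>) \<le> 2 / pi * (pi / 2)" using arctan_ubound by (intro mult_left_mono less_imp_le) auto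
    then show "q \<le> 1" by (simp add: q_def)
  qed
  have \<Phi>0: "\<Phi> \<ge> 0" using nn \<Phi> order.trans by blast
  have den: "(x - u)\<^sup>2 + \<delta>\<^sup>2 > 0" for u using \<delta> by (simp add: add_nonneg_pos)
  have integrable: "(\<lambda>u. \<phi> u * \<delta> / ((x - u)\<^sup>2 + \<delta>\<^sup>2)) integrable_on {a..b}" for a b
    using den less_imp_neq[OF den] by (intro integrable_continuous_interval continuous_intros continuous_on_subset[OF cont]) auto
  have ker0: "0 \<le> \<phi> u * \<delta> / ((x - u)\<^sup>2 + \<delta>\<^sup>2)" for u using nn \<delta> den[of u] by simp
  have P0: "P \<ge> 0" unfolding P_def by (intro integral_nonneg integrable) (use ker0 in auto)
  show ?thesis
  proof (cases "\<phi> x \<le> L * \<eta>")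
    case True
    have "0 \<le> \<Phi> * (1 - q)" using \<Phi>0 q01 by simp
    moreover have "0 \<le> 1 / pi * P" using P0 by simp
    ultimately show ?thesis using True unfolding P_def \<eta>_def q_def by linarith
  next
    case False
    have low: "\<phi> u \<ge> \<phi> x - L * \<eta>" if "u \<in> {x - \<eta>..x + \<eta>}" for u
    proof -
      have "\<bar>x - u\<bar> \<le> \<eta>" using that by (auto simp: abs_if)
      then have "L * \<bar>x - u\<bar> \<le> L * \<eta>" using L by (intro mult_left_mono) auto
      then show ?thesis using L(2)[of x u] by linarith
    qed
    have sub: "{x - \<eta>..x + \<eta>} \<subseteq> {-T..T}"
    proof
      fix u assume "u \<in> {x - \<eta>..x + \<eta>}"
      then have "\<phi> u > 0" using low False by fastforce
      then have "\<not> \<bar>u\<bar> > T" using supp by force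
      then show "u \<in> {-T..T}" by auto
    qed
    have "(\<phi> x - L * \<eta>) * (2 * arctan (\<eta> / \<delta>)) \<le> integral {x - \<eta>..x + \<eta>} (\<lambda>u. \<phi> u * \<delta> / ((x - u)\<^sup>2 + \<delta>\<^sup>2))"
    proof (rule has_integral_le)
      show "((\<lambda>u. (\<phi> x - L * \<eta>) * (\<delta> / ((x - u)\<^sup>2 + \<delta>\<^sup>2))) has_integral (\<phi> x - L * \<eta>) * (2 * arctan (\<eta> / \<delta>))) {x - \<eta>..x + \<eta>}"
        by (intro has_integral_mult_right poisson_kernel_window \<delta> \<eta>)
      show "((\<lambda>u. \<phi> u * \<delta> / ((x - u)\<^sup>2 + \<delta>\<^sup>2)) has_integral integral {x - \<eta>..x + \<eta>} (\<lambda>u. \<phi> u * \<delta> / ((x - u)\<^sup>2 + \<delta>\<^sup>2))) {x - \<eta>..x + \<eta>}"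
        using integrable by (rule integrable_integral)
      fix u assume "u \<in> {x - \<eta>..x + \<eta>}"
      then have "(\<phi> x - L * \<eta>) * (\<delta> / ((x - u)\<^sup>2 + \<delta>\<^sup>2)) \<le> \<phi> u * (\<delta> / ((x - u)\<^sup>2 + \<delta>\<^sup>2))"
        using low \<delta> den[of u] by (intro mult_right_mono) auto
      then show "(\<phi> x - L * \<eta>) * (\<delta> / ((x - u)\<^sup>2 + \<delta>\<^sup>2)) \<le> \<phi> u * \<delta> / ((x - u)\<^sup>2 + \<delta>\<^sup>2)" by simp
    qed
    also have "\<dots> \<le> P" unfolding P_def
      by (rule integral_subset_le[OF sub integrable integrable]) (use ker0 in auto)
    finally have "(1 / pi) * ((\<phi> x - L * \<eta>) * (2 * arctan (\<eta> / \<delta>))) \<le> (1 / pi) * P" by (intro mult_left_mono) auto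
    moreover have "(1 / pi) * ((\<phi> x - L * \<eta>) * (2 * arctan (\<eta> / \<delta>))) = (\<phi> x - L * \<eta>) * q"
      unfolding ratio q_def by simp
    ultimately have "\<phi> x - (1 / pi) * P \<le> \<phi> x * (1 - q) + L * \<eta> * q" by (simp add: algebra_simps)
    also have "\<dots> \<le> \<Phi> * (1 - q) + L * \<eta> * 1"
      using \<Phi> q01 L \<eta> by (intro add_mono mult_right_mono mult_left_mono) auto
    finally show ?thesis by (simp add: P_def \<eta>_def q_def)
  qed
qed

text \<open>The maximum principle on a half disc so large that the decay of \<open>F\<close> makes
  the arc harmless. Decay at infinity takes the place of a theorem of Phragmen-Lindelof type, and
  holomorphy across the axis avoids boundary values.\<close>

lemma upper_half_disc_bound:
  fixes F :: "complex \<Rightarrow> complex"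
  assumes holo: "F holomorphic_on {z. Im z > - \<delta>}" and \<delta>: "\<delta> > 0"
    and dec: "\<And>z. Im z \<ge> 0 \<Longrightarrow> norm (F z) \<le> C / (1 + norm z)"
    and real: "\<And>x::real. norm (F (of_real x)) \<le> B" and B: "B > 0" and z: "Im z > 0"
  shows "norm (F z) \<le> B"
proof -
  define R where "R = max (norm z + 1) (C / B)"
  define S where "S = ball (0::complex) R \<inter> {w. Im w > 0}"
  have op: "open S" unfolding S_def by (intro open_Int open_halfspace_Im_gt) auto
  have clsub: "closure S \<subseteq> cball 0 R \<inter> {w. Im w \<ge> 0}"
    by (rule closure_minimal) (auto simp: S_def intro!: closed_Int closed_halfspace_Im_ge)
  have "norm (F z) \<le> B"
  proof (rule maximum_modulus_frontier[of F S])
    show "F holomorphic_on interior S" unfolding interior_open[OF op]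
      by (rule holomorphic_on_subset[OF holo]) (use \<delta> in \<open>auto simp: S_def\<close>)
    show "continuous_on (closure S) F"
      by (rule holomorphic_on_imp_continuous_on, rule holomorphic_on_subset[OF holo]) (use clsub \<delta> in auto)
    show "bounded S" by (auto simp: S_def)
    show "z \<in> S" using z by (auto simp: S_def R_def)
    fix w assume "w \<in> frontier S"
    then have w: "w \<in> closure S" "w \<notin> S" using op by (auto simp: frontier_def interior_open)
    then have w2: "norm w \<le> R" "Im w \<ge> 0" using clsub by auto
    show "norm (F w) \<le> B"
    proof (cases "Im w = 0")
      case True
      then have "w = of_real (Re w)" by (simp add: complex_eq_iff)
      then show ?thesis using real by metis
    next
      case False
      then have nw: "norm w = R" using w w2 by (auto simp: S_def)
      have Rpos: "R > 0" by (simp add: R_def less_max_iff_disj add_nonneg_pos)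
      have "C / B \<le> R" by (simp add: R_def)
      then have "C \<le> B * (1 + R)" using B by (simp add: field_simps)
      then have "C / (1 + R) \<le> B" using Rpos by (simp add: field_simps)
      then show ?thesis using dec[OF w2(2)] nw by simp
    qed
  qed
  then show ?thesis .
qed

text \<open>The function \<open>h * exp (\<i> * b * z)\<close> is divided by the outer function with
  log-modulus \<phi>, and the maximum principle is applied. The outer function is evaluated at
  \<open>z + \<i> * \<delta>\<close>, which makes the quotient holomorphic beyond the real axis at
  the price of an error \<epsilon> that vanishes as \<delta> tends to 0.\<close>

lemma poisson_majorant:
  fixes h :: "complex \<Rightarrow> complex" and \<phi> :: "real \<Rightarrow> real"
  assumes holo: "h holomorphic_on UNIV" and b: "b \<ge> 0"
    and dec: "\<And>z. norm (h z) \<le> C * exp (b * \<bar>Im z\<bar>) / (1 + norm z)"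
    and nn: "\<And>x. \<phi> x \<ge> 0" and L: "L \<ge> 0" "\<And>x y. \<bar>\<phi> x - \<phi> y\<bar> \<le> L * \<bar>x - y\<bar>"
    and supp: "\<And>x. \<bar>x\<bar> > T \<Longrightarrow> \<phi> x = 0" and T: "T > 0"
    and maj: "\<And>x::real. norm (h (of_real x)) \<le> exp (\<phi> x)" and z: "Im z > 0"
  shows "norm (h z) \<le> exp (b * Im z + 1 / pi * integral {-T..T} (\<lambda>u. \<phi> u * Im z / ((Re z - u)\<^sup>2 + (Im z)\<^sup>2)))"
proof -
  have cont: "continuous_on UNIV \<phi>"
  proof (rule continuous_on_subset)
    show "continuous_on UNIV \<phi>"
      using L by (intro lipschitz_on_continuous_on[of L] lipschitz_onI) (auto simp: dist_real_def)
  qed simp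
  define \<Phi> where "\<Phi> = L * (2 * T + 2)"
  have \<Phi>: "\<phi> x \<le> \<Phi>" for x
  proof (cases "\<bar>x\<bar> \<le> T")
    case True
    have "\<bar>x - (T + 1)\<bar> \<le> 2 * T + 2" using True by linarith
    then have "L * \<bar>x - (T + 1)\<bar> \<le> \<Phi>" unfolding \<Phi>_def using L by (intro mult_left_mono) auto
    moreover have "\<phi> (T + 1) = 0" using T by (intro supp) auto
    ultimately show ?thesis using L(2)[of x "T+1"] by linarith
  next
    case False then show ?thesis using supp L T by (simp add: \<Phi>_def)
  qed
  define I where "I = integral {-T..T} (\<lambda>u. \<phi> u * Im z / ((Re z - u)\<^sup>2 + (Im z)\<^sup>2))"
  define \<epsilon> where "\<epsilon> \<delta> = L * sqrt \<delta> + \<Phi> * (1 - 2 / pi * arctan (1 / sqrt \<delta>))" for \<delta>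
  obtain f where f: "f holomorphic_on {z. Im z > 0}"
    "\<And>z. Im z > 0 \<Longrightarrow> Re (f z) = integral {-T..T} (\<lambda>u. \<phi> u * Im z / ((Re z - u)\<^sup>2 + (Im z)\<^sup>2))"
    using poisson_holomorphic[OF cont T] by blast
  have integrable: "(\<lambda>u. \<phi> u * y / ((x - u)\<^sup>2 + y\<^sup>2)) integrable_on {-T..T}" if "y > 0" for x y
  proof -
    have "(x - u)\<^sup>2 + y\<^sup>2 \<noteq> 0" for u using that by (metis add_nonneg_pos less_numeral_extra(3) zero_le_power2 zero_less_power)
    then show ?thesis by (intro integrable_continuous_interval continuous_intros continuous_on_subset[OF cont]) auto
  qed
  have key: "norm (h z) \<le> exp (b * Im z + \<epsilon> \<delta> + 1 / pi * ((Im z + \<delta>) / Im z * I))" if \<delta>: "\<delta> > 0" for \<delta>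
  proof -
    define F where "F w = h w * exp (\<i> * of_real b * w) * exp (- (of_real (1/pi) * f (w + \<i> * of_real \<delta>)))" for w
    have Fn: "norm (F w) = norm (h w) * exp (- b * Im w) * exp (- (1 / pi * Re (f (w + \<i> * of_real \<delta>))))" for w
      by (simp add: F_def norm_mult norm_exp_eq_Re)
    have Rf: "Re (f (w + \<i> * of_real \<delta>)) \<ge> 0" if "Im w \<ge> 0" for w
    proof -
      have pos: "Im (w + \<i> * of_real \<delta>) > 0" using that \<delta> by simp
      have "0 \<le> integral {-T..T} (\<lambda>u. \<phi> u * Im (w + \<i> * of_real \<delta>) / ((Re (w + \<i> * of_real \<delta>) - u)\<^sup>2 + (Im (w + \<i> * of_real \<delta>))\<^sup>2))"
        by (rule integral_nonneg[OF integrable[OF pos]]) (use nn pos in auto)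
      then show ?thesis unfolding f(2)[OF pos] .
    qed
    have "norm (F z) \<le> exp (\<epsilon> \<delta>)"
    proof (rule upper_half_disc_bound[of F \<delta> C])
      have "(\<lambda>w. f (w + \<i> * of_real \<delta>)) holomorphic_on {z. Im z > - \<delta>}"
        by (rule holomorphic_on_compose_gen[OF _ f(1), unfolded o_def]) (auto intro!: holomorphic_intros)
      then show "F holomorphic_on {z. Im z > - \<delta>}"
        unfolding F_def by (intro holomorphic_intros holomorphic_on_subset[OF holo]) auto
    next
      fix w assume w: "Im w \<ge> 0"
      have "norm (F w) \<le> (C * exp (b * \<bar>Im w\<bar>) / (1 + norm w)) * exp (- b * Im w) * 1"
        unfolding Fn
      proof (intro mult_mono dec)
        have "0 \<le> C * exp (b * \<bar>Im w\<bar>) / (1 + norm w)" by (rule order.trans[OF norm_ge_zero dec])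
        then show "0 \<le> C * exp (b * \<bar>Im w\<bar>) / (1 + norm w)" "0 \<le> C * exp (b * \<bar>Im w\<bar>) / (1 + norm w) * exp (- b * Im w)"
          by (auto intro: mult_nonneg_nonneg simp del: times_divide_eq_left)
      qed (use Rf[OF w] in auto)
      also have "\<dots> = C / (1 + norm w) * (exp (b * \<bar>Im w\<bar>) * exp (- b * Im w))" by simp
      also have "exp (b * \<bar>Im w\<bar>) * exp (- b * Im w) = 1" using w by (simp add: exp_add[symmetric])
      finally show "norm (F w) \<le> C / (1 + norm w)" by simp
    next
      fix x :: real
      have "norm (F (of_real x)) \<le> exp (\<phi> x) * exp (- (1 / pi * Re (f (of_real x + \<i> * of_real \<delta>))))"
        unfolding Fn using maj[of x] by simp
      also have "\<dots> = exp (\<phi> x - 1 / pi * integral {-T..T} (\<lambda>u. \<phi> u * \<delta> / ((x - u)\<^sup>2 + \<delta>\<^sup>2)))"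
        using f(2)[of "of_real x + \<i> * of_real \<delta>"] \<delta> by (simp add: exp_add[symmetric])
      also have "\<dots> \<le> exp (\<epsilon> \<delta>)"
        unfolding \<epsilon>_def using poisson_lower[OF nn L supp \<Phi> \<delta> cont] by simp
      finally show "norm (F (of_real x)) \<le> exp (\<epsilon> \<delta>)" .
    qed (use \<delta> z in auto)
    then have *: "norm (h z) * exp (- b * Im z) * exp (- (1 / pi * Re (f (z + \<i> * of_real \<delta>)))) \<le> exp (\<epsilon> \<delta>)" unfolding Fn .
    have "norm (h z) = (norm (h z) * exp (- b * Im z) * exp (- (1 / pi * Re (f (z + \<i> * of_real \<delta>))))) * exp (b * Im z + 1 / pi * Re (f (z + \<i> * of_real \<delta>)))"
      unfolding mult.assoc exp_add[symmetric] by simp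
    also have "\<dots> \<le> exp (\<epsilon> \<delta>) * exp (b * Im z + 1 / pi * Re (f (z + \<i> * of_real \<delta>)))"
      by (rule mult_right_mono[OF *]) simp
    also have "\<dots> = exp (b * Im z + \<epsilon> \<delta> + 1 / pi * Re (f (z + \<i> * of_real \<delta>)))" by (simp add: exp_add[symmetric] add_ac)
    also have "\<dots> \<le> exp (b * Im z + \<epsilon> \<delta> + 1 / pi * ((Im z + \<delta>) / Im z * I))"
    proof -
      have "Re (f (z + \<i> * of_real \<delta>)) = integral {-T..T} (\<lambda>u. \<phi> u * (Im z + \<delta>) / ((Re z - u)\<^sup>2 + (Im z + \<delta>)\<^sup>2))"
        using f(2)[of "z + \<i> * of_real \<delta>"] z \<delta> by simp
      \<comment> \<open>A larger height only increases the denominator of the kernel, so the shifted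
        integral is at most \<open>(Im z + \<delta>) / Im z\<close> times the original one; no
        convergence of integrals is needed in the limit.\<close>
      also have "\<dots> \<le> integral {-T..T} (\<lambda>u. (Im z + \<delta>) / Im z * (\<phi> u * Im z / ((Re z - u)\<^sup>2 + (Im z)\<^sup>2)))"
      proof (rule integral_le)
        show "(\<lambda>u. \<phi> u * (Im z + \<delta>) / ((Re z - u)\<^sup>2 + (Im z + \<delta>)\<^sup>2)) integrable_on {-T..T}" using z \<delta> by (intro integrable) auto
        show "(\<lambda>u. (Im z + \<delta>) / Im z * (\<phi> u * Im z / ((Re z - u)\<^sup>2 + (Im z)\<^sup>2))) integrable_on {-T..T}"
          by (intro integrable_on_mult_right integrable z)
        fix u
        have "\<phi> u * (Im z + \<delta>) / ((Re z - u)\<^sup>2 + (Im z + \<delta>)\<^sup>2) \<le> \<phi> u * (Im z + \<delta>) / ((Re z - u)\<^sup>2 + (Im z)\<^sup>2)"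
          using nn[of u] z \<delta> by (intro divide_left_mono add_left_mono power_mono mult_pos_pos) (auto intro!: add_nonneg_pos)
        then show "\<phi> u * (Im z + \<delta>) / ((Re z - u)\<^sup>2 + (Im z + \<delta>)\<^sup>2) \<le> (Im z + \<delta>) / Im z * (\<phi> u * Im z / ((Re z - u)\<^sup>2 + (Im z)\<^sup>2))"
          using z by (simp add: mult_ac)
      qed
      also have "\<dots> = (Im z + \<delta>) / Im z * I" unfolding I_def by (rule integral_mult_right)
      finally have "1 / pi * Re (f (z + \<i> * of_real \<delta>)) \<le> 1 / pi * ((Im z + \<delta>) / Im z * I)" by (intro mult_left_mono) auto
      then show ?thesis by simp
    qed
    finally show ?thesis .
  qed
  have "((\<lambda>\<delta>. 1 - 2 / pi * arctan (1 / sqrt \<delta>)) \<longlongrightarrow> 1 - 2 / pi * (pi / 2)) (at_right 0)"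
  proof (intro tendsto_intros)
    have "filterlim (\<lambda>\<delta>. sqrt \<delta>) (at_right 0) (at_right 0)"
      unfolding filterlim_at
    proof
      show "(sqrt \<longlongrightarrow> 0) (at_right 0)" using tendsto_real_sqrt[OF tendsto_ident_at[of 0 "{0<..}"]] by simp
      show "\<forall>\<^sub>F x in at_right 0. sqrt x \<in> {0<..} \<and> sqrt x \<noteq> 0" by (auto simp: eventually_at intro!: exI[of _ 1])
    qed
    then have "filterlim (\<lambda>\<delta>. inverse (sqrt \<delta>)) at_top (at_right 0)"
      by (rule filterlim_compose[OF filterlim_inverse_at_top_right])
    then show "((\<lambda>\<delta>. arctan (1 / sqrt \<delta>)) \<longlongrightarrow> pi / 2) (at_right 0)"
      using filterlim_compose[OF tendsto_arctan_at_top] by (simp add: inverse_eq_divide)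
  qed
  then have lim0: "((\<lambda>\<delta>. 1 - 2 / pi * arctan (1 / sqrt \<delta>)) \<longlongrightarrow> 0) (at_right 0)" by simp
  have lims: "(sqrt \<longlongrightarrow> 0) (at_right 0)" using tendsto_real_sqrt[OF tendsto_ident_at[of 0 "{0<..}"]] by simp
  have "(\<epsilon> \<longlongrightarrow> L * 0 + \<Phi> * 0) (at_right 0)"
    unfolding \<epsilon>_def by (intro tendsto_intros lims lim0)
  then have lime: "(\<epsilon> \<longlongrightarrow> 0) (at_right 0)" by simp
  have "((\<lambda>\<delta>. exp (b * Im z + \<epsilon> \<delta> + 1 / pi * ((Im z + \<delta>) / Im z * I))) \<longlongrightarrow> exp (b * Im z + 0 + 1 / pi * ((Im z + 0) / Im z * I))) (at_right 0)"
    using z by (intro tendsto_intros lime) auto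
  then have "norm (h z) \<le> exp (b * Im z + 0 + 1 / pi * ((Im z + 0) / Im z * I))"
  proof (rule tendsto_lowerbound)
    show "\<forall>\<^sub>F \<delta> in at_right 0. norm (h z) \<le> exp (b * Im z + \<epsilon> \<delta> + 1 / pi * ((Im z + \<delta>) / Im z * I))"
      using key by (auto simp: eventually_at intro!: exI[of _ 1])
  qed simp
  then show ?thesis using z by (simp add: I_def)
qed

text \<open>Points below the axis are treated by the reflected function
  \<open>cnj (h (cnj w))\<close>, which obeys the same hypotheses.\<close>

lemma poisson_bound:
  fixes h :: "complex \<Rightarrow> complex" and \<phi> :: "real \<Rightarrow> real"
  assumes holo: "h holomorphic_on UNIV" and b: "b \<ge> 0"
    and dec: "\<And>z. norm (h z) \<le> C * exp (b * \<bar>Im z\<bar>) / (1 + norm z)"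
    and nn: "\<And>x. \<phi> x \<ge> 0" and L: "L \<ge> 0" "\<And>x y. \<bar>\<phi> x - \<phi> y\<bar> \<le> L * \<bar>x - y\<bar>"
    and supp: "\<And>x. \<bar>x\<bar> > T \<Longrightarrow> \<phi> x = 0" and T: "T > 0"
    and maj: "\<And>x::real. norm (h (of_real x)) \<le> exp (\<phi> x)" and z: "Im z \<noteq> 0"
    and r: "r \<ge> 0" "(\<integral>\<^sup>+u. ennreal (\<phi> u * \<bar>Im z\<bar> / ((Re z - u)\<^sup>2 + (Im z)\<^sup>2)) \<partial>lborel) \<le> ennreal r"
  shows "norm (h z) \<le> exp (b * \<bar>Im z\<bar> + r / pi)"
proof -
  have cont: "continuous_on UNIV \<phi>"
    using L by (intro lipschitz_on_continuous_on[of L] lipschitz_onI) (auto simp: dist_real_def)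
  have int: "integral {-T..T} (\<lambda>u. \<phi> u * \<bar>Im z\<bar> / ((Re z - u)\<^sup>2 + (Im z)\<^sup>2)) \<le> r" (is "integral _ ?g \<le> r")
  proof -
    have ne: "(Re z - u)\<^sup>2 + (Im z)\<^sup>2 \<noteq> 0" for u using z by (simp add: sum_power2_eq_zero_iff)
    have g0: "?g u \<ge> 0" for u using nn by simp
    have "?g integrable_on {-T..T}" using ne by (intro integrable_continuous_interval continuous_intros continuous_on_subset[OF cont]) auto
    then have "(?g has_integral integral {-T..T} ?g) {-T..T}" by (rule integrable_integral)
    from nn_integral_has_integral_lebesgue'[OF _ this]
    have "ennreal (integral {-T..T} ?g) = (\<integral>\<^sup>+u. ennreal (?g u) * indicator {-T..T} u \<partial>lborel)" using g0 by simp
    also have "\<dots> \<le> (\<integral>\<^sup>+u. ennreal (?g u) \<partial>lborel)"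
      by (intro nn_integral_mono) (auto simp: indicator_def)
    also have "\<dots> \<le> ennreal r" by (rule r)
    finally show ?thesis using r(1) by (simp add: ennreal_le_iff)
  qed
  have fin: "1 / pi * integral {-T..T} ?g \<le> r / pi" using mult_left_mono[OF int, of "1 / pi"] by simp
  show ?thesis
  proof (cases "Im z > 0")
    case True
    have "norm (h z) \<le> exp (b * Im z + 1 / pi * integral {-T..T} (\<lambda>u. \<phi> u * Im z / ((Re z - u)\<^sup>2 + (Im z)\<^sup>2)))"
      by (rule poisson_majorant[OF holo b dec nn L supp T maj True])
    also have "\<dots> \<le> exp (b * \<bar>Im z\<bar> + r / pi)" using fin True by simp
    finally show ?thesis .
  next
    case False
    then have neg: "Im (cnj z) > 0" using z by simp
    define k where "k w = cnj (h (cnj w))" for w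
    have "norm (k (cnj z)) \<le> exp (b * Im (cnj z) + 1 / pi * integral {-T..T} (\<lambda>u. \<phi> u * Im (cnj z) / ((Re (cnj z) - u)\<^sup>2 + (Im (cnj z))\<^sup>2)))"
    proof (rule poisson_majorant[OF _ b _ nn L supp T _ neg])
      have "(cnj \<circ> h \<circ> cnj) holomorphic_on UNIV" by (rule holomorphic_on_compose_cnj_cnj) (use holo in \<open>auto intro: holomorphic_on_subset\<close>)
      then show "k holomorphic_on UNIV" by (simp add: k_def[abs_def] o_def)
      show "norm (k w) \<le> C * exp (b * \<bar>Im w\<bar>) / (1 + norm w)" for w using dec[of "cnj w"] by (simp add: k_def)
      show "norm (k (of_real x)) \<le> exp (\<phi> x)" for x using maj[of x] by (simp add: k_def)
    qed
    also have "\<dots> \<le> exp (b * \<bar>Im z\<bar> + r / pi)" using fin neg by simp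
    finally show ?thesis by (simp add: k_def)
  qed
qed

section \<open>Lipschitz majorants\<close>

definition bump :: "(real \<Rightarrow> real) \<Rightarrow> bool" where
  "bump u \<longleftrightarrow> continuous_on UNIV u \<and> (\<forall>x. 0 \<le> u x) \<and> (\<exists>T. \<forall>x. \<bar>x\<bar> > T \<longrightarrow> u x = 0)"

definition lip_maj :: "(real \<Rightarrow> real) \<Rightarrow> real \<Rightarrow> real" where
  "lip_maj u x = (SUP t. u t - \<bar>x - t\<bar>)"

lemma bump_bounded:
  assumes "bump u"
  obtains B where "B > 0" "\<And>x. u x \<le> B"
proof -
  obtain T where T: "\<And>x. \<bar>x\<bar> > T \<Longrightarrow> u x = 0" using assms by (auto simp: bump_def)
  have "compact (u ` {-T..T})"
    using assms by (intro compact_continuous_image) (auto simp: bump_def intro: continuous_on_subset)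
  then have "bounded (u ` {-T..T})" by (rule compact_imp_bounded)
  then obtain B where B: "B > 0" "\<And>y. y \<in> u ` {-T..T} \<Longrightarrow> norm y \<le> B" by (auto simp: bounded_pos)
  have "u x \<le> B" for x
  proof (cases "\<bar>x\<bar> > T")
    case False
    then have "x \<in> {-T..T}" by auto
    then have "norm (u x) \<le> B" using B by blast
    then show ?thesis by simp
  qed (use T B in auto)
  with B that show thesis by blast
qed

text \<open>Competitors farther from \<open>x\<close> than the bound of \<open>u\<close> give a
  value at most 0, which \<open>t = x\<close> already reaches; the supremum is over a compact
  interval.\<close>

lemma lip_maj_attained:
  assumes u: "bump u"
  obtains t where "lip_maj u x = u t - \<bar>x - t\<bar>" "\<And>t'. u t' - \<bar>x - t'\<bar> \<le> u t - \<bar>x - t\<bar>"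
proof -
  obtain B where B: "B > 0" "\<And>x. u x \<le> B" using bump_bounded[OF u] by blast
  have "\<exists>t\<in>{x-B..x+B}. \<forall>t'\<in>{x-B..x+B}. u t' - \<bar>x - t'\<bar> \<le> u t - \<bar>x - t\<bar>"
  proof (rule continuous_attains_sup)
    show "continuous_on {x-B..x+B} (\<lambda>t. u t - \<bar>x - t\<bar>)"
      using u by (intro continuous_intros) (auto simp: bump_def intro: continuous_on_subset)
  qed (use B in auto)
  then obtain t where t: "t \<in> {x-B..x+B}" "\<And>t'. t'\<in>{x-B..x+B} \<Longrightarrow> u t' - \<bar>x - t'\<bar> \<le> u t - \<bar>x - t\<bar>" by blast
  have all: "u t' - \<bar>x - t'\<bar> \<le> u t - \<bar>x - t\<bar>" for t'
  proof (cases "t' \<in> {x-B..x+B}")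
    case False
    then have "\<bar>x - t'\<bar> > B" by auto
    then have "u t' - \<bar>x - t'\<bar> \<le> 0" using B(2)[of t'] by linarith
    also have "0 \<le> u x - \<bar>x - x\<bar>" using u by (simp add: bump_def)
    also have "\<dots> \<le> u t - \<bar>x - t\<bar>" by (rule t(2)) (use B in auto)
    finally show ?thesis .
  qed (rule t(2))
  have "lip_maj u x = u t - \<bar>x - t\<bar>"
    unfolding lip_maj_def by (rule cSup_eq_maximum) (use all in auto)
  with all that show thesis by blast
qed

lemma lip_maj_ge:
  assumes "bump u" shows "u t - \<bar>x - t\<bar> \<le> lip_maj u x"
proof -
  obtain t0 where "lip_maj u x = u t0 - \<bar>x - t0\<bar>" "\<And>t'. u t' - \<bar>x - t'\<bar> \<le> u t0 - \<bar>x - t0\<bar>"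
    using lip_maj_attained[OF assms] by blast
  then show ?thesis by simp
qed

lemma lip_maj_ge_self: "bump u \<Longrightarrow> u x \<le> lip_maj u x"
  using lip_maj_ge[of u x x] by simp

lemma lip_maj_nonneg: "bump u \<Longrightarrow> 0 \<le> lip_maj u x"
  using lip_maj_ge_self[of u x] by (auto simp: bump_def intro: order.trans)

lemma lip_maj_lipschitz: 
  assumes "bump u" shows "\<bar>lip_maj u x - lip_maj u y\<bar> \<le> \<bar>x - y\<bar>"
proof -
  have *: "lip_maj u x \<le> lip_maj u y + \<bar>x - y\<bar>" for x y
  proof -
    obtain t where "lip_maj u x = u t - \<bar>x - t\<bar>" using lip_maj_attained[OF assms] by blast
    then show ?thesis using lip_maj_ge[OF assms, of t y] by linarith
  qed
  show ?thesis using *[of x y] *[of y x] by linarith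
qed

lemma lip_maj_continuous: "bump u \<Longrightarrow> continuous_on S (lip_maj u)"
  using lip_maj_lipschitz[of u]
  by (intro lipschitz_on_continuous_on[of 1] lipschitz_onI) (auto simp: dist_real_def)

lemma lip_maj_mono_add:
  assumes "bump u" "bump v" "\<And>x. u x \<le> v x + e"
  shows "lip_maj u x \<le> lip_maj v x + e"
proof -
  obtain t where "lip_maj u x = u t - \<bar>x - t\<bar>" using lip_maj_attained[OF assms(1)] by blast
  then show ?thesis using lip_maj_ge[OF assms(2), of t x] assms(3)[of t] by linarith
qed

lemma lip_maj_support:
  assumes u: "bump u"
  obtains T where "T > 0" "\<And>x. \<bar>x\<bar> > T \<Longrightarrow> lip_maj u x = 0"
proof -
  obtain B where B: "B > 0" "\<And>x. u x \<le> B" using bump_bounded[OF u] by blast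
  obtain T where T: "\<And>x. \<bar>x\<bar> > T \<Longrightarrow> u x = 0" using assms by (auto simp: bump_def)
  have "lip_maj u x = 0" if x: "\<bar>x\<bar> > \<bar>T\<bar> + B" for x
  proof -
    obtain t where t: "lip_maj u x = u t - \<bar>x - t\<bar>" using lip_maj_attained[OF u] by blast
    have "lip_maj u x \<le> 0"
    proof (cases "\<bar>t\<bar> > T")
      case True then show ?thesis using T t by simp
    next
      case False then show ?thesis using t x B(2)[of t] by linarith
    qed
    then show ?thesis using lip_maj_nonneg[OF u, of x] by linarith
  qed
  then show thesis using that[of "\<bar>T\<bar> + B"] B by force
qed

text \<open>The maximiser for \<open>x\<close> is itself a contact point, and the majorant drops
  from it to \<open>x\<close> with slope exactly 1. Hence a point where the majorant is positive
  lies in the ball about some contact point whose radius is the height there; these balls feed the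
  covering argument.\<close>

lemma lip_maj_contact:
  assumes u: "bump u"
  obtains t where "lip_maj u t = u t" "lip_maj u x = lip_maj u t - \<bar>x - t\<bar>"
proof -
  obtain t where t: "lip_maj u x = u t - \<bar>x - t\<bar>" using lip_maj_attained[OF u] by blast
  have "lip_maj u t \<le> u t" using lip_maj_lipschitz[OF u, of x t] t by linarith
  then have "lip_maj u t = u t" using lip_maj_ge_self[OF u, of t] by linarith
  with t that show thesis by simp
qed

section \<open>Covering by windows about contact points\<close>

lemma nn_integral_inverse_square_tail:
  fixes y r :: real
  assumes r: "r > 0"
  shows "(\<integral>\<^sup>+u. ennreal (1 / (u - y)\<^sup>2) * indicator {u. \<bar>u - y\<bar> \<ge> r} u \<partial>lborel) \<le> ennreal (2 / r)"
proof -
  have right: "(\<integral>\<^sup>+u. ennreal (1 / (u - y)\<^sup>2) * indicator {y + r..} u \<partial>lborel) = ennreal (1 / r)"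
  proof -
    have "(\<integral>\<^sup>+u. ennreal (1 / (u - y)\<^sup>2) * indicator {y + r..} u \<partial>lborel) = ennreal (0 - (- 1 / (y + r - y)))"
    proof (rule nn_integral_FTC_atLeast)
      show "((\<lambda>u. - 1 / (u - y)) has_real_derivative 1 / (u - y)\<^sup>2) (at u)" if "y + r \<le> u" for u
        using that r by (auto intro!: derivative_eq_intros simp: power2_eq_square)
      have "filterlim (\<lambda>u. u - y) at_top at_top"
        using filterlim_tendsto_add_at_top[OF tendsto_const[of "- y"] filterlim_ident] by (simp add: add.commute)
      then show "((\<lambda>u. - 1 / (u - y)) \<longlongrightarrow> 0) at_top"
        by (intro tendsto_divide_0[OF tendsto_const]) (auto intro: filterlim_at_top_imp_at_infinity)
    qed auto
    then show ?thesis by simp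
  qed
  have left: "(\<integral>\<^sup>+u. ennreal (1 / (u - y)\<^sup>2) * indicator {..y - r} u \<partial>lborel) = ennreal (1 / r)"
  proof -
    have "(\<integral>\<^sup>+u. ennreal (1 / (u - y)\<^sup>2) * indicator {..y - r} u \<partial>lborel)
       = (\<integral>\<^sup>+u. ennreal (1 / (u - y)\<^sup>2) * indicator {y + r..} u \<partial>lborel)"
      by (subst nn_integral_real_affine[where c = "-1" and t = "2 * y"])
        (auto intro!: nn_integral_cong simp: power2_eq_square indicator_def algebra_simps)
    then show ?thesis using right by simp
  qed
  have "(\<integral>\<^sup>+u. ennreal (1 / (u - y)\<^sup>2) * indicator {u. \<bar>u - y\<bar> \<ge> r} u \<partial>lborel)
     \<le> (\<integral>\<^sup>+u. ennreal (1 / (u - y)\<^sup>2) * indicator {y + r..} u + ennreal (1 / (u - y)\<^sup>2) * indicator {..y - r} u \<partial>lborel)"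
    by (intro nn_integral_mono) (auto simp: indicator_def)
  also have "\<dots> = ennreal (1 / r) + ennreal (1 / r)"
    by (subst nn_integral_add) (auto simp: left right)
  also have "\<dots> = ennreal (2 / r)" using r by (simp flip: ennreal_plus)
  finally show ?thesis .
qed

lemma disjoint_sum_indicator_le:
  fixes g :: ennreal
  assumes "finite C" "\<And>t t'. t \<in> C \<Longrightarrow> t' \<in> C \<Longrightarrow> u \<in> A t \<Longrightarrow> u \<in> A t' \<Longrightarrow> t = t'"
    "\<And>t. t \<in> C \<Longrightarrow> u \<in> A t \<Longrightarrow> g \<le> f"
  shows "(\<Sum>t\<in>C. g * indicator (A t) u) \<le> f"
proof (cases "\<exists>t\<in>C. u \<in> A t")
  case True
  then obtain t where t: "t \<in> C" "u \<in> A t" by blast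
  have "(\<Sum>t'\<in>C. g * indicator (A t') u) = (\<Sum>t'\<in>C. if t' = t then g else 0)"
    by (rule sum.cong) (use assms t in \<open>auto simp: indicator_def\<close>)
  also have "\<dots> = g" using assms(1) t by simp
  finally show ?thesis using assms(3)[OF t] by simp
qed (auto simp: indicator_def)

text \<open>One factor \<open>s t\<close> is half the length of an interval, and these intervals are
  disjoint and far from \<open>y\<close>, so the sum of \<open>s t / (2 * (y - t)\<^sup>2)\<close>
  is at most the integral of \<open>1 / (u - y)\<^sup>2\<close> over
  \<open>\<bar>u - y\<bar> \<ge> Y / 2\<close>, which is at most \<open>4 / Y\<close>. The other
  factor \<open>s t\<close> is below \<open>Y / K\<close>. In the application \<open>Y\<close> is
  the height of the majorant at \<open>y\<close>, and \<open>far\<close> is the Lipschitz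
  condition.\<close>

lemma disjoint_balls_inverse_square_sum:
  fixes s :: "real \<Rightarrow> real"
  assumes fin: "finite C" and s: "\<And>t. t \<in> C \<Longrightarrow> s t > 0"
    and disj: "\<And>t t' u. t \<in> C \<Longrightarrow> t' \<in> C \<Longrightarrow> \<bar>u - t\<bar> < s t \<Longrightarrow> \<bar>u - t'\<bar> < s t' \<Longrightarrow> t = t'"
    and K: "K \<ge> 4" and Y: "Y > 0"
    and small: "\<And>t. t \<in> C \<Longrightarrow> K * s t < Y" and far: "\<And>t. t \<in> C \<Longrightarrow> \<bar>y - t\<bar> \<ge> Y - s t"
  shows "(\<Sum>t\<in>C. (s t)\<^sup>2 / (y - t)\<^sup>2) \<le> 8 / K"
proof -
  let ?f = "\<lambda>u. ennreal (1 / (u - y)\<^sup>2)"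
  let ?A = "\<lambda>t. {u. \<bar>u - t\<bar> < s t}"
  have A: "?A t = {t - s t<..<t + s t}" for t by (auto simp: abs_less_iff)
  have s4: "4 * s t \<le> Y" if "t \<in> C" for t
  proof -
    have "4 * s t \<le> K * s t" using K s[OF that] by (intro mult_right_mono) auto
    then show ?thesis using small[OF that] by linarith
  qed
  have pos: "\<bar>y - t\<bar> > 0" if "t \<in> C" for t using far[OF that] s4[OF that] s[OF that] by linarith
  have one: "ennreal (s t / (2 * (y - t)\<^sup>2)) \<le> (\<integral>\<^sup>+u. ?f u * indicator (?A t) u \<partial>lborel)" if t: "t \<in> C" for t
  proof -
    have "ennreal (s t / (2 * (y - t)\<^sup>2)) = (\<integral>\<^sup>+u. ennreal (1 / (4 * (y - t)\<^sup>2)) * indicator (?A t) u \<partial>lborel)"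
      unfolding A using s[OF t] by (simp add: nn_integral_cmult_indicator ennreal_mult[symmetric] del: ennreal_le_iff)
    also have "\<dots> \<le> (\<integral>\<^sup>+u. ?f u * indicator (?A t) u \<partial>lborel)"
    proof (rule nn_integral_mono)
      fix u
      show "ennreal (1 / (4 * (y - t)\<^sup>2)) * indicator (?A t) u \<le> ?f u * indicator (?A t) u"
      proof (cases "u \<in> ?A t")
        case True
        then have ut: "\<bar>u - t\<bar> < s t" by simp
        have tri: "\<bar>u - y\<bar> \<le> \<bar>u - t\<bar> + \<bar>y - t\<bar>" "\<bar>y - t\<bar> \<le> \<bar>u - y\<bar> + \<bar>u - t\<bar>" by linarith+
        have 1: "\<bar>u - y\<bar> \<le> 2 * \<bar>y - t\<bar>" using tri ut far[OF t] s4[OF t] s[OF t] by linarith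
        have 2: "\<bar>u - y\<bar> > 0" using tri ut far[OF t] s4[OF t] s[OF t] by linarith
        have "(u - y)\<^sup>2 \<le> (2 * \<bar>y - t\<bar>)\<^sup>2" using 1 by (metis abs_ge_zero power2_abs power_mono)
        then have "(u - y)\<^sup>2 \<le> 4 * (y - t)\<^sup>2" by (simp add: power_mult_distrib)
        then have "1 / (4 * (y - t)\<^sup>2) \<le> 1 / (u - y)\<^sup>2" using 2 pos[OF t] by (intro divide_left_mono mult_pos_pos) auto
        then show ?thesis using True by (simp add: ennreal_leI)
      qed simp
    qed
    finally show ?thesis .
  qed
  have "ennreal (\<Sum>t\<in>C. s t / (2 * (y - t)\<^sup>2)) = (\<Sum>t\<in>C. ennreal (s t / (2 * (y - t)\<^sup>2)))"
    using s by (subst sum_ennreal) (auto simp: less_imp_le)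
  also have "\<dots> \<le> (\<Sum>t\<in>C. \<integral>\<^sup>+u. ?f u * indicator (?A t) u \<partial>lborel)" by (rule sum_mono) (rule one)
  also have "\<dots> = (\<integral>\<^sup>+u. (\<Sum>t\<in>C. ?f u * indicator (?A t) u) \<partial>lborel)"
    by (subst nn_integral_sum) (auto simp: A)
  also have "\<dots> \<le> (\<integral>\<^sup>+u. ?f u * indicator {u. \<bar>u - y\<bar> \<ge> Y / 2} u \<partial>lborel)"
  proof (rule nn_integral_mono, rule disjoint_sum_indicator_le[OF fin])
    fix u t assume t: "t \<in> C" "u \<in> ?A t"
    have "\<bar>u - t\<bar> < s t" using t by simp
    moreover have "\<bar>y - t\<bar> \<le> \<bar>u - y\<bar> + \<bar>u - t\<bar>" by linarith
    ultimately have "\<bar>u - y\<bar> \<ge> Y / 2" using far[OF t(1)] s4[OF t(1)] by linarith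
    then show "?f u \<le> ?f u * indicator {u. \<bar>u - y\<bar> \<ge> Y / 2} u" by simp
  qed (use disj in auto)
  also have "\<dots> \<le> ennreal (2 / (Y / 2))" by (rule nn_integral_inverse_square_tail) (use Y in simp)
  finally have "(\<Sum>t\<in>C. s t / (2 * (y - t)\<^sup>2)) \<le> 4 / Y" using Y by (simp add: ennreal_le_iff)
  then have "(2 * Y / K) * (\<Sum>t\<in>C. s t / (2 * (y - t)\<^sup>2)) \<le> (2 * Y / K) * (4 / Y)" using Y K by (intro mult_left_mono) auto
  also have "\<dots> = 8 / K" using Y by simp
  finally have *: "(2 * Y / K) * (\<Sum>t\<in>C. s t / (2 * (y - t)\<^sup>2)) \<le> 8 / K" .
  have "(\<Sum>t\<in>C. (s t)\<^sup>2 / (y - t)\<^sup>2) \<le> (\<Sum>t\<in>C. (2 * Y / K) * (s t / (2 * (y - t)\<^sup>2)))"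
  proof (rule sum_mono)
    fix t assume t: "t \<in> C"
    have "s t \<le> Y / K" using small[OF t] K by (simp add: field_simps)
    then have "s t * (s t / (y - t)\<^sup>2) \<le> (Y / K) * (s t / (y - t)\<^sup>2)" using s[OF t] by (intro mult_right_mono) auto
    also have "\<dots> = (2 * Y / K) * (s t / (2 * (y - t)\<^sup>2))" by simp
    finally show "(s t)\<^sup>2 / (y - t)\<^sup>2 \<le> (2 * Y / K) * (s t / (2 * (y - t)\<^sup>2))" by (simp add: power2_eq_square)
  qed
  also have "\<dots> \<le> 8 / K" using * by (simp only: sum_distrib_left)
  finally show ?thesis .
qed

text \<open>The constants: the covering gives \<open>G \<le> 3840 (8 Q + 64 G / K)\<close>, and \<open>K = 983040\<close> is chosen so that
  \<open>3840 * 64 / K = 1 / 4\<close>.\<close>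

lemma lip_maj_bootstrap:
  fixes u q :: "real \<Rightarrow> real" and X :: real
  defines "\<sigma> \<equiv> lip_maj u"
  defines "G \<equiv> (\<integral>\<^sup>+x. ennreal (lip_maj u x / (X\<^sup>2 + x\<^sup>2)) \<partial>lborel)"
  assumes u: "bump u" and X: "X \<ge> 1"
    and q: "q \<in> borel_measurable borel" "\<And>x. q x \<ge> 0"
    and G: "G \<le> ennreal (1 / 4000)"
    and contact: "\<And>t. \<sigma> t = u t \<Longrightarrow> \<sigma> t > 0 \<Longrightarrow>
        ennreal ((\<sigma> t)\<^sup>2) \<le> (\<integral>\<^sup>+x. ennreal (q x) * indicator {x. \<bar>x - t\<bar> < 3 * \<sigma> t} x \<partial>lborel)
        \<or> ennreal (2 * 983040 + 2) < (\<integral>\<^sup>+y. ennreal (\<sigma> y / (y - t)\<^sup>2) * indicator {y. \<bar>y - t\<bar> > \<sigma> t} y \<partial>lborel)"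
  shows "G \<le> 61440 * (\<integral>\<^sup>+x. ennreal (q x / (X\<^sup>2 + x\<^sup>2)) \<partial>lborel)"
proof -
  define K where "K = (983040::real)"
  define w where "w x = 1 / (X\<^sup>2 + x\<^sup>2)" for x :: real
  define Q where "Q = (\<integral>\<^sup>+x. ennreal (q x * w x) \<partial>lborel)"
  have den: "X\<^sup>2 + x\<^sup>2 > 0" for x using X by (simp add: add_pos_nonneg)
  have wpos: "w x > 0" for x using den by (simp add: w_def)
  have w1: "w x \<le> 1" for x
  proof -
    have "1 \<le> X\<^sup>2" using X by (simp add: one_le_power)
    then show ?thesis by (simp add: w_def divide_le_eq add_increasing2)
  qed
  have G': "G = (\<integral>\<^sup>+x. ennreal (\<sigma> x * w x) \<partial>lborel)" by (simp add: G_def \<sigma>_def w_def)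
  have \<sigma>nn: "\<sigma> x \<ge> 0" for x unfolding \<sigma>_def by (rule lip_maj_nonneg[OF u])
  have lip: "\<bar>\<sigma> x - \<sigma> y\<bar> \<le> \<bar>x - y\<bar>" for x y unfolding \<sigma>_def by (rule lip_maj_lipschitz[OF u])
  have \<sigma>cont: "continuous_on S \<sigma>" for S unfolding \<sigma>_def by (rule lip_maj_continuous[OF u])
  have [measurable]: "\<sigma> \<in> borel_measurable borel" by (rule borel_measurable_continuous_onI) (rule \<sigma>cont)
  have [measurable]: "w \<in> borel_measurable borel" unfolding w_def by measurable
  note q(1)[measurable]
  have Gfin: "G < top" using G by (rule order.strict_trans1) simp
  have sq: "X\<^sup>2 + x\<^sup>2 \<le> (X + \<bar>x\<bar>)\<^sup>2" "(X + \<bar>x\<bar>)\<^sup>2 \<le> 2 * (X\<^sup>2 + x\<^sup>2)" for x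
  proof -
    have e: "(X + \<bar>x\<bar>)\<^sup>2 = X\<^sup>2 + x\<^sup>2 + 2 * (X * \<bar>x\<bar>)" by (simp add: power2_sum)
    show "X\<^sup>2 + x\<^sup>2 \<le> (X + \<bar>x\<bar>)\<^sup>2" unfolding e using X by simp
    have "0 \<le> (X - \<bar>x\<bar>)\<^sup>2" by simp
    then have "2 * (X * \<bar>x\<bar>) \<le> X\<^sup>2 + x\<^sup>2" by (simp add: power2_diff)
    then show "(X + \<bar>x\<bar>)\<^sup>2 \<le> 2 * (X\<^sup>2 + x\<^sup>2)" unfolding e by simp
  qed
  have wcmp: "w x \<le> 8 * w t" if "X + \<bar>t\<bar> \<le> 2 * (X + \<bar>x\<bar>)" for x t
  proof -
    have "X\<^sup>2 + t\<^sup>2 \<le> (X + \<bar>t\<bar>)\<^sup>2" by (rule sq)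
    also have "\<dots> \<le> (2 * (X + \<bar>x\<bar>))\<^sup>2" using that X by (intro power_mono) auto
    also have "\<dots> \<le> 8 * (X\<^sup>2 + x\<^sup>2)" using sq(2)[of x] by (simp only: power_mult_distrib) simp
    finally show ?thesis unfolding w_def using den[of x] den[of t] by (simp add: field_simps)
  qed
  \<comment> \<open>A peak that is high relative to its distance would by itself carry weighted mass
    \<open>2 / 6561\<close>, more than \<open>1 / 4000\<close>. So windows of radius up to
    \<open>15 * \<sigma> t\<close> are short compared with \<open>X + \<bar>t\<bar>\<close>, and the
    weight \<open>w\<close> varies on them by a factor of at most 8.\<close>
  have small: "40 * \<sigma> t \<le> X + \<bar>t\<bar>" for t
  proof (rule ccontr)
    assume neg: "\<not> 40 * \<sigma> t \<le> X + \<bar>t\<bar>"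
    define r where "r = (X + \<bar>t\<bar>) / 80"
    have r: "r > 0" "X + \<bar>t\<bar> = 80 * r" "\<sigma> t \<ge> 2 * r" using X neg by (auto simp: r_def)
    have "ennreal (2 / 6561) = (\<integral>\<^sup>+x. ennreal (1 / (6561 * r)) * indicator {t - r<..<t + r} x \<partial>lborel)"
      using r by (simp add: nn_integral_cmult_indicator ennreal_mult[symmetric] del: ennreal_le_iff)
    also have "\<dots> \<le> G" unfolding G'
    proof (rule nn_integral_mono)
      fix x
      show "ennreal (1 / (6561 * r)) * indicator {t - r<..<t + r} x \<le> ennreal (\<sigma> x * w x)"
      proof (cases "x \<in> {t - r<..<t + r}")
        case True
        then have xt: "\<bar>x - t\<bar> < r" by (auto simp: abs_less_iff)
        have 1: "r \<le> \<sigma> x" using lip[of x t] xt r(3) by linarith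
        have "X + \<bar>x\<bar> \<le> 81 * r" using xt r(2) by linarith
        then have "(X + \<bar>x\<bar>)\<^sup>2 \<le> (81 * r)\<^sup>2" using X by (intro power_mono) auto
        then have "X\<^sup>2 + x\<^sup>2 \<le> 6561 * r\<^sup>2" using sq(1)[of x] by (simp add: power_mult_distrib)
        then have 2: "1 / (6561 * r\<^sup>2) \<le> w x" unfolding w_def using den[of x] r by (intro divide_left_mono) auto
        have "1 / (6561 * r) = r * (1 / (6561 * r\<^sup>2))" using r by (simp add: power2_eq_square)
        also have "\<dots> \<le> \<sigma> x * w x" by (rule mult_mono[OF 1 2]) (use \<sigma>nn r in auto)
        finally show ?thesis using True by (simp add: ennreal_leI)
      qed simp
    qed
    finally have "ennreal (2 / 6561) \<le> ennreal (1 / 4000)" using G by (rule order.trans)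
    then show False by (simp add: ennreal_le_iff)
  qed
  have wcmp1: "w x \<le> 8 * w t" if "\<bar>x - t\<bar> < 15 * \<sigma> t" for x t
  proof (rule wcmp)
    have "\<bar>t\<bar> \<le> \<bar>x\<bar> + \<bar>x - t\<bar>" by linarith
    then have "\<bar>t\<bar> \<le> \<bar>x\<bar> + 15 * \<sigma> t" using that by simp
    moreover have "X + t' \<le> 2 * (X + x')" if "t' \<le> x' + 15 * \<sigma> t" "40 * \<sigma> t \<le> X + t'" "0 \<le> x'" for t' x'
      using that X by simp
    ultimately show "X + \<bar>t\<bar> \<le> 2 * (X + \<bar>x\<bar>)" using small[of t] by simp
  qed
  have wcmp2: "w t \<le> 8 * w x" if "\<bar>x - t\<bar> < 3 * \<sigma> t" for x t
  proof (rule wcmp)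
    have "\<bar>x\<bar> \<le> \<bar>t\<bar> + \<bar>x - t\<bar>" by linarith
    then have "\<bar>x\<bar> \<le> \<bar>t\<bar> + 3 * \<sigma> t" using that by simp
    moreover have "X + x' \<le> 2 * (X + t')" if "x' \<le> t' + 3 * \<sigma> t" "40 * \<sigma> t \<le> X + t'" "0 \<le> t'" for t' x'
      using that X by simp
    ultimately show "X + \<bar>x\<bar> \<le> 2 * (X + \<bar>t\<bar>)" using small[of t] by simp
  qed
  obtain T where T: "T > 0" "\<And>x. \<bar>x\<bar> > T \<Longrightarrow> \<sigma> x = 0" unfolding \<sigma>_def using lip_maj_support[OF u] by blast
  define Con where "Con = {t. \<sigma> t = u t \<and> \<sigma> t > 0}"
  have main: "G \<le> 3840 * (8 * Q + ennreal (64 / K) * G) + ennreal (2 * T * \<epsilon>)" if \<epsilon>: "\<epsilon> > 0" for \<epsilon>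
  proof -
    \<comment> \<open>Cutting at height \<epsilon> gives a compact set and so a finite cover; the
      neglected part has weighted mass at most \<open>2 * T * \<epsilon>\<close>.\<close>
    define S where "S = {x. \<sigma> x \<ge> \<epsilon>}"
    have "closed S" unfolding S_def using \<sigma>cont[of UNIV] by (intro closed_Collect_le) auto
    moreover have "S \<subseteq> {-T..T}"
    proof
      fix x assume "x \<in> S"
      then have "\<sigma> x \<noteq> 0" using \<epsilon> by (auto simp: S_def)
      then have "\<not> \<bar>x\<bar> > T" using T by blast
      then show "x \<in> {-T..T}" by auto
    qed
    ultimately have cS: "compact S" by (metis bounded_closed_interval bounded_subset compact_eq_bounded_closed)
    have "S \<subseteq> (\<Union>t\<in>Con. ball t (\<sigma> t))"
    proof
      fix x assume x: "x \<in> S"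
      obtain t where t: "\<sigma> t = u t" "\<sigma> x = \<sigma> t - \<bar>x - t\<bar>" unfolding \<sigma>_def using lip_maj_contact[OF u] by metis
      have "\<sigma> x > 0" using x \<epsilon> by (auto simp: S_def)
      then have "t \<in> Con" "x \<in> ball t (\<sigma> t)" using t by (auto simp: Con_def dist_real_def abs_minus_commute)
      then show "x \<in> (\<Union>t\<in>Con. ball t (\<sigma> t))" by blast
    qed
    then obtain D where D: "D \<subseteq> Con" "finite D" "S \<subseteq> (\<Union>t\<in>D. ball t (\<sigma> t))"
      using compactE_image[OF cS, of Con "\<lambda>t. ball t (\<sigma> t)"] by auto
    have rad: "0 < 3 * \<sigma> t \<and> 3 * \<sigma> t \<le> Max ((\<lambda>t. 3 * \<sigma> t) ` D)" if "t \<in> D" for t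
      using that D by (auto simp: Con_def)
    obtain C where C: "C \<subseteq> D" "pairwise (\<lambda>i j. disjnt (cball i (3 * \<sigma> i)) (cball j (3 * \<sigma> j))) C"
      and cov: "\<And>i. i \<in> D \<Longrightarrow> \<exists>j. j \<in> C \<and> \<not> disjnt (cball i (3 * \<sigma> i)) (cball j (3 * \<sigma> j)) \<and> cball i (3 * \<sigma> i) \<subseteq> ball j (5 * (3 * \<sigma> j))"
      by (rule Vitali_covering_lemma_cballs_balls[OF rad, where a = "\<lambda>t. t"]) (blast intro: that)+
    have finC: "finite C" using C(1) D(2) by (rule finite_subset)
    have con: "\<sigma> t = u t" "\<sigma> t > 0" if "t \<in> C" for t using that C D by (auto simp: Con_def)
    have disj: "t = t'" if "t \<in> C" "t' \<in> C" "\<bar>x - t\<bar> < 3 * \<sigma> t" "\<bar>x - t'\<bar> < 3 * \<sigma> t'" for t t' x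
    proof (rule ccontr)
      assume "t \<noteq> t'"
      then have "disjnt (cball t (3 * \<sigma> t)) (cball t' (3 * \<sigma> t'))" using C(2) that by (auto simp: pairwise_def)
      moreover have "x \<in> cball t (3 * \<sigma> t)" "x \<in> cball t' (3 * \<sigma> t')" using that by (auto simp: dist_real_def abs_minus_commute)
      ultimately show False by (auto simp: disjnt_def)
    qed
    have Scov: "\<exists>t\<in>C. \<bar>x - t\<bar> < 15 * \<sigma> t" if xS: "x \<in> S" for x
    proof -
      obtain i where i: "i \<in> D" "x \<in> ball i (\<sigma> i)" using xS D(3) by blast
      obtain j where j: "j \<in> C" "cball i (3 * \<sigma> i) \<subseteq> ball j (5 * (3 * \<sigma> j))" using cov[OF i(1)] by blast
      have "x \<in> cball i (3 * \<sigma> i)" using i \<sigma>nn[of i] by (auto simp: dist_real_def)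
      then show ?thesis using j by (auto simp: dist_real_def abs_minus_commute intro!: bexI[of _ j])
    qed
    \<comment> \<open>On the window of radius \<open>15 * \<sigma> t\<close> the majorant is at most
      \<open>16 * \<sigma> t\<close>, the weight at most \<open>8 * w t\<close>, and the length is
      \<open>30 * \<sigma> t\<close>; the product of 16, 8 and 30 is 3840. The radius 15 is five
      times the radius 3 of the disjoint windows.\<close>
    have G1: "G \<le> (\<Sum>t\<in>C. 3840 * ennreal ((\<sigma> t)\<^sup>2 * w t)) + ennreal (2 * T * \<epsilon>)"
    proof -
      have "G \<le> (\<integral>\<^sup>+x. (\<Sum>t\<in>C. ennreal (128 * \<sigma> t * w t) * indicator {t - 15 * \<sigma> t<..<t + 15 * \<sigma> t} x) + ennreal \<epsilon> * indicator {-T..T} x \<partial>lborel)"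
        unfolding G'
      proof (rule nn_integral_mono)
        fix x
        show "ennreal (\<sigma> x * w x) \<le> (\<Sum>t\<in>C. ennreal (128 * \<sigma> t * w t) * indicator {t - 15 * \<sigma> t<..<t + 15 * \<sigma> t} x) + ennreal \<epsilon> * indicator {-T..T} x"
        proof (cases "x \<in> S")
          case True
          then obtain t where t: "t \<in> C" "\<bar>x - t\<bar> < 15 * \<sigma> t" using Scov by blast
          have "\<sigma> x \<le> 16 * \<sigma> t" using lip[of x t] t(2) by linarith
          then have "\<sigma> x * w x \<le> (16 * \<sigma> t) * (8 * w t)" using wcmp1[OF t(2)] \<sigma>nn wpos[of x] wpos[of t] by (intro mult_mono) (auto simp: less_imp_le)
          then have "ennreal (\<sigma> x * w x) \<le> ennreal (128 * \<sigma> t * w t)" by (intro ennreal_leI) simp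
          also have "\<dots> = ennreal (128 * \<sigma> t * w t) * indicator {t - 15 * \<sigma> t<..<t + 15 * \<sigma> t} x"
            using t(2) by (auto simp: indicator_def abs_less_iff)
          also have "\<dots> \<le> (\<Sum>t\<in>C. ennreal (128 * \<sigma> t * w t) * indicator {t - 15 * \<sigma> t<..<t + 15 * \<sigma> t} x)"
            by (rule member_le_sum[OF t(1)]) (use finC in auto)
          finally show ?thesis by (rule order.trans) simp
        next
          case False
          show ?thesis
          proof (cases "\<bar>x\<bar> > T")
            case True then show ?thesis using T(2)[OF True] by simp
          next
            case inT: False
            then have "x \<in> {-T..T}" by auto
            moreover have "\<sigma> x * w x \<le> \<epsilon> * 1" using False w1[of x] \<sigma>nn wpos[of x] \<epsilon> by (intro mult_mono) (auto simp: S_def less_imp_le)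
            ultimately have "ennreal (\<sigma> x * w x) \<le> ennreal \<epsilon> * indicator {-T..T} x" by (simp add: ennreal_leI)
            then show ?thesis by (rule order.trans) simp
          qed
        qed
      qed
      also have "\<dots> = (\<Sum>t\<in>C. \<integral>\<^sup>+x. ennreal (128 * \<sigma> t * w t) * indicator {t - 15 * \<sigma> t<..<t + 15 * \<sigma> t} x \<partial>lborel) + (\<integral>\<^sup>+x. ennreal \<epsilon> * indicator {-T..T} x \<partial>lborel)"
        by (subst nn_integral_add) (auto simp: nn_integral_sum)
      also have "(\<integral>\<^sup>+x. ennreal \<epsilon> * indicator {-T..T} x \<partial>lborel) = ennreal (2 * T * \<epsilon>)"
        using T \<epsilon> by (simp add: nn_integral_cmult_indicator ennreal_mult[symmetric] mult_ac)
      also have "(\<Sum>t\<in>C. \<integral>\<^sup>+x. ennreal (128 * \<sigma> t * w t) * indicator {t - 15 * \<sigma> t<..<t + 15 * \<sigma> t} x \<partial>lborel) = (\<Sum>t\<in>C. 3840 * ennreal ((\<sigma> t)\<^sup>2 * w t))"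
      proof (rule sum.cong[OF refl])
        fix t assume "t \<in> C"
        have "(\<integral>\<^sup>+x. ennreal (128 * \<sigma> t * w t) * indicator {t - 15 * \<sigma> t<..<t + 15 * \<sigma> t} x \<partial>lborel) = ennreal (128 * \<sigma> t * w t) * ennreal (30 * \<sigma> t)"
          using \<sigma>nn[of t] by (simp add: nn_integral_cmult_indicator)
        also have "\<dots> = ennreal (3840 * ((\<sigma> t)\<^sup>2 * w t))" using \<sigma>nn[of t] wpos[of t] by (simp add: ennreal_mult[symmetric] power2_eq_square mult_ac)
        also have "\<dots> = 3840 * ennreal ((\<sigma> t)\<^sup>2 * w t)" using wpos[of t] by (simp add: ennreal_mult less_imp_le)
        finally show "(\<integral>\<^sup>+x. ennreal (128 * \<sigma> t * w t) * indicator {t - 15 * \<sigma> t<..<t + 15 * \<sigma> t} x \<partial>lborel) = 3840 * ennreal ((\<sigma> t)\<^sup>2 * w t)" .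
      qed
      finally show ?thesis .
    qed
    define CE where "CE = {t\<in>C. ennreal ((\<sigma> t)\<^sup>2) \<le> (\<integral>\<^sup>+x. ennreal (q x) * indicator {x. \<bar>x - t\<bar> < 3 * \<sigma> t} x \<partial>lborel)}"
    define CT where "CT = C - CE"
    have fE: "finite CE" "CE \<subseteq> C" and fT: "finite CT" "CT \<subseteq> C" and un: "C = CE \<union> CT" "CE \<inter> CT = {}"
      using finC by (auto simp: CE_def CT_def)
    \<comment> \<open>Contact points of the first kind: their windows are disjoint, so the masses of
      \<open>q\<close> in them add up to at most one integral.\<close>
    have sE: "(\<Sum>t\<in>CE. ennreal ((\<sigma> t)\<^sup>2 * w t)) \<le> 8 * Q"
    proof -
      have "ennreal ((\<sigma> t)\<^sup>2 * w t) \<le> (\<integral>\<^sup>+x. 8 * ennreal (q x * w x) * indicator {x. \<bar>x - t\<bar> < 3 * \<sigma> t} x \<partial>lborel)" if "t \<in> CE" for t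
      proof -
        have "ennreal ((\<sigma> t)\<^sup>2 * w t) = ennreal (w t) * ennreal ((\<sigma> t)\<^sup>2)" using wpos[of t] by (simp add: ennreal_mult less_imp_le mult.commute)
        also have "\<dots> \<le> ennreal (w t) * (\<integral>\<^sup>+x. ennreal (q x) * indicator {x. \<bar>x - t\<bar> < 3 * \<sigma> t} x \<partial>lborel)"
          using that by (intro mult_left_mono) (auto simp: CE_def)
        also have "\<dots> = (\<integral>\<^sup>+x. ennreal (w t) * (ennreal (q x) * indicator {x. \<bar>x - t\<bar> < 3 * \<sigma> t} x) \<partial>lborel)"
          by (rule nn_integral_cmult[symmetric]) measurable
        also have "\<dots> \<le> (\<integral>\<^sup>+x. 8 * ennreal (q x * w x) * indicator {x. \<bar>x - t\<bar> < 3 * \<sigma> t} x \<partial>lborel)"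
        proof (rule nn_integral_mono)
          fix x
          show "ennreal (w t) * (ennreal (q x) * indicator {x. \<bar>x - t\<bar> < 3 * \<sigma> t} x) \<le> 8 * ennreal (q x * w x) * indicator {x. \<bar>x - t\<bar> < 3 * \<sigma> t} x"
          proof (cases "\<bar>x - t\<bar> < 3 * \<sigma> t")
            case True
            have "w t * q x \<le> 8 * w x * q x" using wcmp2[OF True] q(2) by (intro mult_right_mono) auto
            then have "ennreal (w t * q x) \<le> ennreal (8 * (q x * w x))" by (intro ennreal_leI) (simp add: mult_ac)
            then show ?thesis using True wpos q(2) by (simp add: ennreal_mult less_imp_le)
          qed simp
        qed
        finally show ?thesis .
      qed
      then have "(\<Sum>t\<in>CE. ennreal ((\<sigma> t)\<^sup>2 * w t)) \<le> (\<Sum>t\<in>CE. \<integral>\<^sup>+x. 8 * ennreal (q x * w x) * indicator {x. \<bar>x - t\<bar> < 3 * \<sigma> t} x \<partial>lborel)"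
        by (rule sum_mono)
      also have "\<dots> = (\<integral>\<^sup>+x. (\<Sum>t\<in>CE. 8 * ennreal (q x * w x) * indicator {x. \<bar>x - t\<bar> < 3 * \<sigma> t} x) \<partial>lborel)"
        by (rule nn_integral_sum[symmetric]) measurable
      also have "\<dots> \<le> (\<integral>\<^sup>+x. 8 * ennreal (q x * w x) \<partial>lborel)"
        by (intro nn_integral_mono disjoint_sum_indicator_le fE) (use disj fE in auto)
      also have "\<dots> = 8 * Q" unfolding Q_def by (rule nn_integral_cmult) measurable
      finally show ?thesis .
    qed
    \<comment> \<open>The part of the tail that matters. Points with
      \<open>\<sigma> y \<le> K * \<sigma> t\<close> contribute at most \<open>2 * K\<close> to the
      tail integral, and points farther than \<open>X + \<bar>t\<bar>\<close> at most
      \<open>5 * G\<close>, hence at most 1. Since the tail exceeds \<open>2 * K + 2\<close>, more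
      than 1 is left for \<open>R t\<close>, where the majorant is much higher than at
      \<open>t\<close>.\<close>
    define R where "R t = {y. \<bar>y - t\<bar> > \<sigma> t \<and> \<sigma> y > K * \<sigma> t \<and> \<bar>y - t\<bar> \<le> X + \<bar>t\<bar>}" for t
    have Rm[measurable]: "R t \<in> sets borel" for t unfolding R_def by measurable
    have sT: "(\<Sum>t\<in>CT. ennreal ((\<sigma> t)\<^sup>2 * w t)) \<le> ennreal (64 / K) * G"
    proof -
      have one: "1 \<le> (\<integral>\<^sup>+y. ennreal (\<sigma> y / (y - t)\<^sup>2) * indicator (R t) y \<partial>lborel)" if t: "t \<in> CT" for t
      proof -
        have tC: "t \<in> C" using t by (auto simp: CT_def)
        have st: "\<sigma> t > 0" by (rule con[OF tC])
        let ?I = "\<integral>\<^sup>+y. ennreal (\<sigma> y / (y - t)\<^sup>2) * indicator (R t) y \<partial>lborel"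
        have "ennreal (2 * K + 2) < (\<integral>\<^sup>+y. ennreal (\<sigma> y / (y - t)\<^sup>2) * indicator {y. \<bar>y - t\<bar> > \<sigma> t} y \<partial>lborel)"
          using contact[OF con[OF tC]] t tC by (auto simp: CT_def CE_def K_def)
        also have "\<dots> \<le> (\<integral>\<^sup>+y. ennreal (K * \<sigma> t) * (ennreal (1 / (y - t)\<^sup>2) * indicator {y. \<bar>y - t\<bar> \<ge> \<sigma> t} y) + (5 * ennreal (\<sigma> y * w y) + ennreal (\<sigma> y / (y - t)\<^sup>2) * indicator (R t) y) \<partial>lborel)"
        proof (rule nn_integral_mono)
          fix y
          show "ennreal (\<sigma> y / (y - t)\<^sup>2) * indicator {y. \<bar>y - t\<bar> > \<sigma> t} y \<le> ennreal (K * \<sigma> t) * (ennreal (1 / (y - t)\<^sup>2) * indicator {y. \<bar>y - t\<bar> \<ge> \<sigma> t} y) + (5 * ennreal (\<sigma> y * w y) + ennreal (\<sigma> y / (y - t)\<^sup>2) * indicator (R t) y)"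
          proof (cases "\<bar>y - t\<bar> > \<sigma> t")
            case out: True
            have yt: "(y - t)\<^sup>2 > 0" using out st by auto
            consider "\<sigma> y \<le> K * \<sigma> t" | "\<sigma> y > K * \<sigma> t" "\<bar>y - t\<bar> > X + \<bar>t\<bar>" | "y \<in> R t" using out by (force simp: R_def)
            then show ?thesis
            proof cases
              case 1
              have "\<sigma> y / (y - t)\<^sup>2 \<le> K * \<sigma> t * (1 / (y - t)\<^sup>2)" using divide_right_mono[OF 1, of "(y - t)\<^sup>2"] by simp
              then have "ennreal (\<sigma> y / (y - t)\<^sup>2) \<le> ennreal (K * \<sigma> t) * ennreal (1 / (y - t)\<^sup>2)"
                using st by (subst ennreal_mult[symmetric]) (auto simp: K_def intro!: ennreal_leI)
              then have "ennreal (\<sigma> y / (y - t)\<^sup>2) * indicator {y. \<bar>y - t\<bar> > \<sigma> t} y \<le> ennreal (K * \<sigma> t) * (ennreal (1 / (y - t)\<^sup>2) * indicator {y. \<bar>y - t\<bar> \<ge> \<sigma> t} y)" using out by simp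
              then show ?thesis by (rule order.trans) simp
            next
              case 2
              have "X\<^sup>2 + y\<^sup>2 \<le> 5 * (y - t)\<^sup>2"
              proof -
                have "X\<^sup>2 \<le> (\<bar>y - t\<bar>)\<^sup>2" using 2 X by (intro power_mono) auto
                moreover have "\<bar>y\<bar> \<le> \<bar>t\<bar> + \<bar>y - t\<bar>" by linarith
                then have "\<bar>y\<bar> \<le> 2 * \<bar>y - t\<bar>" using 2 X by argo
                then have "\<bar>y\<bar>\<^sup>2 \<le> (2 * \<bar>y - t\<bar>)\<^sup>2" by (rule power_mono) simp
                ultimately show ?thesis by (simp add: power_mult_distrib)
              qed
              then have "1 / (y - t)\<^sup>2 \<le> 5 * w y" unfolding w_def using yt den[of y] by (simp add: field_simps)
              then have "\<sigma> y * (1 / (y - t)\<^sup>2) \<le> \<sigma> y * (5 * w y)" using \<sigma>nn by (intro mult_left_mono) auto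
              then have "ennreal (\<sigma> y / (y - t)\<^sup>2) \<le> ennreal (5 * (\<sigma> y * w y))" by (intro ennreal_leI) (simp add: mult_ac)
              also have "\<dots> = 5 * ennreal (\<sigma> y * w y)" using \<sigma>nn wpos[of y] by (subst ennreal_mult) (auto simp: less_imp_le)
              finally have "ennreal (\<sigma> y / (y - t)\<^sup>2) \<le> 5 * ennreal (\<sigma> y * w y)" .
              then have "ennreal (\<sigma> y / (y - t)\<^sup>2) * indicator {y. \<bar>y - t\<bar> > \<sigma> t} y \<le> 5 * ennreal (\<sigma> y * w y)" using out by simp
              then show ?thesis by (rule order.trans) (simp add: add_increasing)
            next
              case 3
              then have "ennreal (\<sigma> y / (y - t)\<^sup>2) * indicator {y. \<bar>y - t\<bar> > \<sigma> t} y \<le> ennreal (\<sigma> y / (y - t)\<^sup>2) * indicator (R t) y" using out by simp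
              then show ?thesis by (rule order.trans) (simp add: add_increasing)
            qed
          qed simp
        qed
        also have "\<dots> = ennreal (K * \<sigma> t) * (\<integral>\<^sup>+y. ennreal (1 / (y - t)\<^sup>2) * indicator {y. \<bar>y - t\<bar> \<ge> \<sigma> t} y \<partial>lborel) + (5 * G + ?I)"
          unfolding G' by (simp add: nn_integral_add nn_integral_cmult)
        also have "\<dots> \<le> ennreal (K * \<sigma> t) * ennreal (2 / \<sigma> t) + (5 * ennreal (1 / 4000) + ?I)"
          by (intro add_mono mult_left_mono nn_integral_inverse_square_tail G order.refl st) auto
        also have "ennreal (K * \<sigma> t) * ennreal (2 / \<sigma> t) = ennreal (2 * K)"
          using st by (simp add: ennreal_mult[symmetric] K_def)
        also have "5 * ennreal (1 / 4000) \<le> ennreal 1" by (simp flip: ennreal_numeral ennreal_mult add: ennreal_le_iff del: ennreal_1 ennreal_le_1)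
        finally have *: "ennreal (2 * K + 2) < ennreal (2 * K) + (ennreal 1 + ?I)" by (simp add: add_left_mono add_right_mono)
        show ?thesis
        proof (rule ccontr)
          assume "\<not> 1 \<le> ?I"
          then have "?I \<le> ennreal 1" by simp
          then have "ennreal (2 * K) + (ennreal 1 + ?I) \<le> ennreal (2 * K) + (ennreal 1 + ennreal 1)" by (intro add_left_mono)
          also have "\<dots> = ennreal (2 * K + 2)" by (simp add: K_def flip: ennreal_plus del: ennreal_1)
          finally show False using * by simp
        qed
      qed
      have "ennreal ((\<sigma> t)\<^sup>2 * w t) \<le> (\<integral>\<^sup>+y. 8 * ennreal (\<sigma> y * w y) * (ennreal ((\<sigma> t)\<^sup>2 / (y - t)\<^sup>2) * indicator (R t) y) \<partial>lborel)" if t: "t \<in> CT" for t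
      proof -
        have "ennreal ((\<sigma> t)\<^sup>2 * w t) * 1 \<le> ennreal ((\<sigma> t)\<^sup>2 * w t) * (\<integral>\<^sup>+y. ennreal (\<sigma> y / (y - t)\<^sup>2) * indicator (R t) y \<partial>lborel)"
          by (rule mult_left_mono[OF one[OF t]]) simp
        also have "\<dots> = (\<integral>\<^sup>+y. ennreal ((\<sigma> t)\<^sup>2 * w t) * (ennreal (\<sigma> y / (y - t)\<^sup>2) * indicator (R t) y) \<partial>lborel)"
          by (rule nn_integral_cmult[symmetric]) measurable
        also have "\<dots> \<le> (\<integral>\<^sup>+y. 8 * ennreal (\<sigma> y * w y) * (ennreal ((\<sigma> t)\<^sup>2 / (y - t)\<^sup>2) * indicator (R t) y) \<partial>lborel)"
        proof (rule nn_integral_mono)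
          fix y
          show "ennreal ((\<sigma> t)\<^sup>2 * w t) * (ennreal (\<sigma> y / (y - t)\<^sup>2) * indicator (R t) y) \<le> 8 * ennreal (\<sigma> y * w y) * (ennreal ((\<sigma> t)\<^sup>2 / (y - t)\<^sup>2) * indicator (R t) y)"
          proof (cases "y \<in> R t")
            case True
            have "w t \<le> 8 * w y" by (rule wcmp) (use True X in \<open>auto simp: R_def\<close>)
            then have "(\<sigma> y * ((\<sigma> t)\<^sup>2 / (y - t)\<^sup>2)) * w t \<le> (\<sigma> y * ((\<sigma> t)\<^sup>2 / (y - t)\<^sup>2)) * (8 * w y)" using \<sigma>nn by (intro mult_left_mono) auto
            then have "ennreal (((\<sigma> t)\<^sup>2 * w t) * (\<sigma> y / (y - t)\<^sup>2)) \<le> ennreal ((8 * (\<sigma> y * w y)) * ((\<sigma> t)\<^sup>2 / (y - t)\<^sup>2))" by (intro ennreal_leI) (simp add: mult_ac)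
            then have "ennreal ((\<sigma> t)\<^sup>2 * w t) * ennreal (\<sigma> y / (y - t)\<^sup>2) \<le> ennreal (8 * (\<sigma> y * w y)) * ennreal ((\<sigma> t)\<^sup>2 / (y - t)\<^sup>2)"
              using \<sigma>nn wpos by (subst (1 2) ennreal_mult[symmetric]) (auto simp: less_imp_le)
            moreover have "ennreal (8 * (\<sigma> y * w y)) = 8 * ennreal (\<sigma> y * w y)" using \<sigma>nn wpos[of y] by (subst ennreal_mult) (auto simp: less_imp_le)
            ultimately show ?thesis using True by simp
          qed simp
        qed
        finally show ?thesis by simp
      qed
      then have "(\<Sum>t\<in>CT. ennreal ((\<sigma> t)\<^sup>2 * w t)) \<le> (\<Sum>t\<in>CT. \<integral>\<^sup>+y. 8 * ennreal (\<sigma> y * w y) * (ennreal ((\<sigma> t)\<^sup>2 / (y - t)\<^sup>2) * indicator (R t) y) \<partial>lborel)"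
        by (rule sum_mono)
      also have "\<dots> = (\<integral>\<^sup>+y. (\<Sum>t\<in>CT. 8 * ennreal (\<sigma> y * w y) * (ennreal ((\<sigma> t)\<^sup>2 / (y - t)\<^sup>2) * indicator (R t) y)) \<partial>lborel)"
        by (rule nn_integral_sum[symmetric]) measurable
      \<comment> \<open>Double counting: after the exchange of sum and integral, a fixed
        \<open>y\<close> is charged by all lower contact points \<open>t\<close> with
        \<open>y\<close> in \<open>R t\<close>. The total charge is at most \<open>8 / K\<close>
        because their intervals are disjoint, and another 8 is the comparison of weights.\<close>
      also have "\<dots> \<le> (\<integral>\<^sup>+y. ennreal (64 / K) * ennreal (\<sigma> y * w y) \<partial>lborel)"
      proof (rule nn_integral_mono)
        fix y
        define C' where "C' = {t\<in>CT. y \<in> R t}"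
        have fC': "finite C'" using fT by (simp add: C'_def)
        have "(\<Sum>t\<in>CT. ennreal ((\<sigma> t)\<^sup>2 / (y - t)\<^sup>2) * indicator (R t) y) = (\<Sum>t\<in>C'. ennreal ((\<sigma> t)\<^sup>2 / (y - t)\<^sup>2))"
          unfolding C'_def sum.inter_filter[OF fT(1)] by (intro sum.cong) (auto simp: indicator_def)
        also have "\<dots> = ennreal (\<Sum>t\<in>C'. (\<sigma> t)\<^sup>2 / (y - t)\<^sup>2)" by (rule sum_ennreal) auto
        also have "\<dots> \<le> ennreal (8 / K)"
        proof (cases "C' = {}")
          case False
          then obtain t0 where "t0 \<in> C'" by blast
          then have Y: "\<sigma> y > 0" using con[of t0] by (auto simp: C'_def CT_def R_def K_def intro: less_trans[rotated])
          show ?thesis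
          proof (rule ennreal_leI, rule disjoint_balls_inverse_square_sum[OF fC' _ _ _ Y])
            show "\<sigma> t > 0" if "t \<in> C'" for t using that con by (auto simp: C'_def CT_def)
            show "t = t'" if "t \<in> C'" "t' \<in> C'" "\<bar>x - t\<bar> < \<sigma> t" "\<bar>x - t'\<bar> < \<sigma> t'" for t t' x
              by (rule disj[of t t' x]) (use that \<sigma>nn[of t] \<sigma>nn[of t'] in \<open>auto simp: C'_def CT_def\<close>)
            show "K * \<sigma> t < \<sigma> y" if "t \<in> C'" for t using that by (auto simp: C'_def R_def)
            show "\<sigma> y - \<sigma> t \<le> \<bar>y - t\<bar>" if "t \<in> C'" for t using lip[of y t] by linarith
          qed (simp add: K_def)
        qed (simp add: K_def)
        finally have "8 * ennreal (\<sigma> y * w y) * (\<Sum>t\<in>CT. ennreal ((\<sigma> t)\<^sup>2 / (y - t)\<^sup>2) * indicator (R t) y) \<le> 8 * ennreal (\<sigma> y * w y) * ennreal (8 / K)"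
          by (rule mult_left_mono) simp
        also have "\<dots> = ennreal (64 / K) * ennreal (\<sigma> y * w y)"
        proof -
          have "ennreal (64 / K) = 8 * ennreal (8 / K)" by (simp add: K_def flip: ennreal_numeral ennreal_mult)
          then show ?thesis by (simp add: mult_ac)
        qed
        finally show "(\<Sum>t\<in>CT. 8 * ennreal (\<sigma> y * w y) * (ennreal ((\<sigma> t)\<^sup>2 / (y - t)\<^sup>2) * indicator (R t) y)) \<le> ennreal (64 / K) * ennreal (\<sigma> y * w y)"
          by (simp only: sum_distrib_left)
      qed
      also have "\<dots> = ennreal (64 / K) * G" unfolding G' by (rule nn_integral_cmult) measurable
      finally show ?thesis .
    qed
    have "(\<Sum>t\<in>C. 3840 * ennreal ((\<sigma> t)\<^sup>2 * w t)) = 3840 * ((\<Sum>t\<in>CE. ennreal ((\<sigma> t)\<^sup>2 * w t)) + (\<Sum>t\<in>CT. ennreal ((\<sigma> t)\<^sup>2 * w t)))"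
      unfolding sum_distrib_left[symmetric] using un fE fT by (simp add: sum.union_disjoint)
    also have "\<dots> \<le> 3840 * (8 * Q + ennreal (64 / K) * G)" by (intro mult_left_mono add_mono sE sT) simp
    finally show ?thesis using G1 by (meson add_right_mono order.trans)
  qed
  show ?thesis
  proof (cases "Q = top")
    case True then show ?thesis by (simp add: Q_def w_def ennreal_mult_top)
  next
    case False
    then obtain Qr where Qr: "Q = ennreal Qr" "Qr \<ge> 0" by (metis enn2real_nonneg ennreal_enn2real_if)
    obtain g where g: "G = ennreal g" "g \<ge> 0" using Gfin by (metis enn2real_nonneg ennreal_enn2real_if less_irrefl)
    \<comment> \<open>The term \<open>g / 4\<close> can be absorbed only because \<open>G\<close> is
      finite, which is why the reals are used here.\<close>
    have le: "g \<le> 30720 * Qr + g / 4 + 2 * T * \<epsilon>" if "\<epsilon> > 0" for \<epsilon>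
    proof -
      have "ennreal g \<le> ennreal (3840 * (8 * Qr + 64 / K * g) + 2 * T * \<epsilon>)"
        using main[OF that] T that Qr(2) g(2) unfolding g(1) Qr(1)
        by (simp add: K_def ennreal_mult flip: ennreal_plus ennreal_numeral ennreal_mult)
      then have "g \<le> 3840 * (8 * Qr + 64 / K * g) + 2 * T * \<epsilon>" using T that Qr(2) g(2) by (subst (asm) ennreal_le_iff) (auto simp: K_def)
      then show ?thesis by (simp add: K_def)
    qed
    have "g \<le> 30720 * Qr + g / 4"
    proof (rule field_le_epsilon)
      fix e :: real assume "e > 0"
      then show "g \<le> 30720 * Qr + g / 4 + e" using le[of "e / (2 * T)"] T by simp
    qed
    then have "g \<le> 61440 * Qr" using Qr(2) by linarith
    then have "ennreal g \<le> ennreal (61440 * Qr)" by (rule ennreal_leI)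
    also have "\<dots> = 61440 * ennreal Qr" using Qr(2) by (simp add: ennreal_mult)
    finally show ?thesis unfolding g(1) using Qr(1) by (simp add: Q_def w_def)
  qed
qed

section \<open>Growth near contact points and the uniform bound\<close>

lemma tail_weight_small:
  fixes q :: "real \<Rightarrow> real"
  assumes q: "q \<in> borel_measurable borel" "\<And>x. q x \<ge> 0"
    and fin: "(\<integral>\<^sup>+x. ennreal (q x / (1 + x\<^sup>2)) \<partial>lborel) < top" and \<epsilon>: "\<epsilon> > 0"
  obtains X where "X \<ge> 1" "(\<integral>\<^sup>+x. ennreal (q x / (X\<^sup>2 + x\<^sup>2)) \<partial>lborel) < ennreal \<epsilon>"
proof -
  note q(1)[measurable]
  let ?f = "\<lambda>n::nat. \<lambda>x. ennreal (q x / ((real n + 1)\<^sup>2 + x\<^sup>2))"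
  have "(\<lambda>n. \<integral>\<^sup>+x. ?f n x \<partial>lborel) \<longlonglongrightarrow> (\<integral>\<^sup>+x. 0 \<partial>(lborel :: real measure))"
  proof (rule nn_integral_dominated_convergence[where w = "\<lambda>x. ennreal (q x / (1 + x\<^sup>2))"])
    show "AE x in lborel. ?f n x \<le> ennreal (q x / (1 + x\<^sup>2))" for n
    proof (rule AE_I2, rule ennreal_leI)
      fix x
      have "1 \<le> (real n + 1)\<^sup>2" by (simp add: one_le_power)
      then show "q x / ((real n + 1)\<^sup>2 + x\<^sup>2) \<le> q x / (1 + x\<^sup>2)"
        using q(2)[of x] by (intro divide_left_mono mult_pos_pos) (auto intro!: add_pos_nonneg)
    qed
    show "AE x in lborel. (\<lambda>n. ?f n x) \<longlonglongrightarrow> 0"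
    proof (rule AE_I2)
      fix x
      have "(\<lambda>n. q x / ((real n + 1)\<^sup>2 + x\<^sup>2)) \<longlonglongrightarrow> 0"
      proof (rule tendsto_divide_0[OF tendsto_const])
        have "filterlim (\<lambda>n. real n + 1) at_top sequentially"
          using filterlim_tendsto_add_at_top[OF tendsto_const[of 1] filterlim_real_sequentially] by (simp add: add.commute)
        then have "filterlim (\<lambda>n. (real n + 1)\<^sup>2) at_top sequentially" by (rule filterlim_pow_at_top[rotated]) simp
        then have "filterlim (\<lambda>n. (real n + 1)\<^sup>2 + x\<^sup>2) at_top sequentially"
          by (rule filterlim_at_top_mono) (auto intro!: always_eventually)
        then show "filterlim (\<lambda>n. (real n + 1)\<^sup>2 + x\<^sup>2) at_infinity sequentially" by (rule filterlim_at_top_imp_at_infinity)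
      qed
      then have "(\<lambda>n. ?f n x) \<longlonglongrightarrow> ennreal 0" by (rule tendsto_ennrealI)
      then show "(\<lambda>n. ?f n x) \<longlonglongrightarrow> 0" by simp
    qed
  qed (use fin in auto)
  then have "(\<lambda>n. \<integral>\<^sup>+x. ?f n x \<partial>lborel) \<longlonglongrightarrow> 0" by simp
  then have "eventually (\<lambda>n. (\<integral>\<^sup>+x. ?f n x \<partial>lborel) < ennreal \<epsilon>) sequentially"
    by (rule order_tendstoD(2)) (use \<epsilon> in simp)
  then obtain n where "(\<integral>\<^sup>+x. ?f n x \<partial>lborel) < ennreal \<epsilon>" by (auto simp: eventually_sequentially)
  then show thesis using that[of "real n + 1"] by simp
qed

text \<open>The Poisson integral at \<open>z\<close> is split at distance \<open>2 * s\<close> from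
  \<open>t\<close>. Inside, the majorant is at most \<open>3 * s\<close> and the kernel has mass at
  most \<pi>; outside, the kernel is at most \<open>4 * s / (u - t)\<^sup>2\<close>, which brings in
  the tail integral. On the real axis the Lipschitz condition suffices.\<close>

lemma poisson_contact_bound:
  fixes h :: "complex \<Rightarrow> complex" and \<sigma> :: "real \<Rightarrow> real"
  assumes holo: "h holomorphic_on UNIV" and b: "b \<ge> 0"
    and dec: "\<And>z. norm (h z) \<le> C * exp (b * \<bar>Im z\<bar>) / (1 + norm z)"
    and nn: "\<And>x. \<sigma> x \<ge> 0" and lip: "\<And>x y. \<bar>\<sigma> x - \<sigma> y\<bar> \<le> \<bar>x - y\<bar>" and \<Theta>: "\<Theta> > 0"
    and supp: "\<And>x. \<bar>x\<bar> > T \<Longrightarrow> \<sigma> x = 0" and T: "T > 0"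
    and maj: "\<And>x::real. norm (h (of_real x)) \<le> exp (\<Theta> * \<sigma> x)"
    and s: "\<sigma> t = s" "s > 0" and B: "B \<ge> 0"
    and tail: "(\<integral>\<^sup>+y. ennreal (\<sigma> y / (y - t)\<^sup>2) * indicator {y. \<bar>y - t\<bar> > s} y \<partial>lborel) \<le> ennreal B"
    and z: "norm (z - of_real t) \<le> s"
  shows "norm (h z) \<le> exp (b * \<bar>Im z\<bar> + \<Theta> * (3 + 2 * B) * s)"
proof (cases "Im z = 0")
  case True
  then have zr: "z = of_real (Re z)" by (simp add: complex_eq_iff)
  have "\<bar>Re z - t\<bar> \<le> s" using z abs_Re_le_cmod[of "z - of_real t"] by simp
  then have "\<sigma> (Re z) \<le> 2 * s" using lip[of "Re z" t] s by linarith
  also have "\<dots> \<le> (3 + 2 * B) * s" using s B by (intro mult_right_mono) auto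
  finally have "\<Theta> * \<sigma> (Re z) \<le> \<Theta> * (3 + 2 * B) * s" using \<Theta> by simp
  then have "exp (\<Theta> * \<sigma> (Re z)) \<le> exp (b * \<bar>Im z\<bar> + \<Theta> * (3 + 2 * B) * s)" using True by simp
  then show ?thesis using maj[of "Re z"] zr by (metis order.trans)
next
  case False
  define x where "x = Re z"
  define y where "y = \<bar>Im z\<bar>"
  have y: "0 < y" "y \<le> s" "y\<^sup>2 = (Im z)\<^sup>2" using False z abs_Im_le_cmod[of "z - of_real t"] by (auto simp: y_def)
  have xt: "\<bar>x - t\<bar> \<le> s" using z abs_Re_le_cmod[of "z - of_real t"] by (simp add: x_def)
  have [measurable]: "\<sigma> \<in> borel_measurable borel"
    using lip by (intro borel_measurable_continuous_onI lipschitz_on_continuous_on[of 1] lipschitz_onI) (auto simp: dist_real_def)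
  define r where "r = pi * (\<Theta> * (3 + 2 * B) * s)"
  have "norm (h z) \<le> exp (b * \<bar>Im z\<bar> + r / pi)"
  proof (rule poisson_bound[OF holo b dec, where \<phi> = "\<lambda>x. \<Theta> * \<sigma> x" and L = \<Theta> and T = T])
    show "\<bar>\<Theta> * \<sigma> x - \<Theta> * \<sigma> y\<bar> \<le> \<Theta> * \<bar>x - y\<bar>" for x y
    proof -
      have "\<bar>\<Theta> * \<sigma> x - \<Theta> * \<sigma> y\<bar> = \<Theta> * \<bar>\<sigma> x - \<sigma> y\<bar>" using \<Theta> by (simp add: right_diff_distrib[symmetric] abs_mult)
      then show ?thesis using lip[of x y] \<Theta> by simp
    qed
    show "(\<integral>\<^sup>+u. ennreal (\<Theta> * \<sigma> u * \<bar>Im z\<bar> / ((Re z - u)\<^sup>2 + (Im z)\<^sup>2)) \<partial>lborel) \<le> ennreal r"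
    proof -
      let ?k = "\<lambda>u. y / ((x - u)\<^sup>2 + y\<^sup>2)"
      let ?W = "{x - 3 * s..x + 3 * s}"
      have den: "(x - u)\<^sup>2 + y\<^sup>2 > 0" for u using y(1) by (simp add: add_nonneg_pos)
      have "(\<integral>\<^sup>+u. ennreal (\<Theta> * \<sigma> u * \<bar>Im z\<bar> / ((Re z - u)\<^sup>2 + (Im z)\<^sup>2)) \<partial>lborel)
        \<le> (\<integral>\<^sup>+u. ennreal (3 * s * \<Theta>) * (ennreal (?k u) * indicator ?W u) + ennreal (4 * s * \<Theta>) * (ennreal (\<sigma> u / (u - t)\<^sup>2) * indicator {u. \<bar>u - t\<bar> > s} u) \<partial>lborel)"
      proof (rule nn_integral_mono)
        fix u
        have eq: "\<Theta> * \<sigma> u * \<bar>Im z\<bar> / ((Re z - u)\<^sup>2 + (Im z)\<^sup>2) = \<Theta> * \<sigma> u * ?k u" by (simp add: x_def y_def)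
        show "ennreal (\<Theta> * \<sigma> u * \<bar>Im z\<bar> / ((Re z - u)\<^sup>2 + (Im z)\<^sup>2)) \<le> ennreal (3 * s * \<Theta>) * (ennreal (?k u) * indicator ?W u) + ennreal (4 * s * \<Theta>) * (ennreal (\<sigma> u / (u - t)\<^sup>2) * indicator {u. \<bar>u - t\<bar> > s} u)"
          unfolding eq
        proof (cases "\<bar>u - t\<bar> \<le> 2 * s")
          case True
          have "\<sigma> u \<le> 3 * s" using lip[of u t] s True by linarith
          then have "\<Theta> * \<sigma> u * ?k u \<le> (3 * s * \<Theta>) * ?k u" using \<Theta> den[of u] y by (intro mult_right_mono) auto
          then have "ennreal (\<Theta> * \<sigma> u * ?k u) \<le> ennreal ((3 * s * \<Theta>) * ?k u)" by (rule ennreal_leI)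
          also have "\<dots> = ennreal (3 * s * \<Theta>) * ennreal (?k u)" using \<Theta> s y by (subst ennreal_mult) auto
          also have "\<dots> = ennreal (3 * s * \<Theta>) * (ennreal (?k u) * indicator ?W u)"
          proof -
            have "\<bar>u - x\<bar> \<le> \<bar>u - t\<bar> + \<bar>x - t\<bar>" by linarith
            then have "\<bar>u - x\<bar> \<le> 3 * s" using True xt by argo
            then have "u \<in> ?W" by (auto simp: abs_le_iff)
            then show ?thesis by simp
          qed
          finally show "ennreal (\<Theta> * \<sigma> u * ?k u) \<le> ennreal (3 * s * \<Theta>) * (ennreal (?k u) * indicator ?W u) + ennreal (4 * s * \<Theta>) * (ennreal (\<sigma> u / (u - t)\<^sup>2) * indicator {u. \<bar>u - t\<bar> > s} u)"
            by (rule order.trans) simp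
        next
          case False
          have "\<bar>u - t\<bar> \<le> \<bar>x - u\<bar> + \<bar>x - t\<bar>" by linarith
          then have "\<bar>u - t\<bar> \<le> 2 * \<bar>x - u\<bar>" using False xt by argo
          then have "\<bar>u - t\<bar>\<^sup>2 \<le> (2 * \<bar>x - u\<bar>)\<^sup>2" by (rule power_mono) simp
          then have 1: "(u - t)\<^sup>2 \<le> 4 * ((x - u)\<^sup>2 + y\<^sup>2)" by (simp add: power_mult_distrib add_increasing2)
          have ut: "(u - t)\<^sup>2 > 0" using False s by auto
          have "?k u \<le> s / ((x - u)\<^sup>2 + y\<^sup>2)" using y den[of u] by (intro divide_right_mono) auto
          also have "\<dots> \<le> s / ((u - t)\<^sup>2 / 4)" using 1 ut den[of u] s by (intro divide_left_mono) auto
          also have "\<dots> = 4 * s / (u - t)\<^sup>2" by simp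
          finally have "\<Theta> * \<sigma> u * ?k u \<le> \<Theta> * \<sigma> u * (4 * s / (u - t)\<^sup>2)" using \<Theta> nn by (intro mult_left_mono) auto
          then have "ennreal (\<Theta> * \<sigma> u * ?k u) \<le> ennreal ((4 * s * \<Theta>) * (\<sigma> u / (u - t)\<^sup>2))" by (intro ennreal_leI) (simp add: mult_ac)
          also have "\<dots> = ennreal (4 * s * \<Theta>) * ennreal (\<sigma> u / (u - t)\<^sup>2)" using \<Theta> s nn by (subst ennreal_mult) auto
          also have "\<dots> = ennreal (4 * s * \<Theta>) * (ennreal (\<sigma> u / (u - t)\<^sup>2) * indicator {u. \<bar>u - t\<bar> > s} u)"
            using False s by simp
          finally show "ennreal (\<Theta> * \<sigma> u * ?k u) \<le> ennreal (3 * s * \<Theta>) * (ennreal (?k u) * indicator ?W u) + ennreal (4 * s * \<Theta>) * (ennreal (\<sigma> u / (u - t)\<^sup>2) * indicator {u. \<bar>u - t\<bar> > s} u)"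
            by (rule order.trans) simp
        qed
      qed
      also have "\<dots> = ennreal (3 * s * \<Theta>) * (\<integral>\<^sup>+u. ennreal (?k u) * indicator ?W u \<partial>lborel) + ennreal (4 * s * \<Theta>) * (\<integral>\<^sup>+u. ennreal (\<sigma> u / (u - t)\<^sup>2) * indicator {u. \<bar>u - t\<bar> > s} u \<partial>lborel)"
        by (simp add: nn_integral_add nn_integral_cmult)
      also have "(\<integral>\<^sup>+u. ennreal (?k u) * indicator ?W u \<partial>lborel) = ennreal (2 * arctan (3 * s / y))"
        by (rule nn_integral_has_integral_lebesgue'[OF _ poisson_kernel_window]) (use y s in auto)
      also have "ennreal (3 * s * \<Theta>) * ennreal (2 * arctan (3 * s / y)) + ennreal (4 * s * \<Theta>) * (\<integral>\<^sup>+u. ennreal (\<sigma> u / (u - t)\<^sup>2) * indicator {u. \<bar>u - t\<bar> > s} u \<partial>lborel)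
         \<le> ennreal (3 * s * \<Theta>) * ennreal pi + ennreal (4 * s * \<Theta>) * ennreal B"
      proof (intro add_mono mult_left_mono ennreal_leI tail)
        show "2 * arctan (3 * s / y) \<le> pi" using arctan_ubound[of "3 * s / y"] by linarith
      qed auto
      also have "\<dots> = ennreal (3 * s * \<Theta> * pi + 4 * s * \<Theta> * B)" using s \<Theta> B by (simp add: ennreal_mult[symmetric] flip: ennreal_plus)
      \<comment> \<open>The tail term \<open>4 * B\<close> is at most \<open>2 * B * pi\<close>,
        because \<pi> is at least 2; this is the origin of the factor
        \<open>3 + 2 * B\<close>.\<close>
      also have "\<dots> \<le> ennreal r"
      proof (rule ennreal_leI)
        have "2 * (2 * s * \<Theta> * B) \<le> pi * (2 * s * \<Theta> * B)" using s \<Theta> B pi_ge_two by (intro mult_right_mono) auto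
        then show "3 * s * \<Theta> * pi + 4 * s * \<Theta> * B \<le> r" by (simp add: r_def algebra_simps)
      qed
      finally show ?thesis .
    qed
    show "0 \<le> r" unfolding r_def using \<Theta> B s by simp
  qed (use nn \<Theta> supp T maj False in auto)
  then show ?thesis by (simp add: r_def)
qed

text \<open>Here \<open>3932167 = 3 + 2 * (2 * 983040 + 2)\<close>, from the threshold in the bootstrap lemma and the
  growth bound at a contact point.\<close>

lemma global_bound:
  fixes b \<Theta> :: real and q :: "real \<Rightarrow> real" and P :: "(complex \<Rightarrow> complex) \<Rightarrow> bool"
  assumes b: "b \<ge> 0" and \<Theta>: "\<Theta> > 0"
    and q: "q \<in> borel_measurable borel" "\<And>x. q x \<ge> 0"
    and fin: "(\<integral>\<^sup>+x. ennreal (q x / (1 + x\<^sup>2)) \<partial>lborel) < top"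
    and Pholo: "\<And>h. P h \<Longrightarrow> h holomorphic_on UNIV"
    and Pdec: "\<And>h. P h \<Longrightarrow> \<exists>C. \<forall>z. norm (h z) \<le> C * exp (b * \<bar>Im z\<bar>) / (1 + norm z)"
    and Pscale: "\<And>h c. P h \<Longrightarrow> c \<ge> 0 \<Longrightarrow> P (\<lambda>z. of_real (exp (- c)) * h z)"
    and local: "\<And>h t s. P h \<Longrightarrow> s > 0
      \<Longrightarrow> (\<And>z. norm (z - of_real t) \<le> s \<Longrightarrow> norm (h z) \<le> exp (b * \<bar>Im z\<bar> + \<Theta> * 3932167 * s))
      \<Longrightarrow> (\<integral>\<^sup>+x. ennreal (q x) * indicator {x. \<bar>x - t\<bar> < 3 * s} x \<partial>lborel) < ennreal (s\<^sup>2)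
      \<Longrightarrow> norm (h (of_real t)) < exp (\<Theta> * s)"
  obtains C where "\<And>h. P h \<Longrightarrow> norm (h \<i>) \<le> C"
proof -
  \<comment> \<open>The bootstrap multiplies by 61440, so with this height its conclusion is
    strictly below the threshold \<open>1 / 4000\<close> that it assumes. The height depends on
    \<open>q\<close> alone, hence serves all \<open>h\<close> at once.\<close>
  obtain X where X: "X \<ge> 1" "(\<integral>\<^sup>+x. ennreal (q x / (X\<^sup>2 + x\<^sup>2)) \<partial>lborel) < ennreal (1 / (4000 * 61440))"
    using tail_weight_small[OF q fin, of "1 / (4000 * 61440)"] by auto
  define u where "u h x = ln (max 1 (norm (h (complex_of_real x)))) / \<Theta>" for h :: "complex \<Rightarrow> complex" and x
  define G where "G h = (\<integral>\<^sup>+x. ennreal (lip_maj (u h) x / (X\<^sup>2 + x\<^sup>2)) \<partial>lborel)" for h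
  have exp_u: "exp (\<Theta> * u h x) = max 1 (norm (h (of_real x)))" for h x using \<Theta> by (simp add: u_def)
  have decay: "\<exists>C>0. (\<forall>z. norm (h z) \<le> C * exp (b * \<bar>Im z\<bar>) / (1 + norm z)) \<and> (\<forall>x::real. norm (h (of_real x)) \<le> C) \<and> (\<forall>x::real. \<bar>x\<bar> > C \<longrightarrow> norm (h (of_real x)) \<le> 1)" if "P h" for h
  proof -
    obtain C where C: "\<And>z. norm (h z) \<le> C * exp (b * \<bar>Im z\<bar>) / (1 + norm z)" using Pdec[OF \<open>P h\<close>] by blast
    define D where "D = max C 1"
    have D: "norm (h z) \<le> D * exp (b * \<bar>Im z\<bar>) / (1 + norm z)" for z
    proof -
      have "C * (exp (b * \<bar>Im z\<bar>) / (1 + norm z)) \<le> D * (exp (b * \<bar>Im z\<bar>) / (1 + norm z))"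
        by (intro mult_right_mono) (auto simp: D_def)
      then show ?thesis using C[of z] by simp
    qed
    have R: "norm (h (of_real x)) \<le> D / (1 + \<bar>x\<bar>)" for x :: real using D[of "of_real x"] by simp
    have "norm (h (of_real x)) \<le> D" for x :: real
    proof -
      have "D / (1 + \<bar>x\<bar>) \<le> D / 1" by (intro divide_left_mono) (auto simp: D_def)
      then show ?thesis using R[of x] by simp
    qed
    moreover have "norm (h (of_real x)) \<le> 1" if "\<bar>x\<bar> > D" for x :: real
    proof -
      have "D / (1 + \<bar>x\<bar>) \<le> 1" using that by (simp add: divide_le_eq)
      then show ?thesis using R[of x] by linarith
    qed
    ultimately show ?thesis using D by (intro exI[of _ D]) (auto simp: D_def)
  qed
  have bump: "bump (u h)" if Ph: "P h" for h
    unfolding bump_def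
  proof (intro conjI)
    have "continuous_on UNIV (\<lambda>x. h (complex_of_real x))"
      by (rule continuous_on_compose2[OF holomorphic_on_imp_continuous_on[OF Pholo[OF Ph]]]) (auto intro!: continuous_intros)
    then show "continuous_on UNIV (u h)" unfolding u_def using \<Theta> by (intro continuous_intros) (auto simp: max_def)
    show "\<forall>x. 0 \<le> u h x" using \<Theta> by (simp add: u_def)
    obtain C where "\<forall>x::real. \<bar>x\<bar> > C \<longrightarrow> norm (h (of_real x)) \<le> 1" using decay[OF Ph] by blast
    then show "\<exists>T. \<forall>x. \<bar>x\<bar> > T \<longrightarrow> u h x = 0" by (intro exI[of _ C]) (auto simp: u_def max_def)
  qed
  have maj: "norm (h (of_real x)) \<le> exp (\<Theta> * lip_maj (u h) x)" if "P h" for h x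
  proof -
    have "norm (h (of_real x)) \<le> exp (\<Theta> * u h x)" by (simp add: exp_u)
    also have "\<dots> \<le> exp (\<Theta> * lip_maj (u h) x)" using lip_maj_ge_self[OF bump[OF that]] \<Theta> by simp
    finally show ?thesis .
  qed
  have improve: "G h < ennreal (1 / 4000)" if Ph: "P h" and Gh: "G h \<le> ennreal (1 / 4000)" for h
  proof -
    obtain T where T: "T > 0" "\<And>x. \<bar>x\<bar> > T \<Longrightarrow> lip_maj (u h) x = 0" using lip_maj_support[OF bump[OF Ph]] by blast
    obtain C where C: "\<And>z. norm (h z) \<le> C * exp (b * \<bar>Im z\<bar>) / (1 + norm z)" using decay[OF Ph] by blast
    have "G h \<le> 61440 * (\<integral>\<^sup>+x. ennreal (q x / (X\<^sup>2 + x\<^sup>2)) \<partial>lborel)"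
      unfolding G_def
    proof (rule lip_maj_bootstrap[OF bump[OF Ph] X(1) q])
      show "(\<integral>\<^sup>+x. ennreal (lip_maj (u h) x / (X\<^sup>2 + x\<^sup>2)) \<partial>lborel) \<le> ennreal (1 / 4000)" using Gh by (simp add: G_def)
      fix t assume t: "lip_maj (u h) t = u h t" "0 < lip_maj (u h) t"
      let ?\<sigma> = "lip_maj (u h)"
      show "ennreal ((?\<sigma> t)\<^sup>2) \<le> (\<integral>\<^sup>+x. ennreal (q x) * indicator {x. \<bar>x - t\<bar> < 3 * ?\<sigma> t} x \<partial>lborel)
        \<or> ennreal (2 * 983040 + 2) < (\<integral>\<^sup>+y. ennreal (?\<sigma> y / (y - t)\<^sup>2) * indicator {y. \<bar>y - t\<bar> > ?\<sigma> t} y \<partial>lborel)"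
      proof (rule ccontr)
        assume "\<not> ?thesis"
        then have nE: "(\<integral>\<^sup>+x. ennreal (q x) * indicator {x. \<bar>x - t\<bar> < 3 * ?\<sigma> t} x \<partial>lborel) < ennreal ((?\<sigma> t)\<^sup>2)"
          and nT: "(\<integral>\<^sup>+y. ennreal (?\<sigma> y / (y - t)\<^sup>2) * indicator {y. \<bar>y - t\<bar> > ?\<sigma> t} y \<partial>lborel) \<le> ennreal (2 * 983040 + 2)"
          by (simp_all only: de_Morgan_disj not_le not_less)
        have B0: "(0::real) \<le> 2 * 983040 + 2" by simp
        have "norm (h z) \<le> exp (b * \<bar>Im z\<bar> + \<Theta> * 3932167 * ?\<sigma> t)" if z: "norm (z - of_real t) \<le> ?\<sigma> t" for z
        proof -
          have "norm (h z) \<le> exp (b * \<bar>Im z\<bar> + \<Theta> * (3 + 2 * (2 * 983040 + 2)) * ?\<sigma> t)"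
            by (rule poisson_contact_bound[OF Pholo[OF Ph] b C lip_maj_nonneg[OF bump[OF Ph]] lip_maj_lipschitz[OF bump[OF Ph]] \<Theta> T(2) T(1) maj[OF Ph] refl t(2) B0 nT z])
          then show ?thesis by simp
        qed
        from local[OF Ph t(2) this nE] have lt: "norm (h (of_real t)) < exp (\<Theta> * ?\<sigma> t)" .
        \<comment> \<open>At a contact point of positive height the maximum is attained by
          \<open>norm (h t)\<close>, which then equals \<open>exp (\<Theta> * \<sigma> t)\<close>;
          the strict local bound excludes this.\<close>
        have "max 1 (norm (h (of_real t))) = exp (\<Theta> * ?\<sigma> t)" using exp_u[of h t] t(1) by simp
        moreover have "exp (\<Theta> * ?\<sigma> t) > 1" using t(2) \<Theta> by simp
        ultimately show False using lt by linarith
      qed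
    qed
    also have "\<dots> < 61440 * ennreal (1 / (4000 * 61440))"
      using X(2) by (intro ennreal_mult_strict_left_mono) auto
    also have "\<dots> = ennreal (1 / 4000)" by (simp flip: ennreal_numeral ennreal_mult)
    finally show ?thesis .
  qed
  have small: "G h \<le> ennreal (1 / 4000)" if Ph: "P h" for h
  proof -
    \<comment> \<open>The integral \<open>G (hc c)\<close> is continuous in \<open>c\<close>,
      vanishes once \<open>exp (- c)\<close> makes the function at most 1 on the real line, and can
      never equal \<open>1 / 4000\<close>, since the bootstrap would push it strictly lower. So it
      stays below that value all the way down to \<open>c = 0\<close>.\<close>
    define hc where "hc c = (\<lambda>z. complex_of_real (exp (- c)) * h z)" for c :: real
    have Phc: "P (hc c)" if "c \<ge> 0" for c unfolding hc_def by (rule Pscale[OF Ph that])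
    have h0: "hc 0 = h" by (simp add: hc_def)
    have cmp: "u (hc c) x \<le> u (hc c') x + \<bar>c - c'\<bar> / \<Theta>" for c c' x
    proof -
      let ?a = "norm (h (of_real x))"
      have "max 1 (norm (hc c (of_real x))) \<le> exp \<bar>c - c'\<bar> * max 1 (norm (hc c' (of_real x)))"
      proof (rule max.boundedI)
        have "1 * 1 \<le> exp \<bar>c - c'\<bar> * max 1 (norm (hc c' (of_real x)))" by (intro mult_mono) auto
        then show "1 \<le> exp \<bar>c - c'\<bar> * max 1 (norm (hc c' (of_real x)))" by simp
        have "norm (hc c (of_real x)) = exp (- c) * ?a" by (simp add: hc_def norm_mult)
        also have "\<dots> \<le> exp (\<bar>c - c'\<bar> - c') * ?a" by (intro mult_right_mono) auto
        also have "\<dots> = exp \<bar>c - c'\<bar> * (exp (- c') * ?a)" unfolding mult.assoc[symmetric] exp_add[symmetric] by simp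
        also have "exp (- c') * ?a = norm (hc c' (of_real x))" by (simp add: hc_def norm_mult)
        also have "exp \<bar>c - c'\<bar> * norm (hc c' (of_real x)) \<le> exp \<bar>c - c'\<bar> * max 1 (norm (hc c' (of_real x)))" by (intro mult_left_mono) auto
        finally show "norm (hc c (of_real x)) \<le> exp \<bar>c - c'\<bar> * max 1 (norm (hc c' (of_real x)))" .
      qed
      then have "ln (max 1 (norm (hc c (of_real x)))) \<le> ln (exp \<bar>c - c'\<bar> * max 1 (norm (hc c' (of_real x))))"
        by (intro ln_mono) (auto intro: less_le_trans[of 0 1])
      also have "\<dots> = \<bar>c - c'\<bar> + ln (max 1 (norm (hc c' (of_real x))))"
        by (subst ln_mult_pos) (auto intro: less_le_trans[of 0 1])
      finally show ?thesis unfolding u_def using \<Theta> by (simp add: add_divide_distrib[symmetric] divide_right_mono add.commute)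
    qed
    have mono0: "u (hc c) x \<le> u (hc 0) x" if "c \<ge> 0" for c x
    proof -
      have "norm (hc c (of_real x)) \<le> norm (hc 0 (of_real x))" using that by (simp add: hc_def norm_mult mult_left_le_one_le)
      then have "ln (max 1 (norm (hc c (of_real x)))) \<le> ln (max 1 (norm (hc 0 (of_real x))))"
        by (intro ln_mono) (auto intro: less_le_trans[of 0 1])
      then show ?thesis unfolding u_def using \<Theta> by (intro divide_right_mono) auto
    qed
    let ?\<sigma> = "\<lambda>c. lip_maj (u (hc c))"
    have nn: "?\<sigma> c x \<ge> 0" if "c \<ge> 0" for c x using lip_maj_nonneg[OF bump[OF Phc[OF that]]] .
    obtain T where T: "T > 0" "\<And>x. \<bar>x\<bar> > T \<Longrightarrow> ?\<sigma> 0 x = 0" using lip_maj_support[OF bump[OF Phc[of 0]]] by auto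
    have T': "?\<sigma> c x = 0" if "c \<ge> 0" "\<bar>x\<bar> > T" for c x
    proof -
      have "?\<sigma> c x \<le> ?\<sigma> 0 x + 0" by (rule lip_maj_mono_add) (use bump Phc that mono0 in auto)
      then show ?thesis using T(2)[OF that(2)] nn[OF that(1), of x] by simp
    qed
    define g where "g c = integral {-T..T} (\<lambda>x. ?\<sigma> c x / (X\<^sup>2 + x\<^sup>2))" for c
    have den: "X\<^sup>2 + x\<^sup>2 \<ge> 1" for x
    proof -
      have "1 \<le> X\<^sup>2" using X by (simp add: one_le_power)
      then show ?thesis by (simp add: add_increasing2)
    qed
    have dne: "X\<^sup>2 + x\<^sup>2 \<noteq> 0" for x using den[of x] by linarith
    have cont: "continuous_on {-T..T} (\<lambda>x. ?\<sigma> c x / (X\<^sup>2 + x\<^sup>2))" if "c \<ge> 0" for c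
      using dne by (intro continuous_intros lip_maj_continuous bump Phc that) auto
    have Gg: "G (hc c) = ennreal (g c) \<and> g c \<ge> 0" if "c \<ge> 0" for c
    proof
      have "((\<lambda>x. ?\<sigma> c x / (X\<^sup>2 + x\<^sup>2)) has_integral g c) {-T..T}"
        unfolding g_def by (intro integrable_integral integrable_continuous_interval cont that)
      from nn_integral_has_integral_lebesgue'[OF _ this]
      have "(\<integral>\<^sup>+x. ennreal (?\<sigma> c x / (X\<^sup>2 + x\<^sup>2)) * indicator {-T..T} x \<partial>lborel) = ennreal (g c)"
        using nn[OF that] by simp
      also have "(\<integral>\<^sup>+x. ennreal (?\<sigma> c x / (X\<^sup>2 + x\<^sup>2)) * indicator {-T..T} x \<partial>lborel) = G (hc c)"
        unfolding G_def
      proof (rule nn_integral_cong)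
        fix x
        show "ennreal (?\<sigma> c x / (X\<^sup>2 + x\<^sup>2)) * indicator {-T..T} x = ennreal (?\<sigma> c x / (X\<^sup>2 + x\<^sup>2))"
        proof (cases "\<bar>x\<bar> > T")
          case True then show ?thesis using T'[OF that True] by simp
        next
          case False then have "x \<in> {-T..T}" by auto
          then show ?thesis by simp
        qed
      qed
      finally show "G (hc c) = ennreal (g c)" by simp
      show "g c \<ge> 0" unfolding g_def by (intro integral_nonneg integrable_continuous_interval cont that) (use nn[OF that] in auto)
    qed
    have lipg: "\<bar>g c - g c'\<bar> \<le> (2 * T / \<Theta>) * \<bar>c - c'\<bar>" if "c \<ge> 0" "c' \<ge> 0" for c c'
    proof -
      have "g c - g c' = integral {-T..T} (\<lambda>x. ?\<sigma> c x / (X\<^sup>2 + x\<^sup>2) - ?\<sigma> c' x / (X\<^sup>2 + x\<^sup>2))"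
        unfolding g_def by (intro integral_diff[symmetric] integrable_continuous_interval cont that)
      also have "norm \<dots> \<le> (\<bar>c - c'\<bar> / \<Theta>) * (T - (- T))"
      proof (rule integral_bound)
        fix x
        have 1: "?\<sigma> c x \<le> ?\<sigma> c' x + \<bar>c - c'\<bar> / \<Theta>" by (rule lip_maj_mono_add) (use bump Phc that cmp in auto)
        have 2: "?\<sigma> c' x \<le> ?\<sigma> c x + \<bar>c - c'\<bar> / \<Theta>"
          by (rule lip_maj_mono_add) (use bump Phc that cmp[of c' _ c] in \<open>auto simp: abs_minus_commute\<close>)
        have "\<bar>?\<sigma> c x - ?\<sigma> c' x\<bar> \<le> \<bar>c - c'\<bar> / \<Theta>" using 1 2 by linarith
        then have "\<bar>?\<sigma> c x - ?\<sigma> c' x\<bar> / (X\<^sup>2 + x\<^sup>2) \<le> (\<bar>c - c'\<bar> / \<Theta>) / 1"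
          using den[of x] by (intro frac_le) auto
        then show "norm (?\<sigma> c x / (X\<^sup>2 + x\<^sup>2) - ?\<sigma> c' x / (X\<^sup>2 + x\<^sup>2)) \<le> \<bar>c - c'\<bar> / \<Theta>"
          using den[of x] by (simp add: diff_divide_distrib[symmetric] abs_divide)
      qed (use T that in \<open>auto intro!: continuous_intros cont\<close>)
      finally show ?thesis by (simp add: mult_ac)
    qed
    have contg: "continuous_on {0..} g"
      using lipg T \<Theta> by (intro lipschitz_on_continuous_on[of "2 * T / \<Theta>"] lipschitz_onI) (auto simp: dist_real_def)
    obtain C where C: "C > 0" "\<And>x::real. norm (h (of_real x)) \<le> C" using decay[OF Ph] by blast
    define c1 where "c1 = max 0 (ln C)"
    have c1: "c1 \<ge> 0" by (simp add: c1_def)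
    have "u (hc c1) x = 0" for x
    proof -
      have "norm (hc c1 (of_real x)) = exp (- c1) * norm (h (of_real x))" by (simp add: hc_def norm_mult)
      also have "\<dots> \<le> exp (- c1) * C" using C by (intro mult_left_mono) auto
      also have "\<dots> \<le> exp (- ln C) * C" using C by (intro mult_right_mono) (auto simp: c1_def)
      also have "\<dots> = 1" using C by (simp add: exp_minus)
      finally show ?thesis by (simp add: u_def max_def)
    qed
    then have "?\<sigma> c1 x = 0" for x
    proof -
      obtain t where "?\<sigma> c1 x = u (hc c1) t - \<bar>x - t\<bar>" using lip_maj_attained[OF bump[OF Phc[OF c1]]] by blast
      then show ?thesis using \<open>\<And>x. u (hc c1) x = 0\<close>[of t] nn[OF c1, of x] by linarith
    qed
    then have g1: "g c1 = 0" by (simp add: g_def)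
    show ?thesis
    proof (rule ccontr)
      assume "\<not> ?thesis"
      then have "g 0 > 1 / 4000" using Gg[of 0] h0 by (auto simp: not_le ennreal_less_iff)
      then have "\<exists>c\<ge>0. c \<le> c1 \<and> g c = 1 / 4000"
        by (intro IVT2') (use g1 c1 contg in \<open>auto intro: continuous_on_subset\<close>)
      then obtain c where c: "c \<ge> 0" "g c = 1 / 4000" by blast
      then have "G (hc c) = ennreal (1 / 4000)" using Gg by simp
      then show False using improve[OF Phc[OF c(1)]] by simp
    qed
  qed
  \<comment> \<open>For \<open>X \<ge> 1\<close> the kernel at \<open>\<i>\<close> is at most
    \<open>X\<^sup>2\<close> times the weight at height \<open>X\<close>, so the bound on
    \<open>G\<close> yields one at \<open>\<i>\<close>, with a constant depending on
    \<open>X\<close> but not on \<open>h\<close>.\<close>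
  have "norm (h \<i>) \<le> exp (b + (\<Theta> * X\<^sup>2 / 4000) / pi)" if Ph: "P h" for h
  proof -
    obtain T where T: "T > 0" "\<And>x. \<bar>x\<bar> > T \<Longrightarrow> lip_maj (u h) x = 0" using lip_maj_support[OF bump[OF Ph]] by blast
    obtain C where C: "\<And>z. norm (h z) \<le> C * exp (b * \<bar>Im z\<bar>) / (1 + norm z)" using decay[OF Ph] by blast
    let ?\<sigma> = "lip_maj (u h)"
    have nn: "?\<sigma> x \<ge> 0" for x by (rule lip_maj_nonneg[OF bump[OF Ph]])
    have [measurable]: "?\<sigma> \<in> borel_measurable borel" by (intro borel_measurable_continuous_onI lip_maj_continuous bump Ph)
    have "norm (h \<i>) \<le> exp (b * \<bar>Im \<i>\<bar> + (\<Theta> * X\<^sup>2 / 4000) / pi)"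
    proof (rule poisson_bound[OF Pholo[OF Ph] b C, where \<phi> = "\<lambda>x. \<Theta> * ?\<sigma> x" and L = \<Theta> and T = T])
      show "\<bar>\<Theta> * ?\<sigma> x - \<Theta> * ?\<sigma> y\<bar> \<le> \<Theta> * \<bar>x - y\<bar>" for x y
      proof -
        have "\<bar>\<Theta> * ?\<sigma> x - \<Theta> * ?\<sigma> y\<bar> = \<Theta> * \<bar>?\<sigma> x - ?\<sigma> y\<bar>" using \<Theta> by (simp add: right_diff_distrib[symmetric] abs_mult)
        then show ?thesis using lip_maj_lipschitz[OF bump[OF Ph], of x y] \<Theta> by simp
      qed
      have "(\<integral>\<^sup>+u. ennreal (\<Theta> * ?\<sigma> u * \<bar>Im \<i>\<bar> / ((Re \<i> - u)\<^sup>2 + (Im \<i>)\<^sup>2)) \<partial>lborel)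
         \<le> (\<integral>\<^sup>+u. ennreal (\<Theta> * X\<^sup>2) * ennreal (?\<sigma> u / (X\<^sup>2 + u\<^sup>2)) \<partial>lborel)"
      proof (rule nn_integral_mono)
        fix y
        have X2: "X\<^sup>2 \<ge> 1" using X by (simp add: one_le_power)
        have "X\<^sup>2 + y\<^sup>2 \<le> X\<^sup>2 * (1 + y\<^sup>2)" using mult_right_mono[OF X2, of "y\<^sup>2"] by (simp add: algebra_simps)
        then have "X\<^sup>2 / (X\<^sup>2 * (1 + y\<^sup>2)) \<le> X\<^sup>2 / (X\<^sup>2 + y\<^sup>2)" using X2
          by (intro divide_left_mono mult_pos_pos) (auto intro!: add_pos_nonneg)
        moreover have "X\<^sup>2 / (X\<^sup>2 * (1 + y\<^sup>2)) = 1 / (1 + y\<^sup>2)" using X(1) by simp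
        ultimately have "1 / (1 + y\<^sup>2) \<le> X\<^sup>2 / (X\<^sup>2 + y\<^sup>2)" by simp
        then have "(\<Theta> * ?\<sigma> y) * (1 / (1 + y\<^sup>2)) \<le> (\<Theta> * ?\<sigma> y) * (X\<^sup>2 / (X\<^sup>2 + y\<^sup>2))" using \<Theta> nn by (intro mult_left_mono) auto
        then have "ennreal (\<Theta> * ?\<sigma> y * \<bar>Im \<i>\<bar> / ((Re \<i> - y)\<^sup>2 + (Im \<i>)\<^sup>2)) \<le> ennreal ((\<Theta> * X\<^sup>2) * (?\<sigma> y / (X\<^sup>2 + y\<^sup>2)))"
          by (intro ennreal_leI) (simp add: mult_ac add.commute)
        also have "\<dots> = ennreal (\<Theta> * X\<^sup>2) * ennreal (?\<sigma> y / (X\<^sup>2 + y\<^sup>2))" using \<Theta> nn by (subst ennreal_mult) auto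
        finally show "ennreal (\<Theta> * ?\<sigma> y * \<bar>Im \<i>\<bar> / ((Re \<i> - y)\<^sup>2 + (Im \<i>)\<^sup>2)) \<le> ennreal (\<Theta> * X\<^sup>2) * ennreal (?\<sigma> y / (X\<^sup>2 + y\<^sup>2))" .
      qed
      also have "\<dots> = ennreal (\<Theta> * X\<^sup>2) * G h" unfolding G_def by (rule nn_integral_cmult) measurable
      also have "\<dots> \<le> ennreal (\<Theta> * X\<^sup>2) * ennreal (1 / 4000)" by (intro mult_left_mono small[OF Ph]) simp
      also have "\<dots> = ennreal (\<Theta> * X\<^sup>2 / 4000)" using \<Theta> by (simp add: ennreal_mult[symmetric])
      finally show "(\<integral>\<^sup>+u. ennreal (\<Theta> * ?\<sigma> u * \<bar>Im \<i>\<bar> / ((Re \<i> - u)\<^sup>2 + (Im \<i>)\<^sup>2)) \<partial>lborel) \<le> ennreal (\<Theta> * X\<^sup>2 / 4000)" .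
    qed (use nn \<Theta> T maj[OF Ph] in auto)
    then show ?thesis by simp
  qed
  then show thesis by (rule that)
qed

section \<open>Selecting nodes of small energy\<close>

lemma fact_ge_power: "(real n / exp 1) ^ n \<le> fact n"
  using self_power_le_exp_fact[of n] by (simp add: power_divide exp_of_nat_mult[symmetric] field_simps)

text \<open>The counting bound says that the \<open>i\<close>-th smallest value is at least
  \<open>i / C\<close>; the induction removes the largest one.\<close>

lemma prod_ge_fact_of_count:
  fixes y :: "'a \<Rightarrow> real"
  assumes "finite S" "C > 0" "\<And>l. l \<in> S \<Longrightarrow> y l > 0" "\<And>r. r > 0 \<Longrightarrow> real (card {l\<in>S. y l \<le> r}) \<le> C * r"
  shows "fact (card S) / C ^ card S \<le> (\<Prod>l\<in>S. y l)"
  using assms(1,3,4)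
proof (induction "card S" arbitrary: S)
  case 0
  then show ?case by simp
next
  case (Suc n)
  then have ne: "S \<noteq> {}" by auto
  obtain m where m: "m \<in> S" "\<And>l. l \<in> S \<Longrightarrow> y l \<le> y m"
    using Max_in[of "y ` S"] Max_ge[of "y ` S"] Suc.prems(1) ne by (metis (no_types, lifting) finite_imageI image_iff image_is_empty imageI)
  have card: "card (S - {m}) = n" using Suc.hyps(2) m Suc.prems(1) by simp
  have IH: "fact n / C ^ n \<le> (\<Prod>l\<in>S-{m}. y l)"
  proof -
    have "fact (card (S - {m})) / C ^ card (S - {m}) \<le> (\<Prod>l\<in>S-{m}. y l)"
    proof (rule Suc.hyps(1))
      fix r :: real assume r: "r > 0"
      have "card {l\<in>S-{m}. y l \<le> r} \<le> card {l\<in>S. y l \<le> r}" by (rule card_mono) (use Suc.prems(1) in auto)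
      then show "real (card {l\<in>S-{m}. y l \<le> r}) \<le> C * r" using Suc.prems(3)[OF r] by linarith
    qed (use card Suc.prems in auto)
    then show ?thesis using card by simp
  qed
  have ym: "y m > 0" using Suc.prems m by auto
  have "{l\<in>S. y l \<le> y m} = S" using m by auto
  then have "real (Suc n) \<le> C * y m" using Suc.prems(3)[OF ym] Suc.hyps(2) by simp
  then have "real (Suc n) / C \<le> y m" using assms(2) by (simp add: field_simps)
  then have "(real (Suc n) / C) * (fact n / C ^ n) \<le> y m * (\<Prod>l\<in>S-{m}. y l)"
    using IH ym assms(2) by (intro mult_mono) auto
  also have "\<dots> = (\<Prod>l\<in>S. y l)" using Suc.prems(1) m by (simp add: prod.remove)
  finally show ?case using Suc.hyps(2)[symmetric] by simp
qed

text \<open>With \<open>n\<close> points the product bound and Stirling give at most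
  \<open>n * (ln (C * R / n) + 1)\<close>, and \<open>ln x + 1 \<le> x\<close> removes the
  dependence on \<open>n\<close>. Linear density thus makes a logarithmic sum linear in
  \<open>R\<close>.\<close>

lemma sum_ln_le_of_count:
  fixes y :: "'a \<Rightarrow> real"
  assumes fin: "finite S" and C: "C > 0" and y: "\<And>l. l \<in> S \<Longrightarrow> y l > 0" and R: "R > 0"
    and cnt: "\<And>r. r > 0 \<Longrightarrow> real (card {l\<in>S. y l \<le> r}) \<le> C * r"
  shows "(\<Sum>l\<in>S. ln (R / y l)) \<le> C * R"
proof (cases "S = {}")
  case False
  define n where "n = card S"
  have n: "n > 0" using False fin by (simp add: n_def card_gt_0_iff)
  have Ppos: "(\<Prod>l\<in>S. y l) > 0" using y by (rule prod_pos)
  have "(real n / exp 1) ^ n / C ^ n \<le> fact n / C ^ n" using fact_ge_power C by (intro divide_right_mono) auto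
  also have "\<dots> \<le> (\<Prod>l\<in>S. y l)" unfolding n_def by (rule prod_ge_fact_of_count[OF fin C y cnt])
  finally have "(real n / (exp 1 * C)) ^ n \<le> (\<Prod>l\<in>S. y l)" by (simp add: power_divide[symmetric])
  then have "ln ((real n / (exp 1 * C)) ^ n) \<le> ln (\<Prod>l\<in>S. y l)" using n C by (intro ln_mono) auto
  also have "ln (\<Prod>l\<in>S. y l) = (\<Sum>l\<in>S. ln (y l))" using y by (intro ln_prod) (auto simp: fin less_imp_neq[symmetric])
  finally have 1: "real n * ln (real n / (exp 1 * C)) \<le> (\<Sum>l\<in>S. ln (y l))" using n C by (simp add: ln_realpow)
  have "(\<Sum>l\<in>S. ln (R / y l)) = real n * ln R - (\<Sum>l\<in>S. ln (y l))"
  proof -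
    have "(\<Sum>l\<in>S. ln (R / y l)) = (\<Sum>l\<in>S. ln R - ln (y l))" 
    proof (rule sum.cong[OF refl])
      fix l assume "l \<in> S"
      then show "ln (R / y l) = ln R - ln (y l)" using y[of l] R by (simp add: ln_div)
    qed
    then show ?thesis by (simp add: sum_subtractf n_def)
  qed
  also have "\<dots> \<le> real n * ln R - real n * ln (real n / (exp 1 * C))" using 1 by simp
  also have "\<dots> = real n * (ln (C * R / real n) + 1)"
    using n C R by (simp add: ln_div ln_mult algebra_simps)
  also have "\<dots> \<le> real n * (C * R / real n)"
  proof (rule mult_left_mono)
    show "ln (C * R / real n) + 1 \<le> C * R / real n" using ln_le_minus_one[of "C * R / real n"] n C R by simp
  qed simp
  also have "\<dots> = C * R" using n by simp
  finally show ?thesis .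
qed (use C R in simp)

text \<open>The rank is injective on a finite linearly ordered set, so fewer than
  \<open>r + 1\<close> elements can have rank below \<open>r\<close>.\<close>

lemma card_low_rank:
  fixes J :: "'a::linorder set" and r :: real
  assumes fin: "finite J" and r: "r \<ge> 0"
  shows "real (card {k\<in>J. real (card {j\<in>J. j < k}) < r}) \<le> r + 1"
    and "real (card {k\<in>J. real (card {j\<in>J. k < j}) < r}) \<le> r + 1"
proof -
  have lt: "{j. real j < r} \<subseteq> {..<nat \<lceil>r\<rceil>}" 
    by (auto simp: less_ceiling_iff zless_nat_eq_int_zless)
  have nr: "real (nat \<lceil>r\<rceil>) \<le> r + 1" using r by linarith
  have "card {k\<in>J. real (card {j\<in>J. j < k}) < r} \<le> card {..<nat \<lceil>r\<rceil>}"
  proof (rule card_inj_on_le)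
    show "inj_on (\<lambda>k. card {j\<in>J. j < k}) {k\<in>J. real (card {j\<in>J. j < k}) < r}"
    proof (rule linorder_inj_onI)
      fix k l assume "k \<in> {k\<in>J. real (card {j\<in>J. j < k}) < r}" "l \<in> {k\<in>J. real (card {j\<in>J. j < k}) < r}" "k < l"
      then have "{j\<in>J. j < k} \<subset> {j\<in>J. j < l}" by force
      then have "card {j\<in>J. j < k} < card {j\<in>J. j < l}" using fin by (intro psubset_card_mono) auto
      then show "card {j\<in>J. j < k} \<noteq> card {j\<in>J. j < l}" by simp
    qed auto
  qed (use lt in auto)
  then show "real (card {k\<in>J. real (card {j\<in>J. j < k}) < r}) \<le> r + 1" using nr by simp
  have "card {k\<in>J. real (card {j\<in>J. k < j}) < r} \<le> card {..<nat \<lceil>r\<rceil>}"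
  proof (rule card_inj_on_le)
    show "inj_on (\<lambda>k. card {j\<in>J. k < j}) {k\<in>J. real (card {j\<in>J. k < j}) < r}"
    proof (rule linorder_inj_onI)
      fix k l assume "k \<in> {k\<in>J. real (card {j\<in>J. k < j}) < r}" "l \<in> {k\<in>J. real (card {j\<in>J. k < j}) < r}" "k < l"
      then have "{j\<in>J. l < j} \<subset> {j\<in>J. k < j}" by force
      then have "card {j\<in>J. l < j} < card {j\<in>J. k < j}" using fin by (intro psubset_card_mono) auto
      then show "card {j\<in>J. k < j} \<noteq> card {j\<in>J. l < j}" by simp
    qed auto
  qed (use lt in auto)
  then show "real (card {k\<in>J. real (card {j\<in>J. k < j}) < r}) \<le> r + 1" using nr by simp
qed

lemma card_gt_le_sum:
  fixes f :: "'a \<Rightarrow> real"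
  assumes "finite S" "\<And>k. k \<in> S \<Longrightarrow> f k \<ge> 0" "\<theta> > 0"
  shows "real (card {k\<in>S. f k > \<theta>}) \<le> (\<Sum>k\<in>S. f k) / \<theta>"
proof -
  have "\<theta> * real (card {k\<in>S. f k > \<theta>}) = (\<Sum>k\<in>{k\<in>S. f k > \<theta>}. \<theta>)" by simp
  also have "\<dots> \<le> (\<Sum>k\<in>{k\<in>S. f k > \<theta>}. f k)" by (rule sum_mono) auto
  also have "\<dots> \<le> (\<Sum>k\<in>S. f k)" by (rule sum_mono2) (use assms in auto)
  finally show ?thesis using assms(3) by (simp add: field_simps)
qed

text \<open>The consequences of uniformity that hold for every interval: a positive lower bound for
  the lengths and a linear upper bound for the counts. The exact density holds only asymptotically
  and is handled outside through a finite set of irregular intervals.\<close>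

locale partitioned_points =
  fixes a c :: "int \<Rightarrow> real" and \<delta>0 D0 :: real
  assumes a_mono: "strict_mono a" and c_mono: "strict_mono c"
    and \<delta>0: "0 < \<delta>0" and gap: "\<And>n. \<delta>0 \<le> c (n+1) - c n"
    and D0: "1 \<le> D0"
    and finite_pts: "\<And>n. finite {k. a k \<in> part_int c n}"
    and card_pts: "\<And>n. real (card {k. a k \<in> part_int c n}) \<le> D0 * (c (n+1) - c n)"
begin

definition len :: "int \<Rightarrow> real" where "len n = c (n+1) - c n"
definition pts :: "int \<Rightarrow> int set" where "pts n = {k. a k \<in> part_int c n}"
definition nof :: "real \<Rightarrow> int" where "nof x = (THE n. x \<in> part_int c n)"
definition lof :: "int \<Rightarrow> real" where "lof k = len (nof (a k))"
text \<open>The share of the point \<open>l\<close> in the logarithmic energy of its own interval,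
  normalised by the length so that every term is nonnegative. Summed over the interval it gives the
  numerator of the uniformity condition up to a lower-order term.\<close>

definition row :: "int \<Rightarrow> real" where
  "row l = (\<Sum>j\<in>pts (nof (a l)) - {l}. ln (lof l / \<bar>a j - a l\<bar>))"

lemma len_pos: "len n > 0" using gap[of n] \<delta>0 by (simp add: len_def)

lemma c_linear: "c (n + int i) \<ge> c n + real i * \<delta>0"
proof (induction i)
  case (Suc i)
  then show ?case using gap[of "n + int i"] by (simp add: algebra_simps)
qed simp

lemma c_less_iff: "c m < c n \<longleftrightarrow> m < n" using c_mono by (simp add: strict_mono_less)
lemma c_le_iff: "c m \<le> c n \<longleftrightarrow> m \<le> n" using c_mono by (simp add: strict_mono_less_eq)

lemma part_int_unique: "x \<in> part_int c m \<Longrightarrow> x \<in> part_int c n \<Longrightarrow> m = n"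
proof (induction m n rule: linorder_wlog)
  case (le m n)
  show ?case
  proof (rule ccontr)
    assume "m \<noteq> n"
    then have "c (m + 1) \<le> c n" using le c_le_iff by auto
    then show False using le by (auto simp: part_int_def)
  qed
qed auto

lemma part_int_ex: "\<exists>n. x \<in> part_int c n"
proof -
  obtain i :: nat where i: "x - c 0 \<le> real i * \<delta>0" using \<delta>0 by (meson ex_less_of_nat_mult less_imp_le)
  obtain j :: nat where j: "c 0 - x < real j * \<delta>0" using \<delta>0 by (meson ex_less_of_nat_mult)
  have up: "x \<le> c (int i)" using c_linear[of 0 i] i by simp
  have lo: "c (- int j) < x" using c_linear[of "- int j" j] j by simp
  define S where "S = {n. - int j \<le> n \<and> n \<le> int i \<and> c n < x}"
  have finS: "finite S" by (rule finite_subset[of _ "{- int j..int i}"]) (auto simp: S_def)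
  have "- int j \<in> S" using lo by (auto simp: S_def)
  then have ne: "S \<noteq> {}" by auto
  have M: "Max S \<in> S" using Max_in[OF finS ne] .
  have "\<not> c (Max S + 1) < x"
  proof
    assume lt: "c (Max S + 1) < x"
    have "c (Max S + 1) < c (int i)" using lt up by linarith
    then have "Max S + 1 \<in> S" using M lt c_less_iff by (auto simp: S_def)
    then show False using Max_ge[OF finS, of "Max S + 1"] by simp
  qed
  then show ?thesis using M by (auto simp: S_def part_int_def intro!: exI[of _ "Max S"])
qed

lemma nof_eq: "x \<in> part_int c n \<Longrightarrow> nof x = n"
  unfolding nof_def using part_int_unique by blast

lemma in_nof: "x \<in> part_int c (nof x)"
  using part_int_ex[of x] nof_eq by metis

lemma pts_iff: "k \<in> pts n \<longleftrightarrow> nof (a k) = n"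
  using in_nof nof_eq by (auto simp: pts_def)

lemma finite_pts': "finite (pts n)" using finite_pts by (simp add: pts_def)
lemma card_pts': "real (card (pts n)) \<le> D0 * len n" using card_pts by (simp add: pts_def len_def)

lemma lof_pos: "lof k > 0" by (simp add: lof_def len_pos)

lemma same_part_diff: "x \<in> part_int c n \<Longrightarrow> y \<in> part_int c n \<Longrightarrow> \<bar>x - y\<bar> < len n"
  by (auto simp: part_int_def len_def)

lemma part_int_fmeasurable: "part_int c n \<in> fmeasurable lborel"
  unfolding part_int_def using len_pos[of n] by (intro fmeasurableI) (auto simp: len_def)

lemma sum_len_le:
  assumes fin: "finite F" and sub: "\<And>n. n \<in> F \<Longrightarrow> part_int c n \<subseteq> {A..B}" and AB: "A \<le> B"
  shows "(\<Sum>n\<in>F. len n) \<le> B - A"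
proof -
  have "(\<Sum>n\<in>F. len n) = (\<Sum>n\<in>F. measure lborel (part_int c n))"
    by (intro sum.cong) (use len_pos in \<open>auto simp: part_int_def len_def less_imp_le\<close>)
  also have "\<dots> = measure lborel (\<Union>n\<in>F. part_int c n)"
  proof (rule measure_finite_Union[symmetric, OF fin])
    show "disjoint_family_on (part_int c) F" unfolding disjoint_family_on_def using part_int_unique by blast
    show "emeasure lborel (part_int c n) \<noteq> \<infinity>" for n using part_int_fmeasurable[of n] by (simp add: fmeasurable_def less_top[symmetric])
  qed (auto simp: part_int_def)
  also have "\<dots> \<le> measure lborel {A..B}"
  proof (rule measure_mono_fmeasurable)
    show "{A..B} \<in> fmeasurable lborel" using AB by (intro fmeasurableI) auto
    show "(\<Union>n\<in>F. part_int c n) \<in> sets lborel" using fin by (auto simp: part_int_def)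
    show "(\<Union>n\<in>F. part_int c n) \<subseteq> {A..B}" using sub by blast
  qed
  finally show ?thesis using AB by simp
qed

lemma le_sum_len:
  assumes fin: "finite F" and sub: "{A<..B} \<subseteq> (\<Union>n\<in>F. part_int c n)" and AB: "A \<le> B"
  shows "B - A \<le> (\<Sum>n\<in>F. len n)"
proof -
  have "B - A = measure lborel {A<..B}" using AB by simp
  also have "\<dots> \<le> measure lborel (\<Union>n\<in>F. part_int c n)"
    by (intro measure_mono_fmeasurable sub) (use fin part_int_fmeasurable in \<open>auto intro!: fmeasurable.finite_UN\<close>)
  also have "\<dots> \<le> (\<Sum>n\<in>F. measure lborel (part_int c n))"
    by (intro measure_UNION_le fin) (auto simp: part_int_def)
  also have "\<dots> = (\<Sum>n\<in>F. len n)"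
    by (intro sum.cong) (use len_pos in \<open>auto simp: part_int_def len_def less_imp_le\<close>)
  finally show ?thesis .
qed

text \<open>An interval of length at most \<open>r\<close> containing a point within
  \<open>r\<close> of \<open>x\<close> lies within \<open>2 * r\<close> of \<open>x\<close>; being
  disjoint, such intervals have total length at most \<open>4 * r\<close>. Without the restriction
  on the interval length, points could cluster inside a long interval.\<close>

lemma count_near:
  assumes fin: "finite S" and r: "r > 0"
  shows "real (card {l\<in>S. \<bar>a l - x\<bar> \<le> r \<and> lof l \<le> r}) \<le> 4 * D0 * r"
proof -
  define T where "T = {l\<in>S. \<bar>a l - x\<bar> \<le> r \<and> lof l \<le> r}"
  define F where "F = (\<lambda>l. nof (a l)) ` T"
  have finF: "finite F" using fin by (simp add: F_def T_def)
  have "T \<subseteq> (\<Union>n\<in>F. pts n)" by (auto simp: F_def pts_iff)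
  then have "card T \<le> card (\<Union>n\<in>F. pts n)" by (intro card_mono) (use finF finite_pts' in auto)
  also have "\<dots> \<le> (\<Sum>n\<in>F. card (pts n))" by (rule card_UN_le[OF finF])
  finally have "real (card T) \<le> (\<Sum>n\<in>F. real (card (pts n)))" by (metis of_nat_le_iff of_nat_sum)
  also have "\<dots> \<le> (\<Sum>n\<in>F. D0 * len n)" by (intro sum_mono card_pts')
  also have "\<dots> = D0 * (\<Sum>n\<in>F. len n)" by (rule sum_distrib_left[symmetric])
  also have "\<dots> \<le> D0 * ((x + 2 * r) - (x - 2 * r))"
  proof (intro mult_left_mono sum_len_le finF)
    fix n assume "n \<in> F"
    then obtain l where l: "l \<in> T" "n = nof (a l)" by (auto simp: F_def)
    show "part_int c n \<subseteq> {x - 2 * r..x + 2 * r}"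
    proof
      fix y assume "y \<in> part_int c n"
      then have "\<bar>y - a l\<bar> < len n" using same_part_diff in_nof[of "a l"] l by simp
      moreover have "\<bar>a l - x\<bar> \<le> r" "len n \<le> r" using l by (auto simp: T_def lof_def)
      ultimately have "\<bar>y - a l\<bar> < r" "\<bar>a l - x\<bar> \<le> r" by auto
      then show "y \<in> {x - 2 * r..x + 2 * r}" by (auto simp: abs_le_iff abs_less_iff)
    qed
  qed (use D0 r in auto)
  finally show ?thesis by (simp add: T_def)
qed

lemma row_term_nonneg:
  assumes "j \<in> pts (nof (a l)) - {l}"
  shows "0 \<le> ln (lof l / \<bar>a j - a l\<bar>)"
proof -
  have "a j \<noteq> a l" using assms a_mono by (auto simp: strict_mono_eq)
  moreover have "\<bar>a j - a l\<bar> < lof l"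
    using same_part_diff[OF _ in_nof[of "a l"], of "a j"] assms by (simp add: pts_def lof_def)
  ultimately show ?thesis by simp
qed

lemma row_nonneg: "0 \<le> row l"
  unfolding row_def by (intro sum_nonneg row_term_nonneg)

text \<open>The distance of two points, raised to at least the lengths of their intervals. Small
  distances are split as \<open>s / rad\<close> times \<open>rad / distance\<close>: the first ratio
  is governed by counting alone, the logarithm of the second is \<open>cross\<close> and is charged
  to the energies.\<close>

definition rad :: "int \<Rightarrow> int \<Rightarrow> real" where "rad k l = max \<bar>a k - a l\<bar> (max (lof k) (lof l))"
definition cross :: "int \<Rightarrow> int \<Rightarrow> real" where "cross k l = ln (rad k l / \<bar>a k - a l\<bar>)"
text \<open>Moving every point by at most a third of the gap to its neighbours keeps the points of \<open>inner \<eta> n\<close>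
  in their interval.\<close>

definition inner :: "real \<Rightarrow> int \<Rightarrow> int set" where
  "inner \<eta> n = {k\<in>pts n. \<eta> * len n \<le> real (card {j\<in>pts n. j < k}) \<and> \<eta> * len n \<le> real (card {j\<in>pts n. k < j})}"

lemma rad_pos: "rad k l > 0" using lof_pos[of k] by (simp add: rad_def less_max_iff_disj)

lemma cross_sym: "cross k l = cross l k"
  by (simp add: cross_def rad_def abs_minus_commute max.commute)

lemma a_diff_pos: "k \<noteq> l \<Longrightarrow> \<bar>a k - a l\<bar> > 0"
  using a_mono by (simp add: strict_mono_eq)

lemma cross_nonneg: "k \<noteq> l \<Longrightarrow> 0 \<le> cross k l"
  using a_diff_pos[of k l] by (simp add: cross_def rad_def)

text \<open>Uniformity controls energies within one interval only. If a point \<open>k\<close> of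
  another interval is close to an inner point \<open>l\<close>, then at least
  \<open>\<eta> * lof l\<close> points of the interval of \<open>l\<close> lie between them, all
  even closer to \<open>l\<close>. Each of these contributes at least \<open>cross k l\<close> to
  \<open>row l\<close>.\<close>

lemma cross_le_row:
  assumes l: "l \<in> inner \<eta> (nof (a l))" and \<eta>: "\<eta> > 0" and ne: "nof (a k) \<noteq> nof (a l)"
    and le: "lof k \<le> lof l" and near: "\<bar>a k - a l\<bar> < lof l"
  shows "cross k l \<le> row l / (\<eta> * lof l)"
proof -
  define n where "n = nof (a l)"
  have kl: "k \<noteq> l" using ne by auto
  have cr: "cross k l = ln (lof l / \<bar>a k - a l\<bar>)" using le near by (simp add: cross_def rad_def)
  have cr0: "0 \<le> cross k l" by (rule cross_nonneg[OF kl])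
  have al: "a l \<in> part_int c n" unfolding n_def by (rule in_nof)
  have ak: "a k \<notin> part_int c n" using nof_eq[of "a k" n] ne by (auto simp: n_def)
  obtain B where B: "B \<subseteq> pts n - {l}" "\<eta> * lof l \<le> real (card B)" "\<And>j. j \<in> B \<Longrightarrow> \<bar>a j - a l\<bar> \<le> \<bar>a k - a l\<bar>"
  proof (cases "a k < a l")
    case True
    show thesis
    proof (rule that[of "{j\<in>pts n. j < l}"])
      fix j assume j: "j \<in> {j\<in>pts n. j < l}"
      then have "a j < a l" using a_mono by (simp add: strict_mono_less)
      moreover have "a k < a j" using True al ak j by (auto simp: part_int_def pts_def)
      ultimately show "\<bar>a j - a l\<bar> \<le> \<bar>a k - a l\<bar>" by simp
    qed (use l in \<open>auto simp: inner_def n_def lof_def\<close>)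
  next
    case False
    then have gt: "a l < a k" using a_diff_pos[OF kl] by simp
    show thesis
    proof (rule that[of "{j\<in>pts n. l < j}"])
      fix j assume j: "j \<in> {j\<in>pts n. l < j}"
      then have "a l < a j" using a_mono by (simp add: strict_mono_less)
      moreover have "a j < a k" using gt al ak j by (auto simp: part_int_def pts_def)
      ultimately show "\<bar>a j - a l\<bar> \<le> \<bar>a k - a l\<bar>" by simp
    qed (use l in \<open>auto simp: inner_def n_def lof_def\<close>)
  qed
  have "\<eta> * lof l * cross k l \<le> real (card B) * cross k l" using B(2) cr0 by (rule mult_right_mono)
  also have "\<dots> = (\<Sum>j\<in>B. cross k l)" by simp
  also have "\<dots> \<le> (\<Sum>j\<in>B. ln (lof l / \<bar>a j - a l\<bar>))"
  proof (rule sum_mono)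
    fix j assume j: "j \<in> B"
    then have pos: "\<bar>a j - a l\<bar> > 0" using B(1) a_diff_pos by blast
    have "lof l / \<bar>a k - a l\<bar> \<le> lof l / \<bar>a j - a l\<bar>"
      using B(3)[OF j] pos a_diff_pos[OF kl] lof_pos[of l] by (intro divide_left_mono mult_pos_pos) auto
    then show "cross k l \<le> ln (lof l / \<bar>a j - a l\<bar>)" unfolding cr
      using a_diff_pos[OF kl] lof_pos[of l] by (intro ln_mono) auto
  qed
  also have "\<dots> \<le> row l" unfolding row_def
    by (rule sum_mono2) (use B(1) finite_pts' row_term_nonneg in \<open>auto simp: n_def\<close>)
  finally have "\<eta> * lof l * cross k l \<le> row l" .
  moreover have "\<eta> * lof l > 0" using \<eta> lof_pos[of l] by simp
  ultimately show ?thesis by (simp add: field_simps)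
qed

text \<open>Points of the same interval give at most the row itself; points of shorter intervals
  within \<open>lof l\<close> number at most \<open>4 * D0 * lof l\<close>, each costing at most
  \<open>row l / (\<eta> * lof l)\<close>; all others have \<open>cross\<close> equal to 0.\<close>

lemma sum_cross_le_row:
  assumes fin: "finite S" and l: "l \<in> inner \<eta> (nof (a l))" and \<eta>: "\<eta> > 0"
  shows "(\<Sum>k\<in>{k\<in>S. k \<noteq> l \<and> lof k \<le> lof l}. cross k l) \<le> (1 + 4 * D0 / \<eta>) * row l"
proof -
  define A where "A = {k\<in>S. k \<noteq> l \<and> lof k \<le> lof l}"
  define A1 where "A1 = {k\<in>A. nof (a k) = nof (a l)}"
  define A2 where "A2 = {k\<in>A. nof (a k) \<noteq> nof (a l) \<and> \<bar>a k - a l\<bar> < lof l}"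
  define A3 where "A3 = {k\<in>A. nof (a k) \<noteq> nof (a l) \<and> \<not> \<bar>a k - a l\<bar> < lof l}"
  have finA: "finite A" "finite A1" "finite A2" "finite A3" using fin by (auto simp: A_def A1_def A2_def A3_def)
  have "A = A1 \<union> (A2 \<union> A3)" "A1 \<inter> (A2 \<union> A3) = {}" "A2 \<inter> A3 = {}" by (auto simp: A1_def A2_def A3_def)
  then have split: "(\<Sum>k\<in>A. cross k l) = (\<Sum>k\<in>A1. cross k l) + ((\<Sum>k\<in>A2. cross k l) + (\<Sum>k\<in>A3. cross k l))"
    using finA by (simp add: sum.union_disjoint)
  have s1: "(\<Sum>k\<in>A1. cross k l) \<le> row l"
  proof -
    have "(\<Sum>k\<in>A1. cross k l) = (\<Sum>k\<in>A1. ln (lof l / \<bar>a k - a l\<bar>))"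
    proof (rule sum.cong[OF refl])
      fix k assume k: "k \<in> A1"
      then have "\<bar>a k - a l\<bar> < lof l" using same_part_diff[OF in_nof[of "a k"], of "a l"] in_nof[of "a l"]
        by (simp add: A1_def lof_def)
      then show "cross k l = ln (lof l / \<bar>a k - a l\<bar>)" using k by (simp add: cross_def rad_def A1_def A_def)
    qed
    also have "\<dots> \<le> row l" unfolding row_def
      by (rule sum_mono2) (use finite_pts' row_term_nonneg in \<open>auto simp: A1_def A_def pts_iff\<close>)
    finally show ?thesis .
  qed
  have s2: "(\<Sum>k\<in>A2. cross k l) \<le> 4 * D0 / \<eta> * row l"
  proof -
    have "A2 \<subseteq> {k\<in>S. \<bar>a k - a l\<bar> \<le> lof l \<and> lof k \<le> lof l}" by (auto simp: A2_def A_def)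
    then have "card A2 \<le> card {k\<in>S. \<bar>a k - a l\<bar> \<le> lof l \<and> lof k \<le> lof l}" by (intro card_mono) (use fin in auto)
    then have cA2: "real (card A2) \<le> 4 * D0 * lof l" using count_near[OF fin lof_pos[of l], of "a l"] by linarith
    have "(\<Sum>k\<in>A2. cross k l) \<le> (\<Sum>k\<in>A2. row l / (\<eta> * lof l))"
      by (intro sum_mono cross_le_row l \<eta>) (auto simp: A2_def A_def)
    also have "\<dots> = real (card A2) * (row l / (\<eta> * lof l))" by simp
    also have "\<dots> \<le> (4 * D0 * lof l) * (row l / (\<eta> * lof l))"
      using cA2 row_nonneg[of l] \<eta> lof_pos[of l] by (intro mult_right_mono) auto
    also have "\<dots> = 4 * D0 / \<eta> * row l" using lof_pos[of l] by simp
    finally show ?thesis .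
  qed
  have s3: "(\<Sum>k\<in>A3. cross k l) = 0"
  proof (rule sum.neutral, safe)
    fix k assume "k \<in> A3"
    then have "rad k l = \<bar>a k - a l\<bar>" "k \<noteq> l" by (auto simp: A3_def A_def rad_def)
    then show "cross k l = 0" using a_diff_pos[of k l] by (simp add: cross_def)
  qed
  show ?thesis using split s1 s2 s3 by (simp add: A_def algebra_simps)
qed

text \<open>Each pair is charged to the point in the longer of the two intervals.\<close>

lemma sum_cross_total:
  assumes fin: "finite S" and S: "\<And>l. l \<in> S \<Longrightarrow> l \<in> inner \<eta> (nof (a l))" and \<eta>: "\<eta> > 0"
  shows "(\<Sum>k\<in>S. \<Sum>l\<in>S-{k}. cross k l) \<le> 2 * (1 + 4 * D0 / \<eta>) * (\<Sum>l\<in>S. row l)"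
proof -
  let ?f = "\<lambda>k l. if k \<noteq> l \<and> lof k \<le> lof l then cross k l else 0"
  have "(\<Sum>k\<in>S. \<Sum>l\<in>S-{k}. cross k l) \<le> (\<Sum>k\<in>S. \<Sum>l\<in>S. ?f k l + ?f l k)"
  proof (rule sum_mono)
    fix k assume "k \<in> S"
    have "(\<Sum>l\<in>S-{k}. cross k l) \<le> (\<Sum>l\<in>S-{k}. ?f k l + ?f l k)"
      by (rule sum_mono) (use cross_sym cross_nonneg in auto)
    also have "\<dots> \<le> (\<Sum>l\<in>S. ?f k l + ?f l k)"
      by (rule sum_mono2) (use fin cross_nonneg in auto)
    finally show "(\<Sum>l\<in>S-{k}. cross k l) \<le> (\<Sum>l\<in>S. ?f k l + ?f l k)" .
  qed
  also have "\<dots> = (\<Sum>k\<in>S. \<Sum>l\<in>S. ?f k l) + (\<Sum>k\<in>S. \<Sum>l\<in>S. ?f l k)" by (simp add: sum.distrib)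
  also have "(\<Sum>k\<in>S. \<Sum>l\<in>S. ?f k l) = (\<Sum>k\<in>S. \<Sum>l\<in>S. ?f l k)" by (rule sum.swap)
  also have "(\<Sum>k\<in>S. \<Sum>l\<in>S. ?f l k) + (\<Sum>k\<in>S. \<Sum>l\<in>S. ?f l k) = 2 * (\<Sum>l\<in>S. \<Sum>k\<in>S. ?f k l)" by simp
  also have "(\<Sum>l\<in>S. \<Sum>k\<in>S. ?f k l) \<le> (\<Sum>l\<in>S. (1 + 4 * D0 / \<eta>) * row l)"
  proof (rule sum_mono)
    fix l assume l: "l \<in> S"
    have "(\<Sum>k\<in>S. ?f k l) = (\<Sum>k\<in>{k\<in>S. k \<noteq> l \<and> lof k \<le> lof l}. cross k l)"
      by (rule sum.inter_filter[symmetric, OF fin])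
    then show "(\<Sum>k\<in>S. ?f k l) \<le> (1 + 4 * D0 / \<eta>) * row l" using sum_cross_le_row[OF fin S[OF l] \<eta>] by simp
  qed
  finally show ?thesis by (simp only: sum_distrib_left mult.assoc)
qed

text \<open>Because \<open>rad\<close> dominates both the distance and the interval length, the
  points with \<open>rad k l \<le> r\<close> number at most \<open>4 * D0 * r\<close>, with no
  condition on the fine structure of the sequence.\<close>

lemma sum_near_rad:
  assumes fin: "finite S" and R: "0 < R" "R \<le> s" and S: "\<And>l. l \<in> S \<Longrightarrow> rad k l \<le> R"
  shows "(\<Sum>l\<in>S. ln 3 + ln (s / rad k l)) \<le> 4 * D0 * R * (1 + ln (3 * s / R))"
proof -
  have cnt: "real (card {l\<in>S. rad k l \<le> r}) \<le> 4 * D0 * r" if "r > 0" for r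
  proof -
    have "{l\<in>S. rad k l \<le> r} \<subseteq> {l\<in>S. \<bar>a l - a k\<bar> \<le> r \<and> lof l \<le> r}" by (auto simp: rad_def abs_minus_commute)
    then have "card {l\<in>S. rad k l \<le> r} \<le> card {l\<in>S. \<bar>a l - a k\<bar> \<le> r \<and> lof l \<le> r}" by (intro card_mono) (use fin in auto)
    then show ?thesis using count_near[OF fin that, of "a k"] by linarith
  qed
  have "{l\<in>S. rad k l \<le> R} = S" using S by auto
  then have cS: "real (card S) \<le> 4 * D0 * R" using cnt[OF R(1)] by simp
  have "(\<Sum>l\<in>S. ln 3 + ln (s / rad k l)) = (\<Sum>l\<in>S. ln (3 * s / R) + ln (R / rad k l))"
    using R rad_pos by (intro sum.cong refl) (simp add: ln_div ln_mult less_imp_neq[symmetric])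
  also have "\<dots> = real (card S) * ln (3 * s / R) + (\<Sum>l\<in>S. ln (R / rad k l))" by (simp add: sum.distrib)
  also have "\<dots> \<le> 4 * D0 * R * ln (3 * s / R) + 4 * D0 * R"
  proof (rule add_mono)
    have "0 \<le> ln (3 * s / R)" using R by (simp add: field_simps)
    then show "real (card S) * ln (3 * s / R) \<le> 4 * D0 * R * ln (3 * s / R)" using cS by (rule mult_right_mono[rotated])
    show "(\<Sum>l\<in>S. ln (R / rad k l)) \<le> 4 * D0 * R"
      by (rule sum_ln_le_of_count[OF fin _ rad_pos R(1) cnt]) (use D0 in auto)
  qed
  finally show ?thesis by (simp add: algebra_simps)
qed

section \<open>Displaced nodes and their selection\<close>

definition near_pts :: "(int \<Rightarrow> real) \<Rightarrow> bool" where
  "near_pts x \<longleftrightarrow> (\<forall>k. \<bar>x k - a k\<bar> < min (a (k+1) - a k) (a k - a (k-1)) / 3)"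

text \<open>Between two points each end gives up at most a third of an adjacent gap, and both gaps
  are part of the distance, so a third of it remains.\<close>

lemma near_pts_diff:
  assumes x: "near_pts x" shows "\<bar>a k - a l\<bar> / 3 \<le> \<bar>x k - x l\<bar>"
proof -
  have *: "(a l - a k) / 3 \<le> x l - x k" if "k < l" for k l
  proof -
    have 1: "\<bar>x k - a k\<bar> < min (a (k+1) - a k) (a k - a (k-1)) / 3" "\<bar>x l - a l\<bar> < min (a (l+1) - a l) (a l - a (l-1)) / 3"
      using x by (auto simp: near_pts_def)
    have "\<bar>x k - a k\<bar> < (a (k+1) - a k) / 3" by (rule less_le_trans[OF 1(1)]) simp
    moreover have "\<bar>x l - a l\<bar> < (a l - a (l-1)) / 3" by (rule less_le_trans[OF 1(2)]) simp
    moreover have "a (k+1) \<le> a l" "a k \<le> a (l-1)" using that a_mono by (auto simp: strict_mono_less_eq)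
    moreover have "x k - a k \<le> \<bar>x k - a k\<bar>" "a l - x l \<le> \<bar>x l - a l\<bar>" by linarith+
    ultimately show ?thesis by argo
  qed
  show ?thesis
  proof (cases k l rule: linorder_cases)
    case less then show ?thesis using *[OF less] a_mono by (auto simp: strict_mono_less abs_if)
  next
    case greater then show ?thesis using *[OF greater] a_mono by (auto simp: strict_mono_less abs_if)
  qed simp
qed

lemma near_pts_in_part:
  assumes x: "near_pts x" and k: "k \<in> pts n" and j: "j \<in> pts n" "j < k" and j': "j' \<in> pts n" "k < j'"
  shows "x k \<in> part_int c n"
proof -
  have 1: "\<bar>x k - a k\<bar> < min (a (k+1) - a k) (a k - a (k-1)) / 3" using x by (auto simp: near_pts_def)
  have lt: "a (k-1) < a k" "a k < a (k+1)" using a_mono by (auto simp: strict_mono_less)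
  have "\<bar>x k - a k\<bar> < a (k+1) - a k" "\<bar>x k - a k\<bar> < a k - a (k-1)" using 1 lt by (auto simp: min_def split: if_splits)
  moreover have "a j \<le> a (k-1)" "a (k+1) \<le> a j'" using j j' a_mono by (auto simp: strict_mono_less_eq)
  ultimately show ?thesis using j j' by (auto simp: pts_def part_int_def abs_less_iff)
qed

lemma finite_meeting: "finite {n. part_int c n \<inter> {A..B} \<noteq> {}}"
proof (rule finite_subset)
  show "{n. part_int c n \<inter> {A..B} \<noteq> {}} \<subseteq> {nof A..nof B}"
  proof (rule subsetI)
    fix n assume "n \<in> {n. part_int c n \<inter> {A..B} \<noteq> {}}"
    then obtain y where y: "y \<in> part_int c n" "y \<in> {A..B}" by blast
    have A: "A \<in> part_int c (nof A)" and B: "B \<in> part_int c (nof B)" by (rule in_nof)+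
    have "c (nof A) < c (n + 1)" using A y by (auto simp: part_int_def)
    moreover have "c n < c (nof B + 1)" using B y by (auto simp: part_int_def)
    ultimately show "n \<in> {nof A..nof B}" by (auto simp: c_less_iff)
  qed
qed simp

text \<open>Indices are lost only at the two ends of the interval, fewer than
  \<open>\<eta> * len n + 1\<close> or equally many at each.\<close>

lemma card_inner:
  assumes \<eta>: "\<eta> > 0"
  shows "real (card (pts n)) - 2 * (\<eta> * len n) - 2 \<le> real (card (inner \<eta> n))"
proof -
  let ?r = "\<eta> * len n"
  let ?A = "{k\<in>pts n. real (card {j\<in>pts n. j < k}) < ?r}" and ?B = "{k\<in>pts n. real (card {j\<in>pts n. k < j}) < ?r}"
  have r0: "?r \<ge> 0" using \<eta> len_pos[of n] by simp
  have "pts n \<subseteq> inner \<eta> n \<union> (?A \<union> ?B)" by (auto simp: inner_def)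
  then have "card (pts n) \<le> card (inner \<eta> n \<union> (?A \<union> ?B))"
    by (intro card_mono) (use finite_pts' in \<open>auto simp: inner_def\<close>)
  also have "\<dots> \<le> card (inner \<eta> n) + (card ?A + card ?B)" by (meson add_left_mono card_Un_le order.trans)
  finally have "real (card (pts n)) \<le> real (card (inner \<eta> n)) + (real (card ?A) + real (card ?B))" by linarith
  then show ?thesis using card_low_rank[OF finite_pts' r0, of n] by linarith
qed

text \<open>All inner indices of intervals meeting the window are taken, and those with large weight
  or large cross energy are discarded. The bounds on the total weight and energy limit the discarded
  ones to a small fraction of a single cell, so every cell keeps the density
  \<open>d2\<close>.\<close>

lemma select_nodes:
  fixes W :: "int \<Rightarrow> real" and x :: "int \<Rightarrow> real" and m :: nat
  assumes s: "s > 0" and \<xi>: "\<xi> > 0" and \<tau>: "\<tau> > 0" and \<kappa>: "0 < \<kappa>" "3 * \<kappa> \<le> 1" and m: "m \<ge> 1" and d2: "d2 > 0"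
    and W: "\<And>k. W k \<ge> 0" and x: "near_pts x"
    and Nn: "Nn = {n. part_int c n \<inter> {t - s..t + s} \<noteq> {}}"
    and small: "\<And>n. n \<in> Nn \<Longrightarrow> len n \<le> \<rho> * s" and \<rho>: "0 < \<rho>" "\<rho> \<le> 3 * \<kappa>"
    and irr: "(\<Sum>n\<in>Nn \<inter> Irr. len n) \<le> \<rho> * s"
    and reg: "\<And>n. n \<notin> Irr \<Longrightarrow> (d2 + 3 * \<xi>) * len n \<le> real (card (pts n)) \<and> 4 \<le> \<xi> * len n"
    and rows: "(\<Sum>n\<in>Nn. \<Sum>l\<in>pts n. row l) \<le> \<epsilon> * s\<^sup>2" and Ws: "(\<Sum>n\<in>Nn. \<Sum>k\<in>pts n. W k) \<le> \<epsilon> * s\<^sup>2"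
    and \<kappa>c: "12 * D0 * \<kappa> * (1 + ln (1 / \<kappa>)) \<le> \<tau> / 2"
    and \<rho>c: "(d2 + 2 * \<xi>) * (3 * \<rho>) \<le> \<xi> / real m"
    and \<epsilon>c: "\<epsilon> / \<tau> + 4 * (1 + 16 * D0 / \<xi>) * \<epsilon> / \<tau> \<le> \<xi> / real m"
  obtains S where "finite S"
    "\<And>j::int. - int m \<le> j \<Longrightarrow> j < int m \<Longrightarrow> d2 * s / real m \<le> real (card {k\<in>S. x k \<in> {t + s * of_int j / real m<..t + s * (of_int j + 1) / real m}})"
    "\<And>k. k \<in> S \<Longrightarrow> W k \<le> \<tau> * s"
    "\<And>k. k \<in> S \<Longrightarrow> (\<Sum>l\<in>{l\<in>S. l \<noteq> k \<and> \<bar>x k - x l\<bar> < \<kappa> * s}. ln (s / \<bar>x k - x l\<bar>)) \<le> \<tau> * s"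
proof -
  \<comment> \<open>Passing to inner indices costs \<open>2 * \<eta> * len n + 2\<close>, which is
    at most \<open>\<xi> * len n\<close> when \<open>4 \<le> \<xi> * len n\<close>.\<close>
  define \<eta> where "\<eta> = \<xi> / 4"
  have \<eta>: "\<eta> > 0" using \<xi> by (simp add: \<eta>_def)
  have finN: "finite Nn" unfolding Nn by (rule finite_meeting)
  define S0 where "S0 = (\<Union>n\<in>Nn. inner \<eta> n)"
  have inn: "inner \<eta> n \<subseteq> pts n" for n by (auto simp: inner_def)
  have finI: "finite (inner \<eta> n)" for n using finite_pts' inn by (rule finite_subset[rotated])
  have finS0: "finite S0" unfolding S0_def using finN finI by auto
  have S0in: "k \<in> inner \<eta> (nof (a k)) \<and> nof (a k) \<in> Nn" if "k \<in> S0" for k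
    using that inn by (auto simp: S0_def pts_iff inner_def)
  have sumS0: "(\<Sum>k\<in>S0. f k) \<le> (\<Sum>n\<in>Nn. \<Sum>k\<in>pts n. f k)" if "\<And>k. f k \<ge> 0" for f :: "int \<Rightarrow> real"
  proof -
    have "(\<Sum>k\<in>S0. f k) \<le> (\<Sum>k\<in>(\<Union>n\<in>Nn. pts n). f k)"
      by (rule sum_mono2) (use finN finite_pts' inn that in \<open>auto simp: S0_def\<close>)
    also have "\<dots> = (\<Sum>n\<in>Nn. \<Sum>k\<in>pts n. f k)"
      by (rule sum.UNION_disjoint) (use finN finite_pts' in \<open>auto simp: pts_iff\<close>)
    finally show ?thesis .
  qed
  define cr where "cr k = (\<Sum>l\<in>S0-{k}. cross k l)" for k
  have cr0: "cr k \<ge> 0" for k unfolding cr_def by (intro sum_nonneg cross_nonneg) auto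
  define B1 where "B1 = {k\<in>S0. W k > \<tau> * s}"
  define B2 where "B2 = {k\<in>S0. cr k > \<tau> * s / 2}"
  define S where "S = S0 - (B1 \<union> B2)"
  have \<tau>s: "\<tau> * s > 0" using \<tau> s by simp
  have c1: "real (card B1) \<le> \<epsilon> / \<tau> * s"
  proof -
    have "real (card B1) \<le> (\<Sum>k\<in>S0. W k) / (\<tau> * s)" unfolding B1_def by (rule card_gt_le_sum[OF finS0 W \<tau>s])
    also have "\<dots> \<le> (\<epsilon> * s\<^sup>2) / (\<tau> * s)" using sumS0[of W, OF W] Ws \<tau>s by (intro divide_right_mono) auto
    also have "\<dots> = \<epsilon> / \<tau> * s" using s by (simp add: power2_eq_square)
    finally show ?thesis .
  qed
  have c2: "real (card B2) \<le> 4 * (1 + 16 * D0 / \<xi>) * \<epsilon> / \<tau> * s"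
  proof -
    have "real (card B2) \<le> (\<Sum>k\<in>S0. cr k) / (\<tau> * s / 2)" unfolding B2_def
      by (rule card_gt_le_sum[OF finS0 cr0]) (use \<tau>s in simp)
    also have "\<dots> \<le> (2 * (1 + 4 * D0 / \<eta>) * (\<epsilon> * s\<^sup>2)) / (\<tau> * s / 2)"
    proof (rule divide_right_mono)
      have "(\<Sum>k\<in>S0. cr k) \<le> 2 * (1 + 4 * D0 / \<eta>) * (\<Sum>l\<in>S0. row l)"
        unfolding cr_def by (rule sum_cross_total[OF finS0 _ \<eta>]) (use S0in in blast)
      also have "\<dots> \<le> 2 * (1 + 4 * D0 / \<eta>) * (\<epsilon> * s\<^sup>2)"
        using sumS0[of row, OF row_nonneg] rows \<eta> D0 by (intro mult_left_mono) auto
      finally show "(\<Sum>k\<in>S0. cr k) \<le> 2 * (1 + 4 * D0 / \<eta>) * (\<epsilon> * s\<^sup>2)" .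
    qed (use \<tau>s in simp)
    also have "\<dots> = 4 * (1 + 16 * D0 / \<xi>) * \<epsilon> / \<tau> * s" using s \<xi> \<tau> by (simp add: \<eta>_def power2_eq_square field_simps)
    finally show ?thesis .
  qed
  have finS: "finite S" using finS0 by (simp add: S_def)
  have SS0: "S \<subseteq> S0" by (auto simp: S_def)
  \<comment> \<open>Counted over the whole window but compared with one cell, so the loss can be
    subtracted from each cell separately.\<close>
  have removed: "real (card B1) + real (card B2) \<le> \<xi> / real m * s"
  proof -
    have "(\<epsilon> / \<tau> + 4 * (1 + 16 * D0 / \<xi>) * \<epsilon> / \<tau>) * s \<le> \<xi> / real m * s" using \<epsilon>c s by (intro mult_right_mono) auto
    then show ?thesis using c1 c2 unfolding distrib_right by linarith
  qed
  show thesis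
  proof (rule that[OF finS])
    fix j :: int assume j: "- int m \<le> j" "j < int m"
    define p where "p = t + s * of_int j / real m"
    define p' where "p' = t + s * (of_int j + 1) / real m"
    have mpos: "real m > 0" using m by simp
    have pp: "p' - p = s / real m" using mpos by (simp add: p_def p'_def field_simps)
    have pp0: "p < p'" using pp s mpos by (metis diff_gt_0_iff_gt divide_pos_pos)
    have "- real m \<le> of_int j" "of_int j + 1 \<le> real m" using j by linarith+
    then have "s * (- real m) \<le> s * of_int j" "s * (of_int j + 1) \<le> s * real m" using s by (intro mult_left_mono; simp)+
    then have "- s \<le> s * of_int j / real m" "s * (of_int j + 1) / real m \<le> s" using mpos by (simp_all add: field_simps)
    then have win: "t - s \<le> p" "p' \<le> t + s" by (auto simp: p_def p'_def)
    \<comment> \<open>Only regular intervals contained in the cell are used, since a displaced inner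
      point stays in its interval. What is lost of the length \<open>s / m\<close> is at most
      \<open>3 * \<rho> * s\<close>: the irregular intervals once, and the two intervals containing
      the ends of the cell.\<close>
    define F where "F = {n\<in>Nn. part_int c n \<subseteq> {p<..p'} \<and> n \<notin> Irr}"
    have finF: "finite F" using finN by (simp add: F_def)
    have inNn: "nof y \<in> Nn" if "y \<in> {t - s..t + s}" for y using in_nof[of y] that by (auto simp: Nn)
    have cov: "{p<..p'} \<subseteq> (\<Union>n\<in>F \<union> ((Nn \<inter> Irr) \<union> {nof p, nof p'}). part_int c n)"
    proof
      fix y assume y: "y \<in> {p<..p'}"
      define n where "n = nof y"
      have yn: "y \<in> part_int c n" unfolding n_def by (rule in_nof)
      have nN: "n \<in> Nn" unfolding n_def by (rule inNn) (use y win in auto)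
      have "n \<in> F \<union> ((Nn \<inter> Irr) \<union> {nof p, nof p'})"
      proof (rule ccontr)
        assume neg: "n \<notin> F \<union> ((Nn \<inter> Irr) \<union> {nof p, nof p'})"
        then have "\<not> part_int c n \<subseteq> {p<..p'}" using nN by (auto simp: F_def)
        then have "c n < p \<or> p' < c (n+1)" by (auto simp: part_int_def)
        then have "p \<in> part_int c n \<or> p' \<in> part_int c n" using yn y by (auto simp: part_int_def)
        then have "nof p = n \<or> nof p' = n" using nof_eq by blast
        then show False using neg by auto
      qed
      then show "y \<in> (\<Union>n\<in>F \<union> ((Nn \<inter> Irr) \<union> {nof p, nof p'}). part_int c n)" using yn by blast
    qed
    have "s / real m \<le> (\<Sum>n\<in>F \<union> ((Nn \<inter> Irr) \<union> {nof p, nof p'}). len n)"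
      using le_sum_len[OF _ cov] finF finN pp pp0 by auto
    also have "\<dots> \<le> (\<Sum>n\<in>F. len n) + ((\<Sum>n\<in>Nn \<inter> Irr. len n) + (\<Sum>n\<in>{nof p, nof p'}. len n))"
    proof -
      have le_un: "(\<Sum>n\<in>A \<union> B. len n) \<le> (\<Sum>n\<in>A. len n) + (\<Sum>n\<in>B. len n)" if "finite A" "finite B" for A B
        using that len_pos by (simp add: sum_Un less_imp_le sum_nonneg)
      have "(\<Sum>n\<in>F \<union> ((Nn \<inter> Irr) \<union> {nof p, nof p'}). len n) \<le> (\<Sum>n\<in>F. len n) + (\<Sum>n\<in>(Nn \<inter> Irr) \<union> {nof p, nof p'}. len n)"
        by (rule le_un) (use finF finN in auto)
      moreover have "(\<Sum>n\<in>(Nn \<inter> Irr) \<union> {nof p, nof p'}. len n) \<le> (\<Sum>n\<in>Nn \<inter> Irr. len n) + (\<Sum>n\<in>{nof p, nof p'}. len n)"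
        by (rule le_un) (use finN in auto)
      ultimately show ?thesis by linarith
    qed
    also have "(\<Sum>n\<in>{nof p, nof p'}. len n) \<le> 2 * (\<rho> * s)"
    proof -
      have l1: "len (nof p) \<le> \<rho> * s" by (intro small inNn) (use win pp0 in auto)
      have l2: "len (nof p') \<le> \<rho> * s" by (intro small inNn) (use win pp0 in auto)
      show ?thesis using l1 l2 len_pos[of "nof p"] len_pos[of "nof p'"] by (cases "nof p = nof p'") auto
    qed
    finally have lenF: "s / real m - 3 * \<rho> * s \<le> (\<Sum>n\<in>F. len n)" using irr by simp
    define C where "C = (\<Union>n\<in>F. inner \<eta> n)"
    have finC: "finite C" using finF finI by (auto simp: C_def)
    have CS0: "C \<subseteq> S0" by (auto simp: C_def S0_def F_def)
    have xC: "x k \<in> {p<..p'}" if kC: "k \<in> C" for k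
    proof -
      obtain n where n: "n \<in> F" "k \<in> inner \<eta> n" using kC by (auto simp: C_def)
      have pos: "\<eta> * len n > 0" using \<eta> len_pos by simp
      have kp: "k \<in> pts n" using n inn by blast
      have "real (card {j\<in>pts n. j < k}) > 0" "real (card {j\<in>pts n. k < j}) > 0" using n(2) pos by (auto simp: inner_def)
      then have "{j\<in>pts n. j < k} \<noteq> {}" "{j\<in>pts n. k < j} \<noteq> {}" by (auto simp: card_gt_0_iff)
      then obtain j1 j2 where "j1 \<in> pts n" "j1 < k" "j2 \<in> pts n" "k < j2" by blast
      then have "x k \<in> part_int c n" using near_pts_in_part[OF x kp] by blast
      then show ?thesis using n(1) by (auto simp: F_def)
    qed
    have cardC: "(d2 + \<xi>) * s / real m \<le> real (card C)"
    proof -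
      have "(d2 + 2 * \<xi>) * (s / real m - 3 * \<rho> * s) \<le> (d2 + 2 * \<xi>) * (\<Sum>n\<in>F. len n)"
        using lenF d2 \<xi> by (intro mult_left_mono) auto
      also have "\<dots> = (\<Sum>n\<in>F. (d2 + 2 * \<xi>) * len n)" by (rule sum_distrib_left)
      also have "\<dots> \<le> (\<Sum>n\<in>F. real (card (inner \<eta> n)))"
      proof (rule sum_mono)
        fix n assume "n \<in> F"
        then have r: "(d2 + 3 * \<xi>) * len n \<le> real (card (pts n))" "4 \<le> \<xi> * len n" using reg by (auto simp: F_def)
        have "(d2 + 2 * \<xi>) * len n = (d2 + 3 * \<xi>) * len n - \<xi> * len n" by (simp add: algebra_simps)
        also have "\<dots> \<le> real (card (pts n)) - 2 * (\<eta> * len n) - 2" using r by (simp add: \<eta>_def)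
        also have "\<dots> \<le> real (card (inner \<eta> n))" by (rule card_inner[OF \<eta>])
        finally show "(d2 + 2 * \<xi>) * len n \<le> real (card (inner \<eta> n))" .
      qed
      also have "\<dots> = real (card C)"
      proof -
        have "card C = (\<Sum>n\<in>F. card (inner \<eta> n))" unfolding C_def
          by (rule card_UN_disjoint) (use finF finI inn in \<open>auto simp: pts_iff inner_def\<close>)
        then show ?thesis by simp
      qed
      finally have 1: "(d2 + 2 * \<xi>) * (s / real m - 3 * \<rho> * s) \<le> real (card C)" .
      have "((d2 + 2 * \<xi>) * (3 * \<rho>)) * s \<le> (\<xi> / real m) * s" using \<rho>c s by (intro mult_right_mono) auto
      moreover have "(d2 + 2 * \<xi>) * (s / real m - 3 * \<rho> * s) = (d2 + \<xi>) * s / real m + \<xi> / real m * s - ((d2 + 2 * \<xi>) * (3 * \<rho>)) * s"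
        using mpos by (simp add: field_simps)
      ultimately show ?thesis using 1 by linarith
    qed
    have "C \<subseteq> {k\<in>S. x k \<in> {p<..p'}} \<union> (B1 \<union> B2)" using CS0 xC by (auto simp: S_def)
    then have "card C \<le> card ({k\<in>S. x k \<in> {p<..p'}} \<union> (B1 \<union> B2))"
      by (intro card_mono) (use finS finS0 in \<open>auto simp: B1_def B2_def\<close>)
    also have "\<dots> \<le> card {k\<in>S. x k \<in> {p<..p'}} + (card B1 + card B2)" by (meson add_left_mono card_Un_le order.trans)
    finally have "real (card C) \<le> real (card {k\<in>S. x k \<in> {p<..p'}}) + (real (card B1) + real (card B2))" by linarith
    then have "(d2 + \<xi>) * s / real m - \<xi> / real m * s \<le> real (card {k\<in>S. x k \<in> {p<..p'}})" using cardC removed by linarith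
    moreover have "(d2 + \<xi>) * s / real m - \<xi> / real m * s = d2 * s / real m" using mpos by (simp add: field_simps)
    ultimately show "d2 * s / real m \<le> real (card {k\<in>S. x k \<in> {t + s * of_int j / real m<..t + s * (of_int j + 1) / real m}})"
      by (simp add: p_def p'_def)
  next
    fix k assume "k \<in> S"
    then show "W k \<le> \<tau> * s" by (auto simp: S_def B1_def)
  next
    fix k assume k: "k \<in> S"
    have kS0: "k \<in> S0" and crk: "cr k \<le> \<tau> * s / 2" using k by (auto simp: S_def B2_def)
    define V where "V = {l\<in>S. l \<noteq> k \<and> \<bar>x k - x l\<bar> < \<kappa> * s}"
    have finV: "finite V" using finS by (simp add: V_def)
    have lofS: "lof l \<le> 3 * \<kappa> * s" if "l \<in> S0" for l
    proof -
      have "lof l \<le> \<rho> * s" unfolding lof_def using small S0in[OF that] by blast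
      also have "\<dots> \<le> 3 * \<kappa> * s" using \<rho> s by (intro mult_right_mono) auto
      finally show ?thesis .
    qed
    have xpos: "\<bar>x k - x l\<bar> > 0" if "l \<noteq> k" for l
    proof -
      have "0 < \<bar>a k - a l\<bar> / 3" using a_diff_pos[of k l] that by simp
      then show ?thesis using near_pts_diff[OF x, of k l] by (rule less_le_trans)
    qed
    have radV: "rad k l \<le> 3 * \<kappa> * s" if "l \<in> V" for l
    proof -
      have "\<bar>a k - a l\<bar> \<le> 3 * \<bar>x k - x l\<bar>" using near_pts_diff[OF x, of k l] by simp
      moreover have "\<bar>x k - x l\<bar> < \<kappa> * s" "l \<in> S0" using that SS0 by (auto simp: V_def)
      ultimately show ?thesis using lofS[OF kS0] lofS[of l] by (simp add: rad_def)
    qed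
    \<comment> \<open>The displacement costs \<open>ln 3\<close> per pair. The part with
      \<open>rad\<close> is bounded by counting within radius \<open>3 * \<kappa> * s\<close>, the
      part with \<open>cross\<close> by the selection; each uses half of
      \<open>\<tau> * s\<close>.\<close>
    have "(\<Sum>l\<in>V. ln (s / \<bar>x k - x l\<bar>)) \<le> (\<Sum>l\<in>V. (ln 3 + ln (s / rad k l)) + cross k l)"
    proof (rule sum_mono)
      fix l assume l: "l \<in> V"
      then have ne: "l \<noteq> k" by (auto simp: V_def)
      have apos: "\<bar>a k - a l\<bar> > 0" using a_diff_pos[of k l] ne by simp
      have "s / \<bar>x k - x l\<bar> \<le> s / (\<bar>a k - a l\<bar> / 3)" using near_pts_diff[OF x, of k l] apos s xpos[OF ne] by (intro divide_left_mono) auto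
      then have "ln (s / \<bar>x k - x l\<bar>) \<le> ln (s / (\<bar>a k - a l\<bar> / 3))" using s xpos[OF ne] by (intro ln_mono) auto
      also have "s / (\<bar>a k - a l\<bar> / 3) = 3 * ((s / rad k l) * (rad k l / \<bar>a k - a l\<bar>))" using rad_pos[of k l] by simp
      also have "ln \<dots> = (ln 3 + ln (s / rad k l)) + cross k l"
        unfolding cross_def using s rad_pos[of k l] apos by (subst ln_mult_pos, simp, simp, subst ln_mult_pos) auto
      finally show "ln (s / \<bar>x k - x l\<bar>) \<le> (ln 3 + ln (s / rad k l)) + cross k l" .
    qed
    also have "\<dots> = (\<Sum>l\<in>V. ln 3 + ln (s / rad k l)) + (\<Sum>l\<in>V. cross k l)" by (rule sum.distrib)
    also have "\<dots> \<le> \<tau> * s / 2 + \<tau> * s / 2"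
    proof (rule add_mono)
      have "(\<Sum>l\<in>V. cross k l) \<le> cr k" unfolding cr_def
        by (rule sum_mono2) (use finS0 SS0 cross_nonneg in \<open>auto simp: V_def\<close>)
      then show "(\<Sum>l\<in>V. cross k l) \<le> \<tau> * s / 2" using crk by linarith
      have "3 * \<kappa> * s \<le> 1 * s" using \<kappa> s by (intro mult_right_mono) auto
      then have "(\<Sum>l\<in>V. ln 3 + ln (s / rad k l)) \<le> 4 * D0 * (3 * \<kappa> * s) * (1 + ln (3 * s / (3 * \<kappa> * s)))"
        by (intro sum_near_rad finV radV) (use \<kappa> s in auto)
      also have "\<dots> = (12 * D0 * \<kappa> * (1 + ln (1 / \<kappa>))) * s" using s by simp
      also have "\<dots> \<le> \<tau> / 2 * s" using \<kappa>c s by (intro mult_right_mono) auto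
      finally show "(\<Sum>l\<in>V. ln 3 + ln (s / rad k l)) \<le> \<tau> * s / 2" by simp
    qed
    finally show "(\<Sum>l\<in>{l\<in>S. l \<noteq> k \<and> \<bar>x k - x l\<bar> < \<kappa> * s}. ln (s / \<bar>x k - x l\<bar>)) \<le> \<tau> * s" by (simp add: V_def)
  qed
qed

end

section \<open>From uniformity to a Poisson-summable density\<close>

lemma int_finite_exceptions:
  assumes "eventually P (at_top :: int filter)" "eventually P (at_bot :: int filter)"
  shows "finite {n. \<not> P n}"
proof -
  obtain M N where MN: "\<And>n. n \<ge> M \<Longrightarrow> P n" "\<And>n. n \<le> N \<Longrightarrow> P n"
    using assms by (auto simp: eventually_at_top_linorder eventually_at_bot_linorder)
  have "{n. \<not> P n} \<subseteq> {N..M}"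
  proof
    fix n assume "n \<in> {n. \<not> P n}"
    then have "\<not> n \<ge> M" "\<not> n \<le> N" using MN by blast+
    then show "n \<in> {N..M}" by simp
  qed
  then show ?thesis by (rule finite_subset) simp
qed

text \<open>By \<open>ln x \<le> x - 1\<close> at \<open>1 / sqrt \<kappa>\<close>, the quantity is
  at most \<open>2 * C * sqrt \<kappa>\<close>; \<kappa> is taken as the square of a multiple of
  \<tau>.\<close>

lemma small_entropy_factor:
  fixes C \<tau> :: real
  assumes "C \<ge> 1" "\<tau> > 0"
  obtains \<kappa> where "0 < \<kappa>" "3 * \<kappa> \<le> 1" "C * \<kappa> * (1 + ln (1 / \<kappa>)) \<le> \<tau>"
proof -
  define \<kappa> where "\<kappa> = min (1/3) ((\<tau> / (3 * C))\<^sup>2)"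
  have pos: "\<kappa> > 0" using assms by (simp add: \<kappa>_def)
  have le: "\<kappa> \<le> 1/3" by (simp add: \<kappa>_def)
  have sq: "sqrt \<kappa> \<le> \<tau> / (3 * C)"
  proof (rule real_le_lsqrt)
    show "\<kappa> \<le> (\<tau> / (3 * C))\<^sup>2" by (simp add: \<kappa>_def)
  qed (use assms pos in auto)
  have ks: "\<kappa> = sqrt \<kappa> * sqrt \<kappa>" using pos by simp
  have s1: "sqrt \<kappa> \<le> 1" using le by simp
  have "ln (1 / \<kappa>) = 2 * ln (1 / sqrt \<kappa>)" using pos by (simp add: ln_div ln_sqrt)
  also have "\<dots> \<le> 2 * (1 / sqrt \<kappa> - 1)" using pos ln_le_minus_one[of "1 / sqrt \<kappa>"] by simp
  finally have "1 + ln (1 / \<kappa>) \<le> 2 / sqrt \<kappa>" by simp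
  then have "C * \<kappa> * (1 + ln (1 / \<kappa>)) \<le> C * \<kappa> * (2 / sqrt \<kappa>)" using assms pos by (intro mult_left_mono) auto
  also have "\<dots> = 2 * C * sqrt \<kappa>" using pos by (simp add: real_div_sqrt field_simps)
  also have "\<dots> \<le> 2 * C * (\<tau> / (3 * C))" using sq assms by (intro mult_left_mono) auto
  also have "\<dots> \<le> \<tau>" using assms by (simp add: field_simps)
  finally show thesis using that pos le by simp
qed

lemma infdist_part_int:
  fixes c :: "int \<Rightarrow> real"
  assumes x: "x \<in> part_int c n"
  shows "infdist 0 (part_int c n) \<le> \<bar>x\<bar>" "\<bar>x\<bar> \<le> infdist 0 (part_int c n) + (c (n+1) - c n)"
proof -
  have ne: "part_int c n \<noteq> {}" using x by auto
  show "infdist 0 (part_int c n) \<le> \<bar>x\<bar>" using infdist_le[OF x, of 0] by (simp add: dist_real_def)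
  have "\<bar>x\<bar> - (c (n+1) - c n) \<le> infdist 0 (part_int c n)"
    unfolding infdist_notempty[OF ne]
  proof (rule cINF_greatest[OF ne])
    fix y assume "y \<in> part_int c n"
    then have "\<bar>x - y\<bar> \<le> c (n+1) - c n" using x by (auto simp: part_int_def abs_le_iff)
    then show "\<bar>x\<bar> - (c (n+1) - c n) \<le> dist 0 y" by (simp add: dist_real_def)
  qed
  then show "\<bar>x\<bar> \<le> infdist 0 (part_int c n) + (c (n+1) - c n)" by simp
qed

lemma summable_on_term_le:
  fixes f :: "int \<Rightarrow> real"
  assumes "f summable_on UNIV" "\<And>n. f n \<ge> 0"
  shows "f n \<le> infsum f UNIV"
  using finite_sum_le_infsum[of f UNIV "{n}"] assms by simp

lemma summable_on_nonneg_le: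
  fixes f g :: "int \<Rightarrow> real"
  assumes "g summable_on UNIV" "\<And>n. 0 \<le> f n" "\<And>n. f n \<le> g n"
  shows "f summable_on UNIV"
  using summable_on_comparison_test[OF assms(1)] assms(2,3) by simp

context partitioned_points
begin

text \<open>The indices between \<open>k\<close> and \<open>l\<close> are points in the intervals
  between them, so linear density bounds the index difference by distance plus the two end
  intervals. It serves to convert sums weighted by \<open>1 + k\<^sup>2\<close> into sums over
  intervals weighted by their distance from 0.\<close>

lemma index_diff_le: "\<bar>real_of_int (k - l)\<bar> \<le> D0 * (\<bar>a k - a l\<bar> + lof k + lof l)"
proof -
  have *: "real_of_int (l - k) \<le> D0 * ((a l - a k) + lof k + lof l)" if "k < l" for k l
  proof -
    define F where "F = {nof (a k)..nof (a l)}"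
    define A where "A = c (nof (a k))"
    define B where "B = c (nof (a l) + 1)"
    have k: "a k \<in> part_int c (nof (a k))" and l: "a l \<in> part_int c (nof (a l))" by (rule in_nof)+
    have akl: "a k < a l" using that a_mono by (simp add: strict_mono_less)
    have AB: "A \<le> B" using k l akl by (auto simp: A_def B_def part_int_def)
    have "{k..l} \<subseteq> (\<Union>n\<in>F. pts n)"
    proof
      fix j assume j: "j \<in> {k..l}"
      then have "a k \<le> a j" "a j \<le> a l" using a_mono by (auto simp: strict_mono_less_eq)
      moreover have "a j \<in> part_int c (nof (a j))" by (rule in_nof)
      ultimately have "c (nof (a k)) < c (nof (a j) + 1)" "c (nof (a j)) < c (nof (a l) + 1)" using k l by (auto simp: part_int_def)
      then have "nof (a j) \<in> F" by (auto simp: F_def c_less_iff)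
      then show "j \<in> (\<Union>n\<in>F. pts n)" using pts_iff by blast
    qed
    then have "card {k..l} \<le> card (\<Union>n\<in>F. pts n)" by (intro card_mono) (use finite_pts' in \<open>auto simp: F_def\<close>)
    also have "\<dots> \<le> (\<Sum>n\<in>F. card (pts n))" by (rule card_UN_le) (simp add: F_def)
    finally have "real (card {k..l}) \<le> (\<Sum>n\<in>F. real (card (pts n)))" by (metis of_nat_le_iff of_nat_sum)
    also have "\<dots> \<le> (\<Sum>n\<in>F. D0 * len n)" by (intro sum_mono card_pts')
    also have "\<dots> = D0 * (\<Sum>n\<in>F. len n)" by (rule sum_distrib_left[symmetric])
    also have "\<dots> \<le> D0 * (B - A)"
    proof (intro mult_left_mono sum_len_le AB)
      fix n assume "n \<in> F"
      then have "A \<le> c n" "c (n+1) \<le> B" by (auto simp: F_def A_def B_def c_le_iff)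
      then show "part_int c n \<subseteq> {A..B}" by (auto simp: part_int_def)
    qed (use D0 in \<open>auto simp: F_def\<close>)
    also have "\<dots> \<le> D0 * ((a l - a k) + lof k + lof l)"
      using k l D0 by (intro mult_left_mono) (auto simp: A_def B_def part_int_def lof_def len_def)
    finally show ?thesis using that by simp
  qed
  show ?thesis
  proof (cases k l rule: linorder_cases)
    case less
    then have "a k < a l" using a_mono by (simp add: strict_mono_less)
    then show ?thesis using *[OF less] less by (simp add: algebra_simps)
  next
    case equal then show ?thesis using D0 lof_pos[of l] by simp
  next
    case greater
    then have "a l < a k" using a_mono by (simp add: strict_mono_less)
    then show ?thesis using *[OF greater] greater by (simp add: algebra_simps)
  qed
qed

text \<open>A point has one partner fewer than the interval has points, whence the last term. It is
  at most of the order of the squared length, which is summable for a short partition.\<close>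

lemma sum_row_energy:
  "(\<Sum>l\<in>pts n. row l) = (real (card (pts n)))\<^sup>2 * ln (len n) - energy (range a \<inter> part_int c n) - real (card (pts n)) * ln (len n)"
proof -
  have inj: "inj a" using a_mono by (rule strict_mono_imp_inj_on)
  have img: "range a \<inter> part_int c n = a ` pts n" by (auto simp: pts_def)
  define P where "P = Sigma (pts n) (\<lambda>l. pts n - {l})"
  have eq: "{(x,y). x \<in> a ` pts n \<and> y \<in> a ` pts n \<and> x \<noteq> y} = (\<lambda>(l,j). (a l, a j)) ` P"
  proof (intro equalityI subsetI)
    fix z assume "z \<in> {(x,y). x \<in> a ` pts n \<and> y \<in> a ` pts n \<and> x \<noteq> y}"
    then obtain l j where lj: "z = (a l, a j)" "l \<in> pts n" "j \<in> pts n" "a l \<noteq> a j" by auto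
    then have "(l, j) \<in> P" by (auto simp: P_def)
    then show "z \<in> (\<lambda>(l,j). (a l, a j)) ` P" unfolding lj(1) by (rule rev_image_eqI) simp
  next
    fix z assume "z \<in> (\<lambda>(l,j). (a l, a j)) ` P"
    then obtain l j where lj: "z = (a l, a j)" "(l, j) \<in> P" by auto
    then show "z \<in> {(x,y). x \<in> a ` pts n \<and> y \<in> a ` pts n \<and> x \<noteq> y}" by (auto simp: P_def inj_eq[OF inj])
  qed
  have injP: "inj_on (\<lambda>(l,j). (a l, a j)) P" by (auto simp: inj_on_def inj_eq[OF inj])
  have "energy (range a \<inter> part_int c n) = (\<Sum>(l,j)\<in>P. ln \<bar>a l - a j\<bar>)"
    unfolding energy_def img eq sum.reindex[OF injP] by (simp add: case_prod_unfold o_def)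
  also have "\<dots> = (\<Sum>l\<in>pts n. \<Sum>j\<in>pts n - {l}. ln \<bar>a l - a j\<bar>)"
    unfolding P_def by (rule sum.Sigma[symmetric]) (use finite_pts' in auto)
  finally have E: "energy (range a \<inter> part_int c n) = (\<Sum>l\<in>pts n. \<Sum>j\<in>pts n - {l}. ln \<bar>a l - a j\<bar>)" .
  have "(\<Sum>l\<in>pts n. row l) = (\<Sum>l\<in>pts n. \<Sum>j\<in>pts n - {l}. ln (len n) - ln \<bar>a l - a j\<bar>)"
  proof (rule sum.cong[OF refl])
    fix l assume l: "l \<in> pts n"
    then have nl: "nof (a l) = n" by (simp add: pts_iff)
    show "row l = (\<Sum>j\<in>pts n - {l}. ln (len n) - ln \<bar>a l - a j\<bar>)"
      unfolding row_def lof_def nl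
    proof (rule sum.cong[OF refl])
      fix j assume "j \<in> pts n - {l}"
      then have "\<bar>a j - a l\<bar> > 0" using a_diff_pos[of j l] by simp
      then show "ln (len n / \<bar>a j - a l\<bar>) = ln (len n) - ln \<bar>a l - a j\<bar>" using len_pos[of n] by (simp add: ln_div abs_minus_commute)
    qed
  qed
  also have "\<dots> = (\<Sum>l\<in>pts n. real (card (pts n) - 1) * ln (len n)) - energy (range a \<inter> part_int c n)"
    unfolding E sum_subtractf[symmetric]
    by (intro sum.cong refl) (use finite_pts' in \<open>simp add: sum_subtractf\<close>)
  also have "(\<Sum>l\<in>pts n. real (card (pts n) - 1) * ln (len n)) = real (card (pts n)) * (real (card (pts n) - 1) * ln (len n))" by simp
  also have "\<dots> = (real (card (pts n)))\<^sup>2 * ln (len n) - real (card (pts n)) * ln (len n)"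
    by (cases "card (pts n)") (simp_all add: power2_eq_square algebra_simps)
  finally show ?thesis by simp
qed

text \<open>The mass \<open>Q n\<close> spread evenly over the interval \<open>n\<close>.\<close>

definition qf :: "(int \<Rightarrow> real) \<Rightarrow> real \<Rightarrow> real" where "qf Q x = Q (nof x) / len (nof x)"

lemma nof_measurable: "nof \<in> borel \<rightarrow>\<^sub>M count_space UNIV"
proof (subst measurable_count_space_eq2_countable, safe)
  fix n
  have "nof -` {n} \<inter> space borel = part_int c n" using in_nof nof_eq by auto
  then show "nof -` {n} \<inter> space borel \<in> sets borel" by (simp add: part_int_def)
qed auto

lemma qf_measurable [measurable]: "qf Q \<in> borel_measurable borel"
proof -
  have "(\<lambda>n. Q n / len n) \<in> count_space UNIV \<rightarrow>\<^sub>M borel" by simp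
  from measurable_compose[OF nof_measurable this] show ?thesis by (simp add: qf_def[abs_def])
qed

lemma qf_on_part: "x \<in> part_int c n \<Longrightarrow> qf Q x = Q n / len n"
  by (simp add: qf_def nof_eq)

lemma nn_integral_part_const:
  assumes "v \<ge> 0"
  shows "(\<integral>\<^sup>+x. ennreal v * indicator (part_int c n) x \<partial>lborel) = ennreal (v * len n)"
  using assms len_pos[of n] by (simp add: part_int_def len_def nn_integral_cmult_indicator ennreal_mult)

lemma qf_integral_finite:
  assumes Q: "\<And>n. Q n \<ge> 0" and sm: "(\<lambda>n. Q n / (1 + (infdist 0 (part_int c n))\<^sup>2)) summable_on UNIV"
  shows "(\<integral>\<^sup>+x. ennreal (qf Q x / (1 + x\<^sup>2)) \<partial>lborel) < top"
proof -
  let ?d = "\<lambda>n. 1 + (infdist 0 (part_int c n))\<^sup>2"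
  define v where "v i = Q (int_decode i) / len (int_decode i) / ?d (int_decode i)" for i
  have d1: "?d n \<ge> 1" for n by simp
  have v0: "v i \<ge> 0" for i using Q[of "int_decode i"] len_pos[of "int_decode i"] by (simp add: v_def)
  have "(\<integral>\<^sup>+x. ennreal (qf Q x / (1 + x\<^sup>2)) \<partial>lborel) \<le> (\<integral>\<^sup>+x. (\<Sum>i. ennreal (v i) * indicator (part_int c (int_decode i)) x) \<partial>lborel)"
  proof (rule nn_integral_mono)
    fix x
    define i where "i = int_encode (nof x)"
    have xi: "x \<in> part_int c (int_decode i)" using in_nof by (simp add: i_def)
    have "(infdist 0 (part_int c (nof x)))\<^sup>2 \<le> \<bar>x\<bar>\<^sup>2"
      using infdist_part_int(1)[OF in_nof[of x]] infdist_nonneg by (intro power_mono) auto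
    then have "?d (nof x) \<le> 1 + x\<^sup>2" by simp
    then have "qf Q x / (1 + x\<^sup>2) \<le> qf Q x / ?d (nof x)"
      using Q[of "nof x"] len_pos[of "nof x"] d1[of "nof x"] by (intro divide_left_mono mult_pos_pos) (auto simp: qf_def add_pos_nonneg)
    also have "\<dots> = v i" by (simp add: v_def i_def qf_def)
    finally have "ennreal (qf Q x / (1 + x\<^sup>2)) \<le> ennreal (v i) * indicator (part_int c (int_decode i)) x" using xi by (simp add: ennreal_leI)
    also have "\<dots> \<le> (\<Sum>k. ennreal (v k) * indicator (part_int c (int_decode k)) x)"
    proof -
      have "f i \<le> suminf f" for f :: "nat \<Rightarrow> ennreal" using sum_le_suminf[of f "{i}"] by simp
      then show ?thesis .
    qed
    finally show "ennreal (qf Q x / (1 + x\<^sup>2)) \<le> (\<Sum>i. ennreal (v i) * indicator (part_int c (int_decode i)) x)" .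
  qed
  also have "\<dots> = (\<Sum>i. \<integral>\<^sup>+x. ennreal (v i) * indicator (part_int c (int_decode i)) x \<partial>lborel)"
    by (rule nn_integral_suminf) (auto simp: part_int_def)
  also have "\<dots> = (\<Sum>i. ennreal (Q (int_decode i) / ?d (int_decode i)))"
    using v0 len_pos by (intro suminf_cong) (simp add: nn_integral_part_const v_def less_imp_neq[symmetric])
  also have "\<dots> < top"
  proof -
    have "(\<lambda>i. Q (int_decode i) / ?d (int_decode i)) summable_on UNIV"
      using summable_on_reindex_bij_betw[OF bij_int_decode, of "\<lambda>n. Q n / ?d n"] sm by simp
    then have "summable (\<lambda>i. Q (int_decode i) / ?d (int_decode i))" by (rule summable_on_imp_summable)
    moreover have "0 \<le> Q (int_decode i) / ?d (int_decode i)" for i using Q by simp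
    ultimately show ?thesis by (subst suminf_ennreal2) auto
  qed
  finally show ?thesis .
qed

lemma sum_Q_window:
  assumes Q: "\<And>n. Q n \<ge> 0" and fin: "finite F" and sub: "\<And>n. n \<in> F \<Longrightarrow> part_int c n \<subseteq> U"
  shows "ennreal (\<Sum>n\<in>F. Q n) \<le> (\<integral>\<^sup>+x. ennreal (qf Q x) * indicator U x \<partial>lborel)"
proof -
  have "ennreal (\<Sum>n\<in>F. Q n) = (\<Sum>n\<in>F. ennreal (Q n))" using Q by simp
  also have "\<dots> = (\<Sum>n\<in>F. \<integral>\<^sup>+x. ennreal (Q n / len n) * indicator (part_int c n) x \<partial>lborel)"
    using Q len_pos by (intro sum.cong refl) (simp add: nn_integral_part_const less_imp_neq[symmetric] less_imp_le)
  also have "\<dots> = (\<Sum>n\<in>F. \<integral>\<^sup>+x. ennreal (qf Q x) * indicator (part_int c n) x \<partial>lborel)"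
    by (intro sum.cong refl nn_integral_cong) (auto simp: indicator_def qf_on_part)
  also have "\<dots> = (\<integral>\<^sup>+x. (\<Sum>n\<in>F. ennreal (qf Q x) * indicator (part_int c n) x) \<partial>lborel)"
    by (rule nn_integral_sum[symmetric]) (auto simp: part_int_def)
  also have "\<dots> \<le> (\<integral>\<^sup>+x. ennreal (qf Q x) * indicator U x \<partial>lborel)"
    by (intro nn_integral_mono disjoint_sum_indicator_le fin) (use part_int_unique sub in \<open>auto simp: subset_iff\<close>)
  finally show ?thesis .
qed

text \<open>An interval that meets the inner window and lies in the window of radius
  \<open>3 * s\<close> carries its full mass, at least \<open>A * (len n)\<^sup>2\<close>, below
  \<open>s\<^sup>2\<close>. If it sticks out, it crosses a stretch of length \<open>2 * s\<close>
  with density at least \<open>A * len n \<ge> 2 * s\<close>, so the mass would be at least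
  \<open>4 * s\<^sup>2\<close>. This is why the window has three times the radius of the
  disc.\<close>

lemma window_len_small:
  assumes Q: "\<And>n. Q n \<ge> A * (len n)\<^sup>2" and A: "A \<ge> 1" "1 \<le> A * \<rho>\<^sup>2" and \<rho>: "\<rho> > 0" and s: "s > 0"
    and win: "(\<integral>\<^sup>+x. ennreal (qf Q x) * indicator {x. \<bar>x - t\<bar> < 3 * s} x \<partial>lborel) < ennreal (s\<^sup>2)"
    and n: "part_int c n \<inter> {t - s..t + s} \<noteq> {}"
  shows "len n \<le> \<rho> * s"
proof -
  have Q0: "Q n \<ge> 0" for n using Q[of n] A by (meson mult_nonneg_nonneg order.trans zero_le_one zero_le_power2)
  show ?thesis
  proof (cases "part_int c n \<subseteq> {x. \<bar>x - t\<bar> < 3 * s}")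
    case True
    have "ennreal (\<Sum>n\<in>{n}. Q n) \<le> (\<integral>\<^sup>+x. ennreal (qf Q x) * indicator {x. \<bar>x - t\<bar> < 3 * s} x \<partial>lborel)"
      by (rule sum_Q_window[OF Q0]) (use True in auto)
    then have "ennreal (Q n) < ennreal (s\<^sup>2)" using win by (simp add: le_less_trans)
    then have "Q n < s\<^sup>2" using Q0 by (simp add: ennreal_less_iff)
    then have "A * (len n)\<^sup>2 < s\<^sup>2" using Q[of n] by linarith
    also have "s\<^sup>2 \<le> A * \<rho>\<^sup>2 * s\<^sup>2" using A s by (simp add: mult_le_cancel_right1)
    finally have "A * (len n)\<^sup>2 < A * (\<rho> * s)\<^sup>2" by (simp add: power_mult_distrib)
    then have "(len n)\<^sup>2 < (\<rho> * s)\<^sup>2" using A by simp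
    then show ?thesis using power2_less_imp_less[of "len n" "\<rho> * s"] \<rho> s by simp
  next
    case False
    then obtain z where "z \<in> part_int c n" "z \<notin> {x. \<bar>x - t\<bar> < 3 * s}" by blast
    then have z: "z \<in> part_int c n" "\<bar>z - t\<bar> \<ge> 3 * s" by (auto simp: not_less)
    obtain y where y: "y \<in> part_int c n" "t - s \<le> y" "y \<le> t + s" using n by auto
    obtain p where p: "{p<..<p + 2 * s} \<subseteq> part_int c n" "{p<..<p + 2 * s} \<subseteq> {x. \<bar>x - t\<bar> < 3 * s}"
    proof (cases "z \<ge> t")
      case True
      then have "z \<ge> t + 3 * s" using z by simp
      then show thesis using y z s by (intro that[of "t + s"]) (auto simp: part_int_def abs_less_iff)
    next
      case False
      then have "z \<le> t - 3 * s" using z by simp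
      then show thesis using y z s by (intro that[of "t - 3 * s"]) (auto simp: part_int_def abs_less_iff)
    qed
    have lenge: "len n \<ge> 2 * s"
    proof -
      have "p + s \<in> part_int c n" using p s by auto
      have "measure lborel {p<..<p + 2 * s} \<le> measure lborel (part_int c n)"
        by (intro measure_mono_fmeasurable part_int_fmeasurable p) auto
      then show ?thesis using s len_pos[of n] by (simp add: part_int_def len_def)
    qed
    have "ennreal (A * len n * (2 * s)) = (\<integral>\<^sup>+x. ennreal (A * len n) * indicator {p<..<p + 2 * s} x \<partial>lborel)"
      using s A len_pos[of n] by (simp add: nn_integral_cmult_indicator ennreal_mult)
    also have "\<dots> \<le> (\<integral>\<^sup>+x. ennreal (qf Q x) * indicator {x. \<bar>x - t\<bar> < 3 * s} x \<partial>lborel)"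
    proof (rule nn_integral_mono)
      fix x
      show "ennreal (A * len n) * indicator {p<..<p + 2 * s} x \<le> ennreal (qf Q x) * indicator {x. \<bar>x - t\<bar> < 3 * s} x"
      proof (cases "x \<in> {p<..<p + 2 * s}")
        case True
        then have "x \<in> part_int c n" "x \<in> {x. \<bar>x - t\<bar> < 3 * s}" using p by blast+
        moreover have "A * len n \<le> Q n / len n" using Q[of n] len_pos[of n] by (simp add: field_simps power2_eq_square)
        ultimately show ?thesis using True by (simp add: qf_on_part ennreal_leI)
      qed simp
    qed
    also have "\<dots> < ennreal (s\<^sup>2)" by (rule win)
    finally have "A * len n * (2 * s) < s\<^sup>2" using s A len_pos[of n] by (simp add: ennreal_less_iff)
    moreover have "(1 * (2 * s)) * (2 * s) \<le> (A * len n) * (2 * s)" using A lenge s by (intro mult_mono) auto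
    ultimately have "(1 * (2 * s)) * (2 * s) < s\<^sup>2" by linarith
    moreover have "s * s > 0" using s by simp
    ultimately show ?thesis by (simp add: power2_eq_square)
  qed
qed

end

lemma summable_on_group_pts:
  fixes g :: "int \<Rightarrow> real"
  assumes g: "g summable_on UNIV" "\<And>k. g k \<ge> 0"
    and fin: "\<And>n. finite (J n)" and disj: "\<And>m n k. k \<in> J m \<Longrightarrow> k \<in> J n \<Longrightarrow> m = n"
  shows "(\<lambda>n::int. \<Sum>k\<in>J n. g k) summable_on UNIV"
proof (rule nonneg_bdd_above_summable_on)
  show "0 \<le> (\<Sum>k\<in>J n. g k)" for n using g by (intro sum_nonneg) auto
  show "bdd_above (sum (\<lambda>n. \<Sum>k\<in>J n. g k) ` {F. F \<subseteq> UNIV \<and> finite F})"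
  proof (rule bdd_aboveI2)
    fix F :: "int set" assume "F \<in> {F. F \<subseteq> UNIV \<and> finite F}"
    then have F: "finite F" by simp
    have "(\<Sum>n\<in>F. \<Sum>k\<in>J n. g k) = (\<Sum>k\<in>(\<Union>n\<in>F. J n). g k)"
      by (rule sum.UNION_disjoint[symmetric]) (use F fin disj in auto)
    also have "\<dots> \<le> infsum g UNIV"
      by (rule finite_sum_le_infsum) (use g F fin in auto)
    finally show "(\<Sum>n\<in>F. \<Sum>k\<in>J n. g k) \<le> infsum g UNIV" .
  qed
qed

text \<open>The order of quantifiers matters: \<kappa> is fixed before \<open>m\<close> and
  \<open>s0\<close>, which the interpolation lemma determines from it, while \<open>q\<close> may
  depend on both. The density is then independent of the window and of the displaced points
  \<open>x\<close>.\<close>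

lemma node_density:
  fixes a W :: "int \<Rightarrow> real" and d d2 \<tau> :: real
  assumes a_mono: "strict_mono a" and unif: "d_uniform d (range a)" and d2: "0 < d2" "d2 < d"
    and W: "\<And>k. W k \<ge> 0" "(\<lambda>k. W k / (1 + (real_of_int k)\<^sup>2)) summable_on UNIV" and \<tau>: "\<tau> > 0"
  obtains \<kappa> where "0 < \<kappa>" "\<kappa> \<le> 1"
    "\<And>(m::nat) s0. m \<ge> 1 \<Longrightarrow> \<exists>q. q \<in> borel_measurable borel \<and> (\<forall>x. q x \<ge> 0) \<and> (\<integral>\<^sup>+x. ennreal (q x / (1 + x\<^sup>2)) \<partial>lborel) < top \<and>
      (\<forall>t s x. s > 0 \<longrightarrow> (\<integral>\<^sup>+x. ennreal (q x) * indicator {x. \<bar>x - t\<bar> < 3 * s} x \<partial>lborel) < ennreal (s\<^sup>2) \<longrightarrow>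
        (\<forall>k. \<bar>x k - a k\<bar> < min (a (k+1) - a k) (a k - a (k-1)) / 3) \<longrightarrow>
        s0 \<le> s \<and> (\<exists>S. finite S \<and>
          (\<forall>j::int. - int m \<le> j \<longrightarrow> j < int m \<longrightarrow> d2 * s / real m \<le> real (card {k\<in>S. x k \<in> {t + s * of_int j / real m<..t + s * (of_int j + 1) / real m}})) \<and>
          (\<forall>k\<in>S. W k \<le> \<tau> * s) \<and>
          (\<forall>k\<in>S. (\<Sum>l\<in>{l\<in>S. l \<noteq> k \<and> \<bar>x k - x l\<bar> < \<kappa> * s}. ln (s / \<bar>x k - x l\<bar>)) \<le> \<tau> * s)))"
proof -
  obtain c where short: "short_partition c"
    and top: "(\<lambda>n. real (card (range a \<inter> part_int c n)) - d * (c (n+1) - c n)) \<in> o[at_top](\<lambda>n. c (n+1) - c n)"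
    and bot: "(\<lambda>n. real (card (range a \<inter> part_int c n)) - d * (c (n+1) - c n)) \<in> o[at_bot](\<lambda>n. c (n+1) - c n)"
    and en: "(\<lambda>n. ((real (card (range a \<inter> part_int c n)))\<^sup>2 * ln (c (n+1) - c n) - energy (range a \<inter> part_int c n)) / (1 + (infdist 0 (part_int c n))\<^sup>2)) summable_on UNIV"
    and disc: "discrete_set (range a)" and dpos: "d > 0"
    using unif by (auto simp: d_uniform_def Let_def)
  define L where "L n = c (n+1) - c n" for n
  define dist where "dist n = 1 + (infdist 0 (part_int c n))\<^sup>2" for n
  have c_mono: "strict_mono c" and Ltop: "filterlim L at_top at_top" and Lbot: "filterlim L at_top at_bot"
    and Lsum: "(\<lambda>n. (L n)\<^sup>2 / dist n) summable_on UNIV"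
    using short by (auto simp: short_partition_def L_def[abs_def] dist_def)
  have Lpos: "L n > 0" for n using c_mono by (simp add: L_def strict_mono_less)
  have dist1: "dist n \<ge> 1" for n by (simp add: dist_def)
  have inj: "inj a" using a_mono by (rule strict_mono_imp_inj_on)
  have img: "range a \<inter> part_int c n = a ` {k. a k \<in> part_int c n}" for n by auto
  have finp: "finite {k. a k \<in> part_int c n}" for n
  proof -
    have "finite (range a \<inter> {c n..c (n+1)})" using disc by (auto simp: discrete_set_def)
    then have "finite (a ` {k. a k \<in> part_int c n})" by (rule finite_subset[rotated]) (auto simp: part_int_def)
    then show ?thesis using inj by (simp add: finite_image_iff inj_on_subset)
  qed
  have cardp: "card (range a \<inter> part_int c n) = card {k. a k \<in> part_int c n}" for n
    unfolding img by (rule card_image) (use inj in \<open>auto intro: inj_on_subset\<close>)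
  define \<Delta> where "\<Delta> n = real (card {k. a k \<in> part_int c n})" for n
  have evL: "finite {n. \<not> R \<le> L n}" for R
    using Ltop Lbot by (intro int_finite_exceptions) (auto simp: filterlim_at_top)
  have evD: "finite {n. \<not> \<bar>\<Delta> n - d * L n\<bar> \<le> e * L n}" if "e > 0" for e
  proof (rule int_finite_exceptions)
    show "\<forall>\<^sub>F n in at_top. \<bar>\<Delta> n - d * L n\<bar> \<le> e * L n"
      using landau_o.smallD[OF top that] Lpos by (simp add: \<Delta>_def cardp L_def less_imp_le)
    show "\<forall>\<^sub>F n in at_bot. \<bar>\<Delta> n - d * L n\<bar> \<le> e * L n"
      using landau_o.smallD[OF bot that] Lpos by (simp add: \<Delta>_def cardp L_def less_imp_le)
  qed
  define \<delta>0 where "\<delta>0 = Min (insert 1 (L ` {n. \<not> 1 \<le> L n}))"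
  have \<delta>0: "\<delta>0 > 0" unfolding \<delta>0_def using evL[of 1] Lpos by (subst Min_gr_iff) auto
  have \<delta>0L: "\<delta>0 \<le> L n" for n
  proof (cases "1 \<le> L n")
    case True
    have "\<delta>0 \<le> 1" unfolding \<delta>0_def using evL[of 1] by (intro Min_le) auto
    then show ?thesis using True by linarith
  next
    case False
    then show ?thesis unfolding \<delta>0_def using evL[of 1] by (intro Min_le) auto
  qed
  define X where "X = {n. \<not> \<bar>\<Delta> n - d * L n\<bar> \<le> 1 * L n}"
  have finX: "finite X" unfolding X_def by (rule evD) simp
  \<comment> \<open>The ratio of count to length is at most \<open>d + 1\<close> except on the
    finitely many intervals of \<open>X\<close>, whose ratios are included by hand.\<close>
  define D0 where "D0 = Max (insert (d + 1) ((\<lambda>n. \<Delta> n / L n) ` X))"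
  have D0: "D0 \<ge> d + 1" unfolding D0_def using finX by (intro Max_ge) auto
  have D0c: "\<Delta> n \<le> D0 * L n" for n
  proof (cases "n \<in> X")
    case True
    then have "\<Delta> n / L n \<le> D0" unfolding D0_def using finX by (intro Max_ge) auto
    then show ?thesis using Lpos[of n] by (simp add: field_simps)
  next
    case False
    then have "\<Delta> n \<le> (d + 1) * L n" by (simp add: X_def algebra_simps abs_le_iff)
    also have "\<dots> \<le> D0 * L n" using D0 Lpos[of n] by (intro mult_right_mono) auto
    finally show ?thesis .
  qed
  interpret partitioned_points a c \<delta>0 D0
    by standard (use a_mono c_mono \<delta>0 \<delta>0L D0 dpos finp D0c in \<open>auto simp: L_def \<Delta>_def\<close>)
  have lenL: "len n = L n" for n by (simp add: len_def L_def)
  have \<Delta>pts: "\<Delta> n = real (card (pts n))" for n by (simp add: \<Delta>_def pts_def)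
  obtain \<kappa> where \<kappa>: "0 < \<kappa>" "3 * \<kappa> \<le> 1" "(12 * D0) * \<kappa> * (1 + ln (1 / \<kappa>)) \<le> \<tau> / 2"
    using small_entropy_factor[of "12 * D0" "\<tau> / 2"] D0 dpos \<tau> by auto
  define \<xi> where "\<xi> = (d - d2) / 4"
  have \<xi>: "\<xi> > 0" "d2 + 3 * \<xi> = d - \<xi>" using d2 by (auto simp: \<xi>_def field_simps)
  \<comment> \<open>The intervals on which density or length is not yet close to its limit
    behaviour; there are finitely many.\<close>
  define Irr where "Irr = {n. \<not> \<bar>\<Delta> n - d * L n\<bar> \<le> \<xi> * L n} \<union> {n. \<not> 4 / \<xi> \<le> L n}"
  have finIrr: "finite Irr" unfolding Irr_def using evD[OF \<xi>(1)] evL by auto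
  have reg: "(d2 + 3 * \<xi>) * len n \<le> real (card (pts n)) \<and> 4 \<le> \<xi> * len n" if "n \<notin> Irr" for n
  proof
    have "\<bar>\<Delta> n - d * L n\<bar> \<le> \<xi> * L n" using that by (auto simp: Irr_def)
    then show "(d2 + 3 * \<xi>) * len n \<le> real (card (pts n))" unfolding \<xi>(2) \<Delta>pts[symmetric] lenL by (simp add: algebra_simps abs_le_iff)
    show "4 \<le> \<xi> * len n" using that \<xi>(1) by (simp add: Irr_def lenL field_simps)
  qed
  define C1 where "C1 = infsum (\<lambda>n. (L n)\<^sup>2 / dist n) UNIV"
  have C1: "(L n)\<^sup>2 \<le> C1 * dist n" for n
  proof -
    have "(L n)\<^sup>2 / dist n \<le> C1" unfolding C1_def by (rule summable_on_term_le[OF Lsum]) (use dist1 in \<open>auto simp: order.trans[OF zero_le_one]\<close>)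
    then show ?thesis using dist1[of n] by (simp add: field_simps)
  qed
  have C10: "C1 \<ge> 0" using C1[of 0] dist1[of 0] by (meson dual_order.trans less_le_trans linorder_not_le mult_neg_pos zero_le_power2 zero_less_one)
  have xdist: "x\<^sup>2 \<le> (2 + 2 * C1) * dist n" if "x \<in> part_int c n" for x n
  proof -
    have "\<bar>x\<bar> \<le> infdist 0 (part_int c n) + L n" using infdist_part_int(2)[OF that] by (simp add: L_def)
    then have "\<bar>x\<bar>\<^sup>2 \<le> (infdist 0 (part_int c n) + L n)\<^sup>2" by (rule power_mono) simp
    also have "\<dots> \<le> 2 * (infdist 0 (part_int c n))\<^sup>2 + 2 * (L n)\<^sup>2"
      using sum_squares_bound[of "infdist 0 (part_int c n)" "L n"] by (simp add: power2_sum)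
    also have "\<dots> \<le> 2 * dist n + 2 * (C1 * dist n)" using C1[of n] by (simp add: dist_def)
    finally show ?thesis by (simp add: algebra_simps)
  qed
  \<comment> \<open>Since \<open>(L n)\<^sup>2\<close> is at most a constant times
    \<open>dist n\<close>, all points of an interval have squares comparable to
    \<open>dist n\<close>; with the bound on index differences, so has the index.\<close>
  obtain C4 where C4: "\<And>k. 1 + (real_of_int k)\<^sup>2 \<le> C4 * dist (nof (a k))" "C4 > 0"
  proof -
    define e where "e = \<bar>a 0\<bar> + lof 0"
    define C4 where "C4 = 1 + 3 * D0\<^sup>2 * ((2 + 2 * C1) + C1 + e\<^sup>2)"
    have "1 + (real_of_int k)\<^sup>2 \<le> C4 * dist (nof (a k))" for k
    proof -
      let ?n = "nof (a k)"
      have "\<bar>real_of_int k\<bar> \<le> D0 * (\<bar>a k - a 0\<bar> + lof k + lof 0)" using index_diff_le[of k 0] by simp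
      also have "\<dots> \<le> D0 * (\<bar>a k\<bar> + lof k + e)" using D0 dpos by (intro mult_left_mono) (auto simp: e_def)
      finally have "\<bar>real_of_int k\<bar>\<^sup>2 \<le> (D0 * (\<bar>a k\<bar> + lof k + e))\<^sup>2" by (rule power_mono) simp
      also have "\<dots> = D0\<^sup>2 * (\<bar>a k\<bar> + lof k + e)\<^sup>2" by (simp add: power_mult_distrib)
      also have "\<dots> \<le> D0\<^sup>2 * (3 * ((a k)\<^sup>2 + (lof k)\<^sup>2 + e\<^sup>2))"
      proof (rule mult_left_mono)
        have "0 \<le> (\<bar>a k\<bar> - lof k)\<^sup>2 + (lof k - e)\<^sup>2 + (\<bar>a k\<bar> - e)\<^sup>2" by simp
        then show "(\<bar>a k\<bar> + lof k + e)\<^sup>2 \<le> 3 * ((a k)\<^sup>2 + (lof k)\<^sup>2 + e\<^sup>2)"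
          by (simp add: power2_eq_square algebra_simps)
      qed simp
      also have "\<dots> \<le> D0\<^sup>2 * (3 * ((2 + 2 * C1) * dist ?n + C1 * dist ?n + e\<^sup>2 * dist ?n))"
      proof (intro mult_left_mono add_mono)
        show "(a k)\<^sup>2 \<le> (2 + 2 * C1) * dist ?n" by (rule xdist[OF in_nof])
        show "(lof k)\<^sup>2 \<le> C1 * dist ?n" using C1 by (simp add: lof_def lenL)
        show "e\<^sup>2 \<le> e\<^sup>2 * dist ?n" using mult_left_mono[OF dist1[of ?n], of "e\<^sup>2"] by simp
      qed auto
      finally have "(real_of_int k)\<^sup>2 \<le> 3 * D0\<^sup>2 * ((2 + 2 * C1) + C1 + e\<^sup>2) * dist ?n" by (simp add: algebra_simps)
      then show ?thesis using dist1[of ?n] by (simp add: C4_def distrib_right)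
    qed
    moreover have "C4 > 0" unfolding C4_def using C10 by (intro add_pos_nonneg mult_nonneg_nonneg) auto
    ultimately show thesis by (rule that)
  qed
  define er where "er n = (\<Sum>l\<in>pts n. row l)" for n
  define wn where "wn n = (\<Sum>k\<in>pts n. W k)" for n
  have er0: "er n \<ge> 0" for n unfolding er_def by (intro sum_nonneg row_nonneg)
  have wn0: "wn n \<ge> 0" for n unfolding wn_def by (intro sum_nonneg W)
  have s2: "(\<lambda>n. er n / dist n) summable_on UNIV"
  proof -
    \<comment> \<open>These terms may be negative, so the rows, which are nonnegative, are compared
      with the absolute value and with \<open>\<bar>ln (L n)\<bar>\<close> times the count.\<close>
    define Dn where "Dn n = ((real (card (range a \<inter> part_int c n)))\<^sup>2 * ln (c (n+1) - c n) - energy (range a \<inter> part_int c n)) / dist n" for n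
    define C5 where "C5 = 1 + 1 / \<delta>0\<^sup>2"
    have "Dn summable_on UNIV" using en by (simp add: Dn_def[abs_def] dist_def)
    then have absD: "(\<lambda>n. \<bar>Dn n\<bar>) summable_on UNIV" using summable_on_iff_abs_summable_on_real by (metis (no_types, lifting) real_norm_def summable_on_cong)
    have lnL: "\<bar>ln (L n)\<bar> \<le> C5 * L n" for n
    proof -
      have 1: "ln (L n) \<le> L n" using ln_le_minus_one[OF Lpos[of n]] by linarith
      have "ln (1 / L n) \<le> 1 / L n - 1" using Lpos[of n] by (intro ln_le_minus_one) simp
      then have "- ln (L n) \<le> 1 / L n" using Lpos[of n] by (simp add: ln_div)
      also have "\<dots> \<le> 1 / \<delta>0\<^sup>2 * L n"
      proof -
        have "\<delta>0 * \<delta>0 \<le> L n * L n" using \<delta>0 \<delta>0L[of n] by (intro mult_mono) auto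
        then show ?thesis using Lpos[of n] \<delta>0 by (simp add: field_simps power2_eq_square)
      qed
      finally have 2: "- ln (L n) \<le> 1 / \<delta>0\<^sup>2 * L n" .
      have "1 / \<delta>0\<^sup>2 * L n \<ge> 0" using Lpos[of n] by simp
      then show ?thesis using 1 2 Lpos[of n] unfolding C5_def distrib_right abs_le_iff by linarith
    qed
    show ?thesis
    proof (rule summable_on_nonneg_le)
      show "(\<lambda>n. \<bar>Dn n\<bar> + (D0 * C5) * ((L n)\<^sup>2 / dist n)) summable_on UNIV"
        by (intro summable_on_add absD summable_on_cmult_right Lsum)
      show "0 \<le> er n / dist n" for n using er0 dist1[of n] by simp
      fix n
      have "er n / dist n = Dn n - \<Delta> n * ln (L n) / dist n"
        unfolding er_def sum_row_energy Dn_def by (simp add: \<Delta>pts cardp lenL L_def pts_def diff_divide_distrib)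
      also have "\<dots> \<le> \<bar>Dn n\<bar> + \<Delta> n * \<bar>ln (L n)\<bar> / dist n"
      proof -
        have "- (\<Delta> n * ln (L n)) \<le> \<Delta> n * \<bar>ln (L n)\<bar>" by (metis \<Delta>_def abs_ge_minus_self abs_mult abs_of_nat)
        then have "- (\<Delta> n * ln (L n)) / dist n \<le> \<Delta> n * \<bar>ln (L n)\<bar> / dist n" using dist1[of n] by (intro divide_right_mono) auto
        then show ?thesis using abs_ge_self[of "Dn n"] by simp
      qed
      also have "\<Delta> n * \<bar>ln (L n)\<bar> \<le> (D0 * L n) * (C5 * L n)"
        using D0c[of n] lnL[of n] D0 dpos Lpos[of n] by (intro mult_mono) auto
      also have "(D0 * L n) * (C5 * L n) = (D0 * C5) * (L n)\<^sup>2" by (simp add: power2_eq_square)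
      finally show "er n / dist n \<le> \<bar>Dn n\<bar> + (D0 * C5) * ((L n)\<^sup>2 / dist n)"
        using dist1[of n] by (simp add: divide_right_mono)
    qed
  qed
  have s3: "(\<lambda>n. wn n / dist n) summable_on UNIV"
  proof (rule summable_on_nonneg_le)
    have "(\<lambda>n. \<Sum>k\<in>pts n. W k / (1 + (real_of_int k)\<^sup>2)) summable_on UNIV"
      by (rule summable_on_group_pts[OF W(2)]) (use W(1) finite_pts' in \<open>auto simp: pts_iff\<close>)
    then show "(\<lambda>n. C4 * (\<Sum>k\<in>pts n. W k / (1 + (real_of_int k)\<^sup>2))) summable_on UNIV" by (rule summable_on_cmult_right)
    show "0 \<le> wn n / dist n" for n using wn0 dist1[of n] by simp
    fix n
    have "wn n / dist n = (\<Sum>k\<in>pts n. W k / dist n)" by (simp add: wn_def sum_divide_distrib)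
    also have "\<dots> \<le> (\<Sum>k\<in>pts n. C4 * (W k / (1 + (real_of_int k)\<^sup>2)))"
    proof (rule sum_mono)
      fix k assume "k \<in> pts n"
      then have le: "1 + (real_of_int k)\<^sup>2 \<le> C4 * dist n" using C4(1)[of k] by (simp add: pts_iff)
      have "W k / (C4 * dist n) \<le> W k / (1 + (real_of_int k)\<^sup>2)" using le W(1)[of k] C4(2) dist1[of n]
        by (intro divide_left_mono mult_pos_pos) (auto simp: add_pos_nonneg)
      then have "C4 * (W k / (C4 * dist n)) \<le> C4 * (W k / (1 + (real_of_int k)\<^sup>2))" using C4(2) by (intro mult_left_mono) auto
      then show "W k / dist n \<le> C4 * (W k / (1 + (real_of_int k)\<^sup>2))" using C4(2) by simp
    qed
    finally show "wn n / dist n \<le> C4 * (\<Sum>k\<in>pts n. W k / (1 + (real_of_int k)\<^sup>2))" by (simp only: sum_distrib_left)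
  qed
  define N0 where "N0 = real (card Irr)"
  \<comment> \<open>Extra mass on the irregular intervals: in a window of mass below
    \<open>s\<^sup>2\<close> it forces each of them to be shorter than
    \<open>\<rho> * s / N0\<close>, hence all of them together to be at most
    \<open>\<rho> * s\<close>.\<close>
  define ir where "ir n = (if n \<in> Irr then (N0 * len n)\<^sup>2 else 0)" for n
  have s4: "(\<lambda>n. ir n / dist n) summable_on UNIV"
  proof -
    have "(\<lambda>n. ir n / dist n) summable_on Irr" using finIrr by (rule summable_on_finite)
    then show ?thesis by (rule summable_on_cong_neutral[THEN iffD1, rotated -1]) (auto simp: ir_def)
  qed
  show thesis
  proof (rule that[of \<kappa>])
    show "0 < \<kappa>" "\<kappa> \<le> 1" using \<kappa> by auto
  next
    fix m :: nat and s0 :: real assume m: "m \<ge> 1"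
    \<comment> \<open>The entries serve, in order, to keep the intervals meeting the disc inside the
      window, to make them short against \<kappa>, to make the end losses of a cell small, and to
      force \<open>s \<ge> s0\<close>: the interval containing \<open>t\<close> is at least
      \<delta>0 and at most \<open>\<rho> * s\<close> long.\<close>
    define \<rho> where "\<rho> = min (min 1 (3 * \<kappa>)) (min (\<xi> / (3 * real m * (d2 + 2 * \<xi>))) (\<delta>0 / (\<bar>s0\<bar> + 1)))"
    have \<rho>: "0 < \<rho>" unfolding \<rho>_def using \<kappa> \<xi> d2 m \<delta>0 by (auto intro!: divide_pos_pos mult_pos_pos)
    have \<rho>1: "\<rho> \<le> 1" "\<rho> \<le> 3 * \<kappa>" "\<rho> \<le> \<xi> / (3 * real m * (d2 + 2 * \<xi>))" "\<rho> \<le> \<delta>0 / (\<bar>s0\<bar> + 1)" by (auto simp: \<rho>_def)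
    define E0 where "E0 = 1 / \<tau> + 4 * (1 + 16 * D0 / \<xi>) / \<tau>"
    \<comment> \<open>The reciprocal of \<open>A\<close> is the \<epsilon> of the selection lemma;
      \<open>E0 * m / \<xi>\<close> is what its smallness condition asks for, and
      \<open>1 / \<rho>\<^sup>2\<close> what the length bound asks for.\<close>
    define A where "A = max (max 1 (1 / \<rho>\<^sup>2)) (E0 * real m / \<xi>)"
    have A: "A \<ge> 1" "1 / \<rho>\<^sup>2 \<le> A" "E0 * real m / \<xi> \<le> A" by (auto simp: A_def)
    have A\<rho>: "1 \<le> A * \<rho>\<^sup>2" using A(2) \<rho> by (simp add: field_simps)
    define Q where "Q n = A * ((len n)\<^sup>2 + er n + wn n + ir n)" for n
    have ir0: "ir n \<ge> 0" for n by (simp add: ir_def)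
    have Qge: "Q n \<ge> A * (len n)\<^sup>2" "Q n \<ge> A * er n" "Q n \<ge> A * wn n" "Q n \<ge> A * ir n" "Q n \<ge> 0" for n
      unfolding Q_def using A er0[of n] wn0[of n] ir0[of n] by (auto intro!: mult_left_mono mult_nonneg_nonneg add_nonneg_nonneg)
    have Qsum: "(\<lambda>n. Q n / (1 + (infdist 0 (part_int c n))\<^sup>2)) summable_on UNIV"
    proof -
      have "(\<lambda>n. A * ((L n)\<^sup>2 / dist n + er n / dist n + wn n / dist n + ir n / dist n)) summable_on UNIV"
        by (intro summable_on_cmult_right summable_on_add Lsum s2 s3 s4)
      moreover have "Q n / dist n = A * ((L n)\<^sup>2 / dist n + er n / dist n + wn n / dist n + ir n / dist n)" for n
        by (simp add: Q_def lenL add_divide_distrib[symmetric])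
      ultimately have "(\<lambda>n. Q n / dist n) summable_on UNIV" by simp
      then show ?thesis by (simp add: dist_def)
    qed
    show "\<exists>q. q \<in> borel_measurable borel \<and> (\<forall>x. q x \<ge> 0) \<and> (\<integral>\<^sup>+x. ennreal (q x / (1 + x\<^sup>2)) \<partial>lborel) < top \<and>
      (\<forall>t s x. s > 0 \<longrightarrow> (\<integral>\<^sup>+x. ennreal (q x) * indicator {x. \<bar>x - t\<bar> < 3 * s} x \<partial>lborel) < ennreal (s\<^sup>2) \<longrightarrow>
        (\<forall>k. \<bar>x k - a k\<bar> < min (a (k+1) - a k) (a k - a (k-1)) / 3) \<longrightarrow>
        s0 \<le> s \<and> (\<exists>S. finite S \<and>
          (\<forall>j::int. - int m \<le> j \<longrightarrow> j < int m \<longrightarrow> d2 * s / real m \<le> real (card {k\<in>S. x k \<in> {t + s * of_int j / real m<..t + s * (of_int j + 1) / real m}})) \<and>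
          (\<forall>k\<in>S. W k \<le> \<tau> * s) \<and>
          (\<forall>k\<in>S. (\<Sum>l\<in>{l\<in>S. l \<noteq> k \<and> \<bar>x k - x l\<bar> < \<kappa> * s}. ln (s / \<bar>x k - x l\<bar>)) \<le> \<tau> * s)))"
    proof (intro exI[of _ "qf Q"] conjI allI impI)
      show "qf Q \<in> borel_measurable borel" by (rule qf_measurable)
      show "qf Q x \<ge> 0" for x using Qge(5) len_pos by (simp add: qf_def less_imp_le)
      show "(\<integral>\<^sup>+x. ennreal (qf Q x / (1 + x\<^sup>2)) \<partial>lborel) < top" by (rule qf_integral_finite[OF Qge(5) Qsum])
    next
      fix t s :: real and x :: "int \<Rightarrow> real"
      assume s: "s > 0" and win: "(\<integral>\<^sup>+x. ennreal (qf Q x) * indicator {x. \<bar>x - t\<bar> < 3 * s} x \<partial>lborel) < ennreal (s\<^sup>2)"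
      have small: "len n \<le> \<rho> * s" if "part_int c n \<inter> {t - s..t + s} \<noteq> {}" for n
        by (rule window_len_small[OF Qge(1) A(1) A\<rho> \<rho> s win that])
      have "part_int c (nof t) \<inter> {t - s..t + s} \<noteq> {}" using in_nof[of t] s by auto
      from small[OF this] have "\<delta>0 \<le> \<rho> * s" using \<delta>0L[of "nof t"] by (simp add: lenL)
      also have "\<dots> \<le> \<delta>0 / (\<bar>s0\<bar> + 1) * s" using \<rho>1(4) s by (intro mult_right_mono) auto
      finally have "\<delta>0 * (\<bar>s0\<bar> + 1) \<le> \<delta>0 * s" by (simp add: field_simps)
      then have "\<bar>s0\<bar> + 1 \<le> s" using \<delta>0 by (simp only: mult_le_cancel_left_pos)
      then show "s0 \<le> s" by linarith
    next
      fix t s :: real and x :: "int \<Rightarrow> real"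
      assume s: "s > 0" and win: "(\<integral>\<^sup>+x. ennreal (qf Q x) * indicator {x. \<bar>x - t\<bar> < 3 * s} x \<partial>lborel) < ennreal (s\<^sup>2)"
        and x: "\<forall>k. \<bar>x k - a k\<bar> < min (a (k+1) - a k) (a k - a (k-1)) / 3"
      define Nn where "Nn = {n. part_int c n \<inter> {t - s..t + s} \<noteq> {}}"
      have finN: "finite Nn" unfolding Nn_def by (rule finite_meeting)
      have small: "len n \<le> \<rho> * s" if "n \<in> Nn" for n
        by (rule window_len_small[OF Qge(1) A(1) A\<rho> \<rho> s win]) (use that in \<open>auto simp: Nn_def\<close>)
      have sub: "part_int c n \<subseteq> {x. \<bar>x - t\<bar> < 3 * s}" if nN: "n \<in> Nn" for n
      proof
        fix z assume z: "z \<in> part_int c n"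
        obtain y where y: "y \<in> part_int c n" "t - s \<le> y" "y \<le> t + s" using nN by (auto simp: Nn_def)
        have "\<bar>z - y\<bar> < len n" by (rule same_part_diff[OF z y(1)])
        also have "\<dots> \<le> \<rho> * s" by (rule small[OF nN])
        also have "\<dots> \<le> 1 * s" using \<rho>1(1) s by (intro mult_right_mono) auto
        finally have "\<bar>z - y\<bar> < s" by simp
        then have "- s < z - y" "z - y < s" by (auto simp: abs_less_iff)
        then have "z - t < 3 * s" "- (3 * s) < z - t" using y s by linarith+
        then show "z \<in> {x. \<bar>x - t\<bar> < 3 * s}" by (simp add: abs_less_iff)
      qed
      have "ennreal (\<Sum>n\<in>Nn. Q n) < ennreal (s\<^sup>2)"
        by (rule le_less_trans[OF sum_Q_window[OF Qge(5) finN sub] win])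
      then have Qs: "(\<Sum>n\<in>Nn. Q n) < s\<^sup>2" using Qge(5) by (simp add: ennreal_less_iff sum_nonneg)
      have part: "(\<Sum>n\<in>Nn. f n) \<le> 1 / A * s\<^sup>2" if "\<And>n. A * f n \<le> Q n" for f
      proof -
        have "A * (\<Sum>n\<in>Nn. f n) \<le> (\<Sum>n\<in>Nn. Q n)" unfolding sum_distrib_left by (intro sum_mono that)
        then have "A * (\<Sum>n\<in>Nn. f n) \<le> s\<^sup>2" using Qs by linarith
        then show ?thesis using A(1) by (simp add: field_simps)
      qed
      have irl: "(\<Sum>n\<in>Nn \<inter> Irr. len n) \<le> \<rho> * s"
      proof (cases "Nn \<inter> Irr = {}")
        case False
        then have N0: "N0 \<ge> 1" using finIrr by (auto simp: N0_def card_gt_0_iff Suc_le_eq)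
        have one: "len n \<le> \<rho> * s / N0" if "n \<in> Nn \<inter> Irr" for n
        proof -
          have "A * (N0 * len n)\<^sup>2 \<le> Q n" using Qge(4)[of n] that by (simp add: ir_def)
          also have "Q n \<le> (\<Sum>n\<in>Nn. Q n)" using that finN Qge(5) by (intro member_le_sum) auto
          also have "\<dots> < s\<^sup>2" by (rule Qs)
          also have "s\<^sup>2 \<le> (A * \<rho>\<^sup>2) * s\<^sup>2" using A\<rho> mult_right_mono[of 1 "A * \<rho>\<^sup>2" "s\<^sup>2"] by simp
          finally have "A * (N0 * len n)\<^sup>2 < A * (\<rho> * s)\<^sup>2" by (simp add: power_mult_distrib mult_ac)
          then have "(N0 * len n)\<^sup>2 < (\<rho> * s)\<^sup>2" using A(1) by simp
          then have "N0 * len n < \<rho> * s" using \<rho> s power2_less_imp_less[of "N0 * len n" "\<rho> * s"] by simp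
          then show ?thesis using N0 by (simp add: field_simps)
        qed
        have "(\<Sum>n\<in>Nn \<inter> Irr. len n) \<le> (\<Sum>n\<in>Nn \<inter> Irr. \<rho> * s / N0)" by (rule sum_mono[OF one])
        also have "\<dots> = real (card (Nn \<inter> Irr)) * (\<rho> * s / N0)" by simp
        also have "\<dots> \<le> N0 * (\<rho> * s / N0)"
          using finIrr \<rho> s N0 by (intro mult_right_mono) (auto simp: N0_def card_mono)
        finally show ?thesis using N0 by simp
      qed (use \<rho> s in auto)
      have \<rho>c: "(d2 + 2 * \<xi>) * (3 * \<rho>) \<le> \<xi> / real m"
      proof -
        have "(d2 + 2 * \<xi>) * (3 * \<rho>) \<le> (d2 + 2 * \<xi>) * (3 * (\<xi> / (3 * real m * (d2 + 2 * \<xi>))))"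
          using \<rho>1(3) d2 \<xi> by (intro mult_left_mono) auto
        also have "\<dots> = \<xi> / real m"
        proof -
          have "D * (3 * (\<xi> / (3 * real m * D))) = \<xi> / real m" if "D > 0" for D using that m by simp
          then show ?thesis using d2 \<xi>(1) by (simp only: add_pos_pos mult_pos_pos zero_less_numeral)
        qed
        finally show ?thesis .
      qed
      have \<epsilon>c: "1 / A / \<tau> + 4 * (1 + 16 * D0 / \<xi>) * (1 / A) / \<tau> \<le> \<xi> / real m"
      proof -
        have "1 / A / \<tau> + 4 * (1 + 16 * D0 / \<xi>) * (1 / A) / \<tau> = E0 / A" by (simp add: E0_def add_divide_distrib mult_ac)
        also have "\<dots> \<le> \<xi> / real m" using A(3) A(1) \<xi>(1) m by (simp add: field_simps)
        finally show ?thesis .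
      qed
      have np: "near_pts x" using x by (simp add: near_pts_def)
      obtain S where S: "finite S"
        "\<And>j::int. - int m \<le> j \<Longrightarrow> j < int m \<Longrightarrow> d2 * s / real m \<le> real (card {k\<in>S. x k \<in> {t + s * of_int j / real m<..t + s * (of_int j + 1) / real m}})"
        "\<And>k. k \<in> S \<Longrightarrow> W k \<le> \<tau> * s"
        "\<And>k. k \<in> S \<Longrightarrow> (\<Sum>l\<in>{l\<in>S. l \<noteq> k \<and> \<bar>x k - x l\<bar> < \<kappa> * s}. ln (s / \<bar>x k - x l\<bar>)) \<le> \<tau> * s"
      proof (rule select_nodes[OF s \<xi>(1) \<tau> \<kappa>(1) \<kappa>(2) m d2(1) W(1) np Nn_def small \<rho> \<rho>1(2) irl reg _ _ \<kappa>(3) \<rho>c \<epsilon>c])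
        show "(\<Sum>n\<in>Nn. \<Sum>l\<in>pts n. row l) \<le> 1 / A * s\<^sup>2" using part[of er, OF Qge(2)] by (simp add: er_def)
        show "(\<Sum>n\<in>Nn. \<Sum>k\<in>pts n. W k) \<le> 1 / A * s\<^sup>2" using part[of wn, OF Qge(3)] by (simp add: wn_def)
      qed (blast intro: that)+
      then show "\<exists>S. finite S \<and>
          (\<forall>j::int. - int m \<le> j \<longrightarrow> j < int m \<longrightarrow> d2 * s / real m \<le> real (card {k\<in>S. x k \<in> {t + s * of_int j / real m<..t + s * (of_int j + 1) / real m}})) \<and>
          (\<forall>k\<in>S. W k \<le> \<tau> * s) \<and>
          (\<forall>k\<in>S. (\<Sum>l\<in>{l\<in>S. l \<noteq> k \<and> \<bar>x k - x l\<bar> < \<kappa> * s}. ln (s / \<bar>x k - x l\<bar>)) \<le> \<tau> * s)" by blast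
    qed
  qed
qed

section \<open>Duality\<close>

text \<open>A Hilbert-space projection on square-summable sequences: a minimising sequence converges
  coordinatewise, and the summable weights \<open>c\<close> turn this into convergence of inner products.\<close>

lemma annihilator_of_positive_distance:
  fixes V :: "(nat \<Rightarrow> real) set" and v0 c :: "nat \<Rightarrow> real"
  assumes c: "summable c" "\<And>i. 0 \<le> c i" "\<And>i. c i \<le> 1"
    and dom: "\<And>v. v \<in> insert v0 V \<Longrightarrow> \<exists>B. \<forall>i. \<bar>v i\<bar> \<le> B * c i"
    and zero: "(\<lambda>i. 0) \<in> V" and add: "\<And>u v. u \<in> V \<Longrightarrow> v \<in> V \<Longrightarrow> (\<lambda>i. u i + v i) \<in> V"
    and scale: "\<And>r v. v \<in> V \<Longrightarrow> (\<lambda>i. r * v i) \<in> V"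
    and \<delta>: "\<delta> > 0" "\<And>v. v \<in> V \<Longrightarrow> \<delta> \<le> (\<Sum>i. (v0 i + v i)\<^sup>2)"
  obtains T M where "\<And>i. \<bar>T i\<bar> \<le> M" "\<And>v. v \<in> V \<Longrightarrow> (\<Sum>i. T i * v i) = 0" "(\<Sum>i. T i * v0 i) \<noteq> 0"
proof -
  define D where "D = {v. \<exists>B. \<forall>i. \<bar>v i\<bar> \<le> B * c i}"
  define ip where "ip u v = (\<Sum>i. u i * v i)" for u v :: "nat \<Rightarrow> real"
  have VD: "v \<in> D" if "v \<in> V" for v using dom that by (auto simp: D_def)
  have v0D: "v0 \<in> D" using dom by (auto simp: D_def)
  have addD: "(\<lambda>i. u i + v i) \<in> D" if "u \<in> D" "v \<in> D" for u v
  proof -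
    obtain B B' where B: "\<And>i. \<bar>u i\<bar> \<le> B * c i" "\<And>i. \<bar>v i\<bar> \<le> B' * c i" using \<open>u \<in> D\<close> \<open>v \<in> D\<close> by (auto simp: D_def)
    have "\<bar>u i + v i\<bar> \<le> (B + B') * c i" for i using B(1)[of i] B(2)[of i] by (simp add: distrib_right)
    then show ?thesis by (auto simp: D_def)
  qed
  have scaleD: "(\<lambda>i. r * v i) \<in> D" if vD: "v \<in> D" for r v
  proof -
    obtain B where B: "\<And>i. \<bar>v i\<bar> \<le> B * c i" using vD by (auto simp: D_def)
    have "\<bar>r * v i\<bar> \<le> (\<bar>r\<bar> * B) * c i" for i using mult_left_mono[OF B[of i], of "\<bar>r\<bar>"] by (simp add: abs_mult mult.assoc)
    then show ?thesis by (auto simp: D_def)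
  qed
  have summ: "summable (\<lambda>i. u i * v i)" if uD: "u \<in> D" and vD: "v \<in> D" for u v
  proof -
    obtain B B' where B: "\<And>i. \<bar>u i\<bar> \<le> B * c i" "\<And>i. \<bar>v i\<bar> \<le> B' * c i" using uD vD by (auto simp: D_def)
    show ?thesis
    proof (rule summable_comparison_test')
      show "summable (\<lambda>i. \<bar>B\<bar> * \<bar>B'\<bar> * c i)" by (intro summable_mult c)
      fix i
      have 1: "\<bar>u i\<bar> \<le> \<bar>B\<bar> * c i" using B(1)[of i] mult_right_mono[OF abs_ge_self[of B] c(2)[of i]] by linarith
      have 2: "\<bar>v i\<bar> \<le> \<bar>B'\<bar> * 1"
      proof -
        have "B' * c i \<le> \<bar>B'\<bar> * c i" by (rule mult_right_mono[OF abs_ge_self c(2)])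
        also have "\<dots> \<le> \<bar>B'\<bar> * 1" by (rule mult_left_mono[OF c(3)]) simp
        finally show ?thesis using B(2)[of i] by linarith
      qed
      have "\<bar>u i\<bar> * \<bar>v i\<bar> \<le> (\<bar>B\<bar> * c i) * (\<bar>B'\<bar> * 1)" using 1 2 c(2)[of i] by (intro mult_mono) auto
      then show "norm (u i * v i) \<le> \<bar>B\<bar> * \<bar>B'\<bar> * c i" by (simp add: abs_mult mult_ac)
    qed
  qed
  have ip_add: "ip u (\<lambda>i. v i + w i) = ip u v + ip u w" if "u \<in> D" "v \<in> D" "w \<in> D" for u v w
    unfolding ip_def using suminf_add[OF summ[OF that(1,2)] summ[OF that(1,3)]] by (simp add: distrib_left)
  have ip_scale: "ip u (\<lambda>i. r * v i) = r * ip u v" if "u \<in> D" "v \<in> D" for u v r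
    unfolding ip_def using suminf_mult[OF summ[OF that], of r] by (simp add: mult_ac)
  have ip_comm: "ip u v = ip v u" for u v by (simp add: ip_def mult.commute)
  have ip_nonneg: "ip v v \<ge> 0" if "v \<in> D" for v
    unfolding ip_def by (rule suminf_nonneg[OF summ[OF that that]]) simp
  have term_le: "(v i)\<^sup>2 \<le> ip v v" if "v \<in> D" for v i
    using sum_le_suminf[OF summ[OF that that], of "{i}"] by (simp add: ip_def power2_eq_square)
  define sh where "sh v = (\<lambda>i. v0 i + v i)" for v
  have shD: "sh v \<in> D" if "v \<in> V" for v unfolding sh_def by (intro addD v0D VD that)
  define J where "J v = ip (sh v) (sh v)" for v
  have J\<delta>: "\<delta> \<le> J v" if "v \<in> V" for v using \<delta>(2)[OF that] by (simp add: J_def ip_def sh_def power2_eq_square)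
  define I where "I = Inf (J ` V)"
  have bdd: "bdd_below (J ` V)" using J\<delta> by (auto intro!: bdd_belowI2)
  have IJ: "I \<le> J v" if "v \<in> V" for v unfolding I_def using bdd that by (intro cInf_lower) auto
  have I\<delta>: "\<delta> \<le> I" unfolding I_def using zero J\<delta> by (intro cInf_greatest) auto
  have "\<exists>v\<in>V. J v < I + 1 / (real n + 1)" for n
  proof -
    have "Inf (J ` V) < I + 1 / (real n + 1)" by (simp add: I_def add_pos_nonneg)
    then show ?thesis using zero bdd by (subst (asm) cInf_less_iff) auto
  qed
  then obtain v where v: "\<And>n. v n \<in> V" "\<And>n. J (v n) < I + 1 / (real n + 1)" by metis
  define w where "w n = sh (v n)" for n
  define e where "e n = 1 / (real n + 1)" for n
  have e: "e n > 0" "e n \<le> 1" for n by (auto simp: e_def)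
  have elim: "e \<longlonglongrightarrow> 0" unfolding e_def by real_asymp
  have wD: "w n \<in> D" for n unfolding w_def by (rule shD[OF v(1)])
  have Jw: "ip (w n) (w n) \<le> I + e n" "\<delta> \<le> ip (w n) (w n)" for n
    using v(2)[of n] J\<delta>[OF v(1)[of n]] by (auto simp: J_def w_def e_def)
  have orth: "\<bar>ip (w n) u\<bar> \<le> sqrt (e n * ip u u)" if u: "u \<in> V" for n u
  proof -
    define p where "p = ip (w n) u"
    define N where "N = ip u u"
    have uD: "u \<in> D" by (rule VD[OF u])
    have N0: "N \<ge> 0" unfolding N_def by (rule ip_nonneg[OF uD])
    \<comment> \<open>Adding a multiple of \<open>u\<close> to a vector within \<open>e n\<close> of
      the infimum cannot lower the square norm by more than \<open>e n\<close>. Nonnegativity of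
      this quadratic in \<open>r\<close> gives the near-orthogonality of \<open>w n\<close> to
      \<open>V\<close>.\<close>
    have quad: "0 \<le> e n + 2 * r * p + r\<^sup>2 * N" for r
    proof -
      have ru: "(\<lambda>i. r * u i) \<in> D" by (rule scaleD[OF uD])
      have sD: "(\<lambda>i. w n i + r * u i) \<in> D" by (intro addD wD ru)
      have "I \<le> J (\<lambda>i. v n i + r * u i)" by (intro IJ add v scale u)
      also have "\<dots> = ip (\<lambda>i. w n i + r * u i) (\<lambda>i. w n i + r * u i)" by (simp add: J_def sh_def w_def add.assoc)
      also have "\<dots> = ip (\<lambda>i. w n i + r * u i) (w n) + r * ip (\<lambda>i. w n i + r * u i) u"
        using ip_add[OF sD wD ru] ip_scale[OF sD uD] by simp
      also have "ip (\<lambda>i. w n i + r * u i) (w n) = ip (w n) (w n) + r * p"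
        using ip_add[OF wD wD ru] ip_scale[OF wD uD] ip_comm by (simp add: p_def)
      also have "ip (\<lambda>i. w n i + r * u i) u = p + r * N"
        using ip_add[OF uD wD ru] ip_scale[OF uD uD] ip_comm by (simp add: p_def N_def)
      finally have "I \<le> ip (w n) (w n) + r * p + r * (p + r * N)" .
      then show ?thesis using Jw(1)[of n] by (simp add: algebra_simps power2_eq_square)
    qed
    have "p\<^sup>2 \<le> e n * N"
    proof (cases "N = 0")
      case True
      have "p = 0"
      proof (rule ccontr)
        assume "p \<noteq> 0"
        then show False using quad[of "- e n / p"] True e(1)[of n] by simp
      qed
      then show ?thesis using True by simp
    next
      case False
      then have "N > 0" using N0 by simp
      then show ?thesis using quad[of "- p / N"] by (simp add: field_simps power2_eq_square)
    qed
    then have "sqrt (p\<^sup>2) \<le> sqrt (e n * N)" by (rule real_sqrt_le_mono)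
    then show ?thesis by (simp add: p_def N_def)
  qed
  have diffV: "(\<lambda>i. w m i - w n i) \<in> V" for m n
  proof -
    have "(\<lambda>i. v m i + (-1) * v n i) \<in> V" by (intro add scale v)
    then show ?thesis by (simp add: w_def sh_def)
  qed
  \<comment> \<open>The difference belongs to \<open>V\<close>, and both vectors are nearly
    orthogonal to it, so its norm, and with it each coordinate, is small.\<close>
  have cauchy: "\<bar>w m i - w n i\<bar> \<le> sqrt (e m) + sqrt (e n)" for m n i
  proof -
    define u where "u = (\<lambda>i. w m i - w n i)"
    have uV: "u \<in> V" unfolding u_def by (rule diffV)
    have uD: "u \<in> D" by (rule VD[OF uV])
    define N where "N = ip u u"
    have N0: "N \<ge> 0" unfolding N_def by (rule ip_nonneg[OF uD])
    have "N = ip u (\<lambda>i. w m i + (-1) * w n i)" by (simp add: N_def u_def)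
    also have "\<dots> = ip u (w m) + (-1) * ip u (w n)" using ip_add[OF uD wD scaleD[OF wD]] ip_scale[OF uD wD] by metis
    also have "\<dots> \<le> \<bar>ip (w m) u\<bar> + \<bar>ip (w n) u\<bar>" using ip_comm[of u "w m"] ip_comm[of u "w n"] by linarith
    also have "\<dots> \<le> sqrt (e m * N) + sqrt (e n * N)" unfolding N_def by (intro add_mono orth uV)
    also have "\<dots> = (sqrt (e m) + sqrt (e n)) * sqrt N" by (simp add: real_sqrt_mult distrib_right)
    finally have le: "sqrt N * sqrt N \<le> (sqrt (e m) + sqrt (e n)) * sqrt N" using N0 by simp
    have "sqrt N \<le> sqrt (e m) + sqrt (e n)"
    proof (cases "N = 0")
      case True then show ?thesis using e by (simp add: less_imp_le)
    next
      case False then show ?thesis using mult_right_le_imp_le[OF le] N0 by simp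
    qed
    moreover have "\<bar>u i\<bar> \<le> sqrt N" using real_sqrt_le_mono[OF term_le[OF uD, of i]] by (simp add: N_def)
    ultimately show ?thesis by (simp add: u_def)
  qed
  have "\<exists>t. (\<lambda>n. w n i) \<longlonglongrightarrow> t" for i
  proof -
    have "Cauchy (\<lambda>n. w n i)"
    proof (rule metric_CauchyI)
      fix \<epsilon> :: real assume \<epsilon>: "\<epsilon> > 0"
      have "(\<lambda>n. sqrt (e n)) \<longlonglongrightarrow> sqrt 0" by (intro tendsto_real_sqrt elim)
      then have "eventually (\<lambda>n. sqrt (e n) < \<epsilon> / 2) sequentially" using \<epsilon> by (intro order_tendstoD(2)) auto
      then obtain N where N: "\<And>n. n \<ge> N \<Longrightarrow> sqrt (e n) < \<epsilon> / 2" by (auto simp: eventually_sequentially)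
      show "\<exists>M. \<forall>m\<ge>M. \<forall>n\<ge>M. dist (w m i) (w n i) < \<epsilon>"
      proof (intro exI[of _ N] allI impI)
        fix m n assume "m \<ge> N" "n \<ge> N"
        then have "sqrt (e m) < \<epsilon> / 2" "sqrt (e n) < \<epsilon> / 2" using N by auto
        then show "dist (w m i) (w n i) < \<epsilon>" using cauchy[of m i n] by (simp add: dist_real_def)
      qed
    qed
    then show ?thesis using convergent_eq_Cauchy by (auto simp: convergent_def)
  qed
  then obtain T where T: "\<And>i. (\<lambda>n. w n i) \<longlonglongrightarrow> T i" by metis
  define M where "M = sqrt (I + 1)"
  have wM: "\<bar>w n i\<bar> \<le> M" for n i
  proof -
    have "(w n i)\<^sup>2 \<le> I + 1" using term_le[OF wD[of n], of i] Jw(1)[of n] e(2)[of n] by linarith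
    then have "sqrt ((w n i)\<^sup>2) \<le> M" unfolding M_def by (rule real_sqrt_le_mono)
    then show ?thesis by simp
  qed
  have M0: "M \<ge> 0" using I\<delta> \<delta>(1) by (simp add: M_def)
  have lim: "(\<lambda>n. ip (w n) u) \<longlonglongrightarrow> (\<Sum>i. T i * u i)" if uD: "u \<in> D" for u
  proof -
    obtain B where B: "\<And>i. \<bar>u i\<bar> \<le> B * c i" using uD by (auto simp: D_def)
    have "eventually (\<lambda>n. summable (\<lambda>i. norm (w n i * u i))) sequentially \<and> summable (\<lambda>i. norm (T i * u i)) \<and>
        ((\<lambda>n. \<Sum>i. w n i * u i) \<longlonglongrightarrow> (\<Sum>i. T i * u i))"
    proof (rule tannerys_theorem[where M = "\<lambda>i. M * (B * c i)"])
      show "(\<lambda>n. w n i * u i) \<longlonglongrightarrow> T i * u i" for i by (intro tendsto_intros T)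
      show "summable (\<lambda>i. M * (B * c i))" by (intro summable_mult c)
      show "\<forall>\<^sub>F (i, n) in sequentially \<times>\<^sub>F sequentially. norm (w n i * u i) \<le> M * (B * c i)"
      proof (rule always_eventually, clarify)
        fix i n show "norm (w n i * u i) \<le> M * (B * c i)"
          using mult_mono[OF wM[of n i] B[of i]] M0 by (simp add: abs_mult)
      qed
    qed simp
    then show ?thesis by (simp add: ip_def)
  qed
  show thesis
  proof (rule that[of T M])
    show "\<bar>T i\<bar> \<le> M" for i
      by (rule Lim_bounded[OF tendsto_rabs[OF T[of i]]]) (use wM in auto)
    show "(\<Sum>i. T i * u i) = 0" if u: "u \<in> V" for u
    proof (rule LIMSEQ_unique[OF lim[OF VD[OF u]]])
      show "(\<lambda>n. ip (w n) u) \<longlonglongrightarrow> 0"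
      proof (rule tendsto_rabs_zero_cancel, rule tendsto_sandwich[OF _ _ tendsto_const])
        have "(\<lambda>n. sqrt (e n * ip u u)) \<longlonglongrightarrow> sqrt (0 * ip u u)" by (intro tendsto_intros elim)
        then show "(\<lambda>n. sqrt (e n * ip u u)) \<longlonglongrightarrow> 0" by simp
      qed (use orth[OF u] in auto)
    qed
    \<comment> \<open>The inner product of \<open>w n\<close> with \<open>v0\<close> is its square
      norm minus its product with \<open>v n\<close>; the former is at least \<delta>, the latter
      vanishes in the limit because the norms of \<open>v n\<close> stay bounded.\<close>
    have "\<delta> \<le> (\<Sum>i. T i * v0 i)"
    proof -
      define K where "K = 2 * (I + 1) + 2 * ip v0 v0"
      have vb: "ip (v n) (v n) \<le> K" for n
      proof -
        have vD: "v n \<in> D" by (rule VD[OF v(1)])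
        have "ip (v n) (v n) \<le> (\<Sum>i. 2 * (w n i * w n i) + 2 * (v0 i * v0 i))"
          unfolding ip_def
        proof (rule suminf_le)
          show "v n i * v n i \<le> 2 * (w n i * w n i) + 2 * (v0 i * v0 i)" for i
          proof -
            have "0 \<le> (2 * v0 i + v n i)\<^sup>2" by simp
            then show ?thesis by (simp add: w_def sh_def power2_eq_square algebra_simps)
          qed
          show "summable (\<lambda>i. v n i * v n i)" by (rule summ[OF vD vD])
          show "summable (\<lambda>i. 2 * (w n i * w n i) + 2 * (v0 i * v0 i))" by (intro summable_add summable_mult summ wD v0D)
        qed
        also have "\<dots> = 2 * ip (w n) (w n) + 2 * ip v0 v0"
          unfolding ip_def by (subst suminf_add[symmetric]) (auto intro!: summable_mult summ wD v0D simp: suminf_mult summ wD v0D)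
        also have "\<dots> \<le> K" using Jw(1)[of n] e(2)[of n] by (simp add: K_def)
        finally show ?thesis .
      qed
      have low: "\<delta> - sqrt (e n * K) \<le> ip (w n) v0" for n
      proof -
        have vD: "v n \<in> D" by (rule VD[OF v(1)])
        have "ip (w n) (w n) = ip (w n) v0 + ip (w n) (v n)" using ip_add[OF wD v0D vD] by (simp add: w_def sh_def)
        moreover have "\<bar>ip (w n) (v n)\<bar> \<le> sqrt (e n * K)"
          by (rule order.trans[OF orth[OF v(1)]]) (use vb e in \<open>auto intro!: mult_left_mono simp: less_imp_le\<close>)
        ultimately show ?thesis using Jw(2)[of n] by linarith
      qed
      have "(\<lambda>n. \<delta> - sqrt (e n * K)) \<longlonglongrightarrow> \<delta> - sqrt (0 * K)" by (intro tendsto_intros elim)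
      then have "(\<lambda>n. \<delta> - sqrt (e n * K)) \<longlonglongrightarrow> \<delta>" by simp
      then show ?thesis by (rule LIMSEQ_le[OF _ lim[OF v0D]]) (use low in auto)
    qed
    then show "(\<Sum>i. T i * v0 i) \<noteq> 0" using \<delta>(1) by simp
  qed
qed

text \<open>The function is \<open>sin (\<eta> * z) / z\<close> with its singularity removed. It
  buys decay on the real line at the cost of exponential type \<eta>, and its zeros are
  real.\<close>

lemma sinc_factor:
  fixes \<eta> :: real
  assumes \<eta>: "\<eta> > 0"
  obtains S :: "complex \<Rightarrow> complex" and B :: real where "S holomorphic_on UNIV" "B > 0"
    "\<And>z. norm (S z) \<le> B * exp (\<eta> * \<bar>Im z\<bar>) / (1 + norm z)" "S \<i> \<noteq> 0"
proof -
  define f where "f z = sin (of_real \<eta> * z)" for z :: complex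
  define S where "S z = (if z = 0 then deriv f 0 else (f z - f 0) / (z - 0))" for z
  have fh: "f holomorphic_on UNIV" unfolding f_def by (intro holomorphic_intros)
  have Sh: "S holomorphic_on UNIV" unfolding S_def using pole_lemma_open[OF fh open_UNIV, of 0] by simp
  have fb: "norm (f z) \<le> exp (\<eta> * \<bar>Im z\<bar>)" for z
  proof -
    let ?w = "of_real \<eta> * z"
    have "norm (f z) = norm (exp (\<i> * ?w) - exp (- (\<i> * ?w))) / 2" by (simp add: f_def sin_exp_eq norm_divide norm_mult)
    also have "\<dots> \<le> (norm (exp (\<i> * ?w)) + norm (exp (- (\<i> * ?w)))) / 2" by (intro divide_right_mono norm_triangle_ineq4) simp
    also have "\<dots> = (exp (- (\<eta> * Im z)) + exp (\<eta> * Im z)) / 2" by (simp add: norm_exp_eq_Re)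
    also have "\<dots> \<le> (exp (\<eta> * \<bar>Im z\<bar>) + exp (\<eta> * \<bar>Im z\<bar>)) / 2"
    proof (intro divide_right_mono add_mono)
      show "exp (- (\<eta> * Im z)) \<le> exp (\<eta> * \<bar>Im z\<bar>)" using mult_left_mono[OF abs_ge_minus_self[of "Im z"], of \<eta>] \<eta> by simp
      show "exp (\<eta> * Im z) \<le> exp (\<eta> * \<bar>Im z\<bar>)" using mult_left_mono[OF abs_ge_self[of "Im z"], of \<eta>] \<eta> by simp
    qed simp
    finally show ?thesis by simp
  qed
  have "compact (S ` cball 0 1)"
    by (intro compact_continuous_image holomorphic_on_imp_continuous_on holomorphic_on_subset[OF Sh]) auto
  then obtain B0 where B0: "B0 > 0" "\<And>z. norm z \<le> 1 \<Longrightarrow> norm (S z) \<le> B0"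
    using compact_imp_bounded by (force simp: bounded_pos)
  define B where "B = max (2 * B0) 2"
  have bound: "norm (S z) \<le> B * exp (\<eta> * \<bar>Im z\<bar>) / (1 + norm z)" for z
  proof -
    define T where "T = exp (\<eta> * \<bar>Im z\<bar>)"
    have T1: "T \<ge> 1" using \<eta> by (simp add: T_def)
    have pos: "1 + norm z > 0" by (simp add: add_pos_nonneg)
    have "norm (S z) * (1 + norm z) \<le> B * T"
    proof (cases "norm z \<le> 1")
      case True
      have "norm (S z) * (1 + norm z) \<le> B0 * 2" using B0(2)[OF True] True B0(1) by (intro mult_mono) auto
      also have "\<dots> \<le> B * 1" by (simp add: B_def)
      also have "\<dots> \<le> B * T" using T1 B0 by (intro mult_left_mono) (auto simp: B_def)
      finally show ?thesis .
    next
      case False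
      then have z: "z \<noteq> 0" "norm z > 1" by auto
      have "norm (S z) = norm (f z) / norm z" using z by (simp add: S_def f_def norm_divide)
      then have "norm (S z) * (1 + norm z) = norm (f z) * ((1 + norm z) / norm z)" by simp
      also have "\<dots> \<le> T * 2"
      proof (rule mult_mono)
        show "norm (f z) \<le> T" using fb[of z] by (simp add: T_def)
        show "(1 + norm z) / norm z \<le> 2" using z by (simp add: divide_le_eq)
      qed (use T1 in auto)
      also have "\<dots> \<le> T * B" using T1 by (intro mult_left_mono) (auto simp: B_def)
      finally show ?thesis by (simp add: mult.commute)
    qed
    then show ?thesis unfolding T_def[symmetric] using pos by (simp add: pos_le_divide_eq)
  qed
  have "f \<i> \<noteq> 0"
  proof
    assume "f \<i> = 0"
    then obtain n :: int where "of_real \<eta> * \<i> = complex_of_real (of_int n * pi)" by (auto simp: f_def sin_eq_0)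
    then have "Im (of_real \<eta> * \<i>) = Im (complex_of_real (of_int n * pi))" by (rule arg_cong)
    then show False using \<eta> by simp
  qed
  then have "S \<i> \<noteq> 0" by (simp add: S_def f_def)
  with Sh bound show thesis using that[of S B] by (simp add: B_def)
qed

text \<open>If the mean \<open>m\<close> were not attained, \<open>g - m\<close> would have one sign
  on the interval by connectedness, and with zero integral it would vanish almost everywhere there,
  against positive measure. The lemma turns a small average into a small value at some point of the
  interval.\<close>

lemma mean_value_on_interval:
  fixes \<mu> :: "real measure" and g :: "real \<Rightarrow> real"
  assumes sets: "sets \<mu> = sets borel" and fin: "finite_measure \<mu>" and cont: "continuous_on UNIV g" and bdd: "\<And>x. \<bar>g x\<bar> \<le> B"
    and pos: "measure \<mu> {p<..<q} > 0"
  obtains x where "x \<in> {p<..<q}" "(LINT x|\<mu>. indicator {p<..<q} x * g x) = g x * measure \<mu> {p<..<q}"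
proof -
  interpret finite_measure \<mu> by (rule fin)
  have [measurable]: "g \<in> borel_measurable \<mu>"
    using borel_measurable_continuous_onI[OF cont] measurable_cong_sets[OF sets refl] by blast
  have U[measurable]: "{p<..<q} \<in> sets \<mu>" by (simp add: sets)
  define m where "m = (LINT x|\<mu>. indicator {p<..<q} x * g x) / measure \<mu> {p<..<q}"
  have intg: "integrable \<mu> (\<lambda>x. indicator {p<..<q} x * (s * g x + r))" for s r
  proof -
    have "integrable \<mu> g" by (rule integrable_const_bound[where B = B]) (use bdd in auto)
    then have "integrable \<mu> (\<lambda>x. s * g x + r)" by simp
    from integrable_real_mult_indicator[OF U this] show ?thesis by (simp add: mult.commute)
  qed
  have val: "(LINT x|\<mu>. indicator {p<..<q} x * (s * g x + r)) = s * (m * measure \<mu> {p<..<q}) + r * measure \<mu> {p<..<q}" for s r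
  proof -
    have i1: "integrable \<mu> (\<lambda>x. indicator {p<..<q} x * g x)" using intg[of 1 0] by simp
    have i2: "integrable \<mu> (\<lambda>x. indicator {p<..<q} x :: real)" using intg[of 0 1] by simp
    have "(LINT x|\<mu>. indicator {p<..<q} x * (s * g x + r)) = (LINT x|\<mu>. s * (indicator {p<..<q} x * g x) + r * indicator {p<..<q} x)"
      by (rule Bochner_Integration.integral_cong) (auto simp: algebra_simps)
    also have "\<dots> = s * (LINT x|\<mu>. indicator {p<..<q} x * g x) + r * (LINT x|\<mu>. indicator {p<..<q} x)"
      using i1 i2 by simp
    also have "(LINT x|\<mu>. indicator {p<..<q} x) = measure \<mu> {p<..<q}" by simp
    finally show ?thesis using pos by (simp add: m_def)
  qed
  have "\<exists>x\<in>{p<..<q}. g x = m"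
  proof (rule ccontr)
    assume neg: "\<not> (\<exists>x\<in>{p<..<q}. g x = m)"
    have conn: "connected (g ` {p<..<q})" by (intro connected_continuous_image continuous_on_subset[OF cont]) auto
    have "(\<forall>x\<in>{p<..<q}. g x > m) \<or> (\<forall>x\<in>{p<..<q}. g x < m)"
    proof (rule ccontr)
      assume "\<not> ?thesis"
      then obtain x y where xy: "x \<in> {p<..<q}" "y \<in> {p<..<q}" "g x \<le> m" "m \<le> g y" by (auto simp: not_less)
      have "m \<in> g ` {p<..<q}" by (rule connectedD_interval[OF conn _ _ xy(3,4)]) (use xy in auto)
      then show False using neg by auto
    qed
    then obtain s :: real where s: "\<And>x. x \<in> {p<..<q} \<Longrightarrow> s * g x + (- s * m) > 0"
    proof
      assume a: "\<forall>x\<in>{p<..<q}. g x > m" show thesis by (rule that[of 1]) (use a in auto)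
    next
      assume a: "\<forall>x\<in>{p<..<q}. g x < m" show thesis by (rule that[of "-1"]) (use a in auto)
    qed
    have "(LINT x|\<mu>. indicator {p<..<q} x * (s * g x + (- s * m))) = 0" unfolding val by simp
    then have "AE x in \<mu>. indicator {p<..<q} x * (s * g x + (- s * m)) = 0"
      by (subst (asm) integral_nonneg_eq_0_iff_AE[OF intg]) (use s in \<open>auto simp: indicator_def less_imp_le intro!: AE_I2\<close>)
    then have "AE x in \<mu>. x \<notin> {p<..<q}"
    proof eventually_elim
      case (elim x)
      show ?case
      proof
        assume "x \<in> {p<..<q}"
        then show False using elim s[of x] by auto
      qed
    qed
    then have "emeasure \<mu> {x\<in>space \<mu>. x \<in> {p<..<q}} = 0" by (rule emeasure_eq_0_AE)
    moreover have "{x\<in>space \<mu>. x \<in> {p<..<q}} = {p<..<q}" using sets_eq_imp_space_eq[OF sets] by auto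
    ultimately have "measure \<mu> {p<..<q} = 0" by (simp add: measure_def)
    then show False using pos by simp
  qed
  then show thesis using that pos by (auto simp: m_def)
qed

section \<open>Weights on the integers and the a priori bound at \<open>\<i>\<close>\<close>

lemma summable_on_even_int:
  fixes f :: "int \<Rightarrow> real"
  assumes f: "summable (\<lambda>n::nat. f (int n))" "\<And>k. f (- k) = f k" "\<And>k. f k \<ge> 0"
  shows "f summable_on UNIV"
proof -
  have N: "(\<lambda>n::nat. f (int n)) summable_on UNIV" using f by (simp add: summable_on_UNIV_nonneg_real_iff)
  have p: "f summable_on (int ` UNIV)" using N by (subst summable_on_reindex) (auto simp: o_def)
  have "(\<lambda>n::nat. f (- int n)) summable_on UNIV" using N f(2) by simp
  then have q: "f summable_on ((\<lambda>n. - int n) ` UNIV)" by (subst summable_on_reindex) (auto simp: o_def inj_on_def)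
  have "(UNIV :: int set) = int ` UNIV \<union> (\<lambda>n. - int n) ` UNIV"
  proof -
    have "k \<in> int ` UNIV \<union> (\<lambda>n. - int n) ` UNIV" for k :: int by (cases k rule: int_cases2) auto
    then show ?thesis by auto
  qed
  then show ?thesis using summable_on_union[OF p q] by simp
qed

lemma summable_on_int_weights:
  "(\<lambda>k::int. 1 / (1 + (real_of_int k)\<^sup>2)) summable_on UNIV"
  "(\<lambda>k::int. ln (1 + (real_of_int k)\<^sup>2) / (1 + (real_of_int k)\<^sup>2)) summable_on UNIV"
proof -
  have s: "summable (\<lambda>n. norm (real n powr (- 3 / 2)))" by (simp add: summable_real_powr_iff)
  have "(\<lambda>n::nat. 1 / (1 + (real n)\<^sup>2)) \<in> O(\<lambda>n. real n powr (- 3 / 2))" by real_asymp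
  from summable_comparison_test_bigo[OF s this]
  show "(\<lambda>k::int. 1 / (1 + (real_of_int k)\<^sup>2)) summable_on UNIV"
    by (intro summable_on_even_int) auto
  have "(\<lambda>n::nat. ln (1 + (real n)\<^sup>2) / (1 + (real n)\<^sup>2)) \<in> O(\<lambda>n. real n powr (- 3 / 2))" by real_asymp
  from summable_comparison_test_bigo[OF s this]
  show "(\<lambda>k::int. ln (1 + (real_of_int k)\<^sup>2) / (1 + (real_of_int k)\<^sup>2)) summable_on UNIV"
    by (intro summable_on_even_int) (auto intro!: divide_nonneg_nonneg ln_ge_zero)
qed

lemma near_points_strict_mono:
  fixes a x :: "int \<Rightarrow> real"
  assumes a: "strict_mono a" and x: "\<And>k. \<bar>x k - a k\<bar> < min (a (k+1) - a k) (a k - a (k-1)) / 3"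
  shows "strict_mono x"
proof (rule strict_monoI)
  fix k l :: int assume "k < l"
  have "\<bar>x k - a k\<bar> < (a (k+1) - a k) / 3" by (rule less_le_trans[OF x]) simp
  moreover have "\<bar>x l - a l\<bar> < (a l - a (l-1)) / 3" by (rule less_le_trans[OF x]) simp
  moreover have "a (k+1) \<le> a l" "a k \<le> a (l-1)" "a k < a l" using \<open>k < l\<close> a by (auto simp: strict_mono_less_eq strict_mono_less)
  moreover have "x k - a k \<le> \<bar>x k - a k\<bar>" "a l - x l \<le> \<bar>x l - a l\<bar>" by linarith+
  ultimately show "x k < x l" by argo
qed

text \<open>The constant \<open>C\<close> depends on the sequence, \<open>W\<close> and
  \<open>b\<close>, but neither on \<open>h\<close> nor on the points \<open>x\<close>, nor on the
  constant \<open>M\<close> in the decay of \<open>h\<close>, which is a merely qualitative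
  assumption.\<close>

lemma interpolation_apriori:
  fixes a W :: "int \<Rightarrow> real" and d b :: real
  assumes a: "strict_mono a" and unif: "d_uniform d (range a)"
    and W: "\<And>k. W k \<ge> 0" "(\<lambda>k. W k / (1 + (real_of_int k)\<^sup>2)) summable_on UNIV"
    and b: "0 \<le> b" "b < pi * d"
  obtains C where "\<And>h x. \<lbrakk>h holomorphic_on UNIV; \<exists>M. \<forall>z. norm (h z) \<le> M * exp (b * \<bar>Im z\<bar>) / (1 + norm z);
     \<And>k. \<bar>x k - a k\<bar> < min (a (k+1) - a k) (a k - a (k-1)) / 3;
     \<And>k. norm (h (complex_of_real (x k))) \<le> exp (W k)\<rbrakk> \<Longrightarrow> norm (h \<i>) \<le> C"
proof -
  define d2 where "d2 = (b / pi + d) / 2"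
  have "b / pi < d" using b by (simp add: divide_less_eq mult.commute)
  moreover have "r < (r + d) / 2 \<and> (r + d) / 2 < d" if "r < d" for r using that by simp
  ultimately have d2: "b / pi < d2" "d2 < d" unfolding d2_def by blast+
  have d2b: "b < pi * d2" using d2(1) by (simp add: divide_less_eq mult.commute)
  have d20: "d2 > 0" using b d2(1) by (meson divide_nonneg_pos le_less_trans pi_gt_zero)
  \<comment> \<open>Chosen so that the growth exponent at a contact point is a sixteenth of the
    surplus, as the local interpolation bound requires.\<close>
  define \<Theta> where "\<Theta> = (pi * d2 - b) / (16 * 3932167)"
  have \<Theta>: "\<Theta> > 0" "\<Theta> * 3932167 = (pi * d2 - b) / 16" using d2b by (auto simp: \<Theta>_def)
  have \<tau>: "\<Theta> / 8 > 0" using \<Theta> by simp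
  obtain \<kappa> where \<kappa>: "0 < \<kappa>" "\<kappa> \<le> 1" and dens:
    "\<And>(m::nat) s0. m \<ge> 1 \<Longrightarrow> \<exists>q. q \<in> borel_measurable borel \<and> (\<forall>x. q x \<ge> 0) \<and> (\<integral>\<^sup>+x. ennreal (q x / (1 + x\<^sup>2)) \<partial>lborel) < top \<and>
      (\<forall>t s x. s > 0 \<longrightarrow> (\<integral>\<^sup>+x. ennreal (q x) * indicator {x. \<bar>x - t\<bar> < 3 * s} x \<partial>lborel) < ennreal (s\<^sup>2) \<longrightarrow>
        (\<forall>k. \<bar>x k - a k\<bar> < min (a (k+1) - a k) (a k - a (k-1)) / 3) \<longrightarrow>
        s0 \<le> s \<and> (\<exists>S. finite S \<and>
          (\<forall>j::int. - int m \<le> j \<longrightarrow> j < int m \<longrightarrow> d2 * s / real m \<le> real (card {k\<in>S. x k \<in> {t + s * of_int j / real m<..t + s * (of_int j + 1) / real m}})) \<and>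
          (\<forall>k\<in>S. W k \<le> \<Theta> / 8 * s) \<and>
          (\<forall>k\<in>S. (\<Sum>l\<in>{l\<in>S. l \<noteq> k \<and> \<bar>x k - x l\<bar> < \<kappa> * s}. ln (s / \<bar>x k - x l\<bar>)) \<le> \<Theta> / 8 * s)))"
    apply (rule node_density[OF a unif d20 d2(2) W \<tau>])
    subgoal premises p by (rule p(1)[OF p(2-)])
    done
  obtain m :: nat and s0 :: real where m: "m \<ge> 1" and loc:
    "\<And>s (H :: complex \<Rightarrow> complex) Z. \<lbrakk>s \<ge> s0; H holomorphic_on UNIV; finite Z;
      \<And>z. norm z \<le> 1 \<Longrightarrow> norm (H z) \<le> exp (s * (b * \<bar>Im z\<bar> + (pi * d2 - b) / 16));
      \<And>j::int. - int m \<le> j \<Longrightarrow> j < int m \<Longrightarrow> d2 * s / real m \<le> real (card (Z \<inter> {of_int j / real m<..(of_int j + 1) / real m}));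
      \<And>y. y \<in> Z \<Longrightarrow> norm (H (of_real y)) \<le> exp (\<Theta> / 8 * s);
      \<And>y. y \<in> Z \<Longrightarrow> (\<Sum>y'\<in>{y'\<in>Z. y' \<noteq> y \<and> \<bar>y - y'\<bar> < \<kappa>}. ln (1 / \<bar>y - y'\<bar>)) \<le> \<Theta> / 8 * s\<rbrakk>
      \<Longrightarrow> norm (H 0) < exp (\<Theta> * s)"
    apply (rule interpolation_local_bound[OF b(1) d2b \<Theta>(1) \<kappa>])
    subgoal premises p by (rule p(1)) (fact p)+
    done
  obtain q where q: "q \<in> borel_measurable borel" "\<And>x. q x \<ge> 0" "(\<integral>\<^sup>+x. ennreal (q x / (1 + x\<^sup>2)) \<partial>lborel) < top" and
    sel: "\<And>t s x. \<lbrakk>s > 0; (\<integral>\<^sup>+x. ennreal (q x) * indicator {x. \<bar>x - t\<bar> < 3 * s} x \<partial>lborel) < ennreal (s\<^sup>2);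
        \<forall>k. \<bar>x k - a k\<bar> < min (a (k+1) - a k) (a k - a (k-1)) / 3\<rbrakk> \<Longrightarrow>
        s0 \<le> s \<and> (\<exists>S. finite S \<and>
          (\<forall>j::int. - int m \<le> j \<longrightarrow> j < int m \<longrightarrow> d2 * s / real m \<le> real (card {k\<in>S. x k \<in> {t + s * of_int j / real m<..t + s * (of_int j + 1) / real m}})) \<and>
          (\<forall>k\<in>S. W k \<le> \<Theta> / 8 * s) \<and>
          (\<forall>k\<in>S. (\<Sum>l\<in>{l\<in>S. l \<noteq> k \<and> \<bar>x k - x l\<bar> < \<kappa> * s}. ln (s / \<bar>x k - x l\<bar>)) \<le> \<Theta> / 8 * s))"
    using dens[OF m, of s0] by blast
  \<comment> \<open>The points \<open>x\<close> are quantified inside, so that the class is closed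
    under multiplication by \<open>exp (- c)\<close>, as the continuity argument demands.\<close>
  define P where "P h \<longleftrightarrow> h holomorphic_on UNIV \<and> (\<exists>M. \<forall>z. norm (h z) \<le> M * exp (b * \<bar>Im z\<bar>) / (1 + norm z)) \<and>
     (\<exists>x. (\<forall>k. \<bar>x k - a k\<bar> < min (a (k+1) - a k) (a k - a (k-1)) / 3) \<and> (\<forall>k. norm (h (complex_of_real (x k))) \<le> exp (W k)))" for h :: "complex \<Rightarrow> complex"
  have "\<exists>C. \<forall>h. P h \<longrightarrow> norm (h \<i>) \<le> C"
  proof (rule global_bound[where P = P, OF b(1) \<Theta>(1) q])
    show "h holomorphic_on UNIV" if "P h" for h using that by (simp add: P_def)
    show "\<exists>C. \<forall>z. norm (h z) \<le> C * exp (b * \<bar>Im z\<bar>) / (1 + norm z)" if "P h" for h using that by (simp add: P_def)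
    show "P (\<lambda>z. of_real (exp (- c)) * h z)" if Ph: "P h" and c: "c \<ge> 0" for h c
    proof -
      obtain M where M: "\<And>z. norm (h z) \<le> M * exp (b * \<bar>Im z\<bar>) / (1 + norm z)" using Ph by (auto simp: P_def)
      have le: "norm (of_real (exp (- c)) * h z) \<le> norm (h z)" for z using c by (simp add: norm_mult mult_left_le_one_le)
      show ?thesis using Ph le M order.trans[OF le M] order.trans[OF le] unfolding P_def
        by (auto intro!: holomorphic_intros)
    qed
  next
    fix h t s assume Ph: "P h" and s: "s > 0"
      and disc: "\<And>z. norm (z - of_real t) \<le> s \<Longrightarrow> norm (h z) \<le> exp (b * \<bar>Im z\<bar> + \<Theta> * 3932167 * s)"
      and win: "(\<integral>\<^sup>+x. ennreal (q x) * indicator {x. \<bar>x - t\<bar> < 3 * s} x \<partial>lborel) < ennreal (s\<^sup>2)"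
    obtain x where x: "\<And>k. \<bar>x k - a k\<bar> < min (a (k+1) - a k) (a k - a (k-1)) / 3" "\<And>k. norm (h (complex_of_real (x k))) \<le> exp (W k)"
      using Ph by (auto simp: P_def)
    have holo: "h holomorphic_on UNIV" using Ph by (simp add: P_def)
    obtain S where ss0: "s0 \<le> s" and S: "finite S"
          "\<And>j::int. - int m \<le> j \<Longrightarrow> j < int m \<Longrightarrow> d2 * s / real m \<le> real (card {k\<in>S. x k \<in> {t + s * of_int j / real m<..t + s * (of_int j + 1) / real m}})"
          "\<And>k. k \<in> S \<Longrightarrow> W k \<le> \<Theta> / 8 * s"
          "\<And>k. k \<in> S \<Longrightarrow> (\<Sum>l\<in>{l\<in>S. l \<noteq> k \<and> \<bar>x k - x l\<bar> < \<kappa> * s}. ln (s / \<bar>x k - x l\<bar>)) \<le> \<Theta> / 8 * s"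
    proof -
      have "\<forall>k. \<bar>x k - a k\<bar> < min (a (k+1) - a k) (a k - a (k-1)) / 3" using x(1) by blast
      note sel[OF s win this]
      then show thesis by (elim conjE exE) (rule that, assumption, assumption, blast, (erule bspec, assumption)+)
    qed
    define H where "H z = h (of_real t + of_real s * z)" for z
    define y where "y k = (x k - t) / s" for k
    have xinj: "x k = x l \<longleftrightarrow> k = l" for k l using near_points_strict_mono[OF a x(1)] by (simp add: strict_mono_eq)
    have yinj: "inj_on y A" for A using s xinj by (auto simp: inj_on_def y_def)
    have ty: "t + s * y k = x k" for k using s by (simp add: y_def)
    have ydiff: "\<bar>y k - y l\<bar> = \<bar>x k - x l\<bar> / s" for k l using s by (simp add: y_def diff_divide_distrib[symmetric] abs_divide)
    have "norm (H 0) < exp (\<Theta> * s)"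
    proof (rule loc[OF ss0, where Z = "y ` S"])
      show "H holomorphic_on UNIV" unfolding H_def
        by (intro holomorphic_on_compose_gen[OF _ holo, unfolded o_def] holomorphic_intros) auto
      show "finite (y ` S)" using S(1) by simp
    next
      fix z :: complex assume z: "norm z \<le> 1"
      have "norm (of_real t + of_real s * z - of_real t) \<le> s" using z s by (simp add: norm_mult)
      from disc[OF this] have "norm (H z) \<le> exp (b * \<bar>s * Im z\<bar> + (pi * d2 - b) / 16 * s)" by (simp add: H_def \<Theta>(2))
      then show "norm (H z) \<le> exp (s * (b * \<bar>Im z\<bar> + (pi * d2 - b) / 16))" using s by (simp add: abs_mult algebra_simps)
    next
      fix j :: int assume j: "- int m \<le> j" "j < int m"
      have "y ` S \<inter> {of_int j / real m<..(of_int j + 1) / real m} = y ` {k\<in>S. x k \<in> {t + s * of_int j / real m<..t + s * (of_int j + 1) / real m}}"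
      proof -
        have "y k \<in> {of_int j / real m<..(of_int j + 1) / real m} \<longleftrightarrow> x k \<in> {t + s * of_int j / real m<..t + s * (of_int j + 1) / real m}" for k
        proof -
          have "x k \<in> {t + s * of_int j / real m<..t + s * (of_int j + 1) / real m} \<longleftrightarrow> s * (of_int j / real m) < s * y k \<and> s * y k \<le> s * ((of_int j + 1) / real m)"
            using ty[of k, symmetric] by simp
          then show ?thesis using s by (simp only: mult_less_cancel_left_pos mult_le_cancel_left_pos greaterThanAtMost_iff)
        qed
        then show ?thesis by auto
      qed
      then show "d2 * s / real m \<le> real (card (y ` S \<inter> {of_int j / real m<..(of_int j + 1) / real m}))"
        using S(2)[OF j] by (simp only: card_image[OF yinj])
    next
      fix v assume "v \<in> y ` S"
      then obtain k where k: "k \<in> S" "v = y k" by auto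
      have "H (of_real v) = h (complex_of_real (x k))" unfolding H_def k(2) ty[of k, symmetric] by simp
      then have "norm (H (of_real v)) \<le> exp (W k)" using x(2)[of k] by simp
      also have "\<dots> \<le> exp (\<Theta> / 8 * s)" using S(3)[OF k(1)] by simp
      finally show "norm (H (of_real v)) \<le> exp (\<Theta> / 8 * s)" .
      have "{y'\<in>y ` S. y' \<noteq> v \<and> \<bar>v - y'\<bar> < \<kappa>} = y ` {l\<in>S. l \<noteq> k \<and> \<bar>x k - x l\<bar> < \<kappa> * s}"
      proof -
        have "y l \<noteq> v \<and> \<bar>v - y l\<bar> < \<kappa> \<longleftrightarrow> l \<noteq> k \<and> \<bar>x k - x l\<bar> < \<kappa> * s" for l
          unfolding k(2) ydiff using yinj[of UNIV] s by (auto simp: inj_on_def divide_less_eq)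
        then show ?thesis by auto
      qed
      then have "(\<Sum>y'\<in>{y'\<in>y ` S. y' \<noteq> v \<and> \<bar>v - y'\<bar> < \<kappa>}. ln (1 / \<bar>v - y'\<bar>)) = (\<Sum>l\<in>{l\<in>S. l \<noteq> k \<and> \<bar>x k - x l\<bar> < \<kappa> * s}. ln (s / \<bar>x k - x l\<bar>))"
        by (simp only: sum.reindex[OF yinj] o_def k(2) ydiff) simp
      then show "(\<Sum>y'\<in>{y'\<in>y ` S. y' \<noteq> v \<and> \<bar>v - y'\<bar> < \<kappa>}. ln (1 / \<bar>v - y'\<bar>)) \<le> \<Theta> / 8 * s" using S(4)[OF k(1)] by simp
    qed
    then show "norm (h (of_real t)) < exp (\<Theta> * s)" by (simp add: H_def)
  qed (rule exI, blast)
  then obtain C where C: "\<And>h. P h \<Longrightarrow> norm (h \<i>) \<le> C" by blast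
  show thesis
  proof (rule that[of C], rule C)
    fix h x
    assume "h holomorphic_on UNIV" "\<exists>M. \<forall>z. norm (h z) \<le> M * exp (b * \<bar>Im z\<bar>) / (1 + norm z)"
     "\<And>k. \<bar>x k - a k\<bar> < min (a (k+1) - a k) (a k - a (k-1)) / 3" "\<And>k. norm (h (complex_of_real (x k))) \<le> exp (W k)"
    then show "P h" unfolding P_def by blast
  qed
qed

text \<open>Functions of Paley-Wiener kind that are real on the real line, so that the duality can
  be carried out with real sequences; cosines and sines take the place of exponentials.\<close>

definition real_type :: "real \<Rightarrow> (complex \<Rightarrow> complex) \<Rightarrow> bool" where
  "real_type b0 h \<longleftrightarrow> h holomorphic_on UNIV \<and> (\<forall>x::real. Im (h (of_real x)) = 0) \<and>
     (\<exists>M. \<forall>z. norm (h z) \<le> M * exp (b0 * \<bar>Im z\<bar>))"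

lemma real_type_add: "real_type b0 g \<Longrightarrow> real_type b0 h \<Longrightarrow> real_type b0 (\<lambda>z. g z + h z)"
proof -
  assume g: "real_type b0 g" and h: "real_type b0 h"
  obtain M M' where M: "\<And>z. norm (g z) \<le> M * exp (b0 * \<bar>Im z\<bar>)" "\<And>z. norm (h z) \<le> M' * exp (b0 * \<bar>Im z\<bar>)"
    using g h by (auto simp: real_type_def)
  have "norm (g z + h z) \<le> (M + M') * exp (b0 * \<bar>Im z\<bar>)" for z
    using norm_triangle_ineq[of "g z" "h z"] M(1)[of z] M(2)[of z] by (simp add: distrib_right)
  then show ?thesis using g h unfolding real_type_def by (auto intro!: holomorphic_intros)
qed

lemma real_type_scale: "real_type b0 h \<Longrightarrow> real_type b0 (\<lambda>z. of_real r * h z)"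
proof -
  assume h: "real_type b0 h"
  obtain M where M: "\<And>z. norm (h z) \<le> M * exp (b0 * \<bar>Im z\<bar>)" using h by (auto simp: real_type_def)
  have "norm (of_real r * h z) \<le> (\<bar>r\<bar> * M) * exp (b0 * \<bar>Im z\<bar>)" for z
    using mult_left_mono[OF M[of z], of "\<bar>r\<bar>"] by (simp add: norm_mult mult.assoc)
  then show ?thesis using h unfolding real_type_def by (auto intro!: holomorphic_intros)
qed

lemma real_type_trig:
  assumes l: "\<bar>l\<bar> \<le> b0"
  shows "real_type b0 (\<lambda>z. cos (of_real l * z))" "real_type b0 (\<lambda>z. sin (of_real l * z))"
proof -
  have e: "norm (exp (\<i> * (of_real l * z))) \<le> exp (b0 * \<bar>Im z\<bar>)" "norm (exp (- (\<i> * (of_real l * z)))) \<le> exp (b0 * \<bar>Im z\<bar>)" for z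
  proof -
    have "\<bar>l * Im z\<bar> \<le> b0 * \<bar>Im z\<bar>" unfolding abs_mult using l by (rule mult_right_mono) simp
    then have "- (l * Im z) \<le> b0 * \<bar>Im z\<bar>" "l * Im z \<le> b0 * \<bar>Im z\<bar>" by linarith+
    then show "norm (exp (\<i> * (of_real l * z))) \<le> exp (b0 * \<bar>Im z\<bar>)" "norm (exp (- (\<i> * (of_real l * z)))) \<le> exp (b0 * \<bar>Im z\<bar>)"
      by (simp_all add: norm_exp_eq_Re)
  qed
  have "norm (cos (of_real l * z)) \<le> 1 * exp (b0 * \<bar>Im z\<bar>)" for z
  proof -
    have "norm (cos (of_real l * z)) = norm (exp (\<i> * (of_real l * z)) + exp (- (\<i> * (of_real l * z)))) / 2" by (simp add: cos_exp_eq norm_divide)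
    also have "\<dots> \<le> (norm (exp (\<i> * (of_real l * z))) + norm (exp (- (\<i> * (of_real l * z))))) / 2" by (intro divide_right_mono norm_triangle_ineq) simp
    also have "\<dots> \<le> (exp (b0 * \<bar>Im z\<bar>) + exp (b0 * \<bar>Im z\<bar>)) / 2" by (intro divide_right_mono add_mono e) simp
    finally show ?thesis by simp
  qed
  moreover have "norm (sin (of_real l * z)) \<le> 1 * exp (b0 * \<bar>Im z\<bar>)" for z
  proof -
    have "norm (sin (of_real l * z)) = norm (exp (\<i> * (of_real l * z)) - exp (- (\<i> * (of_real l * z)))) / 2" by (simp add: sin_exp_eq norm_divide norm_mult)
    also have "\<dots> \<le> (norm (exp (\<i> * (of_real l * z))) + norm (exp (- (\<i> * (of_real l * z))))) / 2" by (intro divide_right_mono norm_triangle_ineq4) simp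
    also have "\<dots> \<le> (exp (b0 * \<bar>Im z\<bar>) + exp (b0 * \<bar>Im z\<bar>)) / 2" by (intro divide_right_mono add_mono e) simp
    finally show ?thesis by simp
  qed
  moreover have "Im (cos (of_real l * complex_of_real x)) = 0" "Im (sin (of_real l * complex_of_real x)) = 0" for x
    unfolding of_real_mult[symmetric] cos_of_real sin_of_real by simp_all
  ultimately show "real_type b0 (\<lambda>z. cos (of_real l * z))" "real_type b0 (\<lambda>z. sin (of_real l * z))"
    unfolding real_type_def by (intro conjI holomorphic_intros allI exI[of _ 1]; blast)+
qed

text \<open>The function annihilating the trigonometric functions is sought as a combination of
  indicators of the intervals around the \<open>a n\<close>; its coefficients form a bounded
  sequence orthogonal to the sequences of weighted averages. Such a sequence exists because the
  averages of \<open>1 / (1 + x\<^sup>2)\<close> keep a positive distance from those of the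
  functions of type \<open>b0\<close>.\<close>

lemma gap_witness_below:
  fixes \<mu> :: "real measure" and a :: "int \<Rightarrow> real" and d b0 :: real
  assumes sets: "sets \<mu> = sets borel" and fin: "finite_measure \<mu>" and a: "strict_mono a" and unif: "d_uniform d (range a)"
    and pos: "\<forall>n. measure \<mu> {a n - min (a (n+1) - a n) (a n - a (n-1)) / 3 <..<
                            a n + min (a (n+1) - a n) (a n - a (n-1)) / 3} > 0"
    and logs: "(\<lambda>n::int. ln (measure \<mu> {a n - min (a (n+1) - a n) (a n - a (n-1)) / 3 <..<
                            a n + min (a (n+1) - a n) (a n - a (n-1)) / 3})
                   / (1 + (real_of_int n)\<^sup>2)) summable_on UNIV"
    and b0: "0 < b0" "b0 < pi * d"
  shows "gap_witness \<mu> (2 * b0)"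
proof -
  interpret finite_measure \<mu> by (rule fin)
  define eps where "eps k = min (a (k+1) - a k) (a k - a (k-1)) / 3" for k
  define U where "U k = {a k - eps k<..<a k + eps k}" for k
  define mu where "mu k = measure \<mu> (U k)" for k
  have mu: "mu k > 0" for k using pos by (simp add: mu_def U_def eps_def)
  have space: "space \<mu> = UNIV" using sets_eq_imp_space_eq[OF sets] by simp
  have Um[measurable]: "U k \<in> sets \<mu>" for k by (simp add: U_def sets)
  \<comment> \<open>The first term pays for the weight \<open>1 / (1 + k\<^sup>2)\<close> attached
    to the averages, the second for division by the mass of the interval.\<close>
  define W where "W k = ln (1 + (real_of_int k)\<^sup>2) + \<bar>ln (mu k)\<bar>" for k
  have W0: "W k \<ge> 0" for k unfolding W_def by (intro add_nonneg_nonneg ln_ge_zero) auto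
  have Wsum: "(\<lambda>k. W k / (1 + (real_of_int k)\<^sup>2)) summable_on UNIV"
  proof -
    have "(\<lambda>k. ln (mu k) / (1 + (real_of_int k)\<^sup>2)) summable_on UNIV" using logs by (simp add: mu_def U_def eps_def)
    then have "(\<lambda>k. norm (ln (mu k) / (1 + (real_of_int k)\<^sup>2))) summable_on UNIV" by (rule summable_on_iff_abs_summable_on_real[THEN iffD1])
    moreover have "norm (ln (mu k) / (1 + (real_of_int k)\<^sup>2)) = \<bar>ln (mu k)\<bar> / (1 + (real_of_int k)\<^sup>2)" for k
      by (simp add: abs_divide add_pos_nonneg abs_of_pos)
    ultimately have "(\<lambda>k. \<bar>ln (mu k)\<bar> / (1 + (real_of_int k)\<^sup>2)) summable_on UNIV" by simp
    from summable_on_add[OF summable_on_int_weights(2) this] show ?thesis by (simp add: W_def add_divide_distrib)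
  qed
  \<comment> \<open>Four damping factors raise the type from \<open>b0\<close> to
    \<open>b = b0 + 4 * \<eta>\<close>, the midpoint between \<open>b0\<close> and
    \<open>pi * d\<close>.\<close>
  define \<eta> where "\<eta> = (pi * d - b0) / 8"
  have \<eta>: "\<eta> > 0" using b0 by (simp add: \<eta>_def)
  define b where "b = b0 + 4 * \<eta>"
  have b: "0 \<le> b" "b < pi * d" using b0 \<eta> by (auto simp: b_def \<eta>_def field_simps)
  obtain C where C: "\<And>h x. \<lbrakk>h holomorphic_on UNIV; \<exists>M. \<forall>z. norm (h z) \<le> M * exp (b * \<bar>Im z\<bar>) / (1 + norm z);
     \<And>k. \<bar>x k - a k\<bar> < min (a (k+1) - a k) (a k - a (k-1)) / 3;
     \<And>k. norm (h (complex_of_real (x k))) \<le> exp (W k)\<rbrakk> \<Longrightarrow> norm (h \<i>) \<le> C"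
    apply (rule interpolation_apriori[OF a unif W0 Wsum b])
    subgoal premises p by (rule p(1)) (fact p)+
    done
  obtain S :: "complex \<Rightarrow> complex" and B :: real where S: "S holomorphic_on UNIV" "B > 0"
    "\<And>z. norm (S z) \<le> B * exp (\<eta> * \<bar>Im z\<bar>) / (1 + norm z)" "S \<i> \<noteq> 0"
    using sinc_factor[OF \<eta>] by blast
  have S4: "norm (S z ^ 4) \<le> B ^ 4 * exp (4 * \<eta> * \<bar>Im z\<bar>) / (1 + norm z) ^ 4" for z
  proof -
    have "norm (S z ^ 4) \<le> (B * exp (\<eta> * \<bar>Im z\<bar>) / (1 + norm z)) ^ 4" unfolding norm_power by (intro power_mono S) simp
    also have "\<dots> = B ^ 4 * exp (4 * \<eta> * \<bar>Im z\<bar>) / (1 + norm z) ^ 4"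
      using exp_of_nat_mult[of 4 "\<eta> * \<bar>Im z\<bar>"] by (simp add: power_mult_distrib power_divide mult.assoc)
    finally show ?thesis .
  qed
  define c where "c i = 1 / (1 + (real_of_int (int_decode i))\<^sup>2)" for i
  have c0: "0 \<le> c i" "c i \<le> 1" "c i > 0" for i by (simp_all add: c_def add_pos_nonneg)
  have csum: "summable c"
  proof -
    have "c summable_on UNIV" unfolding c_def
      using summable_on_reindex_bij_betw[OF bij_int_decode, of "\<lambda>k. 1 / (1 + (real_of_int k)\<^sup>2)"] summable_on_int_weights(1) by simp
    then show ?thesis by (rule summable_on_imp_summable)
  qed
  define V where "V i = U (int_decode i)" for i
  have Vm[measurable]: "V i \<in> sets \<mu>" for i by (simp add: V_def Um)
  \<comment> \<open>The factor \<open>c i\<close> makes these sequences dominated by a summable one,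
    as the projection argument demands.\<close>
  define T where "T g i = c i * (LINT x|\<mu>. indicator (V i) x * g x)" for g :: "real \<Rightarrow> real" and i
  define good where "good g \<longleftrightarrow> continuous_on UNIV g \<and> (\<exists>M. \<forall>x. \<bar>g x\<bar> \<le> M)" for g :: "real \<Rightarrow> real"
  have meas: "g \<in> borel_measurable \<mu>" if "good g" for g
    using that borel_measurable_continuous_onI[of g] measurable_cong_sets[OF sets refl] by (auto simp: good_def)
  have intg: "integrable \<mu> (\<lambda>x. indicator A x * g x)" if g: "good g" and A: "A \<in> sets \<mu>" for g A
  proof -
    obtain M where M: "\<And>x. \<bar>g x\<bar> \<le> M" using g by (auto simp: good_def)
    have "integrable \<mu> g" by (rule integrable_const_bound[where B = M]) (use M meas[OF g] in auto)
    from integrable_real_mult_indicator[OF A this] show ?thesis by (simp add: mult.commute)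
  qed
  have Tdom: "\<exists>B. \<forall>i. \<bar>T g i\<bar> \<le> B * c i" if g: "good g" for g
  proof -
    obtain M where M: "\<And>x. \<bar>g x\<bar> \<le> M" using g by (auto simp: good_def)
    have "\<bar>LINT x|\<mu>. indicator (V i) x * g x\<bar> \<le> M * measure \<mu> (space \<mu>)" for i
    proof -
      have "\<bar>LINT x|\<mu>. indicator (V i) x * g x\<bar> \<le> (LINT x|\<mu>. \<bar>indicator (V i) x * g x\<bar>)" by (rule integral_abs_bound)
      also have "\<dots> \<le> (LINT x|\<mu>. M)"
      proof (rule integral_mono)
        show "integrable \<mu> (\<lambda>x. \<bar>indicator (V i) x * g x\<bar>)" by (rule integrable_abs[OF intg[OF g Vm]])
        show "\<bar>indicator (V i) x * g x\<bar> \<le> M" for x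
          using M[of x] order.trans[OF abs_ge_zero M[of x]] by (cases "x \<in> V i") auto
      qed simp
      finally show ?thesis by (simp add: mult.commute)
    qed
    from mult_left_mono[OF this c0(1)] have "\<bar>T g i\<bar> \<le> (M * measure \<mu> (space \<mu>)) * c i" for i
      by (simp add: T_def abs_mult c0 mult.commute)
    then show ?thesis by blast
  qed
  have Tadd: "T (\<lambda>x. g x + g' x) i = T g i + T g' i" if "good g" "good g'" for g g' i
    using intg[OF that(1) Vm] intg[OF that(2) Vm] by (simp add: T_def distrib_left)
  have Tscale: "T (\<lambda>x. r * g x) i = r * T g i" if "good g" for g r i
  proof -
    have "(LINT x|\<mu>. indicator (V i) x * (r * g x)) = (LINT x|\<mu>. r * (indicator (V i) x * g x))"
      by (rule Bochner_Integration.integral_cong) auto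
    then show ?thesis by (simp add: T_def)
  qed
  define re where "re h x = Re (h (complex_of_real x))" for h :: "complex \<Rightarrow> complex" and x
  have re_good: "good (re h)" if h: "real_type b0 h" for h
  proof -
    obtain M where M: "\<And>z. norm (h z) \<le> M * exp (b0 * \<bar>Im z\<bar>)" using h by (auto simp: real_type_def)
    have "\<bar>re h x\<bar> \<le> M" for x using abs_Re_le_cmod[of "h (of_real x)"] M[of "of_real x"] by (simp add: re_def)
    moreover have "continuous_on UNIV (\<lambda>x. h (complex_of_real x))"
      by (rule continuous_on_compose2[OF holomorphic_on_imp_continuous_on]) (use h in \<open>auto simp: real_type_def intro!: continuous_intros\<close>)
    then have "continuous_on UNIV (re h)" unfolding re_def by (intro continuous_intros)
    ultimately show ?thesis by (auto simp: good_def)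
  qed
  define g0 where "g0 x = 1 / (1 + x\<^sup>2)" for x :: real
  have g0_good: "good g0"
  proof -
    have "1 + x\<^sup>2 \<noteq> 0" for x :: real by (metis add_pos_nonneg less_irrefl zero_le_power2 zero_less_one)
    then have "continuous_on UNIV g0" unfolding g0_def by (intro continuous_intros) auto
    moreover have "\<bar>g0 x\<bar> \<le> 1" for x by (simp add: g0_def add_pos_nonneg)
    ultimately show ?thesis by (auto simp: good_def)
  qed
  have good_add: "good (\<lambda>x. g x + g' x)" if "good g" "good g'" for g g'
  proof -
    obtain M M' where M: "\<And>x. \<bar>g x\<bar> \<le> M" "\<And>x. \<bar>g' x\<bar> \<le> M'" using \<open>good g\<close> \<open>good g'\<close> by (auto simp: good_def)
    have "\<bar>g x + g' x\<bar> \<le> M + M'" for x using M(1)[of x] M(2)[of x] by linarith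
    then show ?thesis using that by (auto simp: good_def intro!: continuous_intros)
  qed
  define VV where "VV = {T (re h) | h. real_type b0 h}"
  \<comment> \<open>Chosen so that at a distance below it the normalised function \<open>H\<close>
    would have modulus \<open>\<bar>C\<bar> + 1\<close> at \<open>\<i>\<close>, exceeding the a
    priori bound.\<close>
  define \<delta>' where "\<delta>' = norm (S \<i>) ^ 4 / (B ^ 4 * (\<bar>C\<bar> + 1))"
  have \<delta>': "\<delta>' > 0" using S(2,4) by (simp add: \<delta>'_def add_nonneg_pos)
  obtain T' M where T': "\<And>i. \<bar>T' i\<bar> \<le> M" "\<And>v. v \<in> VV \<Longrightarrow> (\<Sum>i. T' i * v i) = 0" "(\<Sum>i. T' i * T g0 i) \<noteq> 0"
  proof (rule annihilator_of_positive_distance[of c "T g0" VV "\<delta>'\<^sup>2"])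
    show "summable c" by (rule csum)
    show "0 \<le> c i" "c i \<le> 1" for i by (rule c0)+
    show "\<exists>B. \<forall>i. \<bar>v i\<bar> \<le> B * c i" if "v \<in> insert (T g0) VV" for v
      using that Tdom g0_good re_good by (auto simp: VV_def)
    have "real_type b0 (\<lambda>z. 0)" by (auto simp: real_type_def intro: exI[of _ 0])
    moreover have "T (re (\<lambda>z. 0)) = (\<lambda>i. 0)" by (simp add: T_def re_def fun_eq_iff)
    ultimately show "(\<lambda>i. 0) \<in> VV" unfolding VV_def by (metis (mono_tags, lifting) mem_Collect_eq)
    show "(\<lambda>i. u i + v i) \<in> VV" if u: "u \<in> VV" and v: "v \<in> VV" for u v
    proof -
      obtain g h where gh: "real_type b0 g" "u = T (re g)" "real_type b0 h" "v = T (re h)" using u v by (auto simp: VV_def)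
      have "re (\<lambda>z. g z + h z) = (\<lambda>x. re g x + re h x)" by (simp add: re_def fun_eq_iff)
      then have "(\<lambda>i. u i + v i) = T (re (\<lambda>z. g z + h z))" using Tadd[OF re_good[OF gh(1)] re_good[OF gh(3)]] by (simp only: gh(2,4)) (rule ext, simp)
      then show ?thesis unfolding VV_def using real_type_add[OF gh(1,3)] by blast
    qed
    show "(\<lambda>i. r * v i) \<in> VV" if v: "v \<in> VV" for r v
    proof -
      obtain h where h: "real_type b0 h" "v = T (re h)" using v by (auto simp: VV_def)
      have "re (\<lambda>z. of_real r * h z) = (\<lambda>x. r * re h x)" by (simp add: re_def fun_eq_iff)
      then have "(\<lambda>i. r * v i) = T (re (\<lambda>z. of_real r * h z))" using Tscale[OF re_good[OF h(1)]] by (simp only: h(2)) (rule ext, simp)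
      then show ?thesis unfolding VV_def using real_type_scale[OF h(1), of r] by blast
    qed
    show "\<delta>'\<^sup>2 > 0" using \<delta>' by simp
    show "\<delta>'\<^sup>2 \<le> (\<Sum>i. (T g0 i + v i)\<^sup>2)" if v: "v \<in> VV" for v
    proof (rule ccontr)
      assume "\<not> ?thesis"
      then have lt: "(\<Sum>i. (T g0 i + v i)\<^sup>2) < \<delta>'\<^sup>2" by simp
      obtain h where h: "real_type b0 h" "v = T (re h)" using v by (auto simp: VV_def)
      define g where "g x = g0 x + re h x" for x
      have gg: "good g" unfolding g_def by (intro good_add g0_good re_good h)
      have Tg: "T g0 i + v i = T g i" for i unfolding g_def h(2) using Tadd[OF g0_good re_good[OF h(1)]] by simp
      obtain Bg where Bg: "\<And>i. \<bar>T g i\<bar> \<le> Bg * c i" using Tdom[OF gg] by blast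
      have sq: "summable (\<lambda>i. (T g i)\<^sup>2)"
      proof (rule summable_comparison_test')
        show "summable (\<lambda>i. Bg\<^sup>2 * c i)" by (intro summable_mult csum)
        fix i
        have "(\<bar>T g i\<bar>)\<^sup>2 \<le> (Bg * c i)\<^sup>2" by (rule power_mono[OF Bg]) simp
        also have "\<dots> = Bg\<^sup>2 * (c i * c i)" by (simp add: power_mult_distrib power2_eq_square)
        also have "\<dots> \<le> Bg\<^sup>2 * (c i * 1)" using c0 by (intro mult_left_mono) auto
        finally show "norm ((T g i)\<^sup>2) \<le> Bg\<^sup>2 * c i" by simp
      qed
      have Tle: "\<bar>T g i\<bar> \<le> \<delta>'" for i
      proof -
        have "(T g i)\<^sup>2 \<le> (\<Sum>i. (T g i)\<^sup>2)" using sum_le_suminf[OF sq, of "{i}"] by simp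
        also have "\<dots> < \<delta>'\<^sup>2" using lt by (simp only: Tg)
        finally have "\<bar>T g i\<bar>\<^sup>2 \<le> \<delta>'\<^sup>2" by simp
        then show ?thesis by (rule power2_le_imp_le) (use \<delta>' in simp)
      qed
      have "\<exists>x. x \<in> U k \<and> \<bar>g x\<bar> \<le> \<delta>' * (1 + (real_of_int k)\<^sup>2) / mu k" for k
      proof -
        obtain Mg where Mg: "\<And>x. \<bar>g x\<bar> \<le> Mg" using gg by (auto simp: good_def)
        obtain x where x: "x \<in> {a k - eps k<..<a k + eps k}" "(LINT x|\<mu>. indicator {a k - eps k<..<a k + eps k} x * g x) = g x * measure \<mu> {a k - eps k<..<a k + eps k}"
          using mean_value_on_interval[OF sets fin, of g Mg "a k - eps k" "a k + eps k"] gg Mg mu[of k] unfolding good_def mu_def U_def by blast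
        define i where "i = int_encode k"
        have "T g i = 1 / (1 + (real_of_int k)\<^sup>2) * (g x * mu k)"
          using x(2) by (simp add: T_def c_def V_def i_def U_def mu_def)
        then have "\<bar>g x\<bar> * mu k / (1 + (real_of_int k)\<^sup>2) = \<bar>T g i\<bar>" using mu[of k] by (simp add: abs_mult abs_divide add_pos_nonneg abs_of_pos)
        also have "\<dots> \<le> \<delta>'" by (rule Tle)
        finally have "\<bar>g x\<bar> * mu k \<le> \<delta>' * (1 + (real_of_int k)\<^sup>2)" by (simp add: divide_le_eq add_pos_nonneg)
        then have "\<bar>g x\<bar> \<le> \<delta>' * (1 + (real_of_int k)\<^sup>2) / mu k" using mu[of k] by (simp add: pos_le_divide_eq)
        then show ?thesis using x(1) by (auto simp: U_def)
      qed
      then obtain x where x: "\<And>k. x k \<in> U k" "\<And>k. \<bar>g (x k)\<bar> \<le> \<delta>' * (1 + (real_of_int k)\<^sup>2) / mu k" by metis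
      \<comment> \<open>On the real axis this is the damping factor times
        \<open>(1 + x\<^sup>2) * g x\<close>, hence small at the points \<open>x k\<close>. At
        \<open>\<i>\<close> the factor \<open>1 + z\<^sup>2\<close> vanishes, so the value is
        \<open>S \<i> ^ 4\<close> whatever \<open>h\<close> is. The fourth power outweighs
        \<open>1 + z\<^sup>2\<close> and leaves the decay that the a priori bound assumes.\<close>
      define K where "K z = S z ^ 4 * (1 + (1 + z\<^sup>2) * h z)" for z
      define H where "H z = K z / of_real (B ^ 4 * \<delta>')" for z
      have den: "B ^ 4 * \<delta>' > 0" using S(2) \<delta>' by simp
      have holoh: "h holomorphic_on UNIV" using h by (simp add: real_type_def)
      obtain Mh where Mh: "\<And>z. norm (h z) \<le> Mh * exp (b0 * \<bar>Im z\<bar>)" using h by (auto simp: real_type_def)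
      have Mh0: "Mh \<ge> 0" using order.trans[OF norm_ge_zero Mh[of 0]] by simp
      have "norm (H \<i>) \<le> C"
      proof (rule C)
        show "H holomorphic_on UNIV" unfolding H_def K_def using den by (intro holomorphic_intros S holoh) auto
        show "\<bar>x k - a k\<bar> < min (a (k+1) - a k) (a k - a (k-1)) / 3" for k
          using x(1)[of k] unfolding eps_def[symmetric] by (simp add: U_def abs_less_iff algebra_simps)
        show "\<exists>M. \<forall>z. norm (H z) \<le> M * exp (b * \<bar>Im z\<bar>) / (1 + norm z)"
        proof (intro exI allI)
          fix z :: complex
          define n where "n = 1 + norm z"
          have n1: "n \<ge> 1" by (simp add: n_def)
          have E1: "1 \<le> exp (b0 * \<bar>Im z\<bar>)" using b0 by simp
          have n2: "1 + (norm z)\<^sup>2 \<le> n\<^sup>2" by (simp add: n_def power2_eq_square algebra_simps)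
          have "norm (1 + (1 + z\<^sup>2) * h z) \<le> norm (1::complex) + norm ((1 + z\<^sup>2) * h z)" by (rule norm_triangle_ineq)
          also have "\<dots> \<le> 1 + (1 + (norm z)\<^sup>2) * (Mh * exp (b0 * \<bar>Im z\<bar>))"
            unfolding norm_mult using norm_triangle_ineq[of 1 "z\<^sup>2"] by (intro add_mono mult_mono Mh) (auto simp: norm_power)
          also have "\<dots> \<le> n\<^sup>2 * exp (b0 * \<bar>Im z\<bar>) + n\<^sup>2 * (Mh * exp (b0 * \<bar>Im z\<bar>))"
          proof (intro add_mono mult_right_mono n2)
            have "1 * 1 \<le> n\<^sup>2 * exp (b0 * \<bar>Im z\<bar>)" using n1 E1 by (intro mult_mono one_le_power) auto
            then show "1 \<le> n\<^sup>2 * exp (b0 * \<bar>Im z\<bar>)" by simp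
          qed (use Mh0 in auto)
          finally have k1: "norm (1 + (1 + z\<^sup>2) * h z) \<le> (1 + Mh) * n\<^sup>2 * exp (b0 * \<bar>Im z\<bar>)" by (simp add: algebra_simps)
          have "norm (K z) \<le> (B ^ 4 * exp (4 * \<eta> * \<bar>Im z\<bar>) / n ^ 4) * ((1 + Mh) * n\<^sup>2 * exp (b0 * \<bar>Im z\<bar>))"
            unfolding K_def norm_mult using S4[of z] S(2) n1 by (intro mult_mono k1) (auto simp: n_def)
          also have "\<dots> = B ^ 4 * (1 + Mh) * (exp (4 * \<eta> * \<bar>Im z\<bar>) * exp (b0 * \<bar>Im z\<bar>)) * (n\<^sup>2 / n ^ 4)" by simp
          also have "exp (4 * \<eta> * \<bar>Im z\<bar>) * exp (b0 * \<bar>Im z\<bar>) = exp (b * \<bar>Im z\<bar>)" by (simp add: exp_add[symmetric] b_def algebra_simps)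
          also have "n\<^sup>2 / n ^ 4 = 1 / n\<^sup>2" using n1 by (simp add: power_eq_if)
          also have "B ^ 4 * (1 + Mh) * exp (b * \<bar>Im z\<bar>) * (1 / n\<^sup>2) \<le> B ^ 4 * (1 + Mh) * exp (b * \<bar>Im z\<bar>) * (1 / n)"
          proof (rule mult_left_mono)
            show "1 / n\<^sup>2 \<le> 1 / n" using n1 by (simp add: power2_eq_square field_simps)
          qed (use S(2) Mh0 in auto)
          finally have "norm (K z) / (B ^ 4 * \<delta>') \<le> B ^ 4 * (1 + Mh) * exp (b * \<bar>Im z\<bar>) * (1 / n) / (B ^ 4 * \<delta>')" using den by (intro divide_right_mono) auto
          also have "\<dots> = (B ^ 4 * (1 + Mh) / (B ^ 4 * \<delta>')) * exp (b * \<bar>Im z\<bar>) / (1 + norm z)" by (simp add: n_def)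
          finally show "norm (H z) \<le> (B ^ 4 * (1 + Mh) / (B ^ 4 * \<delta>')) * exp (b * \<bar>Im z\<bar>) / (1 + norm z)"
            using den by (simp only: H_def norm_divide norm_of_real abs_of_pos)
        qed
        fix k
        let ?x = "x k"
        have hx: "h (of_real ?x) = of_real (re h ?x)" using h(1) by (auto simp: real_type_def re_def complex_eq_iff)
        have x2: "1 + ?x\<^sup>2 > 0" by (simp add: add_pos_nonneg)
        have "1 + (1 + (complex_of_real ?x)\<^sup>2) * h (of_real ?x) = of_real ((1 + ?x\<^sup>2) * g ?x)"
          unfolding hx g_def g0_def using x2 by (simp add: distrib_left)
        then have nn: "norm (1 + (1 + (complex_of_real ?x)\<^sup>2) * h (of_real ?x)) = (1 + ?x\<^sup>2) * \<bar>g ?x\<bar>"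
          by (simp only: norm_of_real abs_mult abs_of_pos[OF x2])
        have "norm (K (of_real ?x)) = norm (S (of_real ?x) ^ 4) * ((1 + ?x\<^sup>2) * \<bar>g ?x\<bar>)"
          unfolding K_def norm_mult[of "_ ^ 4"] nn ..
        also have "\<dots> \<le> (B ^ 4 / (1 + \<bar>?x\<bar>) ^ 4) * ((1 + ?x\<^sup>2) * \<bar>g ?x\<bar>)"
          using S4[of "of_real ?x"] x2 by (intro mult_right_mono) auto
        also have "\<dots> = (B ^ 4 * \<bar>g ?x\<bar>) * ((1 + ?x\<^sup>2) / (1 + \<bar>?x\<bar>) ^ 4)" by simp
        also have "\<dots> \<le> (B ^ 4 * \<bar>g ?x\<bar>) * 1"
        proof (rule mult_left_mono)
          have "1 + ?x\<^sup>2 \<le> (1 + \<bar>?x\<bar>)\<^sup>2" by (simp add: power2_sum)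
          also have "\<dots> \<le> (1 + \<bar>?x\<bar>) ^ 4" by (rule power_increasing) auto
          finally show "(1 + ?x\<^sup>2) / (1 + \<bar>?x\<bar>) ^ 4 \<le> 1" by (simp add: divide_le_eq zero_less_power add_pos_nonneg)
        qed simp
        finally have "norm (K (of_real ?x)) / (B ^ 4 * \<delta>') \<le> (B ^ 4 * \<bar>g ?x\<bar>) / (B ^ 4 * \<delta>')" using den by (intro divide_right_mono) auto
        also have "\<dots> = \<bar>g ?x\<bar> / \<delta>'" using S(2) by simp
        also have "\<dots> \<le> (\<delta>' * (1 + (real_of_int k)\<^sup>2) / mu k) / \<delta>'" using x(2)[of k] \<delta>' by (intro divide_right_mono) auto
        also have "\<dots> = (1 + (real_of_int k)\<^sup>2) / mu k" using \<delta>' by simp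
        also have "\<dots> \<le> exp (W k)"
        proof -
          have "exp (W k) = (1 + (real_of_int k)\<^sup>2) * exp \<bar>ln (mu k)\<bar>" unfolding W_def exp_add by (simp add: add_pos_nonneg)
          moreover have "1 / mu k \<le> exp \<bar>ln (mu k)\<bar>"
          proof -
            have "1 / mu k = exp (- ln (mu k))" using mu[of k] by (simp add: exp_minus divide_inverse)
            also have "\<dots> \<le> exp \<bar>ln (mu k)\<bar>" by simp
            finally show ?thesis .
          qed
          ultimately show ?thesis using mult_left_mono[of "1 / mu k" "exp \<bar>ln (mu k)\<bar>" "1 + (real_of_int k)\<^sup>2"] by simp
        qed
        finally show "norm (H (complex_of_real (x k))) \<le> exp (W k)"
          using den by (simp only: H_def norm_divide norm_of_real abs_of_pos)
      qed
      moreover have "norm (H \<i>) = norm (S \<i>) ^ 4 / (B ^ 4 * \<delta>')"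
        using den by (simp only: H_def norm_divide norm_of_real abs_of_pos) (simp add: K_def norm_mult norm_power)
      moreover have "norm (S \<i>) ^ 4 / (B ^ 4 * \<delta>') = \<bar>C\<bar> + 1"
        unfolding \<delta>'_def using S(2,4) by (simp add: field_simps)
      ultimately show False by linarith
    qed
  qed (blast intro: that)+
  \<comment> \<open>Pairing with this function turns integrals against \<mu> into sums of
    \<open>T' i\<close> times weighted averages.\<close>
  define f where "f x = (\<Sum>i. T' i * c i * indicator (V i) x)" for x
  have M0: "M \<ge> 0" using T'(1)[of 0] by linarith
  have tb: "\<bar>T' i * c i * indicator (V i) x * y\<bar> \<le> M * c i * \<bar>y\<bar>" for i x y
  proof -
    have "\<bar>T' i * c i * indicator (V i) x * y\<bar> = \<bar>T' i\<bar> * c i * indicator (V i) x * \<bar>y\<bar>" using c0 by (simp add: abs_mult)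
    also have "\<dots> \<le> M * c i * 1 * \<bar>y\<bar>" using T'(1)[of i] c0 M0 by (intro mult_mono) (auto simp: indicator_def)
    finally show ?thesis by simp
  qed
  have fsum: "summable (\<lambda>i. \<bar>T' i * c i * indicator (V i) x * y\<bar>)" for x y
    by (rule summable_comparison_test'[of "\<lambda>i. M * c i * \<bar>y\<bar>"]) (use tb csum in \<open>auto intro!: summable_mult summable_mult2\<close>)
  have fm[measurable]: "f \<in> borel_measurable \<mu>" unfolding f_def by measurable
  have fsum1: "summable (\<lambda>i. T' i * c i * indicator (V i) x)" for x using summable_rabs_cancel[OF fsum[of x 1]] by simp
  have fb: "\<bar>f x\<bar> \<le> M * (\<Sum>i. c i)" for x
  proof -
    have "\<bar>f x\<bar> \<le> (\<Sum>i. \<bar>T' i * c i * indicator (V i) x\<bar>)" unfolding f_def using fsum[of x 1] by (intro summable_rabs) simp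
    also have "\<dots> \<le> (\<Sum>i. M * c i)" using tb[of _ x 1] fsum[of x 1] csum by (intro suminf_le summable_mult) auto
    finally show ?thesis by (simp add: suminf_mult csum)
  qed
  have pair: "(LINT x|\<mu>. f x * g x) = (\<Sum>i. T' i * T g i)" if g: "good g" for g
  proof -
    obtain Mg where Mg: "\<And>x. \<bar>g x\<bar> \<le> Mg" using g by (auto simp: good_def)
    note meas[OF g, measurable]
    have int: "integrable \<mu> (\<lambda>x. T' i * c i * indicator (V i) x * g x)" for i
      using integrable_mult_right[OF intg[OF g Vm[of i]], of "T' i * c i"] by (simp add: mult.assoc)
    have "(LINT x|\<mu>. f x * g x) = (LINT x|\<mu>. (\<Sum>i. T' i * c i * indicator (V i) x * g x))"
      unfolding f_def by (intro Bochner_Integration.integral_cong refl suminf_mult2 fsum1)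
    also have "\<dots> = (\<Sum>i. LINT x|\<mu>. T' i * c i * indicator (V i) x * g x)"
    proof (rule integral_suminf[OF int])
      show "AE x in \<mu>. summable (\<lambda>i. norm (T' i * c i * indicator (V i) x * g x))" using fsum by simp
      show "summable (\<lambda>i. LINT x|\<mu>. norm (T' i * c i * indicator (V i) x * g x))"
      proof (rule summable_comparison_test')
        show "summable (\<lambda>i. (M * Mg * measure \<mu> (space \<mu>)) * c i)" by (intro summable_mult csum)
        fix i
        have "(LINT x|\<mu>. norm (T' i * c i * indicator (V i) x * g x)) \<le> (LINT x|\<mu>. M * c i * Mg)"
        proof (rule integral_mono)
          show "integrable \<mu> (\<lambda>x. norm (T' i * c i * indicator (V i) x * g x))" by (intro integrable_norm int)
          fix x
          show "norm (T' i * c i * indicator (V i) x * g x) \<le> M * c i * Mg"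
            using tb[of i x "g x"] mult_left_mono[OF Mg[of x], of "M * c i"] M0 c0 by simp
        qed simp
        then show "norm (LINT x|\<mu>. norm (T' i * c i * indicator (V i) x * g x)) \<le> (M * Mg * measure \<mu> (space \<mu>)) * c i"
          by (simp add: mult_ac integral_nonneg)
      qed
    qed
    also have "\<dots> = (\<Sum>i. T' i * T g i)"
    proof (rule suminf_cong)
      fix i
      have "(LINT x|\<mu>. T' i * c i * indicator (V i) x * g x) = (LINT x|\<mu>. (T' i * c i) * (indicator (V i) x * g x))"
        by (rule Bochner_Integration.integral_cong) (auto simp: mult.assoc)
      then show "(LINT x|\<mu>. T' i * c i * indicator (V i) x * g x) = T' i * T g i" by (simp add: T_def)
    qed
    finally show ?thesis .
  qed
  have zero: "(LINT x|\<mu>. f x * cos (l * x)) = 0" "(LINT x|\<mu>. f x * sin (l * x)) = 0" if l: "\<bar>l\<bar> \<le> b0" for l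
  proof -
    have rc: "re (\<lambda>z. cos (of_real l * z)) = (\<lambda>x. cos (l * x))" "re (\<lambda>z. sin (of_real l * z)) = (\<lambda>x. sin (l * x))"
      unfolding re_def fun_eq_iff of_real_mult[symmetric] cos_of_real sin_of_real by simp_all
    have "T (re (\<lambda>z. cos (of_real l * z))) \<in> VV" "T (re (\<lambda>z. sin (of_real l * z))) \<in> VV"
      unfolding VV_def using real_type_trig[OF l] by blast+
    then have "(\<Sum>i. T' i * T (re (\<lambda>z. cos (of_real l * z))) i) = 0" "(\<Sum>i. T' i * T (re (\<lambda>z. sin (of_real l * z))) i) = 0"
      by (auto intro: T'(2))
    then show "(LINT x|\<mu>. f x * cos (l * x)) = 0" "(LINT x|\<mu>. f x * sin (l * x)) = 0"
      using pair[OF re_good[OF real_type_trig(1)[OF l]]] pair[OF re_good[OF real_type_trig(2)[OF l]]] by (simp_all only: rc)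
  qed
  have nz: "(LINT x|\<mu>. f x * g0 x) \<noteq> 0" using pair[OF g0_good] T'(3) by simp
  \<comment> \<open>So far the transform vanishes on the symmetric interval from \<open>- b0\<close>
    to \<open>b0\<close>; the modulation moves it to the interval from 0 to
    \<open>2 * b0\<close>.\<close>
  define F where "F x = complex_of_real (f x) * cis (- b0 * x)" for x
  have idm[measurable]: "(\<lambda>x::real. x) \<in> borel_measurable \<mu>" by (simp add: measurable_cong_sets[OF sets refl])
  have Fm: "F \<in> borel_measurable \<mu>"
  proof -
    have "(\<lambda>x. cis (- b0 * x)) \<in> borel_measurable \<mu>"
      unfolding measurable_cong_sets[OF sets refl] cis_conv_exp
      by (intro borel_measurable_continuous_onI continuous_intros)
    then show ?thesis unfolding F_def by measurable
  qed
  have Fz: "F x = 0 \<longleftrightarrow> f x = 0" for x by (simp add: F_def)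
  have ind: "integrable \<mu> (\<lambda>x. f x * cos (l * x))" "integrable \<mu> (\<lambda>x. f x * sin (l * x))" for l
  proof -
    have A: "0 \<le> M * (\<Sum>i. c i)" using order.trans[OF abs_ge_zero fb] .
    have "\<bar>f x * cos (l * x)\<bar> \<le> M * (\<Sum>i. c i)" "\<bar>f x * sin (l * x)\<bar> \<le> M * (\<Sum>i. c i)" for x
      unfolding abs_mult using mult_mono[OF fb[of x] abs_cos_le_one A] mult_mono[OF fb[of x] abs_sin_le_one A] by auto
    then show "integrable \<mu> (\<lambda>x. f x * cos (l * x))" "integrable \<mu> (\<lambda>x. f x * sin (l * x))"
      by (auto intro!: integrable_const_bound[where B = "M * (\<Sum>i. c i)"])
  qed
  show ?thesis unfolding gap_witness_def
  proof (intro conjI exI[of _ F] ballI)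
    show "2 * b0 > 0" using b0 by simp
    show "F \<in> borel_measurable \<mu>" by (rule Fm)
    show "\<exists>C. AE x in \<mu>. norm (F x) \<le> C" using fb by (intro exI[of _ "M * (\<Sum>i. c i)"]) (simp add: F_def norm_mult)
    show "\<not> (AE x in \<mu>. F x = 0)"
    proof
      assume "AE x in \<mu>. F x = 0"
      then have "AE x in \<mu>. f x * g0 x = 0" by eventually_elim (simp add: Fz)
      then have "(LINT x|\<mu>. f x * g0 x) = 0" by (rule integral_eq_zero_AE)
      then show False using nz by simp
    qed
    fix t assume t: "t \<in> {0..2 * b0}"
    define l where "l = t - b0"
    have l: "\<bar>l\<bar> \<le> b0" using t by (auto simp: l_def)
    have "F x * cis (t * x) = complex_of_real (f x * cos (l * x)) + \<i> * complex_of_real (f x * sin (l * x))" for x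
    proof -
      have "F x * cis (t * x) = complex_of_real (f x) * cis (l * x)" by (simp add: F_def cis_mult l_def mult.assoc algebra_simps)
      then show ?thesis by (simp add: complex_eq_iff)
    qed
    then have "(LINT x|\<mu>. F x * cis (t * x)) = (LINT x|\<mu>. complex_of_real (f x * cos (l * x)) + \<i> * complex_of_real (f x * sin (l * x)))" by simp
    also have "\<dots> = (LINT x|\<mu>. complex_of_real (f x * cos (l * x))) + (LINT x|\<mu>. \<i> * complex_of_real (f x * sin (l * x)))"
      by (intro Bochner_Integration.integral_add integrable_of_real integrable_mult_right ind)
    also have "\<dots> = complex_of_real (LINT x|\<mu>. f x * cos (l * x)) + \<i> * complex_of_real (LINT x|\<mu>. f x * sin (l * x))"
      by (simp only: integral_mult_right_zero integral_complex_of_real)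
    also have "\<dots> = 0" using zero[OF l] by simp
    finally show "(LINT x|\<mu>. F x * cis (t * x)) = 0" .
  qed
qed

theorem theorem5:
  fixes \<mu> :: "real measure" and a :: "int \<Rightarrow> real" and d :: real
  assumes "sets \<mu> = sets borel"
    and "finite_measure \<mu>"
    and "strict_mono a"
    and "d_uniform d (range a)"
    and "\<forall>n. measure \<mu> {a n - min (a (n+1) - a n) (a n - a (n-1)) / 3 <..<
                            a n + min (a (n+1) - a n) (a n - a (n-1)) / 3} > 0"
    and "(\<lambda>n::int. ln (measure \<mu> {a n - min (a (n+1) - a n) (a n - a (n-1)) / 3 <..<
                            a n + min (a (n+1) - a n) (a n - a (n-1)) / 3})
                   / (1 + (real_of_int n)\<^sup>2)) summable_on UNIV"
  shows "gap_infty \<mu> \<ge> ereal (2 * pi * d)"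
proof -
  have d: "d > 0" using assms(4) by (simp add: d_uniform_def)
  then have pd: "pi * d > 0" by simp
  have wit: "gap_witness \<mu> (2 * b0)" if "0 < b0" "b0 < pi * d" for b0
    by (rule gap_witness_below[OF assms that])
  have "gap_witness \<mu> (2 * (pi * d / 2))" using pd d by (intro wit) auto
  then have ne: "{a. gap_witness \<mu> a} \<noteq> {}" by blast
  have "ereal (2 * pi * d) \<le> Sup (ereal ` {a. gap_witness \<mu> a})"
  proof (rule dense_le)
    fix y assume y: "y < ereal (2 * pi * d)"
    show "y \<le> Sup (ereal ` {a. gap_witness \<mu> a})"
    proof (cases y)
      case (real r)
      \<comment> \<open>The second entry keeps \<open>b0\<close> positive when \<open>r\<close> is
        small or negative.\<close>
      define b0 where "b0 = max (r / 2) (pi * d / 2)"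
      have b0: "0 < b0" "b0 < pi * d" using y pd d by (auto simp: real b0_def less_max_iff_disj)
      have "y \<le> ereal (2 * b0)" by (simp add: real b0_def)
      also have "\<dots> \<le> Sup (ereal ` {a. gap_witness \<mu> a})" using wit[OF b0] by (intro Sup_upper) auto
      finally show ?thesis .
    qed (use y in auto)
  qed
  then show ?thesis unfolding gap_infty_def using ne by (simp only: if_False)
qed

end
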